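(* Let $H\in(\tfrac12,1)$, let $z_0\in\mathbb{C}\setminus\{0\}$, and let $B=(B_t)_{t\ge 0}$ be a complex fractional Brownian motion with Hurst parameter $H$ started at $z_0$. Then, almost surely, $$B_t=z_0\exp\left(\int_0^t\frac{\delta B_s}{B_s}\right)=z_0\exp\left(\int_0^t\frac{dB_s}{B_s}\right),\qquad t\ge0,$$ where the first integral is the (local) divergence integral and the second one is the pathwise Riemann–Stieltjes integral.
   Context: Complex fractional Brownian motion started at $z_0=x^1+ix^2$: $B_t=B_t^1+iB_t^2$, where $B^1,B^2$ are independent real continuous Gaussian processes with $\mathbb{E}(B^j_t)=x^j$ and covariance $R(t,s)=\tfrac12(s^{2H}+t^{2H}-|t-s|^{2H})$. Almost surely $B$ never vanishes, so that $1/B$ is well defined. Pathwise integral: for a process $u$ whose paths are locally $\gamma$-Hölder with $\gamma>1-H$, $\int_0^t u_s\,dB_s$ denotes the pathwise Riemann–Stieltjes (Young) integral. Divergence integral: let $\mathcal{H}$ be the closure of the real step functions on $\mathbb{R}_+$ for the scalar product $\langle \mathbf 1_{[0,t]},\mathbf 1_{[0,s]}\rangle_{\mathcal H}=R(t,s)$, and let $\varphi\mapsto B^j(\varphi)$ be the isometry from $\mathcal H$ into $L^2(\Omega)$ extending $\mathbf 1_{[0,t]}\mapsto B^j_t-x^j$. Let $\mathcal H^2=\mathcal H\oplus\mathcal H$ and, for $\varphi=(\varphi^1,\varphi^2)\in\mathcal H^2$, $B(\varphi)=(B^1(\varphi^1),B^2(\varphi^2))$. For a smooth cylindrical variable $F=g(B(\varphi_1),\dots,B(\varphi_n))$,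 $g\in C_b^\infty(\mathbb{R}^{2n})$, written in variables $(x_j,y_j)_{1\le j\le n}$, the derivative is the $\mathcal H^2$-valued variable $DF=\sum_j\big(\frac{\partial g}{\partial x_j}\varphi_j^1,\frac{\partial g}{\partial y_j}\varphi_j^2\big)$, the partial derivatives being evaluated at $(B(\varphi_1),\dots,B(\varphi_n))$. The operator $D$ is closable; $\mathbb{D}^{1,2}$ is the closure of the smooth cylindrical variables for the norm $(\mathbb{E}|F|^2+\mathbb{E}\|DF\|^2_{\mathcal H^2})^{1/2}$, and $\mathbb{D}^{1,2}(\mathcal H^2)$ is the analogous space of $\mathcal H^2$-valued variables. The divergence $\delta$ is the adjoint of $D$: $\mathbb{E}(F\delta(u))=\mathbb{E}\langle DF,u\rangle_{\mathcal H^2}$; its domain contains $\mathbb{D}^{1,2}(\mathcal H^2)$, and one writes $\delta(u)=\int_0^\infty u^1_s\,\delta B^1_s+\int_0^\infty u^2_s\,\delta B^2_s$. It is extended by localization: if $\Omega_n\uparrow\Omega$ a.s. and $u=u^n$ on $\Omega_n$ with $u^n\in\mathbb{D}^{1,2}(\mathcal H^2)$ (one says $u\in\mathbb{D}^{1,2}_{\mathrm{loc}}(\mathcal H^2)$), then $\delta(u):=\delta(u^n)$ on $\Omega_n$, which is unambiguous. For a complex integrand $u=a+ib$, $\int_0^t u_s\,\delta B_s$ is the complex variable with real part $\delta\big((a,-b)\mathbf 1_{(0,t)}\big)$ and imaginary part $\delta\big((b,a)\mathbf 1_{(0,t)}\big)$, in this local sense; $\int_0^t\frac{\delta B_s}{B_s}$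 means $u=1/B$. *)

theory Defs
  imports "HOL-Probability.Probability"
begin

definition fbm_cov :: "real \<Rightarrow> real \<Rightarrow> real \<Rightarrow> real" where
  "fbm_cov H t s = (s powr (2 * H) + t powr (2 * H) - \<bar>t - s\<bar> powr (2 * H)) / 2"

text \<open>Constants count as (degenerate) Gaussian variables; this is needed already at time \<open>0\<close>.\<close>

definition gaussian_rv :: "'a measure \<Rightarrow> ('a \<Rightarrow> real) \<Rightarrow> bool" where
  "gaussian_rv M X \<longleftrightarrow> X \<in> borel_measurable M \<and>
     ((\<exists>m. AE \<omega> in M. X \<omega> = m) \<or>
      (\<exists>m \<sigma>. 0 < \<sigma> \<and> distributed M lborel X (\<lambda>x. ennreal (normal_density m \<sigma> x))))"

definition gaussian_process :: "'a measure \<Rightarrow> (real \<Rightarrow> 'a \<Rightarrow> real) \<Rightarrow> bool" where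
  "gaussian_process M X \<longleftrightarrow>
     (\<forall>T c. finite T \<longrightarrow> T \<subseteq> {0..} \<longrightarrow> gaussian_rv M (\<lambda>\<omega>. \<Sum>t\<in>T. c t * X t \<omega>))"

definition real_fbm :: "'a measure \<Rightarrow> real \<Rightarrow> real \<Rightarrow> (real \<Rightarrow> 'a \<Rightarrow> real) \<Rightarrow> bool" where
  "real_fbm M H x X \<longleftrightarrow>
     gaussian_process M X \<and>
     (AE \<omega> in M. continuous_on {0..} (\<lambda>t. X t \<omega>)) \<and>
     (\<forall>t\<ge>0. (\<integral>\<omega>. X t \<omega> \<partial>M) = x) \<and>
     (\<forall>t\<ge>0. \<forall>s\<ge>0. (\<integral>\<omega>. (X t \<omega> - x) * (X s \<omega> - x) \<partial>M) = fbm_cov H t s)"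

definition complex_fbm :: "'a measure \<Rightarrow> real \<Rightarrow> complex \<Rightarrow> (real \<Rightarrow> 'a \<Rightarrow> complex) \<Rightarrow> bool" where
  "complex_fbm M H z0 B \<longleftrightarrow>
     real_fbm M H (Re z0) (\<lambda>t \<omega>. Re (B t \<omega>)) \<and>
     real_fbm M H (Im z0) (\<lambda>t \<omega>. Im (B t \<omega>)) \<and>
     prob_space.indep_var M
       (\<Pi>\<^sub>M t\<in>{0..}. borel) (\<lambda>\<omega>. \<lambda>t\<in>{0..}. Re (B t \<omega>))
       (\<Pi>\<^sub>M t\<in>{0..}. borel) (\<lambda>\<omega>. \<lambda>t\<in>{0..}. Im (B t \<omega>))"

definition generated_algebra :: "'a measure \<Rightarrow> (real \<Rightarrow> 'a \<Rightarrow> complex) \<Rightarrow> 'a measure" where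
  "generated_algebra M B =
     vimage_algebra (space M) (\<lambda>\<omega>. \<lambda>t\<in>{0..}. B t \<omega>) (\<Pi>\<^sub>M t\<in>{0..}. borel)"

definition has_RS_integral ::
    "(real \<Rightarrow> complex) \<Rightarrow> (real \<Rightarrow> complex) \<Rightarrow> real \<Rightarrow> real \<Rightarrow> complex \<Rightarrow> bool" where
  "has_RS_integral f g a b I \<longleftrightarrow>
     (\<forall>\<epsilon>>0. \<exists>\<eta>>0. \<forall>p. p tagged_division_of {a..b} \<longrightarrow> (\<forall>(x, K)\<in>p. diameter K < \<eta>) \<longrightarrow>
        norm ((\<Sum>(x, K)\<in>p. f x * (g (Sup K) - g (Inf K))) - I) < \<epsilon>)"

text \<open>
  The closure of the step functions is given up to isometry: a separable real Hilbert space
  together with the images \<open>e t\<close> of the indicators of \<open>[0,t]\<close>, having the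
  prescribed scalar products and a dense linear span. A step function is a list of pairs
  \<open>(c, t)\<close>, standing for the sum of the functions \<open>c * indicator {0..t}\<close>.
\<close>

definition fbm_hilbert_space ::
    "real \<Rightarrow> (real \<Rightarrow> 'h::{real_inner, banach, second_countable_topology}) \<Rightarrow> bool" where
  "fbm_hilbert_space H e \<longleftrightarrow>
     (\<forall>t\<ge>0. \<forall>s\<ge>0. e t \<bullet> e s = fbm_cov H t s) \<and> closure (span (e ` {0..})) = UNIV"

definition step_fun :: "(real \<times> real) list \<Rightarrow> real \<Rightarrow> real" where
  "step_fun cs r = (\<Sum>(c, t)\<leftarrow>cs. c * indicator {0..t} r)"

definition step_elem :: "(real \<Rightarrow> 'h::real_vector) \<Rightarrow> (real \<times> real) list \<Rightarrow> 'h" where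
  "step_elem e cs = (\<Sum>(c, t)\<leftarrow>cs. c *\<^sub>R e t)"

text \<open>
  For \<open>H > 1/2\<close> one has
  \<open>fbm_cov H t s = H (2 H - 1) \<integral>\<^sub>0\<^sup>t \<integral>\<^sub>0\<^sup>s |r - q| powr (2 H - 2) dq dr\<close>. Hence the scalar
  product norm of a step function is dominated, up to a constant, by the norm whose square is
  \<open>abs_energy\<close>, and a function on the half line is identified with an element of the closure
  by approximating it by step functions in the latter norm.
\<close>

definition abs_energy :: "real \<Rightarrow> (real \<Rightarrow> real) \<Rightarrow> ennreal" where
  "abs_energy H f =
     (\<integral>\<^sup>+ r\<in>{0..}. (\<integral>\<^sup>+ q\<in>{0..}. ennreal (\<bar>f r\<bar> * \<bar>f q\<bar> * \<bar>r - q\<bar> powr (2 * H - 2)) \<partial>lborel) \<partial>lborel)"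

definition represents ::
    "real \<Rightarrow> (real \<Rightarrow> 'h::real_normed_vector) \<Rightarrow> (real \<Rightarrow> real) \<Rightarrow> 'h \<Rightarrow> bool" where
  "represents H e f h \<longleftrightarrow> f \<in> borel_measurable borel \<and>
     (\<exists>cs. (\<forall>n. \<forall>(c, t)\<in>set (cs n). 0 \<le> t) \<and>
        (\<lambda>n. abs_energy H (\<lambda>r. f r - step_fun (cs n) r)) \<longlonglongrightarrow> 0 \<and>
        (\<lambda>n. step_elem e (cs n)) \<longlonglongrightarrow> h)"

definition square_integrable :: "'a measure \<Rightarrow> ('a \<Rightarrow> 'b::real_normed_vector) \<Rightarrow> bool" where
  "square_integrable M f \<longleftrightarrow> f \<in> borel_measurable M \<and> integrable M (\<lambda>\<omega>. (norm (f \<omega>))\<^sup>2)"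

definition L2_tendsto ::
    "'a measure \<Rightarrow> (nat \<Rightarrow> 'a \<Rightarrow> 'b::real_normed_vector) \<Rightarrow> ('a \<Rightarrow> 'b) \<Rightarrow> bool" where
  "L2_tendsto M f g \<longleftrightarrow> (\<forall>n. square_integrable M (f n)) \<and> square_integrable M g \<and>
     (\<lambda>n. \<integral>\<omega>. (norm (f n \<omega> - g \<omega>))\<^sup>2 \<partial>M) \<longlonglongrightarrow> 0"

text \<open>
  \<open>W h\<close> is a version of the Wiener integral of \<open>h\<close> with respect to the process \<open>X\<close> of mean
  \<open>x\<close>. Preservation of scalar products entails linearity almost surely.
\<close>

definition wiener_isometry ::
    "'a measure \<Rightarrow> (real \<Rightarrow> 'h::real_inner) \<Rightarrow> real \<Rightarrow> (real \<Rightarrow> 'a \<Rightarrow> real) \<Rightarrow> ('h \<Rightarrow> 'a \<Rightarrow> real) \<Rightarrow> bool" where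
  "wiener_isometry M e x X W \<longleftrightarrow>
     (\<forall>h. square_integrable M (W h)) \<and>
     (\<forall>h k. (\<integral>\<omega>. W h \<omega> * W k \<omega> \<partial>M) = h \<bullet> k) \<and>
     (\<forall>t\<ge>0. AE \<omega> in M. W (e t) \<omega> = X t \<omega> - x)"

text \<open>
  Functions on \<open>\<real>\<^sup>m\<close>, for varying \<open>m\<close>, are functions of a sequence that depend only on its
  first \<open>m\<close> entries.
\<close>

definition partial_deriv :: "nat \<Rightarrow> ((nat \<Rightarrow> real) \<Rightarrow> real) \<Rightarrow> (nat \<Rightarrow> real) \<Rightarrow> real" where
  "partial_deriv i g x = deriv (\<lambda>r. g (x(i := r))) (x i)"

definition iterated_partial :: "nat list \<Rightarrow> ((nat \<Rightarrow> real) \<Rightarrow> real) \<Rightarrow> (nat \<Rightarrow> real) \<Rightarrow> real" where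
  "iterated_partial is g = foldr partial_deriv is g"

definition Cb_infinity :: "nat \<Rightarrow> ((nat \<Rightarrow> real) \<Rightarrow> real) set" where
  "Cb_infinity m = {g.
     (\<forall>x y. (\<forall>i<m. x i = y i) \<longrightarrow> g x = g y) \<and>
     (\<forall>is. set is \<subseteq> {..<m} \<longrightarrow>
        continuous_on UNIV (iterated_partial is g) \<and>
        bounded (range (iterated_partial is g)) \<and>
        (\<forall>i<m. \<forall>x. (\<lambda>r. iterated_partial is g (x(i := r))) differentiable (at (x i))))}"

text \<open>
  \<open>smooth_cylindrical W1 W2 F U\<close>: \<open>F\<close> is a smooth cylindrical variable with derivative \<open>U\<close>.
  The variables \<open>x\<^sub>j, y\<^sub>j\<close> of \<open>g\<close> are its coordinates \<open>2 * j\<close> and \<open>2 * j + 1\<close>,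
  with \<open>j\<close> counted from \<open>0\<close>.
\<close>

definition cyl_point ::
    "('h \<Rightarrow> 'a \<Rightarrow> real) \<Rightarrow> ('h \<Rightarrow> 'a \<Rightarrow> real) \<Rightarrow> (nat \<Rightarrow> 'h \<times> 'h) \<Rightarrow> 'a \<Rightarrow> nat \<Rightarrow> real" where
  "cyl_point W1 W2 \<phi> \<omega> i =
     (if even i then W1 (fst (\<phi> (i div 2))) \<omega> else W2 (snd (\<phi> (i div 2))) \<omega>)"

definition smooth_cylindrical ::
    "('h::real_normed_vector \<Rightarrow> 'a \<Rightarrow> real) \<Rightarrow> ('h \<Rightarrow> 'a \<Rightarrow> real) \<Rightarrow> ('a \<Rightarrow> real) \<Rightarrow> ('a \<Rightarrow> 'h \<times> 'h) \<Rightarrow> bool" where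
  "smooth_cylindrical W1 W2 F U \<longleftrightarrow>
     (\<exists>n g \<phi>. g \<in> Cb_infinity (2 * n) \<and>
        F = (\<lambda>\<omega>. g (cyl_point W1 W2 \<phi> \<omega>)) \<and>
        U = (\<lambda>\<omega>. \<Sum>j<n.
               (partial_deriv (2 * j) g (cyl_point W1 W2 \<phi> \<omega>) *\<^sub>R fst (\<phi> j),
                partial_deriv (2 * j + 1) g (cyl_point W1 W2 \<phi> \<omega>) *\<^sub>R snd (\<phi> j))))"

text \<open>
  \<open>malliavin_deriv M W1 W2 F U\<close>: \<open>F\<close> lies in \<open>\<bbbD>\<^sup>1\<^sup>,\<^sup>2\<close> and \<open>U\<close> is a version of \<open>DF\<close>; this is the
  closure of the graph of \<open>D\<close>.
\<close>

definition malliavin_deriv ::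
    "'a measure \<Rightarrow> ('h::real_normed_vector \<Rightarrow> 'a \<Rightarrow> real) \<Rightarrow> ('h \<Rightarrow> 'a \<Rightarrow> real)
     \<Rightarrow> ('a \<Rightarrow> real) \<Rightarrow> ('a \<Rightarrow> 'h \<times> 'h) \<Rightarrow> bool" where
  "malliavin_deriv M W1 W2 F U \<longleftrightarrow>
     (\<exists>Fs Us. (\<forall>n. smooth_cylindrical W1 W2 (Fs n) (Us n)) \<and> L2_tendsto M Fs F \<and> L2_tendsto M Us U)"

text \<open>
  A list of triples \<open>(F, U, v)\<close>, with \<open>U\<close> the derivative of \<open>F\<close>, encodes the smooth vector
  valued variable \<open>u = \<Sum> F v\<close>, whose derivative is \<open>\<Sum> U \<otimes> v\<close>. The squared norm of the latter
  in the Hilbert tensor product is \<open>deriv_normsq\<close>, so that only norms of differences of smooth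
  variables, and no type of tensors, are needed to form \<open>\<bbbD>\<^sup>1\<^sup>,\<^sup>2\<close> of vector valued variables.
\<close>

type_synonym ('a, 'v) smooth_rep = "(('a \<Rightarrow> real) \<times> ('a \<Rightarrow> 'v) \<times> 'v) list"

definition smooth_val :: "('a, 'v::real_vector) smooth_rep \<Rightarrow> 'a \<Rightarrow> 'v" where
  "smooth_val S \<omega> = (\<Sum>(F, U, v)\<leftarrow>S. F \<omega> *\<^sub>R v)"

definition smooth_diff :: "('a, 'v::real_vector) smooth_rep \<Rightarrow> ('a, 'v) smooth_rep \<Rightarrow> ('a, 'v) smooth_rep" where
  "smooth_diff S T = S @ map (\<lambda>(F, U, v). (F, U, - v)) T"

definition deriv_normsq :: "('a, 'v::real_inner) smooth_rep \<Rightarrow> 'a \<Rightarrow> real" where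
  "deriv_normsq S \<omega> = (\<Sum>(F, U, v)\<leftarrow>S. \<Sum>(F', U', v')\<leftarrow>S. (U \<omega> \<bullet> U' \<omega>) * (v \<bullet> v'))"

definition D12_H2 ::
    "'a measure \<Rightarrow> ('h::real_inner \<Rightarrow> 'a \<Rightarrow> real) \<Rightarrow> ('h \<Rightarrow> 'a \<Rightarrow> real) \<Rightarrow> ('a \<Rightarrow> 'h \<times> 'h) set" where
  "D12_H2 M W1 W2 = {u. \<exists>S :: nat \<Rightarrow> ('a, 'h \<times> 'h) smooth_rep.
     (\<forall>n. \<forall>(F, U, v)\<in>set (S n). smooth_cylindrical W1 W2 F U) \<and>
     L2_tendsto M (\<lambda>n. smooth_val (S n)) u \<and>
     (\<forall>\<epsilon>>0. \<exists>N. \<forall>m\<ge>N. \<forall>n\<ge>N.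
        (\<integral>\<^sup>+ \<omega>. ennreal (deriv_normsq (smooth_diff (S m) (S n)) \<omega>) \<partial>M) < ennreal \<epsilon>)}"

text \<open>
  The adjoint is taken in the \<open>L\<^sup>2\<close> space of the \<open>\<sigma>\<close>-algebra \<open>G\<close> generated by the process. If
  \<open>M\<close> carries more randomness than \<open>G\<close>, the duality relation alone would determine only the
  conditional expectation of \<open>X\<close> given \<open>G\<close>.
\<close>

definition has_divergence ::
    "'a measure \<Rightarrow> 'a measure \<Rightarrow> ('h::real_inner \<Rightarrow> 'a \<Rightarrow> real) \<Rightarrow> ('h \<Rightarrow> 'a \<Rightarrow> real)
     \<Rightarrow> ('a \<Rightarrow> 'h \<times> 'h) \<Rightarrow> ('a \<Rightarrow> real) \<Rightarrow> bool" where
  "has_divergence M G W1 W2 u X \<longleftrightarrow>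
     square_integrable M u \<and> square_integrable M X \<and> X \<in> borel_measurable G \<and>
     (\<forall>F U. malliavin_deriv M W1 W2 F U \<longrightarrow> (\<integral>\<omega>. F \<omega> * X \<omega> \<partial>M) = (\<integral>\<omega>. U \<omega> \<bullet> u \<omega> \<partial>M))"

definition has_local_divergence ::
    "'a measure \<Rightarrow> 'a measure \<Rightarrow> ('h::real_inner \<Rightarrow> 'a \<Rightarrow> real) \<Rightarrow> ('h \<Rightarrow> 'a \<Rightarrow> real)
     \<Rightarrow> ('a \<Rightarrow> 'h \<times> 'h) \<Rightarrow> ('a \<Rightarrow> real) \<Rightarrow> bool" where
  "has_local_divergence M G W1 W2 u X \<longleftrightarrow> X \<in> borel_measurable M \<and>
     (\<exists>A v Y. (\<forall>n. A n \<in> sets M) \<and> incseq A \<and> (AE \<omega> in M. \<omega> \<in> (\<Union>n. A n)) \<and>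
        (\<forall>n. v n \<in> D12_H2 M W1 W2 \<and> has_divergence M G W1 W2 (v n) (Y n) \<and>
             (AE \<omega> in M. \<omega> \<in> A n \<longrightarrow> u \<omega> = v n \<omega> \<and> X \<omega> = Y n \<omega>)))"

text \<open>\<open>has_real_divergence_integral \<dots> a b t X\<close>: \<open>X\<close> is a version of
  \<open>\<integral>\<^sub>0\<^sup>t a \<delta>B\<^sup>1 + \<integral>\<^sub>0\<^sup>t b \<delta>B\<^sup>2\<close>.\<close>

definition has_real_divergence_integral ::
    "'a measure \<Rightarrow> 'a measure \<Rightarrow> real \<Rightarrow> (real \<Rightarrow> 'h::real_inner) \<Rightarrow> ('h \<Rightarrow> 'a \<Rightarrow> real) \<Rightarrow> ('h \<Rightarrow> 'a \<Rightarrow> real)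
     \<Rightarrow> (real \<Rightarrow> 'a \<Rightarrow> real) \<Rightarrow> (real \<Rightarrow> 'a \<Rightarrow> real) \<Rightarrow> real \<Rightarrow> ('a \<Rightarrow> real) \<Rightarrow> bool" where
  "has_real_divergence_integral M G H e W1 W2 a b t X \<longleftrightarrow>
     (\<exists>u. (AE \<omega> in M.
             represents H e (\<lambda>s. a s \<omega> * indicator {0<..<t} s) (fst (u \<omega>)) \<and>
             represents H e (\<lambda>s. b s \<omega> * indicator {0<..<t} s) (snd (u \<omega>))) \<and>
          has_local_divergence M G W1 W2 u X)"

definition has_divergence_integral ::
    "'a measure \<Rightarrow> 'a measure \<Rightarrow> real \<Rightarrow> (real \<Rightarrow> 'h::real_inner) \<Rightarrow> ('h \<Rightarrow> 'a \<Rightarrow> real) \<Rightarrow> ('h \<Rightarrow> 'a \<Rightarrow> real)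
     \<Rightarrow> (real \<Rightarrow> 'a \<Rightarrow> complex) \<Rightarrow> real \<Rightarrow> ('a \<Rightarrow> complex) \<Rightarrow> bool" where
  "has_divergence_integral M G H e W1 W2 u t Z \<longleftrightarrow>
     has_real_divergence_integral M G H e W1 W2
       (\<lambda>s \<omega>. Re (u s \<omega>)) (\<lambda>s \<omega>. - Im (u s \<omega>)) t (\<lambda>\<omega>. Re (Z \<omega>)) \<and>
     has_real_divergence_integral M G H e W1 W2
       (\<lambda>s \<omega>. Im (u s \<omega>)) (\<lambda>s \<omega>. Re (u s \<omega>)) t (\<lambda>\<omega>. Im (Z \<omega>))"

end

theory Submission
  imports Defs "HOL-Real_Asymp.Real_Asymp"
begin

text \<open>
  The paths are Hoelder continuous of some order \<open>\<gamma> > 1/2\<close>. At a given time \<open>B\<close> lies within \<open>r\<close>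
  of the origin with probability at most a constant times \<open>r\<^sup>2\<close>, while about \<open>r\<close> to the power
  \<open>-1/\<gamma>\<close> grid points control the path at scale \<open>r\<close>; hence \<open>B\<close> never vanishes, and
  \<open>B = z0 * exp L\<close> for a continuous \<open>L\<close>. As \<open>exp w - 1 - w\<close> is quadratic in \<open>w\<close>, the Riemann sums of
  \<open>dB / B\<close> differ from the increments of \<open>L\<close> by sums of \<open>|\<Delta>t|\<close> to the power \<open>2 * \<gamma>\<close>, which
  tend to \<open>0\<close>; so \<open>L\<close> is the pathwise integral.

  For a smooth bounded planar field \<open>f\<close>, Gaussian integration by parts identifies the divergence
  of \<open>f(B)\<close> with the limit of the Riemann sums corrected by a trace term that involves only the
  planar divergence of \<open>f\<close> along the path. By the Cauchy-Riemann equations the fields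
  \<open>(Re (1/z), - Im (1/z))\<close> and \<open>(Im (1/z), Re (1/z))\<close> have divergence zero. Cutting them off near
  the origin and near infinity, one sees that the local divergence integral of \<open>1/B\<close> is also
  \<open>L\<close>.
\<close>

section \<open>A smooth cutoff of the reciprocal\<close>

text \<open>The condition H > 1/2 is also what makes the divergence sums converge. Disjoint
  increments are then positively correlated, so quadratic forms over a grid can be estimated through
  their coefficients. Halving \<open>2 ^ N\<close> cells changes the corrected Riemann sums by
  \<open>2 ^ N\<close> second order terms, each of mean square of order 2 to the power -4HN; the
  crude bound for the square of a sum costs \<open>4 ^ N\<close> in total, and 2 - 4H < 0 leaves a
  geometric series.

  The coefficient of the trace term is the covariance of the position with the next increment. It is
  the same for both coordinates, and independence removes the mixed terms; this is why exactly the
  planar divergence survives. Over a grid on [0,t] these coefficients add up to nearly half of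
  \<open>t powr (2 * H)\<close>, so refinement does not make the correction disappear: it has to
  vanish through the Cauchy-Riemann equations, on an open set on which the cutoff is exact.

  All limits are taken along the same dyadic grids. The limit of the dyadic sums of dB / B can
  therefore be compared both with the continuous logarithm of the path and with the
  divergence.\<close>

definition exp_flat :: "nat \<Rightarrow> real \<Rightarrow> real" where
  "exp_flat k s = (if 0 < s then exp (- 1 / s) / s ^ k else 0)"

lemma exp_flat_nonneg: "0 \<le> exp_flat k s"
  by (simp add: exp_flat_def)

lemma exp_flat_pos: "0 < s \<Longrightarrow> 0 < exp_flat k s"
  by (simp add: exp_flat_def)

lemma exp_flat_tendsto_0: "(exp_flat k \<longlongrightarrow> 0) (at 0)"
proof -
  have "((\<lambda>x::real. x ^ k / exp x) \<longlongrightarrow> 0) at_top"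
    by (rule tendsto_power_div_exp_0)
  then have "((\<lambda>s. inverse s ^ k / exp (inverse s)) \<longlongrightarrow> 0) (at_right (0::real))"
    by (rule filterlim_compose[OF _ filterlim_inverse_at_top_right])
  then have "(exp_flat k \<longlongrightarrow> 0) (at_right 0)"
    by (rule Lim_transform_eventually)
       (auto simp: exp_flat_def eventually_at_filter exp_minus divide_simps)
  moreover have "(exp_flat k \<longlongrightarrow> 0) (at_left 0)"
    by (rule tendsto_eventually) (auto simp: exp_flat_def eventually_at_filter)
  ultimately show ?thesis
    by (simp add: filterlim_split_at_real)
qed

text \<open>The functions exp (-1/s) / s^k, extended by 0, form a family closed under
  differentiation up to linear combinations. Indexing by k lets a single formula yield derivatives
  of every order, also at the flat point 0.\<close>

lemma DERIV_exp_flat: "(exp_flat k has_real_derivative exp_flat (k + 2) s - real k * exp_flat (k + 1) s) (at s)"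
proof -
  consider "0 < s" | "s < 0" | "s = 0" by linarith
  then show ?thesis
  proof cases
    case 1
    have "((\<lambda>s. exp (- 1 / s) / s ^ k) has_real_derivative
        exp (- 1 / s) / s ^ (k + 2) - real k * (exp (- 1 / s) / s ^ (k + 1))) (at s)"
    proof (cases k)
      case 0
      then show ?thesis
        using 1 by (auto intro!: derivative_eq_intros simp: power2_eq_square)
    next
      case (Suc n)
      have "((\<lambda>s. exp (- 1 / s) / s ^ Suc n) has_real_derivative
          (exp (- 1 / s) * (1 / s\<^sup>2) * s ^ Suc n - exp (- 1 / s) * (real (Suc n) * s ^ n)) /
          (s ^ Suc n * s ^ Suc n)) (at s)"
        using 1 DERIV_pow[of "Suc n" s UNIV]
        by (auto intro!: derivative_eq_intros simp: power2_eq_square simp del: power_Suc of_nat_Suc)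
      also have "(exp (- 1 / s) * (1 / s\<^sup>2) * s ^ Suc n - exp (- 1 / s) * (real (Suc n) * s ^ n)) /
          (s ^ Suc n * s ^ Suc n) =
          exp (- 1 / s) / s ^ (Suc n + 2) - real (Suc n) * (exp (- 1 / s) / s ^ (Suc n + 1))"
        using 1 by (simp add: divide_simps power2_eq_square; simp add: algebra_simps)
      finally show ?thesis
        using Suc by simp
    qed
    then have "(exp_flat k has_real_derivative
        exp (- 1 / s) / s ^ (k + 2) - real k * (exp (- 1 / s) / s ^ (k + 1))) (at s)"
      by (rule has_field_derivative_transform_within_open[where S="{0<..}"])
        (use 1 in \<open>auto simp: exp_flat_def\<close>)
    then show ?thesis
      using 1 by (simp add: exp_flat_def)
  next
    case 2
    have "((\<lambda>s. 0) has_real_derivative 0) (at s)" by simp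
    then have "(exp_flat k has_real_derivative 0) (at s)"
      by (rule has_field_derivative_transform_within_open[where S="{..<0}"])
        (use 2 in \<open>auto simp: exp_flat_def\<close>)
    then show ?thesis
      using 2 by (simp add: exp_flat_def)
  next
    case 3
    \<comment> \<open>At 0 the difference quotient of a member of the family is its next member,
      which tends to 0.\<close>
    have "(\<lambda>h. exp_flat k h / h) = exp_flat (Suc k)"
      by (rule ext) (simp add: exp_flat_def)
    then have "(exp_flat k has_real_derivative 0) (at 0)"
      using exp_flat_tendsto_0[of "Suc k"] by (simp add: DERIV_def) (simp add: exp_flat_def)
    then show ?thesis
      using 3 by (simp add: exp_flat_def)
  qed
qed

text \<open>A class generated by operations under which partial derivatives stay in the class, so
  membership certifies smoothness of every order and is proved by introduction rules alone.
  Subtraction is expressed through a factor -1.\<close>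

inductive_set smooth_funs :: "((nat \<Rightarrow> real) \<Rightarrow> real) set" where
  const: "(\<lambda>_. c) \<in> smooth_funs"
| coord: "(\<lambda>x. x i) \<in> smooth_funs"
| add: "g \<in> smooth_funs \<Longrightarrow> h \<in> smooth_funs \<Longrightarrow> (\<lambda>x. g x + h x) \<in> smooth_funs"
| mult: "g \<in> smooth_funs \<Longrightarrow> h \<in> smooth_funs \<Longrightarrow> (\<lambda>x. g x * h x) \<in> smooth_funs"
| inv: "g \<in> smooth_funs \<Longrightarrow> (\<And>x. g x \<noteq> 0) \<Longrightarrow> (\<lambda>x. inverse (g x)) \<in> smooth_funs"
| exp_flat: "g \<in> smooth_funs \<Longrightarrow> (\<lambda>x. exp_flat k (g x)) \<in> smooth_funs"

lemma smooth_funs_continuous: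
  assumes "g \<in> smooth_funs" shows "continuous_on UNIV g"
  using assms
proof induction
  case (coord i)
  show ?case by (intro continuous_intros continuous_on_product_coordinates)
next
  case (exp_flat g k)
  have "continuous_on UNIV (exp_flat k)"
    using DERIV_exp_flat[of k] DERIV_isCont continuous_at_imp_continuous_on by blast
  then show ?case
    using exp_flat continuous_on_compose2[of UNIV "exp_flat k" UNIV g] by auto
qed (auto intro!: continuous_intros)

lemma smooth_funs_partial:
  assumes "g \<in> smooth_funs"
  shows "\<exists>g'\<in>smooth_funs. \<forall>x. ((\<lambda>r. g (x(i := r))) has_real_derivative g' x) (at (x i))"
  using assms
proof induction
  case (const c)
  show ?case by (rule bexI[OF _ smooth_funs.const[of 0]]) auto
next
  case (coord j)
  show ?case
    by (rule bexI[OF _ smooth_funs.const[of "if i = j then 1 else 0"]])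
       (auto intro!: derivative_eq_intros)
next
  case (add g h)
  then obtain g' h' where "g' \<in> smooth_funs" "h' \<in> smooth_funs"
    "\<And>x. ((\<lambda>r. g (x(i := r))) has_real_derivative g' x) (at (x i))"
    "\<And>x. ((\<lambda>r. h (x(i := r))) has_real_derivative h' x) (at (x i))" by blast
  then show ?case
    by (intro bexI[of _ "\<lambda>x. g' x + h' x"]) (auto intro!: derivative_eq_intros smooth_funs.intros simp del: fun_upd_apply)
next
  case (mult g h)
  then obtain g' h' where "g' \<in> smooth_funs" "h' \<in> smooth_funs"
    "\<And>x. ((\<lambda>r. g (x(i := r))) has_real_derivative g' x) (at (x i))"
    "\<And>x. ((\<lambda>r. h (x(i := r))) has_real_derivative h' x) (at (x i))" by blast
  then show ?case
    using mult.hyps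
    by (intro bexI[of _ "\<lambda>x. g' x * h x + h' x * g x"])
       (auto intro!: derivative_eq_intros smooth_funs.intros simp del: fun_upd_apply)
next
  case (inv g)
  then obtain g' where "g' \<in> smooth_funs"
    "\<And>x. ((\<lambda>r. g (x(i := r))) has_real_derivative g' x) (at (x i))" by blast
  then show ?case
    using inv.hyps
    by (intro bexI[of _ "\<lambda>x. (- 1) * (inverse (g x) * (g' x * inverse (g x)))"] allI
        smooth_funs.mult smooth_funs.inv smooth_funs.const)
       (auto simp del: fun_upd_apply intro!: derivative_eq_intros)
next
  case (exp_flat g k)
  then obtain g' where "g' \<in> smooth_funs"
    and g': "\<And>x. ((\<lambda>r. g (x(i := r))) has_real_derivative g' x) (at (x i))" by blast
  moreover have "((\<lambda>r. exp_flat k (g (x(i := r)))) has_real_derivative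
      (exp_flat (k + 2) (g x) - real k * exp_flat (k + 1) (g x)) * g' x) (at (x i))" for x
    using DERIV_chain2[OF DERIV_exp_flat g'[of x]] by simp
  moreover have "(\<lambda>x. (exp_flat (k + 2) (g x) + (- real k) * exp_flat (k + 1) (g x)) * g' x) \<in> smooth_funs"
    using exp_flat.hyps \<open>g' \<in> smooth_funs\<close> by (intro smooth_funs.intros)
  ultimately show ?case
    by (intro bexI[of _ "\<lambda>x. (exp_flat (k + 2) (g x) + (- real k) * exp_flat (k + 1) (g x)) * g' x"])
       (auto simp del: fun_upd_apply)
qed

lemma smooth_funs_partial_deriv:
  assumes "g \<in> smooth_funs"
  shows "partial_deriv i g \<in> smooth_funs"
    and "((\<lambda>r. g (x(i := r))) has_real_derivative partial_deriv i g x) (at (x i))"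
proof -
  obtain g' where g': "g' \<in> smooth_funs"
    "\<And>x. ((\<lambda>r. g (x(i := r))) has_real_derivative g' x) (at (x i))"
    using smooth_funs_partial[OF assms] by blast
  then have "partial_deriv i g = g'"
    by (intro ext) (simp add: partial_deriv_def DERIV_imp_deriv)
  with g' show "partial_deriv i g \<in> smooth_funs"
    "((\<lambda>r. g (x(i := r))) has_real_derivative partial_deriv i g x) (at (x i))" by auto
qed

text \<open>Dependence on the first m coordinates and support in a box both pass to partial
  derivatives, so the class \<open>K\<close> contains every iterated partial; each member of
  \<open>K\<close> is bounded because it is continuous and its values are taken on a compact
  set.\<close>

lemma smooth_funs_Cb_infinity:
  assumes "g \<in> smooth_funs"
    and dep: "\<And>x y. (\<And>i. i < m \<Longrightarrow> x i = y i) \<Longrightarrow> g x = g y"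
    and supp: "\<And>x. g x \<noteq> 0 \<Longrightarrow> \<forall>i<m. \<bar>x i\<bar> \<le> R"
  shows "g \<in> Cb_infinity m"
proof -
  define K where "K = {g \<in> smooth_funs. (\<forall>x y. (\<forall>i<m. x i = y i) \<longrightarrow> g x = g y) \<and>
    (\<forall>x. g x \<noteq> 0 \<longrightarrow> (\<forall>i<m. \<bar>x i\<bar> \<le> R))}"
  have K_partial: "partial_deriv i g \<in> K" if "g \<in> K" "i < m" for g i
  proof -
    have "partial_deriv i g x = partial_deriv i g y" if "\<forall>i<m. x i = y i" for x y
    proof -
      have "g (x(i := r)) = g (y(i := r))" for r
        using \<open>g \<in> K\<close> that by (auto simp: K_def)
      then show ?thesis using that \<open>i < m\<close> by (simp add: partial_deriv_def)
    qed
    moreover have "partial_deriv i g x = 0" if "j < m" "R < \<bar>x j\<bar>" for x j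
    proof -
      \<comment> \<open>The exterior of the box is open, so \<open>g\<close> vanishes along the i-th
        coordinate line near a point outside the box, and its derivative there is 0.\<close>
      have "open {r. R < \<bar>r\<bar>}"
        by (intro open_Collect_less continuous_intros)
      then have "\<forall>\<^sub>F r in nhds (x i). r \<in> {r. j = i \<longrightarrow> R < \<bar>r\<bar>}"
        using that eventually_nhds_in_open[of "{r. R < \<bar>r\<bar>}" "x i"] by (cases "j = i") auto
      then have "\<forall>\<^sub>F r in nhds (x i). g (x(i := r)) = 0"
      proof (rule eventually_mono)
        fix r assume "r \<in> {r. j = i \<longrightarrow> R < \<bar>r\<bar>}"
        then have "\<not> \<bar>(x(i := r)) j\<bar> \<le> R" using that by auto
        moreover have "g (x(i := r)) \<noteq> 0 \<longrightarrow> (\<forall>i'<m. \<bar>(x(i := r)) i'\<bar> \<le> R)"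
          using \<open>g \<in> K\<close> unfolding K_def by blast
        ultimately show "g (x(i := r)) = 0"
          using \<open>j < m\<close> by blast
      qed
      then have "deriv (\<lambda>r. g (x(i := r))) (x i) = deriv (\<lambda>r. 0) (x i)"
        by (rule deriv_cong_ev) simp
      then show ?thesis by (simp add: partial_deriv_def)
    qed
    ultimately show ?thesis
      using smooth_funs_partial_deriv(1)[of g i] \<open>g \<in> K\<close> unfolding K_def mem_Collect_eq
      by (intro conjI) (blast, blast, metis not_less)
  qed
  have K_bounded: "bounded (range g)" if "g \<in> K" for g
  proof -
    \<comment> \<open>A box in the first m coordinates is not compact among all sequences. Pinning
      the remaining coordinates at 0, to which \<open>g\<close> is blind, turns it into a product of
      compact sets.\<close>
    define C where "C = (\<Pi>\<^sub>E i\<in>UNIV. if i < m then {-R..R} else {0::real})"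
    have "compactin (product_topology (\<lambda>i. euclidean) UNIV) C"
      unfolding C_def by (subst compactin_PiE) auto
    then have "compact C"
      by (simp add: euclidean_product_topology)
    moreover have "continuous_on C g"
      using smooth_funs_continuous that continuous_on_subset unfolding K_def by blast
    ultimately have "bounded (g ` C)"
      by (intro compact_imp_bounded compact_continuous_image)
    moreover have "g x \<in> insert 0 (g ` C)" for x
    proof (cases "g x = 0")
      case False
      have "g x = g (\<lambda>i. if i < m then x i else 0)"
        using that unfolding K_def by auto
      moreover have "(\<lambda>i. if i < m then x i else 0) \<in> C"
      proof -
        have "\<forall>i<m. \<bar>x i\<bar> \<le> R"
          using that False unfolding K_def by blast
        then show ?thesis by (auto simp: C_def abs_le_iff minus_le_iff)
      qed
      ultimately show ?thesis by auto
    qed simp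
    ultimately show ?thesis
      by (metis bounded_insert bounded_subset image_subsetI)
  qed
  have it: "iterated_partial is g \<in> K" if "set is \<subseteq> {..<m}" for "is"
    using that
  proof (induction "is")
    case Nil
    have "g \<in> K"
      unfolding K_def mem_Collect_eq using assms(1) supp by (intro conjI allI impI dep) blast+
    then show ?case by (simp add: iterated_partial_def)
  next
    case (Cons i "is")
    then show ?case using K_partial[of "iterated_partial is g" i] by (simp add: iterated_partial_def)
  qed
  have K_diff: "(\<lambda>r. h (x(i := r))) differentiable (at (x i))" if "h \<in> K" for h x i
    using smooth_funs_partial_deriv(2) that unfolding K_def real_differentiable_def by blast
  have K_cont: "continuous_on UNIV h" if "h \<in> K" for h
    using that smooth_funs_continuous unfolding K_def by blast
  show ?thesis
    unfolding Cb_infinity_def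
    using K_diff[OF it] K_cont[OF it] K_bounded[OF it] by (auto intro: dep)
qed

text \<open>With z = (w 0 + a) + i (w 1 + b), \<open>p\<close> and \<open>q\<close> are the real and
  imaginary parts of 1/z times a cutoff depending on the squared modulus \<open>s\<close>. The last
  two claims are the Cauchy-Riemann equations on the open annulus where the cutoff is exact. The
  shift by a and b accounts for the Gaussian coordinates being centred.\<close>

lemma reciprocal_cutoff:
  fixes a b \<delta> R :: real
  defines "s \<equiv> \<lambda>w::nat \<Rightarrow> real. (w 0 + a)\<^sup>2 + (w 1 + b)\<^sup>2"
  assumes "0 < \<delta>" "\<delta> < R"
  obtains p q where "p \<in> Cb_infinity 2" "q \<in> Cb_infinity 2" "(\<lambda>w. - q w) \<in> Cb_infinity 2"
    "\<And>w. \<delta> < s w \<Longrightarrow> s w < R \<Longrightarrow> p w = (w 0 + a) / s w"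
    "\<And>w. \<delta> < s w \<Longrightarrow> s w < R \<Longrightarrow> q w = - (w 1 + b) / s w"
    "\<And>w. \<delta> < s w \<Longrightarrow> s w < R \<Longrightarrow>
       partial_deriv 0 p w + partial_deriv 1 (\<lambda>w. - q w) w = 0"
    "\<And>w. \<delta> < s w \<Longrightarrow> s w < R \<Longrightarrow> partial_deriv 0 q w + partial_deriv 1 p w = 0"
proof -
  \<comment> \<open>\<open>D\<close> is positive everywhere and equals \<open>s\<close> where s is
    at least \<delta>, which removes the pole. The quotient with denominator \<open>E\<close> is the
    usual smooth transition, equal to 1 where s is at most R and to 0 where s is at least
    2R.\<close>
  define D where "D w = s w + exp_flat 0 (\<delta> + (- 1) * s w)" for w
  define E where "E w = exp_flat 0 (2 * R + (- 1) * s w) + exp_flat 0 (s w + (- R))" for w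
  define g where "g w = inverse (D w) * (exp_flat 0 (2 * R + (- 1) * s w) * inverse (E w))" for w
  define p where "p w = (w 0 + a) * g w" for w
  define q where "q w = (- 1) * ((w 1 + b) * g w)" for w
  have D_pos: "0 < D w" for w
  proof (cases "0 < s w")
    case True
    then show ?thesis unfolding D_def using exp_flat_nonneg add_pos_nonneg by blast
  next
    case False
    then have "s w = 0"
      by (metis not_sum_power2_lt_zero s_def linorder_neqE_linordered_idom)
    then show ?thesis
      using \<open>0 < \<delta>\<close> by (simp add: D_def exp_flat_pos)
  qed
  have E_pos: "0 < E w" for w
  proof (cases "s w < 2 * R")
    case True
    then show ?thesis unfolding E_def
      by (intro add_pos_nonneg[OF exp_flat_pos exp_flat_nonneg]) auto
  next
    case False
    then show ?thesis
      using assms unfolding E_def by (intro add_nonneg_pos[OF exp_flat_nonneg exp_flat_pos]) auto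
  qed
  have coord: "(\<lambda>w. w i + c) \<in> smooth_funs" for i c
    by (intro smooth_funs.intros)
  have s: "s \<in> smooth_funs"
    unfolding s_def power2_eq_square by (intro smooth_funs.add smooth_funs.mult coord)
  have DE: "D \<in> smooth_funs" "E \<in> smooth_funs"
    unfolding D_def[abs_def] E_def[abs_def] by (intro smooth_funs.intros s)+
  have g: "g \<in> smooth_funs"
    unfolding g_def[abs_def]
    by (intro smooth_funs.mult smooth_funs.inv DE smooth_funs.exp_flat smooth_funs.add
        smooth_funs.const s) (use D_pos E_pos in \<open>simp_all add: less_imp_neq[THEN not_sym]\<close>)
  have smooth: "p \<in> smooth_funs" "q \<in> smooth_funs" "(\<lambda>w. - q w) \<in> smooth_funs"
  proof -
    show "p \<in> smooth_funs" "q \<in> smooth_funs"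
      unfolding p_def[abs_def] q_def[abs_def] by (intro smooth_funs.mult smooth_funs.const coord g)+
    then have "(\<lambda>w. (- 1) * q w) \<in> smooth_funs"
      by (intro smooth_funs.mult smooth_funs.const)
    then show "(\<lambda>w. - q w) \<in> smooth_funs" by simp
  qed
  have supp: "\<forall>i<2. \<bar>w i\<bar> \<le> sqrt (2 * R) + \<bar>a\<bar> + \<bar>b\<bar>" if "g w \<noteq> 0" for w
  proof -
    have "0 < 2 * R - s w"
      using that unfolding g_def exp_flat_def by (auto split: if_splits)
    then have "(w 0 + a)\<^sup>2 \<le> 2 * R" "(w 1 + b)\<^sup>2 \<le> 2 * R"
      unfolding s_def using zero_le_power2[of "w 0 + a"] zero_le_power2[of "w 1 + b"] by linarith+
    then have "\<bar>w 0 + a\<bar> \<le> sqrt (2 * R)" "\<bar>w 1 + b\<bar> \<le> sqrt (2 * R)"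
      by (metis real_sqrt_abs real_sqrt_le_mono)+
    then show ?thesis
      by (auto simp: numeral_2_eq_2 less_Suc_eq)
  qed
  have dep: "g w = g w'" if "\<And>i. i < 2 \<Longrightarrow> w i = w' i" for w w'
    using that[of 0] that[of 1] by (simp add: g_def D_def E_def s_def)
  have p_Cb: "p \<in> Cb_infinity 2"
  proof (rule smooth_funs_Cb_infinity[OF smooth(1)])
    show "p x = p y" if "\<And>i. i < 2 \<Longrightarrow> x i = y i" for x y
      using that[of 0] dep[OF that] by (simp add: p_def)
  qed (use supp in \<open>auto simp: p_def\<close>)
  have q_Cb: "q \<in> Cb_infinity 2"
  proof (rule smooth_funs_Cb_infinity[OF smooth(2)])
    show "q x = q y" if "\<And>i. i < 2 \<Longrightarrow> x i = y i" for x y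
      using that[of 1] dep[OF that] by (simp add: q_def)
  qed (use supp in \<open>auto simp: q_def\<close>)
  have q'_Cb: "(\<lambda>w. - q w) \<in> Cb_infinity 2"
  proof (rule smooth_funs_Cb_infinity[OF smooth(3)])
    show "- q x = - q y" if "\<And>i. i < 2 \<Longrightarrow> x i = y i" for x y
      using that[of 1] dep[OF that] by (simp add: q_def)
  qed (use supp in \<open>auto simp: q_def\<close>)
  have g_eq: "g w = inverse (s w)" if "\<delta> < s w" "s w < R" for w
  proof -
    have "exp_flat 0 (2 * R + (- 1) * s w) \<noteq> 0"
      using that assms by (intro less_imp_neq[THEN not_sym] exp_flat_pos) auto
    then show ?thesis
      using that by (simp add: g_def D_def E_def) (simp add: exp_flat_def)
  qed
  have deriv: "((\<lambda>r. p (w(0 := r))) has_real_derivative ((w 1 + b)\<^sup>2 - (w 0 + a)\<^sup>2) / (s w)\<^sup>2) (at (w 0))"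
    "((\<lambda>r. p (w(1 := r))) has_real_derivative - (2 * (w 0 + a) * (w 1 + b)) / (s w)\<^sup>2) (at (w 1))"
    "((\<lambda>r. q (w(0 := r))) has_real_derivative (2 * (w 0 + a) * (w 1 + b)) / (s w)\<^sup>2) (at (w 0))"
    "((\<lambda>r. - q (w(1 := r))) has_real_derivative ((w 0 + a)\<^sup>2 - (w 1 + b)\<^sup>2) / (s w)\<^sup>2) (at (w 1))"
    if w: "\<delta> < s w" "s w < R" for w
  proof -
    have s0: "s w \<noteq> 0" using w(1) \<open>0 < \<delta>\<close> by linarith
    \<comment> \<open>Openness of the slices of the annulus allows \<open>p\<close> and
      \<open>q\<close> to be replaced by the explicit quotients before differentiating in one
      variable.\<close>
    have op: "open {r. \<delta> < (r + a)\<^sup>2 + (w 1 + b)\<^sup>2 \<and> (r + a)\<^sup>2 + (w 1 + b)\<^sup>2 < R}"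
      "open {r. \<delta> < (w 0 + a)\<^sup>2 + (r + b)\<^sup>2 \<and> (w 0 + a)\<^sup>2 + (r + b)\<^sup>2 < R}"
      by (intro open_Collect_conj open_Collect_less continuous_intros)+
    have g0: "g (w(0 := r)) = inverse ((r + a)\<^sup>2 + (w 1 + b)\<^sup>2)"
      if "r \<in> {r. \<delta> < (r + a)\<^sup>2 + (w 1 + b)\<^sup>2 \<and> (r + a)\<^sup>2 + (w 1 + b)\<^sup>2 < R}" for r
      using g_eq[of "w(0 := r)"] that by (simp add: s_def)
    have g1: "g (w(1 := r)) = inverse ((w 0 + a)\<^sup>2 + (r + b)\<^sup>2)"
      if "r \<in> {r. \<delta> < (w 0 + a)\<^sup>2 + (r + b)\<^sup>2 \<and> (w 0 + a)\<^sup>2 + (r + b)\<^sup>2 < R}" for r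
      using g_eq[of "w(1 := r)"] that by (simp add: s_def)
    have "((\<lambda>r. (r + a) * inverse ((r + a)\<^sup>2 + (w 1 + b)\<^sup>2)) has_real_derivative
        ((w 1 + b)\<^sup>2 - (w 0 + a)\<^sup>2) / (s w)\<^sup>2) (at (w 0))"
      using s0 unfolding s_def
      by (auto intro!: derivative_eq_intros simp: field_simps power2_eq_square)
    then show "((\<lambda>r. p (w(0 := r))) has_real_derivative ((w 1 + b)\<^sup>2 - (w 0 + a)\<^sup>2) / (s w)\<^sup>2) (at (w 0))"
      by (rule has_field_derivative_transform_within_open[OF _ op(1)])
         (use w in \<open>auto simp: p_def g0 s_def\<close>)
    have "((\<lambda>r. (w 0 + a) * inverse ((w 0 + a)\<^sup>2 + (r + b)\<^sup>2)) has_real_derivative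
        - (2 * (w 0 + a) * (w 1 + b)) / (s w)\<^sup>2) (at (w 1))"
      using s0 unfolding s_def
      by (auto intro!: derivative_eq_intros simp: field_simps power2_eq_square)
    then show "((\<lambda>r. p (w(1 := r))) has_real_derivative - (2 * (w 0 + a) * (w 1 + b)) / (s w)\<^sup>2) (at (w 1))"
      by (rule has_field_derivative_transform_within_open[OF _ op(2)])
         (use w in \<open>auto simp: p_def g1[simplified] s_def\<close>)
    have "((\<lambda>r. - ((w 1 + b) * inverse ((r + a)\<^sup>2 + (w 1 + b)\<^sup>2))) has_real_derivative
        (2 * (w 0 + a) * (w 1 + b)) / (s w)\<^sup>2) (at (w 0))"
      using s0 unfolding s_def
      by (auto intro!: derivative_eq_intros simp: divide_inverse power2_eq_square mult_ac)
    then show "((\<lambda>r. q (w(0 := r))) has_real_derivative (2 * (w 0 + a) * (w 1 + b)) / (s w)\<^sup>2) (at (w 0))"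
      by (rule has_field_derivative_transform_within_open[OF _ op(1)])
         (use w in \<open>auto simp: q_def g0 s_def\<close>)
    have "((\<lambda>r. (r + b) * inverse ((w 0 + a)\<^sup>2 + (r + b)\<^sup>2)) has_real_derivative
        ((w 0 + a)\<^sup>2 - (w 1 + b)\<^sup>2) / (s w)\<^sup>2) (at (w 1))"
      using s0 unfolding s_def
      by (auto intro!: derivative_eq_intros simp: field_simps power2_eq_square)
    then show "((\<lambda>r. - q (w(1 := r))) has_real_derivative ((w 0 + a)\<^sup>2 - (w 1 + b)\<^sup>2) / (s w)\<^sup>2) (at (w 1))"
      by (rule has_field_derivative_transform_within_open[OF _ op(2)])
         (use w in \<open>auto simp: q_def g1[simplified] s_def\<close>)
  qed
  show thesis
  proof (rule that[OF p_Cb q_Cb q'_Cb])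
    fix w assume w: "\<delta> < s w" "s w < R"
    show "p w = (w 0 + a) / s w" "q w = - (w 1 + b) / s w"
      using g_eq[OF w] by (simp_all add: p_def q_def divide_inverse algebra_simps)
    show "partial_deriv 0 p w + partial_deriv 1 (\<lambda>w. - q w) w = 0"
      using deriv(1,4)[OF w, THEN DERIV_imp_deriv]
      by (simp add: partial_deriv_def add_divide_distrib[symmetric])
    show "partial_deriv 0 q w + partial_deriv 1 p w = 0"
      using deriv[OF w, THEN DERIV_imp_deriv] by (simp add: partial_deriv_def)
  qed
qed

section \<open>Gaussian integration by parts\<close>

lemma tendsto_componentwise_fun:
  fixes f :: "'b \<Rightarrow> 'i \<Rightarrow> 'c::topological_space"
  assumes "\<And>i. ((\<lambda>x. f x i) \<longlongrightarrow> l i) F"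
  shows "(f \<longlongrightarrow> l) F"
proof -
  have "limitin (product_topology (\<lambda>i. euclidean) UNIV) f l F"
    using assms by (simp add: limitin_componentwise)
  then show ?thesis by (simp add: euclidean_product_topology)
qed

text \<open>The chain rule along a line is obtained from continuous partial derivatives: the
  increment is telescoped one coordinate at a time, the mean value theorem is applied to each piece,
  and the intermediate points converge coordinatewise.\<close>

lemma DERIV_partial_chain:
  fixes G :: "(nat \<Rightarrow> real) \<Rightarrow> real" and G' :: "nat \<Rightarrow> (nat \<Rightarrow> real) \<Rightarrow> real"
  assumes dep: "\<And>x y. (\<And>i. i < m \<Longrightarrow> x i = y i) \<Longrightarrow> G x = G y"
    and der: "\<And>j x. j < m \<Longrightarrow> ((\<lambda>r. G (x(j := r))) has_real_derivative G' j x) (at (x j))"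
    and cont: "\<And>j. j < m \<Longrightarrow> continuous_on UNIV (G' j)"
  shows "((\<lambda>s. G (\<lambda>j. a j + s * c j)) has_real_derivative
           (\<Sum>j<m. c j * G' j (\<lambda>i. a i + s * c i))) (at s)"
proof -
  define y where "y t = (\<lambda>j. a j + t * c j)" for t
  \<comment> \<open>A hybrid point: coordinates below k are already moved to parameter t, the others
    still sit at parameter s.\<close>
  define p where "p k t = (\<lambda>j. if j < k then y t j else y s j)" for k :: nat and t
  have step: "\<exists>\<theta>. \<bar>\<theta> - y s k\<bar> \<le> \<bar>y t k - y s k\<bar> \<and>
      G (p (Suc k) t) - G (p k t) = (y t k - y s k) * G' k ((p k t)(k := \<theta>))"
    if "k < m" for k t
  proof -
    have p: "p (Suc k) t = (p k t)(k := y t k)" "p k t = (p k t)(k := y s k)"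
      by (auto simp: p_def less_Suc_eq)
    have d: "((\<lambda>r. G ((p k t)(k := r))) has_real_derivative G' k ((p k t)(k := r))) (at r)" for r
      using der[OF that, of "(p k t)(k := r)"] by simp
    consider "y s k = y t k" | "y s k < y t k" | "y t k < y s k" by linarith
    then show ?thesis
    proof cases
      case 1
      then show ?thesis using p by (intro exI[of _ "y s k"]) auto
    next
      case 2
      from MVT2[OF 2 d] obtain z where "y s k < z" "z < y t k"
        "G ((p k t)(k := y t k)) - G ((p k t)(k := y s k)) = (y t k - y s k) * G' k ((p k t)(k := z))"
        by blast
      then show ?thesis using p by (intro exI[of _ z]) auto
    next
      case 3
      from MVT2[OF 3 d] obtain z where "y t k < z" "z < y s k"
        "G ((p k t)(k := y s k)) - G ((p k t)(k := y t k)) = (y s k - y t k) * G' k ((p k t)(k := z))"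
        by blast
      then show ?thesis using p by (intro exI[of _ z]) (auto simp: algebra_simps)
    qed
  qed
  have "\<forall>k t. \<exists>\<theta>. k < m \<longrightarrow> \<bar>\<theta> - y s k\<bar> \<le> \<bar>y t k - y s k\<bar> \<and>
      G (p (Suc k) t) - G (p k t) = (y t k - y s k) * G' k ((p k t)(k := \<theta>))"
    using step by blast
  then obtain \<theta> where \<theta>: "\<And>k t. k < m \<Longrightarrow> \<bar>\<theta> k t - y s k\<bar> \<le> \<bar>y t k - y s k\<bar>"
    "\<And>k t. k < m \<Longrightarrow> G (p (Suc k) t) - G (p k t) = (y t k - y s k) * G' k ((p k t)(k := \<theta> k t))"
    by metis
  have y_lim: "((\<lambda>t. y t j) \<longlongrightarrow> y s j) (at s)" for j
    unfolding y_def by (intro tendsto_intros)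
  have lim: "((\<lambda>t. G' k ((p k t)(k := \<theta> k t))) \<longlongrightarrow> G' k (y s)) (at s)" if "k < m" for k
  proof -
    have "((\<lambda>t. \<theta> k t - y s k) \<longlongrightarrow> 0) (at s)"
    proof (rule tendsto_rabs_zero_cancel, rule tendsto_sandwich[of "\<lambda>_. 0"])
      show "((\<lambda>t. \<bar>y t k - y s k\<bar>) \<longlongrightarrow> 0) (at s)"
        using y_lim[of k] by (intro tendsto_rabs_zero) (simp add: LIM_zero)
    qed (use \<theta>(1)[OF that] in auto)
    then have "(\<theta> k \<longlongrightarrow> y s k) (at s)" by (simp add: LIM_zero_iff)
    then have "((\<lambda>t. (p k t)(k := \<theta> k t)) \<longlongrightarrow> y s) (at s)"
    proof (intro tendsto_componentwise_fun)
      show "((\<lambda>t. ((p k t)(k := \<theta> k t)) i) \<longlongrightarrow> y s i) (at s)" for i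
        using \<open>(\<theta> k \<longlongrightarrow> y s k) (at s)\<close> y_lim[of i]
        by (cases "i = k"; cases "i < k") (auto simp: p_def)
    qed
    moreover have "isCont (G' k) (y s)"
      using cont[OF that] by (simp add: continuous_on_eq_continuous_at)
    ultimately show ?thesis
      by (rule isCont_tendsto_compose[rotated])
  qed
  have quot: "(G (y t) - G (y s)) / (t - s) = (\<Sum>k<m. c k * G' k ((p k t)(k := \<theta> k t)))" if "t \<noteq> s" for t
  proof -
    have "G (y t) - G (y s) = G (p m t) - G (p 0 t)"
      by (intro arg_cong2[of _ _ _ _ "(-)"] dep) (auto simp: p_def)
    also have "\<dots> = (\<Sum>k<m. G (p (Suc k) t) - G (p k t))"
      by (rule sum_lessThan_telescope[symmetric])
    also have "\<dots> = (\<Sum>k<m. (t - s) * (c k * G' k ((p k t)(k := \<theta> k t))))"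
      by (intro sum.cong) (auto simp: \<theta>(2) y_def algebra_simps)
    finally show ?thesis
      using that by (simp add: sum_distrib_left[symmetric])
  qed
  have "((\<lambda>t. \<Sum>k<m. c k * G' k ((p k t)(k := \<theta> k t))) \<longlongrightarrow> (\<Sum>k<m. c k * G' k (y s))) (at s)"
    by (intro tendsto_intros lim) auto
  then have "((\<lambda>t. (G (y t) - G (y s)) / (t - s)) \<longlongrightarrow> (\<Sum>k<m. c k * G' k (y s))) (at s)"
    by (rule Lim_transform_eventually) (auto simp: quot eventually_at_filter)
  then show ?thesis
    by (simp add: has_field_derivative_iff y_def)
qed

text \<open>The standard normal density has derivative -x times itself, so the difference of the two
  integrands, weighted by the density, is the derivative of \<open>g\<close> times the density. Its
  integral over the line is 0 because \<open>g\<close> is bounded.\<close>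

lemma stein_identity:
  fixes g :: "real \<Rightarrow> real"
  assumes der: "\<And>x. (g has_real_derivative g' x) (at x)"
    and cont: "continuous_on UNIV g'"
    and bnd: "\<And>x. \<bar>g x\<bar> \<le> C" "\<And>x. \<bar>g' x\<bar> \<le> C"
  shows "(\<integral>x. x * g x \<partial>std_normal_distribution) = (\<integral>x. g' x \<partial>std_normal_distribution)"
proof -
  have [measurable]: "g \<in> borel_measurable borel" "g' \<in> borel_measurable borel"
    using cont der by (auto intro!: borel_measurable_continuous_onI continuous_at_imp_continuous_on
        DERIV_isCont)
  let ?\<phi> = std_normal_density
  have \<phi>_der: "(?\<phi> has_real_derivative - x * ?\<phi> x) (at x)" for x
    unfolding std_normal_density_def[abs_def]
    by (auto intro!: derivative_eq_intros simp: field_simps)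
  have int1: "integrable lborel (\<lambda>x. ?\<phi> x * g' x)"
    by (rule Bochner_Integration.integrable_bound[of _ "\<lambda>x. C * ?\<phi> x"])
       (use bnd in \<open>auto simp: abs_mult mult.commute intro!: mult_mono order_trans[OF bnd(2)]\<close>)
  have int2: "integrable lborel (\<lambda>x. ?\<phi> x * (x * g x))"
  proof (rule Bochner_Integration.integrable_bound)
    show "integrable lborel (\<lambda>x. C * (?\<phi> x * \<bar>x\<bar>))"
      using integrable_std_normal_moment_abs[of 1] by simp
    show "AE x in lborel. norm (?\<phi> x * (x * g x)) \<le> norm (C * (?\<phi> x * \<bar>x\<bar>))"
    proof (rule AE_I2)
      fix x
      have "?\<phi> x * \<bar>x\<bar> * \<bar>g x\<bar> \<le> ?\<phi> x * \<bar>x\<bar> * \<bar>C\<bar>"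
        using bnd(1)[of x] by (intro mult_left_mono) auto
      then show "norm (?\<phi> x * (x * g x)) \<le> norm (C * (?\<phi> x * \<bar>x\<bar>))"
        by (simp add: abs_mult mult_ac)
    qed
  qed simp
  have lim: "((\<lambda>x. g x * ?\<phi> x) \<longlongrightarrow> 0) F" if "(?\<phi> \<longlongrightarrow> 0) F" for F
  proof (rule tendsto_rabs_zero_cancel, rule tendsto_sandwich[of "\<lambda>_. 0"])
    show "((\<lambda>x. C * ?\<phi> x) \<longlongrightarrow> 0) F" using tendsto_mult_right_zero[OF that] by simp
    show "\<forall>\<^sub>F x in F. \<bar>g x * ?\<phi> x\<bar> \<le> C * ?\<phi> x"
      using bnd(1) by (auto simp: abs_mult intro!: always_eventually mult_right_mono)
  qed auto
  have \<phi>_lim: "(?\<phi> \<longlongrightarrow> 0) at_top" "(?\<phi> \<longlongrightarrow> 0) at_bot"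
    unfolding std_normal_density_def by real_asymp+
  have "(LBINT x=-\<infinity>..\<infinity>. ?\<phi> x * g' x - ?\<phi> x * (x * g x)) = 0 - 0"
  proof (rule interval_integral_FTC_integrable[where F="\<lambda>x. g x * ?\<phi> x"])
    show "((\<lambda>x. g x * ?\<phi> x) has_vector_derivative ?\<phi> x * g' x - ?\<phi> x * (x * g x)) (at x)" for x
      using DERIV_mult[OF der[of x] \<phi>_der[of x]]
      by (simp add: has_real_derivative_iff_has_vector_derivative[symmetric] algebra_simps)
    show "isCont (\<lambda>x. ?\<phi> x * g' x - ?\<phi> x * (x * g x)) x" for x
      using cont DERIV_isCont[OF der[of x]] DERIV_isCont[OF \<phi>_der[of x]]
      by (intro continuous_intros) (auto simp: continuous_on_eq_continuous_at)
    show "set_integrable lborel (einterval (-\<infinity>) \<infinity>) (\<lambda>x. ?\<phi> x * g' x - ?\<phi> x * (x * g x))"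
      using int1 int2 by (simp add: set_integrable_def)
    show "(((\<lambda>x. g x * ?\<phi> x) \<circ> real_of_ereal) \<longlongrightarrow> 0) (at_right (-\<infinity>))"
      using lim[OF \<phi>_lim(2)] by (simp add: ereal_tendsto_simps1)
    show "(((\<lambda>x. g x * ?\<phi> x) \<circ> real_of_ereal) \<longlongrightarrow> 0) (at_left \<infinity>)"
      using lim[OF \<phi>_lim(1)] by (simp add: ereal_tendsto_simps1)
  qed simp
  then have "(\<integral>x. ?\<phi> x * g' x - ?\<phi> x * (x * g x) \<partial>lborel) = 0"
    by (simp add: interval_lebesgue_integral_def set_lebesgue_integral_def)
  then have "(\<integral>x. ?\<phi> x * g' x \<partial>lborel) = (\<integral>x. ?\<phi> x * (x * g x) \<partial>lborel)"
    using int1 int2 by simp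
  then show ?thesis
    by (subst (1 2) integral_density) auto
qed

section \<open>Independence from characteristic functions\<close>

lemma (in prob_space) iexp_determines_real:
  fixes X Z :: "'a \<Rightarrow> real"
  assumes [measurable]: "X \<in> borel_measurable M" "Z \<in> borel_measurable M"
    and bnd: "\<And>\<omega>. \<bar>Z \<omega>\<bar> \<le> C" and "0 < C"
    and char: "\<And>s. expectation (\<lambda>\<omega>. iexp (s * X \<omega>) * complex_of_real (Z \<omega>)) = 0"
    and [measurable]: "A \<in> sets borel"
  shows "expectation (\<lambda>\<omega>. indicator A (X \<omega>) * Z \<omega>) = 0"
proof -
  \<comment> \<open>\<open>Z\<close> may change sign, but \<open>D\<close> is nonnegative with mean
    1. The hypothesis then says that X has the same characteristic function under the density
    \<open>D\<close> as under \<open>M\<close>, and uniqueness applies to two probability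
    measures.\<close>
  define D where "D \<omega> = 1 + Z \<omega> / C" for \<omega>
  have [measurable]: "D \<in> borel_measurable M" by (simp add: D_def[abs_def])
  have D: "0 \<le> D \<omega>" "\<bar>D \<omega>\<bar> \<le> 2" for \<omega>
    using bnd[of \<omega>] \<open>0 < C\<close> by (auto simp: D_def field_simps abs_le_iff)
  have intZ: "integrable M Z"
    by (rule integrable_const_bound[of _ C]) (use bnd in auto)
  have "expectation (\<lambda>\<omega>. complex_of_real (Z \<omega>)) = 0"
    using char[of 0] by simp
  then have EZ: "expectation Z = 0"
    by simp
  define \<mu> where "\<mu> = distr (density M (\<lambda>\<omega>. ennreal (D \<omega>))) borel X"
  define \<nu> where "\<nu> = distr M borel X"
  have "emeasure (density M (\<lambda>\<omega>. ennreal (D \<omega>))) (space M) = 1"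
    using D intZ EZ by (simp add: emeasure_density nn_integral_eq_integral D_def prob_space
        cong: nn_integral_cong_simp)
  then have "prob_space (density M (\<lambda>\<omega>. ennreal (D \<omega>)))"
    by (intro prob_spaceI) simp
  then have "prob_space \<mu>"
    unfolding \<mu>_def by (rule prob_space.prob_space_distr) simp
  moreover have "prob_space \<nu>"
    unfolding \<nu>_def by (rule prob_space_distr) simp
  ultimately have rd: "real_distribution \<mu>" "real_distribution \<nu>"
    by (auto simp: real_distribution_def real_distribution_axioms_def \<mu>_def \<nu>_def)
  have int_iexp: "integrable M (\<lambda>\<omega>. iexp (s * X \<omega>))"
    "integrable M (\<lambda>\<omega>. iexp (s * X \<omega>) * complex_of_real (Z \<omega>))" for s
     by (rule integrable_const_bound[of _ 1] integrable_const_bound[of _ C];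
         use bnd in \<open>simp add: norm_mult\<close>)+
  have "char \<mu> s = char \<nu> s" for s
  proof -
    have "char \<mu> s = expectation (\<lambda>\<omega>. D \<omega> *\<^sub>R iexp (s * X \<omega>))"
      unfolding char_def \<mu>_def using D by (simp add: integral_distr integral_density)
    also have "\<dots> = expectation (\<lambda>\<omega>. iexp (s * X \<omega>) +
        complex_of_real (1 / C) * (iexp (s * X \<omega>) * complex_of_real (Z \<omega>)))"
      by (intro Bochner_Integration.integral_cong) (auto simp: D_def scaleR_conv_of_real algebra_simps)
    also have "\<dots> = expectation (\<lambda>\<omega>. iexp (s * X \<omega>)) + complex_of_real (1 / C) * 0"
      using int_iexp[of s] char[of s] by (subst Bochner_Integration.integral_add) simp_all
    finally show ?thesis
      by (simp add: char_def \<nu>_def integral_distr)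
  qed
  then have "\<mu> = \<nu>"
    using Levy_uniqueness[OF rd] by blast
  have "expectation (\<lambda>\<omega>. D \<omega> * indicator A (X \<omega>)) = (\<integral>x. indicator A x \<partial>\<mu>)"
    unfolding \<mu>_def using D by (subst integral_distr) (auto simp: integral_density)
  also have "\<dots> = (\<integral>x. indicator A x \<partial>\<nu>)"
    by (simp only: \<open>\<mu> = \<nu>\<close>)
  also have "\<dots> = expectation (\<lambda>\<omega>. indicator A (X \<omega>))"
    unfolding \<nu>_def by (subst integral_distr) auto
  finally have "expectation (\<lambda>\<omega>. D \<omega> * indicator A (X \<omega>)) = expectation (\<lambda>\<omega>. indicator A (X \<omega>))" .
  moreover have "expectation (\<lambda>\<omega>. D \<omega> * indicator A (X \<omega>)) =
      expectation (\<lambda>\<omega>. indicator A (X \<omega>)) + (1 / C) * expectation (\<lambda>\<omega>. indicator A (X \<omega>) * Z \<omega>)"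
  proof -
    have "integrable M (\<lambda>\<omega>. indicator A (X \<omega>) :: real)"
      by (rule integrable_const_bound[of _ 1]) (auto simp: indicator_def)
    moreover have "integrable M (\<lambda>\<omega>. indicator A (X \<omega>) * Z \<omega>)"
      by (rule integrable_const_bound[of _ C])
         (use bnd \<open>0 < C\<close> in \<open>auto simp: indicator_def less_imp_le\<close>)
    ultimately show ?thesis
      by (simp add: D_def algebra_simps)
  qed
  ultimately show ?thesis using \<open>0 < C\<close> by simp
qed

text \<open>The conjugate of \<open>Z\<close> satisfies the same hypothesis, by passing from s to
  -s. Hence so do the real and the imaginary part, to which the real case applies.\<close>

lemma (in prob_space) iexp_determines:
  fixes X :: "'a \<Rightarrow> real" and Z :: "'a \<Rightarrow> complex"
  assumes [measurable]: "X \<in> borel_measurable M" "Z \<in> borel_measurable M"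
    and bnd: "\<And>\<omega>. norm (Z \<omega>) \<le> C" and "0 < C"
    and char: "\<And>s. expectation (\<lambda>\<omega>. iexp (s * X \<omega>) * Z \<omega>) = 0"
    and [measurable]: "A \<in> sets borel"
  shows "expectation (\<lambda>\<omega>. indicator A (X \<omega>) * Z \<omega>) = 0"
proof -
  have [measurable]: "(\<lambda>\<omega>. cnj (Z \<omega>)) \<in> borel_measurable M"
    by (rule measurable_compose[OF \<open>Z \<in> borel_measurable M\<close>])
       (intro borel_measurable_continuous_onI continuous_intros)
  have int: "integrable M (\<lambda>\<omega>. iexp (s * X \<omega>) * Z \<omega>)" for s
    by (rule integrable_const_bound[of _ C]) (use bnd in \<open>auto simp: norm_mult\<close>)
  have int': "integrable M (\<lambda>\<omega>. iexp (s * X \<omega>) * cnj (Z \<omega>))" for s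
    by (rule integrable_const_bound[of _ C]) (use bnd in \<open>auto simp: norm_mult\<close>)
  have char': "expectation (\<lambda>\<omega>. iexp (s * X \<omega>) * cnj (Z \<omega>)) = 0" for s
  proof -
    have "expectation (\<lambda>\<omega>. iexp (s * X \<omega>) * cnj (Z \<omega>)) =
        expectation (\<lambda>\<omega>. cnj (iexp (- s * X \<omega>) * Z \<omega>))"
      by (intro Bochner_Integration.integral_cong) (auto simp: exp_cnj)
    also have "\<dots> = cnj (expectation (\<lambda>\<omega>. iexp (- s * X \<omega>) * Z \<omega>))"
      by (rule Bochner_Integration.integral_cnj)
    finally show ?thesis using char[of "- s"] by simp
  qed
  have "\<bar>Re (Z \<omega>)\<bar> \<le> C" "\<bar>Im (Z \<omega>)\<bar> \<le> C" for \<omega>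
    using bnd[of \<omega>] abs_Re_le_cmod[of "Z \<omega>"] abs_Im_le_cmod[of "Z \<omega>"] by linarith+
  note ReIm = this
  have "expectation (\<lambda>\<omega>. iexp (s * X \<omega>) * complex_of_real (Re (Z \<omega>))) = 0" for s
  proof -
    have "expectation (\<lambda>\<omega>. iexp (s * X \<omega>) * complex_of_real (Re (Z \<omega>))) =
        expectation (\<lambda>\<omega>. (iexp (s * X \<omega>) * Z \<omega> + iexp (s * X \<omega>) * cnj (Z \<omega>)) / 2)"
      by (intro Bochner_Integration.integral_cong)
         (auto simp: complex_add_cnj distrib_left[symmetric])
    then show ?thesis using int[of s] int'[of s] char[of s] char'[of s] by simp
  qed
  then have Re0: "expectation (\<lambda>\<omega>. indicator A (X \<omega>) * Re (Z \<omega>)) = 0"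
    by (intro iexp_determines_real[of _ _ C] ReIm \<open>0 < C\<close>) auto
  have "expectation (\<lambda>\<omega>. iexp (s * X \<omega>) * complex_of_real (Im (Z \<omega>))) = 0" for s
  proof -
    have "expectation (\<lambda>\<omega>. iexp (s * X \<omega>) * complex_of_real (Im (Z \<omega>))) =
        expectation (\<lambda>\<omega>. (iexp (s * X \<omega>) * Z \<omega> - iexp (s * X \<omega>) * cnj (Z \<omega>)) / (2 * \<i>))"
    proof (intro Bochner_Integration.integral_cong refl)
      fix \<omega>
      have "complex_of_real (Im (Z \<omega>)) = (Z \<omega> - cnj (Z \<omega>)) / (2 * \<i>)"
        by (simp add: complex_diff_cnj field_simps)
      then show "iexp (s * X \<omega>) * complex_of_real (Im (Z \<omega>)) =
          (iexp (s * X \<omega>) * Z \<omega> - iexp (s * X \<omega>) * cnj (Z \<omega>)) / (2 * \<i>)"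
        by (simp only: right_diff_distrib times_divide_eq_right)
    qed
    then show ?thesis using int[of s] int'[of s] char[of s] char'[of s] by simp
  qed
  then have Im0: "expectation (\<lambda>\<omega>. indicator A (X \<omega>) * Im (Z \<omega>)) = 0"
    by (intro iexp_determines_real[of _ _ C] ReIm \<open>0 < C\<close>) auto
  have intA: "integrable M (\<lambda>\<omega>. indicator A (X \<omega>) * Z \<omega>)"
    by (rule integrable_const_bound[of _ C])
       (use bnd \<open>0 < C\<close> in \<open>auto simp: indicator_def less_imp_le\<close>)
  have "Re (indicator A (X \<omega>) * Z \<omega>) = indicator A (X \<omega>) * Re (Z \<omega>)"
    "Im (indicator A (X \<omega>) * Z \<omega>) = indicator A (X \<omega>) * Im (Z \<omega>)" for \<omega>
    by (auto simp: indicator_def)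
  with Re0 Im0 integral_Re[OF intA] integral_Im[OF intA] show ?thesis
    by (simp add: complex_eq_iff)
qed

text \<open>The exponentials are exchanged for indicators one coordinate at a time. The remaining
  exponentials and the indicators already obtained are absorbed into the bounded factor
  \<open>Z\<close>, so one-dimensional uniqueness suffices.\<close>

lemma (in prob_space) iexp_determines_joint:
  fixes V :: "nat \<Rightarrow> 'a \<Rightarrow> real" and Z :: "'a \<Rightarrow> complex"
  assumes [measurable]: "\<And>j. V j \<in> borel_measurable M" "Z \<in> borel_measurable M"
    and bnd: "\<And>\<omega>. norm (Z \<omega>) \<le> C" and "0 < C"
    and char: "\<And>\<xi>. expectation (\<lambda>\<omega>. iexp (\<Sum>j<m. \<xi> j * V j \<omega>) * Z \<omega>) = 0"
    and A [measurable]: "\<And>j. A j \<in> sets borel"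
  shows "expectation (\<lambda>\<omega>. (\<Prod>j<m. indicator (A j) (V j \<omega>)) * Z \<omega>) = 0"
proof -
  have "n \<le> m \<Longrightarrow> \<forall>\<xi>. expectation (\<lambda>\<omega>. iexp (\<Sum>j\<in>{n..<m}. \<xi> j * V j \<omega>) *
      ((\<Prod>j<n. indicator (A j) (V j \<omega>)) * Z \<omega>)) = 0" for n
  proof (induction n)
    case 0
    then show ?case using char by (simp add: lessThan_atLeast0)
  next
    case (Suc n)
    show ?case
    proof
      fix \<xi> :: "nat \<Rightarrow> real"
      define Z' where "Z' \<omega> = iexp (\<Sum>j\<in>{Suc n..<m}. \<xi> j * V j \<omega>) *
          ((\<Prod>j<n. indicator (A j) (V j \<omega>)) * Z \<omega>)" for \<omega>
      have [measurable]: "Z' \<in> borel_measurable M" by (simp add: Z'_def[abs_def])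
      have "norm (Z' \<omega>) \<le> C" for \<omega>
      proof -
        have "norm (\<Prod>j<n. indicator (A j) (V j \<omega>) :: complex) \<le> 1"
          unfolding prod_norm[symmetric] by (intro prod_le_1) (auto simp: indicator_def)
        then have "norm (\<Prod>j<n. indicator (A j) (V j \<omega>) :: complex) * norm (Z \<omega>) \<le> 1 * C"
          using bnd[of \<omega>] by (intro mult_mono) auto
        then show ?thesis by (simp add: Z'_def norm_mult)
      qed
      moreover have "expectation (\<lambda>\<omega>. iexp (s * V n \<omega>) * Z' \<omega>) = 0" for s
      proof -
        have "iexp (s * V n \<omega>) * Z' \<omega> = iexp (\<Sum>j\<in>{n..<m}. (\<xi>(n := s)) j * V j \<omega>) *
          ((\<Prod>j<n. indicator (A j) (V j \<omega>)) * Z \<omega>)" for \<omega>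
        proof -
          have "(\<Sum>j\<in>{n..<m}. (\<xi>(n := s)) j * V j \<omega>) = s * V n \<omega> + (\<Sum>j\<in>{Suc n..<m}. \<xi> j * V j \<omega>)"
            using Suc.prems by (subst sum.atLeast_Suc_lessThan) auto
          then show ?thesis
            by (simp add: Z'_def exp_add[symmetric] algebra_simps)
        qed
        then show ?thesis using Suc.IH Suc.prems by simp
      qed
      ultimately have "expectation (\<lambda>\<omega>. indicator (A n) (V n \<omega>) * Z' \<omega>) = 0"
        by (intro iexp_determines[of _ _ C] \<open>0 < C\<close>) auto
      then show "expectation (\<lambda>\<omega>. iexp (\<Sum>j\<in>{Suc n..<m}. \<xi> j * V j \<omega>) *
          ((\<Prod>j<Suc n. indicator (A j) (V j \<omega>)) * Z \<omega>)) = 0"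
        by (simp add: Z'_def mult_ac)
    qed
  qed
  from this[of m] show ?thesis by simp
qed

text \<open>X is independent of the vector V if the joint characteristic function factors. The
  conclusion is phrased as an equality of the product law and the joint law, the form in which it
  feeds Fubini's theorem.\<close>

lemma (in prob_space) distr_pair_eq_of_iexp:
  fixes X :: "'a \<Rightarrow> real" and V :: "nat \<Rightarrow> 'a \<Rightarrow> real"
  assumes [measurable]: "X \<in> borel_measurable M" "\<And>j. V j \<in> borel_measurable M"
    and char: "\<And>s \<xi>. expectation (\<lambda>\<omega>. iexp (s * X \<omega>) * iexp (\<Sum>j<m. \<xi> j * V j \<omega>)) =
      expectation (\<lambda>\<omega>. iexp (s * X \<omega>)) * expectation (\<lambda>\<omega>. iexp (\<Sum>j<m. \<xi> j * V j \<omega>))"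
  shows "distr M borel X \<Otimes>\<^sub>M distr M (\<Pi>\<^sub>M j\<in>{..<m}. borel) (\<lambda>\<omega>. \<lambda>j\<in>{..<m}. V j \<omega>) =
    distr M (borel \<Otimes>\<^sub>M (\<Pi>\<^sub>M j\<in>{..<m}. borel)) (\<lambda>\<omega>. (X \<omega>, \<lambda>j\<in>{..<m}. V j \<omega>))"
proof -
  let ?P = "\<Pi>\<^sub>M j\<in>{..<m}. (borel :: real measure)" and ?V = "\<lambda>\<omega>. \<lambda>j\<in>{..<m}. V j \<omega>"
  have [measurable]: "?V \<in> measurable M ?P" by (intro measurable_restrict) auto
  have fact: "prob {\<omega> \<in> space M. X \<omega> \<in> A \<and> (\<forall>j<m. V j \<omega> \<in> F j)} =
      prob {\<omega> \<in> space M. X \<omega> \<in> A} * prob {\<omega> \<in> space M. \<forall>j<m. V j \<omega> \<in> F j}"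
    if [measurable]: "A \<in> sets borel" "\<And>j. F j \<in> sets borel" for A F
  proof -
    define I where "I \<omega> = (\<Prod>j<m. indicator (F j) (V j \<omega>) :: complex)" for \<omega>
    have [measurable]: "I \<in> borel_measurable M" by (simp add: I_def[abs_def])
    have I_eq: "I \<omega> = (if \<forall>j<m. V j \<omega> \<in> F j then 1 else 0)" for \<omega>
      by (auto simp: I_def indicator_def prod_zero_iff)
    have I_bnd: "norm (I \<omega>) \<le> 1" for \<omega> by (simp add: I_eq)
    have iI: "integrable M I" "integrable M (\<lambda>\<omega>. iexp (s * X \<omega>) * I \<omega>)"
      "integrable M (\<lambda>\<omega>. iexp (s * X \<omega>))" "integrable M (\<lambda>\<omega>. iexp (\<Sum>j<m. \<xi> j * V j \<omega>))"
      "integrable M (\<lambda>\<omega>. iexp (\<Sum>j<m. \<xi> j * V j \<omega>) * iexp (s * X \<omega>))" for s \<xi>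
      by (rule integrable_const_bound[of _ 1]; use I_bnd in \<open>simp add: norm_mult\<close>)+
    have EI: "expectation (\<lambda>\<omega>. iexp (s * X \<omega>) * I \<omega>) = expectation (\<lambda>\<omega>. iexp (s * X \<omega>)) * expectation I" for s
    proof -
      define c where "c = expectation (\<lambda>\<omega>. iexp (s * X \<omega>))"
      have "norm c \<le> expectation (\<lambda>\<omega>. norm (iexp (s * X \<omega>)))"
        unfolding c_def by (rule integral_norm_bound)
      then have c: "norm c \<le> 1" by (simp add: prob_space)
      \<comment> \<open>The exponentials of V are first exchanged for indicators, tested against the
        centred variable \<open>iexp (s * X \<omega>) - c\<close>. A second pass then exchanges the
        exponential of X for an indicator, tested against the centred \<open>I\<close>.\<close>
      have "expectation (\<lambda>\<omega>. I \<omega> * (iexp (s * X \<omega>) - c)) = 0"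
        unfolding I_def
      proof (rule iexp_determines_joint[where C=2])
        show "norm (iexp (s * X \<omega>) - c) \<le> 2" for \<omega>
          using norm_triangle_ineq4[of "iexp (s * X \<omega>)" c] c by simp
        show "expectation (\<lambda>\<omega>. iexp (\<Sum>j<m. \<xi> j * V j \<omega>) * (iexp (s * X \<omega>) - c)) = 0" for \<xi>
          using char[of s \<xi>] iI(4,5)
          by (simp add: right_diff_distrib c_def mult.commute)
      qed auto
      then show ?thesis
        using iI(1,2) by (simp add: right_diff_distrib c_def mult.commute)
    qed
    have "expectation (\<lambda>\<omega>. indicator A (X \<omega>) * (I \<omega> - expectation I)) = 0"
    proof (rule iexp_determines[where C=2])
      have "norm (expectation I) \<le> expectation (\<lambda>\<omega>. norm (I \<omega>))"
        by (rule integral_norm_bound)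
      also have "\<dots> \<le> 1"
        using I_bnd iI(1) by (intro integral_le_const) auto
      finally show "norm (I \<omega> - expectation I) \<le> 2" for \<omega>
        using norm_triangle_ineq4[of "I \<omega>" "expectation I"] I_bnd[of \<omega>] by linarith
      show "expectation (\<lambda>\<omega>. iexp (s * X \<omega>) * (I \<omega> - expectation I)) = 0" for s
        using EI[of s] iI(2,3) by (simp add: right_diff_distrib)
    qed auto
    moreover have iA: "integrable M (\<lambda>\<omega>. indicator A (X \<omega>) * I \<omega>)" "integrable M (\<lambda>\<omega>. indicator A (X \<omega>) :: complex)"
      by (rule integrable_const_bound[of _ 1]; use I_bnd in \<open>simp add: norm_mult indicator_def\<close>)+
    ultimately have e1: "expectation (\<lambda>\<omega>. indicator A (X \<omega>) * I \<omega>) =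
        expectation (\<lambda>\<omega>. indicator A (X \<omega>)) * expectation I"
      by (simp add: right_diff_distrib)
    have e2: "expectation (\<lambda>\<omega>. indicator A (X \<omega>) * I \<omega>) =
        complex_of_real (prob {\<omega> \<in> space M. X \<omega> \<in> A \<and> (\<forall>j<m. V j \<omega> \<in> F j)})"
    proof -
      have "expectation (\<lambda>\<omega>. indicator A (X \<omega>) * I \<omega>) = expectation (\<lambda>\<omega>. complex_of_real (indicator
          {\<omega> \<in> space M. X \<omega> \<in> A \<and> (\<forall>j<m. V j \<omega> \<in> F j)} \<omega>))"
        by (intro Bochner_Integration.integral_cong) (auto simp: I_eq indicator_def)
      then show ?thesis by (subst (asm) integral_complex_of_real) simp
    qed
    have e3: "expectation (\<lambda>\<omega>. indicator A (X \<omega>)) = complex_of_real (prob {\<omega> \<in> space M. X \<omega> \<in> A})"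
    proof -
      have "expectation (\<lambda>\<omega>. indicator A (X \<omega>)) = expectation (\<lambda>\<omega>. complex_of_real (indicator
          {\<omega> \<in> space M. X \<omega> \<in> A} \<omega>))"
        by (intro Bochner_Integration.integral_cong) (auto simp: indicator_def)
      then show ?thesis by (subst (asm) integral_complex_of_real) simp
    qed
    have e4: "expectation I = complex_of_real (prob {\<omega> \<in> space M. \<forall>j<m. V j \<omega> \<in> F j})"
    proof -
      have "expectation I = expectation (\<lambda>\<omega>. complex_of_real (indicator
          {\<omega> \<in> space M. \<forall>j<m. V j \<omega> \<in> F j} \<omega>))"
        by (intro Bochner_Integration.integral_cong) (auto simp: I_eq indicator_def)
      then show ?thesis by (subst (asm) integral_complex_of_real) simp
    qed
    have "complex_of_real (prob {\<omega> \<in> space M. X \<omega> \<in> A \<and> (\<forall>j<m. V j \<omega> \<in> F j)}) =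
        complex_of_real (prob {\<omega> \<in> space M. X \<omega> \<in> A}) *
        complex_of_real (prob {\<omega> \<in> space M. \<forall>j<m. V j \<omega> \<in> F j})"
      using e1 unfolding e2 e3 e4 .
    then show ?thesis
      by (simp only: of_real_mult[symmetric] of_real_eq_iff)
  qed
  have eq: "prob (X -` A \<inter> ?V -` E \<inter> space M) = prob (X -` A \<inter> space M) * prob (?V -` E \<inter> space M)"
    if [measurable]: "A \<in> sets borel" and E: "E \<in> sets ?P" for A E
  proof -
    \<comment> \<open>For fixed A both sides are finite measures in E. They agree on boxes by
      \<open>fact\<close>, hence on all measurable sets.\<close>
    define \<mu> where "\<mu> = distr (density M (\<lambda>\<omega>. indicator (X -` A \<inter> space M) \<omega>)) ?P ?V"
    define \<nu> where "\<nu> = scale_measure (emeasure M (X -` A \<inter> space M)) (distr M ?P ?V)"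
    have \<mu>: "emeasure \<mu> E = emeasure M (X -` A \<inter> ?V -` E \<inter> space M)" if [measurable]: "E \<in> sets ?P" for E
    proof -
      have "emeasure \<mu> E = (\<integral>\<^sup>+ \<omega>. indicator (X -` A \<inter> space M) \<omega> * indicator (?V -` E \<inter> space M) \<omega> \<partial>M)"
        unfolding \<mu>_def by (subst emeasure_distr) (simp_all add: emeasure_density that)
      also have "\<dots> = (\<integral>\<^sup>+ \<omega>. indicator (X -` A \<inter> ?V -` E \<inter> space M) \<omega> \<partial>M)"
        by (intro nn_integral_cong) (auto split: split_indicator)
      finally show ?thesis
        by (subst (asm) nn_integral_indicator) simp_all
    qed
    have "\<mu> = \<nu>"
    proof (rule measure_eqI_PiM_finite[where I="{..<m}" and M="\<lambda>_. borel"])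
      fix F :: "nat \<Rightarrow> real set" assume F: "\<And>i. i \<in> {..<m} \<Longrightarrow> F i \<in> sets borel"
      define F' where "F' i = (if i < m then F i else UNIV)" for i
      have F': "F' i \<in> sets borel" for i using F by (auto simp: F'_def)
      have PF: "Pi\<^sub>E {..<m} F \<in> sets ?P" 
        by (rule sets_PiM_I_finite) (use F in simp_all)
      have V_in: "?V \<omega> \<in> Pi\<^sub>E {..<m} F \<longleftrightarrow> (\<forall>j<m. V j \<omega> \<in> F' j)" for \<omega>
        unfolding F'_def by (simp add: restrict_PiE_iff Pi_iff Ball_def)
      have sets: "X -` A \<inter> ?V -` Pi\<^sub>E {..<m} F \<inter> space M = {\<omega> \<in> space M. X \<omega> \<in> A \<and> (\<forall>j<m. V j \<omega> \<in> F' j)}"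
        "?V -` Pi\<^sub>E {..<m} F \<inter> space M = {\<omega> \<in> space M. \<forall>j<m. V j \<omega> \<in> F' j}"
        "X -` A \<inter> space M = {\<omega> \<in> space M. X \<omega> \<in> A}"
        unfolding set_eq_iff vimage_eq Int_iff mem_Collect_eq V_in by blast+
      have "emeasure \<nu> (Pi\<^sub>E {..<m} F) =
          emeasure M (X -` A \<inter> space M) * emeasure M (?V -` Pi\<^sub>E {..<m} F \<inter> space M)"
        unfolding \<nu>_def emeasure_scale_measure by (subst emeasure_distr) (use PF in simp_all)
      then show "emeasure \<mu> (Pi\<^sub>E {..<m} F) = emeasure \<nu> (Pi\<^sub>E {..<m} F)"
        unfolding \<mu>[OF PF] sets emeasure_eq_measure
        by (simp only: fact[OF \<open>A \<in> sets borel\<close> F'] ennreal_mult measure_nonneg)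
    next
      show "range (\<lambda>n::nat. space ?P) \<subseteq> prod_algebra {..<m} (\<lambda>_. borel)"
        by (auto simp: space_PiM intro!: prod_algebraI_finite)
      show "emeasure \<mu> (space ?P) \<noteq> \<infinity>" by (subst \<mu>) auto
    qed (auto simp: \<mu>_def \<nu>_def)
    show ?thesis
    proof -
      have "emeasure \<nu> E = emeasure M (X -` A \<inter> space M) * emeasure M (?V -` E \<inter> space M)"
        using E by (simp add: \<nu>_def emeasure_distr)
      with \<open>\<mu> = \<nu>\<close> \<mu>[OF E] have "emeasure M (X -` A \<inter> ?V -` E \<inter> space M) =
          emeasure M (X -` A \<inter> space M) * emeasure M (?V -` E \<inter> space M)"
        by (simp only:)
      then show ?thesis
        by (simp only: emeasure_eq_measure ennreal_mult[symmetric] measure_nonneg ennreal_inj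
            mult_nonneg_nonneg)
    qed
  qed
  show ?thesis
  proof (rule pair_measure_eqI)
    show "sigma_finite_measure (distr M borel X)" "sigma_finite_measure (distr M ?P ?V)"
      by (auto intro!: prob_space_imp_sigma_finite prob_space_distr)
    show "sets (distr M borel X \<Otimes>\<^sub>M distr M ?P ?V) = sets (distr M (borel \<Otimes>\<^sub>M ?P) (\<lambda>\<omega>. (X \<omega>, ?V \<omega>)))"
      by (simp cong: sets_pair_measure_cong)
    fix A E assume "A \<in> sets (distr M borel X)" "E \<in> sets (distr M ?P ?V)"
    then have [measurable]: "A \<in> sets borel" "E \<in> sets ?P" by simp_all
    have vim: "(\<lambda>\<omega>. (X \<omega>, ?V \<omega>)) -` (A \<times> E) \<inter> space M = X -` A \<inter> ?V -` E \<inter> space M" by auto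
    have "emeasure (distr M (borel \<Otimes>\<^sub>M ?P) (\<lambda>\<omega>. (X \<omega>, ?V \<omega>))) (A \<times> E) =
        emeasure M (X -` A \<inter> ?V -` E \<inter> space M)"
      by (subst emeasure_distr) (simp_all only: vim, measurable)
    also have "\<dots> = emeasure M (X -` A \<inter> space M) * emeasure M (?V -` E \<inter> space M)"
      unfolding emeasure_eq_measure
      by (simp only: eq[of A E] \<open>A \<in> sets borel\<close> \<open>E \<in> sets ?P\<close> ennreal_mult measure_nonneg)
    finally show "emeasure (distr M borel X) A * emeasure (distr M ?P ?V) E =
        emeasure (distr M (borel \<Otimes>\<^sub>M ?P) (\<lambda>\<omega>. (X \<omega>, ?V \<omega>))) (A \<times> E)"
      by (simp add: emeasure_distr)
  qed
qed

text \<open>A centred Gaussian family indexed by a Hilbert space, specified by its characteristic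
  functions. \<open>W k\<close> is a choice of versions, so linearity can only hold up to a null set
  that depends on the vectors.\<close>

locale isonormal = prob_space M for M :: "'a measure" +
  fixes W :: "'k::real_inner \<Rightarrow> 'a \<Rightarrow> real"
  assumes W_measurable [measurable]: "W k \<in> borel_measurable M"
    and W_linear: "AE \<omega> in M. W (c *\<^sub>R k + l) \<omega> = c * W k \<omega> + W l \<omega>"
    and W_iexp: "expectation (\<lambda>\<omega>. iexp (W k \<omega>)) = complex_of_real (exp (- (norm k)\<^sup>2 / 2))"
begin

lemma W_zero: "AE \<omega> in M. W 0 \<omega> = 0"
  using W_linear[of 1 0 0] by simp

lemma W_scale: "AE \<omega> in M. W (c *\<^sub>R k) \<omega> = c * W k \<omega>"
  using W_linear[of c k 0] W_zero by eventually_elim simp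

lemma W_sum:
  assumes "finite I"
  shows "AE \<omega> in M. W (\<Sum>i\<in>I. c i *\<^sub>R k i) \<omega> = (\<Sum>i\<in>I. c i * W (k i) \<omega>)"
  using assms
proof induction
  case (insert i I)
  from insert.IH W_linear[of "c i" "k i" "\<Sum>i\<in>I. c i *\<^sub>R k i"] show ?case
    by eventually_elim (simp add: insert.hyps)
qed (use W_zero in simp)

lemma iexp_W_scale: "expectation (\<lambda>\<omega>. iexp (s * W k \<omega>)) = complex_of_real (exp (- (s * norm k)\<^sup>2 / 2))"
proof -
  have "expectation (\<lambda>\<omega>. iexp (s * W k \<omega>)) = expectation (\<lambda>\<omega>. iexp (W (s *\<^sub>R k) \<omega>))"
  proof (rule integral_cong_AE)
    show "AE \<omega> in M. iexp (s * W k \<omega>) = iexp (W (s *\<^sub>R k) \<omega>)"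
      using W_scale[of s k] by eventually_elim simp
  qed auto
  then show ?thesis by (simp add: W_iexp power_mult_distrib)
qed

lemma distr_W_unit:
  assumes "norm k = 1"
  shows "distr M borel (W k) = std_normal_distribution"
proof (rule Levy_uniqueness)
  show "real_distribution (distr M borel (W k))"
    by (simp add: real_distribution_def real_distribution_axioms_def prob_space_distr)
  show "char (distr M borel (W k)) = char std_normal_distribution"
  proof
    fix t
    have "char (distr M borel (W k)) t = expectation (\<lambda>\<omega>. iexp (t * W k \<omega>))"
      by (simp add: char_def integral_distr)
    also have "\<dots> = char std_normal_distribution t"
      unfolding iexp_W_scale char_std_normal_distribution using assms by simp
    finally show "char (distr M borel (W k)) t = char std_normal_distribution t" .
  qed
qed (rule real_dist_normal_dist)

text \<open>The fourth moments serve the refinement estimate for the corrected Riemann sums; even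
  moments of high order serve the Hoelder bound for the paths.\<close>

lemma W_moment:
  shows integrable_W_power: "integrable M (\<lambda>\<omega>. W k \<omega> ^ n)"
    and expectation_W_power_even: "expectation (\<lambda>\<omega>. W k \<omega> ^ (2 * p)) =
          fact (2 * p) / (2 ^ p * fact p) * norm k ^ (2 * p)"
proof -
  define u where "u = (if k = 0 then k else k /\<^sub>R norm k)"
  have k: "k = norm k *\<^sub>R u" by (simp add: u_def)
  have W_u: "AE \<omega> in M. W k \<omega> = norm k * W u \<omega>"
    using W_scale[of "norm k" u] k by simp
  have "integrable M (\<lambda>\<omega>. W k \<omega> ^ n) \<and> expectation (\<lambda>\<omega>. W k \<omega> ^ (2 * p)) =
          fact (2 * p) / (2 ^ p * fact p) * norm k ^ (2 * p)"
  proof (cases "k = 0")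
    case True
    have a: "AE \<omega> in M. W k \<omega> ^ n = 0 ^ n" for n
      using W_zero True by auto
    have "integrable M (\<lambda>\<omega>. W k \<omega> ^ n) = integrable M (\<lambda>\<omega>. (0::real) ^ n)"
      by (rule integrable_cong_AE) (use a[of n] in simp_all)
    moreover have "expectation (\<lambda>\<omega>. W k \<omega> ^ (2 * p)) = expectation (\<lambda>\<omega>. 0 ^ (2 * p))"
      by (rule integral_cong_AE) (use a[of "2 * p"] in simp_all)
    ultimately show ?thesis using True by (cases p) (simp_all add: prob_space)
  next
    case False
    then have "norm u = 1" by (simp add: u_def)
    note d = distr_W_unit[OF this]
    have int: "integrable M (\<lambda>\<omega>. W u \<omega> ^ n)" for n
      using integrable_distr[of "W u" M borel "\<lambda>x. x ^ n"] integrable_std_normal_distribution_moment[of n]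
      by (simp add: d)
    have E: "expectation (\<lambda>\<omega>. W u \<omega> ^ (2 * p)) = fact (2 * p) / (2 ^ p * fact p)"
      using integral_distr[of "W u" M borel "\<lambda>x. x ^ (2 * p)"] std_normal_distribution_even_moments(1)[of p]
      by (simp add: d)
    have eq: "AE \<omega> in M. W k \<omega> ^ n = norm k ^ n * W u \<omega> ^ n" for n
      using W_u by eventually_elim (simp add: power_mult_distrib)
    have "integrable M (\<lambda>\<omega>. W k \<omega> ^ n) = integrable M (\<lambda>\<omega>. norm k ^ n * W u \<omega> ^ n)"
      by (rule integrable_cong_AE) (use eq[of n] in simp_all)
    moreover have "expectation (\<lambda>\<omega>. W k \<omega> ^ (2 * p)) = expectation (\<lambda>\<omega>. norm k ^ (2 * p) * W u \<omega> ^ (2 * p))"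
      by (rule integral_cong_AE) (use eq[of "2 * p"] in simp_all)
    ultimately show ?thesis using int E by simp
  qed
  then show "integrable M (\<lambda>\<omega>. W k \<omega> ^ n)" "expectation (\<lambda>\<omega>. W k \<omega> ^ (2 * p)) =
          fact (2 * p) / (2 ^ p * fact p) * norm k ^ (2 * p)" by auto
qed

lemma integrable_W: "integrable M (W k)"
  using integrable_W_power[of k 1] by simp

text \<open>Removing from each \<open>W (\<psi> j)\<close> its projection on \<open>W h\<close>
  leaves variables \<open>V j\<close> independent of \<open>W h\<close>. With the \<open>V j\<close>
  frozen, G becomes a function of one standard normal variable along a line of direction c. Stein's
  identity applies there, the chain rule produces the coefficients
  \<open>\<psi> j \<bullet> h\<close>, and Fubini's theorem puts the pieces together.\<close>

lemma gaussian_ibp_unit: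
  fixes \<psi> :: "nat \<Rightarrow> 'k" and G :: "(nat \<Rightarrow> real) \<Rightarrow> real" and G' :: "nat \<Rightarrow> (nat \<Rightarrow> real) \<Rightarrow> real"
  assumes h: "norm h = 1"
    and dep: "\<And>x y. (\<And>i. i < m \<Longrightarrow> x i = y i) \<Longrightarrow> G x = G y"
    and der: "\<And>j x. j < m \<Longrightarrow> ((\<lambda>r. G (x(j := r))) has_real_derivative G' j x) (at (x j))"
    and contG: "continuous_on UNIV G" and cont: "\<And>j. j < m \<Longrightarrow> continuous_on UNIV (G' j)"
    and bndG: "\<And>x. \<bar>G x\<bar> \<le> C" and bnd: "\<And>j x. j < m \<Longrightarrow> \<bar>G' j x\<bar> \<le> C"
  shows "expectation (\<lambda>\<omega>. W h \<omega> * G (\<lambda>j. W (\<psi> j) \<omega>)) =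
    (\<Sum>j<m. (\<psi> j \<bullet> h) * expectation (\<lambda>\<omega>. G' j (\<lambda>i. W (\<psi> i) \<omega>)))"
proof -
  define c where "c j = \<psi> j \<bullet> h" for j
  define V where "V j \<omega> = W (\<psi> j) \<omega> - c j * W h \<omega>" for j \<omega>
  have [measurable]: "V j \<in> borel_measurable M" for j by (simp add: V_def[abs_def])
  have [measurable]: "G \<in> borel_measurable borel" using contG by (rule borel_measurable_continuous_onI)
  have G'm: "G' j \<in> borel_measurable borel" if "j < m" for j
    using cont[OF that] by (rule borel_measurable_continuous_onI)
  let ?P = "\<Pi>\<^sub>M j\<in>{..<m}. (borel :: real measure)"
  let ?V = "\<lambda>\<omega>. \<lambda>j\<in>{..<m}. V j \<omega>"
  have [measurable]: "?V \<in> measurable M ?P" by (intro measurable_restrict) auto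
  have comb: "AE \<omega> in M. s * W h \<omega> + (\<Sum>j<m. \<xi> j * V j \<omega>) =
      W (s *\<^sub>R h + (\<Sum>j<m. \<xi> j *\<^sub>R (\<psi> j - c j *\<^sub>R h))) \<omega>" for s \<xi>
  proof -
    have "AE \<omega> in M. \<forall>j. W (\<psi> j - c j *\<^sub>R h) \<omega> = V j \<omega>"
    proof (subst AE_all_countable, rule allI)
      fix j
      have "- c j *\<^sub>R h + \<psi> j = \<psi> j - c j *\<^sub>R h" by simp
      then show "AE \<omega> in M. W (\<psi> j - c j *\<^sub>R h) \<omega> = V j \<omega>"
        using W_linear[of "- c j" h "\<psi> j"] by (simp add: V_def)
    qed
    moreover note W_sum[of "{..<m}" \<xi> "\<lambda>j. \<psi> j - c j *\<^sub>R h"]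
      W_linear[of s h "\<Sum>j<m. \<xi> j *\<^sub>R (\<psi> j - c j *\<^sub>R h)"]
    ultimately show ?thesis by (auto elim: eventually_elim2)
  qed
  \<comment> \<open>As h is a unit vector orthogonal to every
    \<open>\<psi> j - c j *\<^sub>R h\<close>, the squared norms add and the characteristic function
    splits into a product. This is the reason for the choice of c.\<close>
  have comb': "expectation (\<lambda>\<omega>. iexp (s * W h \<omega> + (\<Sum>j<m. \<xi> j * V j \<omega>))) =
      complex_of_real (exp (- (s\<^sup>2 + (norm (\<Sum>j<m. \<xi> j *\<^sub>R (\<psi> j - c j *\<^sub>R h)))\<^sup>2) / 2))" for s \<xi>
  proof -
    define l where "l = (\<Sum>j<m. \<xi> j *\<^sub>R (\<psi> j - c j *\<^sub>R h))"
    have "h \<bullet> h = 1" using h by (simp add: dot_square_norm)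
    then have "h \<bullet> l = 0"
      by (simp add: l_def inner_sum_right inner_diff_right c_def inner_commute)
    then have "(norm (s *\<^sub>R h + l))\<^sup>2 = s\<^sup>2 + (norm l)\<^sup>2"
      unfolding power2_norm_eq_inner
      by (simp add: inner_add_left inner_add_right inner_commute \<open>h \<bullet> h = 1\<close> power2_eq_square)
    moreover have "expectation (\<lambda>\<omega>. iexp (s * W h \<omega> + (\<Sum>j<m. \<xi> j * V j \<omega>))) =
        expectation (\<lambda>\<omega>. iexp (W (s *\<^sub>R h + l) \<omega>))"
    proof (rule integral_cong_AE)
      show "AE \<omega> in M. iexp (s * W h \<omega> + (\<Sum>j<m. \<xi> j * V j \<omega>)) = iexp (W (s *\<^sub>R h + l) \<omega>)"
        using comb[of s \<xi>] unfolding l_def by eventually_elim (simp only:)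
    qed auto
    ultimately show ?thesis by (simp add: W_iexp l_def)
  qed
  have pair: "distr M borel (W h) \<Otimes>\<^sub>M distr M ?P ?V = distr M (borel \<Otimes>\<^sub>M ?P) (\<lambda>\<omega>. (W h \<omega>, ?V \<omega>))"
  proof (rule distr_pair_eq_of_iexp)
    fix s \<xi>
    have "expectation (\<lambda>\<omega>. iexp (s * W h \<omega>)) = complex_of_real (exp (- s\<^sup>2 / 2))"
      "expectation (\<lambda>\<omega>. iexp (\<Sum>j<m. \<xi> j * V j \<omega>)) =
        complex_of_real (exp (- (norm (\<Sum>j<m. \<xi> j *\<^sub>R (\<psi> j - c j *\<^sub>R h)))\<^sup>2 / 2))"
      using comb'[of s "\<lambda>_. 0"] comb'[of 0 \<xi>] by simp_all
    moreover have "expectation (\<lambda>\<omega>. iexp (s * W h \<omega>) * iexp (\<Sum>j<m. \<xi> j * V j \<omega>)) =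
        expectation (\<lambda>\<omega>. iexp (s * W h \<omega> + (\<Sum>j<m. \<xi> j * V j \<omega>)))"
      by (simp add: exp_add[symmetric] distrib_left)
    ultimately show "expectation (\<lambda>\<omega>. iexp (s * W h \<omega>) * iexp (\<Sum>j<m. \<xi> j * V j \<omega>)) =
        expectation (\<lambda>\<omega>. iexp (s * W h \<omega>)) * expectation (\<lambda>\<omega>. iexp (\<Sum>j<m. \<xi> j * V j \<omega>))"
      unfolding comb' by (simp only: of_real_mult[symmetric] exp_add[symmetric]) (simp add: field_simps)
  qed auto
  define \<nu> where "\<nu> = distr M ?P ?V"
  have sets_\<nu> [measurable_cong]: "sets \<nu> = sets ?P" by (simp add: \<nu>_def)
  interpret \<nu>: prob_space \<nu> unfolding \<nu>_def by (rule prob_space_distr) simp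
  interpret N: real_distribution std_normal_distribution by (rule real_dist_normal_dist)
  interpret pair_sigma_finite std_normal_distribution \<nu> ..
  have pair': "std_normal_distribution \<Otimes>\<^sub>M \<nu> = distr M (borel \<Otimes>\<^sub>M ?P) (\<lambda>\<omega>. (W h \<omega>, ?V \<omega>))"
    using pair by (simp add: distr_W_unit[OF h] \<nu>_def)
  define \<Phi> where "\<Phi> x n = (\<lambda>j. if j < m then n j + x * c j else 0)" for x :: real and n :: "nat \<Rightarrow> real"
  have [measurable]: "(\<lambda>(x, n). \<Phi> x n) \<in> borel_measurable (std_normal_distribution \<Otimes>\<^sub>M \<nu>)"
  proof (rule measurable_coordinatewise_then_product)
    fix i
    show "(\<lambda>x. (case x of (x, n) \<Rightarrow> \<Phi> x n) i) \<in> borel_measurable (std_normal_distribution \<Otimes>\<^sub>M \<nu>)"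
      by (cases "i < m") (simp_all add: \<Phi>_def split_beta')
  qed
  have \<Phi>_G: "G (\<Phi> (W h \<omega>) (?V \<omega>)) = G (\<lambda>j. W (\<psi> j) \<omega>)" for \<omega>
    by (rule dep) (simp add: \<Phi>_def V_def)
  \<comment> \<open>The assumed derivatives inherit the dependence on the first m coordinates by
    uniqueness of derivatives.\<close>
  have dep': "G' j x = G' j y" if "j < m" "\<And>i. i < m \<Longrightarrow> x i = y i" for j x y
  proof -
    have "G (x(j := r)) = G (y(j := r))" for r using that by (intro dep) auto
    then show ?thesis
      using der[OF \<open>j < m\<close>, of x] der[OF \<open>j < m\<close>, of y] that DERIV_unique by force
  qed
  have \<Phi>_G': "G' j (\<Phi> (W h \<omega>) (?V \<omega>)) = G' j (\<lambda>j. W (\<psi> j) \<omega>)" if "j < m" for j \<omega>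
    by (rule dep'[OF that]) (simp add: \<Phi>_def V_def)
  define D where "D x n = (\<Sum>j<m. c j * G' j (\<Phi> x n))" for x n
  have D_bnd: "\<bar>D x n\<bar> \<le> (\<Sum>j<m. \<bar>c j\<bar> * C)" for x n
    unfolding D_def by (rule order_trans[OF sum_abs]) (auto simp: abs_mult intro!: sum_mono mult_left_mono bnd)
  have stein: "(\<integral>x. x * G (\<Phi> x n) \<partial>std_normal_distribution) = (\<integral>x. D x n \<partial>std_normal_distribution)" for n
  proof (rule stein_identity)
    define C' where "C' = max C (\<Sum>j<m. \<bar>c j\<bar> * C)"
    have \<Phi>_eq: "\<Phi> x n = (\<lambda>j. (if j < m then n j else 0) + x * (if j < m then c j else 0))" for x
      by (auto simp: \<Phi>_def)
    show "((\<lambda>x. G (\<Phi> x n)) has_real_derivative D x n) (at x)" for x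
      unfolding \<Phi>_eq D_def
      by (rule DERIV_cong[OF DERIV_partial_chain[of m G G', OF dep der cont]]) (auto intro!: sum.cong)
    have "continuous_on UNIV (\<lambda>x. \<Phi> x n)"
      unfolding \<Phi>_eq by (intro continuous_intros continuous_on_coordinatewise_then_product)
    then show "continuous_on UNIV (\<lambda>x. D x n)"
      unfolding D_def
      by (intro continuous_intros) (rule continuous_on_compose2[OF cont], auto)
    show "\<bar>G (\<Phi> x n)\<bar> \<le> C'" "\<bar>D x n\<bar> \<le> C'" for x
      using bndG[of "\<Phi> x n"] D_bnd[of x n] by (auto simp: C'_def)
  qed
  have G'\<Phi>_measurable: "(\<lambda>(x, n). G' j (\<Phi> x n)) \<in> borel_measurable (std_normal_distribution \<Otimes>\<^sub>M \<nu>)" if "j < m" for j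
    using measurable_compose[OF \<open>(\<lambda>(x, n). \<Phi> x n) \<in> _\<close> G'm[OF that]] by (simp add: split_beta')
  have [measurable]: "(\<lambda>(x, n). G (\<Phi> x n)) \<in> borel_measurable (std_normal_distribution \<Otimes>\<^sub>M \<nu>)"
    using measurable_compose[OF \<open>(\<lambda>(x, n). \<Phi> x n) \<in> _\<close> \<open>G \<in> _\<close>] by (simp add: split_beta')
  have [measurable]: "(\<lambda>(x, n). D x n) \<in> borel_measurable (std_normal_distribution \<Otimes>\<^sub>M \<nu>)"
    unfolding D_def split_beta'
    by (intro borel_measurable_sum borel_measurable_times borel_measurable_const)
       (use G'\<Phi>_measurable in \<open>simp add: split_beta'\<close>)
  interpret PM: prob_space "std_normal_distribution \<Otimes>\<^sub>M \<nu>"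
    unfolding pair' by (rule prob_space_distr) simp
  have int_G': "integrable M (\<lambda>\<omega>. G' j (\<lambda>i. W (\<psi> i) \<omega>))" if "j < m" for j
  proof (rule integrable_const_bound[of _ C])
    show "(\<lambda>\<omega>. G' j (\<lambda>i. W (\<psi> i) \<omega>)) \<in> borel_measurable M"
      by (rule measurable_compose[OF _ G'm[OF that]]) (rule measurable_coordinatewise_then_product, simp)
  qed (use bnd[OF that] in auto)
  have int1: "integrable (std_normal_distribution \<Otimes>\<^sub>M \<nu>) (\<lambda>(x, n). x * G (\<Phi> x n))"
  proof -
    have "integrable M (\<lambda>\<omega>. W h \<omega> * G (\<lambda>j. W (\<psi> j) \<omega>))"
    proof (rule Bochner_Integration.integrable_bound)
      show "integrable M (\<lambda>\<omega>. C * W h \<omega>)" using integrable_W by simp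
      show "(\<lambda>\<omega>. W h \<omega> * G (\<lambda>j. W (\<psi> j) \<omega>)) \<in> borel_measurable M"
        by (intro borel_measurable_times W_measurable measurable_compose[OF _ \<open>G \<in> _\<close>]
            measurable_coordinatewise_then_product)
      show "AE \<omega> in M. norm (W h \<omega> * G (\<lambda>j. W (\<psi> j) \<omega>)) \<le> norm (C * W h \<omega>)"
      proof (rule AE_I2)
        fix \<omega>
        have "\<bar>W h \<omega>\<bar> * \<bar>G (\<lambda>j. W (\<psi> j) \<omega>)\<bar> \<le> \<bar>W h \<omega>\<bar> * \<bar>C\<bar>"
          using bndG[of "\<lambda>j. W (\<psi> j) \<omega>"] by (intro mult_left_mono) auto
        then show "norm (W h \<omega> * G (\<lambda>j. W (\<psi> j) \<omega>)) \<le> norm (C * W h \<omega>)"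
          by (simp add: abs_mult mult.commute)
      qed
    qed
    then show ?thesis
      unfolding pair' by (subst integrable_distr_eq) (auto simp: \<Phi>_G)
  qed
  have int2: "integrable (std_normal_distribution \<Otimes>\<^sub>M \<nu>) (\<lambda>(x, n). D x n)"
    by (rule PM.integrable_const_bound[of _ "\<Sum>j<m. \<bar>c j\<bar> * C"]) (use D_bnd in auto)
  have "expectation (\<lambda>\<omega>. W h \<omega> * G (\<lambda>j. W (\<psi> j) \<omega>)) =
      (\<integral>(x, n). x * G (\<Phi> x n) \<partial>(std_normal_distribution \<Otimes>\<^sub>M \<nu>))"
    unfolding pair' by (subst integral_distr) (auto simp: \<Phi>_G)
  also have "\<dots> = (\<integral>n. \<integral>x. x * G (\<Phi> x n) \<partial>std_normal_distribution \<partial>\<nu>)"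
    using integral_snd[OF int1] by simp
  also have "\<dots> = (\<integral>n. \<integral>x. D x n \<partial>std_normal_distribution \<partial>\<nu>)"
    by (simp only: stein)
  also have "\<dots> = (\<integral>(x, n). D x n \<partial>(std_normal_distribution \<Otimes>\<^sub>M \<nu>))"
    using integral_snd[OF int2] by simp
  also have "\<dots> = expectation (\<lambda>\<omega>. D (W h \<omega>) (?V \<omega>))"
    unfolding pair' by (subst integral_distr) auto
  also have "\<dots> = expectation (\<lambda>\<omega>. \<Sum>j<m. c j * G' j (\<lambda>i. W (\<psi> i) \<omega>))"
    unfolding D_def by (intro Bochner_Integration.integral_cong sum.cong refl) (simp add: \<Phi>_G')
  also have "\<dots> = (\<Sum>j<m. c j * expectation (\<lambda>\<omega>. G' j (\<lambda>i. W (\<psi> i) \<omega>)))"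
    using int_G' by (subst Bochner_Integration.integral_sum) auto
  finally show ?thesis by (simp add: c_def)
qed

theorem gaussian_ibp:
  fixes \<psi> :: "nat \<Rightarrow> 'k" and G :: "(nat \<Rightarrow> real) \<Rightarrow> real" and G' :: "nat \<Rightarrow> (nat \<Rightarrow> real) \<Rightarrow> real"
  assumes "\<And>x y. (\<And>i. i < m \<Longrightarrow> x i = y i) \<Longrightarrow> G x = G y"
    and "\<And>j x. j < m \<Longrightarrow> ((\<lambda>r. G (x(j := r))) has_real_derivative G' j x) (at (x j))"
    and contG: "continuous_on UNIV G" and "\<And>j. j < m \<Longrightarrow> continuous_on UNIV (G' j)"
    and "\<And>x. \<bar>G x\<bar> \<le> C" and "\<And>j x. j < m \<Longrightarrow> \<bar>G' j x\<bar> \<le> C"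
  shows "expectation (\<lambda>\<omega>. W h \<omega> * G (\<lambda>j. W (\<psi> j) \<omega>)) =
    (\<Sum>j<m. (\<psi> j \<bullet> h) * expectation (\<lambda>\<omega>. G' j (\<lambda>i. W (\<psi> i) \<omega>)))"
proof -
  have [measurable]: "(\<lambda>\<omega>. G (\<lambda>j. W (\<psi> j) \<omega>)) \<in> borel_measurable M"
    by (intro measurable_compose[OF _ borel_measurable_continuous_onI[OF contG]]
            measurable_coordinatewise_then_product W_measurable)
  show ?thesis
  proof (cases "h = 0")
    case True
    have "expectation (\<lambda>\<omega>. W h \<omega> * G (\<lambda>j. W (\<psi> j) \<omega>)) = expectation (\<lambda>\<omega>. 0)"
      by (rule integral_cong_AE) (use W_zero True in auto)
    then show ?thesis using True by simp
  next
    case False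
    define u where "u = h /\<^sub>R norm h"
    have h: "h = norm h *\<^sub>R u" "norm u = 1" using False by (auto simp: u_def)
    have "expectation (\<lambda>\<omega>. W h \<omega> * G (\<lambda>j. W (\<psi> j) \<omega>)) =
        expectation (\<lambda>\<omega>. norm h * (W u \<omega> * G (\<lambda>j. W (\<psi> j) \<omega>)))"
    proof (rule integral_cong_AE)
      have "AE \<omega> in M. W h \<omega> = norm h * W u \<omega>"
        using W_scale[of "norm h" u] h(1) by simp
      then show "AE \<omega> in M. W h \<omega> * G (\<lambda>j. W (\<psi> j) \<omega>) = norm h * (W u \<omega> * G (\<lambda>j. W (\<psi> j) \<omega>))"
        by eventually_elim simp
    qed auto
    also have "\<dots> = norm h * (\<Sum>j<m. (\<psi> j \<bullet> u) * expectation (\<lambda>\<omega>. G' j (\<lambda>i. W (\<psi> i) \<omega>)))"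
      using gaussian_ibp_unit[where \<psi>=\<psi>, OF h(2) assms] by simp
    also have "\<dots> = (\<Sum>j<m. (\<psi> j \<bullet> h) * expectation (\<lambda>\<omega>. G' j (\<lambda>i. W (\<psi> i) \<omega>)))"
    proof -
      have "norm h * (\<psi> j \<bullet> u) = \<psi> j \<bullet> h" for j
        using h(1) by (metis inner_scaleR_right)
      then show ?thesis by (simp add: sum_distrib_left mult.assoc[symmetric])
    qed
    finally show ?thesis .
  qed
qed

end

section \<open>The Hilbert space of fractional Brownian motion\<close>

text \<open>Convexity of the power function: increments over a fixed length grow with the base
  point. The base point 0, where the power need not be differentiable, is treated by hand.\<close>

lemma powr_increment_mono:
  fixes p x y \<delta> :: real
  assumes "1 \<le> p" "0 \<le> x" "x \<le> y" "0 \<le> \<delta>"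
  shows "(x + \<delta>) powr p - x powr p \<le> (y + \<delta>) powr p - y powr p"
proof (cases "x = 0 \<or> x = y \<or> \<delta> = 0")
  case True
  have "\<delta> powr p + y powr p \<le> (y + \<delta>) powr p" if "0 < y" "0 < \<delta>"
  proof -
    have "\<delta> powr p + y powr p = \<delta> * \<delta> powr (p - 1) + y * y powr (p - 1)"
      using that by (simp add: powr_mult_base)
    also have "\<dots> \<le> \<delta> * (y + \<delta>) powr (p - 1) + y * (y + \<delta>) powr (p - 1)"
      using that assms by (intro add_mono mult_left_mono powr_mono2) auto
    also have "\<dots> = (y + \<delta>) powr p"
      using that by (simp add: distrib_right[symmetric] powr_mult_base add.commute)
    finally show ?thesis .
  qed
  then show ?thesis
    using True assms by (cases "y = 0"; cases "\<delta> = 0") auto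
next
  case False
  then have pos: "0 < x" "x < y" "0 < \<delta>" using assms by auto
  define \<phi> where "\<phi> t = (t + \<delta>) powr p - t powr p" for t
  have "\<exists>d. (\<phi> has_real_derivative d) (at t) \<and> 0 \<le> d" if "x \<le> t" "t \<le> y" for t
  proof -
    have "(\<phi> has_real_derivative p * (t + \<delta>) powr (p - 1) - p * t powr (p - 1)) (at t)"
      unfolding \<phi>_def[abs_def] using that pos by (auto intro!: derivative_eq_intros)
    moreover have "p * t powr (p - 1) \<le> p * (t + \<delta>) powr (p - 1)"
      using that pos assms by (intro mult_left_mono powr_mono2) auto
    ultimately show ?thesis by (intro exI conjI) auto
  qed
  then have "\<phi> x \<le> \<phi> y"
    using assms by (intro DERIV_nonneg_imp_nondecreasing[of x y \<phi>]) auto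
  then show ?thesis by (simp add: \<phi>_def)
qed

lemma powr_diff_le:
  fixes p s t T :: real
  assumes "1 \<le> p" "0 \<le> s" "s \<le> t" "t \<le> T"
  shows "t powr p - s powr p \<le> p * T powr (p - 1) * (t - s)"
proof (cases "s = 0 \<or> s = t")
  case True
  have "t powr p \<le> p * T powr (p - 1) * t" if "0 < t"
  proof -
    have "t powr p = 1 * t powr (p - 1) * t" using that by (simp add: powr_mult_base mult.commute)
    also have "\<dots> \<le> p * T powr (p - 1) * t"
      using that assms by (intro mult_right_mono mult_mono powr_mono2) auto
    finally show ?thesis .
  qed
  then show ?thesis using True assms by (cases "t = 0") auto
next
  case False
  then have "s < t" "0 < s" using assms by auto
  then obtain z where z: "s < z" "z < t" "t powr p - s powr p = (t - s) * (p * z powr (p - 1))"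
    using MVT2[of s t "\<lambda>x. x powr p" "\<lambda>x. p * x powr (p - 1)"]
    by (force intro!: derivative_eq_intros)
  have "(t - s) * (p * z powr (p - 1)) \<le> (t - s) * (p * T powr (p - 1))"
    using z assms \<open>0 < s\<close> by (intro mult_left_mono powr_mono2) auto
  then show ?thesis using z(3) by (simp add: mult_ac)
qed

locale fbm_space =
  fixes H :: real and e :: "real \<Rightarrow> 'h::{real_inner, banach, second_countable_topology}"
  assumes H_gt_half: "1 / 2 < H" and hilbert: "fbm_hilbert_space H e"
begin

lemma fbm_inner: "0 \<le> t \<Longrightarrow> 0 \<le> s \<Longrightarrow> e t \<bullet> e s = fbm_cov H t s"
  using hilbert by (simp add: fbm_hilbert_space_def)

lemma fbm_increment_norm:
  assumes "0 \<le> s" "0 \<le> t"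
  shows "norm (e t - e s) = \<bar>t - s\<bar> powr H"
proof -
  have "(norm (e t - e s))\<^sup>2 = \<bar>t - s\<bar> powr (2 * H)"
    using assms by (simp add: power2_norm_eq_inner inner_diff_left inner_diff_right fbm_inner)
      (simp add: fbm_cov_def abs_minus_commute field_simps)
  also have "\<dots> = (\<bar>t - s\<bar> powr H)\<^sup>2"
    by (simp add: power2_eq_square powr_add[symmetric])
  finally show ?thesis
    by (simp add: power2_eq_iff_nonneg)
qed

lemma fbm_e_zero: "e 0 = 0"
  using fbm_inner[of 0 0] by (simp add: fbm_cov_def)

lemma fbm_norm: "0 \<le> t \<Longrightarrow> norm (e t) = t powr H"
  using fbm_increment_norm[of 0 t] by (simp add: fbm_e_zero)

text \<open>Convexity of the power 2H makes disjoint increments positively correlated. This sign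
  replaces the orthogonality of Brownian increments: sums over pairs of cells become monotone in
  their coefficients.\<close>

lemma fbm_increments_nonneg:
  assumes "0 \<le> a" "a \<le> b" "b \<le> c" "c \<le> d"
  shows "0 \<le> (e b - e a) \<bullet> (e d - e c)"
proof -
  have "(c - b + (d - c)) powr (2 * H) - (c - b) powr (2 * H) \<le>
      (c - a + (d - c)) powr (2 * H) - (c - a) powr (2 * H)"
    using assms H_gt_half by (intro powr_increment_mono) auto
  then show ?thesis
    using assms by (simp add: inner_diff_left inner_diff_right fbm_inner)
      (simp add: fbm_cov_def field_simps)
qed

text \<open>The trace coefficient is linear in the step length, not of the smaller order 2H. Its
  sums over a grid therefore stay of order one, and only the factor in front of it can kill the
  trace term.\<close>

lemma fbm_increment_inner_bound:
  assumes "0 \<le> s" "s \<le> t" "t \<le> T"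
  shows "0 \<le> e s \<bullet> (e t - e s)" "e s \<bullet> (e t - e s) \<le> H * T powr (2 * H - 1) * (t - s)"
proof -
  show "0 \<le> e s \<bullet> (e t - e s)"
    using fbm_increments_nonneg[of 0 s s t] assms by (simp add: fbm_e_zero)
  have "e s \<bullet> (e t - e s) = (t powr (2 * H) - s powr (2 * H) - (t - s) powr (2 * H)) / 2"
    using assms by (simp add: inner_diff_right fbm_inner) (simp add: fbm_cov_def field_simps)
  also have "\<dots> \<le> (t powr (2 * H) - s powr (2 * H)) / 2" by simp
  also have "\<dots> \<le> (2 * H * T powr (2 * H - 1) * (t - s)) / 2"
    using powr_diff_le[of "2 * H" s t T] assms H_gt_half by (intro divide_right_mono) auto
  finally show "e s \<bullet> (e t - e s) \<le> H * T powr (2 * H - 1) * (t - s)" by simp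
qed

end

lemma cmod_iexp_diff_le: "cmod (iexp x - iexp y) \<le> \<bar>x - y\<bar>"
proof -
  have "iexp x = iexp y * iexp (x - y)"
    by (subst exp_add[symmetric]) (simp add: algebra_simps)
  then have "iexp x - iexp y = iexp y * (iexp (x - y) - 1)"
    by (simp only: right_diff_distrib mult_1_right)
  then have "cmod (iexp x - iexp y) = cmod (iexp (x - y) - 1)"
    by (simp only: norm_mult norm_exp_i_times mult_1)
  then show ?thesis
    using iexp_approx1[of "x - y" 0] by simp
qed

text \<open>Cauchy-Schwarz against the constant 1, read off from the nonnegative variance of the
  absolute value.\<close>

lemma (in prob_space) expectation_abs_le:
  fixes Z :: "'a \<Rightarrow> real"
  assumes [measurable]: "Z \<in> borel_measurable M" and "integrable M (\<lambda>\<omega>. (Z \<omega>)\<^sup>2)"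
  shows "integrable M Z" "(expectation (\<lambda>\<omega>. \<bar>Z \<omega>\<bar>))\<^sup>2 \<le> expectation (\<lambda>\<omega>. (Z \<omega>)\<^sup>2)"
proof -
  show int: "integrable M Z"
    by (rule square_integrable_imp_integrable[OF assms])
  have "0 \<le> variance (\<lambda>\<omega>. \<bar>Z \<omega>\<bar>)" by (rule variance_positive)
  also have "\<dots> = expectation (\<lambda>\<omega>. \<bar>Z \<omega>\<bar>\<^sup>2) - (expectation (\<lambda>\<omega>. \<bar>Z \<omega>\<bar>))\<^sup>2"
    using int assms by (intro variance_eq) auto
  finally show "(expectation (\<lambda>\<omega>. \<bar>Z \<omega>\<bar>))\<^sup>2 \<le> expectation (\<lambda>\<omega>. (Z \<omega>)\<^sup>2)" by simp
qed

lemma square_integrable_prod: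
  fixes f g :: "'a \<Rightarrow> real"
  assumes "square_integrable M f" "square_integrable M g"
  shows "integrable M (\<lambda>\<omega>. f \<omega> * g \<omega>)"
proof (rule Bochner_Integration.integrable_bound)
  show "integrable M (\<lambda>\<omega>. (f \<omega>)\<^sup>2 + (g \<omega>)\<^sup>2)"
    using assms by (simp add: square_integrable_def)
  show "AE \<omega> in M. norm (f \<omega> * g \<omega>) \<le> norm ((f \<omega>)\<^sup>2 + (g \<omega>)\<^sup>2)"
  proof (rule AE_I2)
    fix \<omega>
    have "2 * (\<bar>f \<omega>\<bar> * \<bar>g \<omega>\<bar>) \<le> (f \<omega>)\<^sup>2 + (g \<omega>)\<^sup>2"
      using sum_squares_bound[of "\<bar>f \<omega>\<bar>" "\<bar>g \<omega>\<bar>"] by (simp add: mult.assoc)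
    moreover have "0 \<le> \<bar>f \<omega>\<bar> * \<bar>g \<omega>\<bar>" by simp
    ultimately have "\<bar>f \<omega> * g \<omega>\<bar> \<le> (f \<omega>)\<^sup>2 + (g \<omega>)\<^sup>2"
      unfolding abs_mult by linarith
    then show "norm (f \<omega> * g \<omega>) \<le> norm ((f \<omega>)\<^sup>2 + (g \<omega>)\<^sup>2)" by simp
  qed
qed (use assms in \<open>auto simp: square_integrable_def\<close>)

context prob_space
begin

context
  fixes e :: "real \<Rightarrow> 'h::{real_inner, banach, second_countable_topology}"
    and x :: real and X :: "real \<Rightarrow> 'a \<Rightarrow> real" and W :: "'h \<Rightarrow> 'a \<Rightarrow> real"
  assumes wiener: "wiener_isometry M e x X W"
begin

lemma wiener_square_integrable: "square_integrable M (W h)"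
  using wiener by (simp add: wiener_isometry_def)

lemma wiener_measurable: "W h \<in> borel_measurable M"
  using wiener_square_integrable by (simp add: square_integrable_def)

lemma wiener_integrable_prod: "integrable M (\<lambda>\<omega>. W h \<omega> * W k \<omega>)"
  by (intro square_integrable_prod wiener_square_integrable)

lemma wiener_inner: "expectation (\<lambda>\<omega>. W h \<omega> * W k \<omega>) = h \<bullet> k"
  using wiener by (simp add: wiener_isometry_def)

lemma wiener_dist:
  "integrable M (\<lambda>\<omega>. (W h \<omega> - W k \<omega>)\<^sup>2)" "expectation (\<lambda>\<omega>. (W h \<omega> - W k \<omega>)\<^sup>2) = (norm (h - k))\<^sup>2"
proof -
  have eq: "(\<lambda>\<omega>. (W h \<omega> - W k \<omega>)\<^sup>2) = (\<lambda>\<omega>. W h \<omega> * W h \<omega> - 2 * (W h \<omega> * W k \<omega>) + W k \<omega> * W k \<omega>)"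
    by (auto simp: power2_eq_square algebra_simps)
  show "integrable M (\<lambda>\<omega>. (W h \<omega> - W k \<omega>)\<^sup>2)"
    unfolding eq by (intro Bochner_Integration.integrable_add Bochner_Integration.integrable_diff
        integrable_mult_right wiener_integrable_prod)
  show "expectation (\<lambda>\<omega>. (W h \<omega> - W k \<omega>)\<^sup>2) = (norm (h - k))\<^sup>2"
    unfolding eq by (simp add: wiener_integrable_prod wiener_inner power2_norm_eq_inner
        inner_diff_left inner_diff_right inner_commute)
qed

text \<open>Preserved scalar products determine the second moment of the linearity defect. Expanding
  it gives 0, so the defect vanishes almost surely.\<close>

lemma wiener_linear: "AE \<omega> in M. W (c *\<^sub>R k + l) \<omega> = c * W k \<omega> + W l \<omega>"
proof -
  note [measurable] = wiener_measurable
  define D where "D \<omega> = W (c *\<^sub>R k + l) \<omega> - c * W k \<omega> - W l \<omega>" for \<omega>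
  have eq: "(D \<omega>)\<^sup>2 = W (c *\<^sub>R k + l) \<omega> * W (c *\<^sub>R k + l) \<omega> - 2 * c * (W (c *\<^sub>R k + l) \<omega> * W k \<omega>)
      - 2 * (W (c *\<^sub>R k + l) \<omega> * W l \<omega>) + c\<^sup>2 * (W k \<omega> * W k \<omega>) + 2 * c * (W k \<omega> * W l \<omega>) + W l \<omega> * W l \<omega>" for \<omega>
    by (simp add: D_def power2_eq_square algebra_simps)
  have int: "integrable M (\<lambda>\<omega>. (D \<omega>)\<^sup>2)"
    unfolding eq by (intro Bochner_Integration.integrable_add Bochner_Integration.integrable_diff
        integrable_mult_right wiener_integrable_prod)
  have "expectation (\<lambda>\<omega>. (D \<omega>)\<^sup>2) = 0"
    unfolding eq by (simp add: wiener_integrable_prod wiener_inner inner_add_left inner_add_right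
        inner_commute power2_eq_square algebra_simps)
  then have "AE \<omega> in M. (D \<omega>)\<^sup>2 = 0"
    using integral_nonneg_eq_0_iff_AE[OF int] by simp
  then show ?thesis by eventually_elim (simp add: D_def)
qed

lemma wiener_sum:
  assumes "finite I"
  shows "AE \<omega> in M. W (\<Sum>i\<in>I. c i *\<^sub>R k i) \<omega> = (\<Sum>i\<in>I. c i * W (k i) \<omega>)"
  using assms
proof induction
  case empty
  then show ?case using wiener_linear[of 1 0 0] by simp
next
  case (insert i I)
  from insert.IH wiener_linear[of "c i" "k i" "\<Sum>i\<in>I. c i *\<^sub>R k i"] show ?case
    by eventually_elim (simp add: insert.hyps)
qed

lemma wiener_span:
  assumes "h \<in> span (e ` {0..})"
  obtains T c where "finite T" "T \<subseteq> {0..}" "h = (\<Sum>t\<in>T. c t *\<^sub>R e t)"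
    "AE \<omega> in M. W h \<omega> = (\<Sum>t\<in>T. c t * (X t \<omega> - x))"
proof -
  obtain S r where S: "finite S" "S \<subseteq> e ` {0..}" "h = (\<Sum>a\<in>S. r a *\<^sub>R a)"
    using assms unfolding span_explicit by blast
  \<comment> \<open>The span is written over distinct vectors. Choosing one time for each of them
    turns this into a combination over a finite set of times.\<close>
  then obtain T where T: "T \<subseteq> {0..}" "inj_on e T" "S = e ` T"
    by (meson subset_image_inj)
  have fin: "finite T" using T S finite_image_iff by blast
  have h: "h = (\<Sum>t\<in>T. r (e t) *\<^sub>R e t)"
    using S(3) T by (simp add: sum.reindex)
  have "AE \<omega> in M. \<forall>t\<in>T. W (e t) \<omega> = X t \<omega> - x"
    using wiener T fin unfolding wiener_isometry_def
    by (auto intro!: AE_finite_allI)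
  with wiener_sum[OF fin, of "\<lambda>t. r (e t)" e]
  have "AE \<omega> in M. W h \<omega> = (\<Sum>t\<in>T. r (e t) * (X t \<omega> - x))"
    unfolding h by eventually_elim simp
  then show thesis by (rule that[OF fin T(1) h])
qed

text \<open>On the span, \<open>W h\<close> is almost surely a centred linear combination of values
  of the process, hence Gaussian by assumption. Its variance is the squared norm of h by the
  isometry; in the degenerate case the variance forces h = 0.\<close>

lemma wiener_iexp_span:
  assumes "gaussian_process M X" "\<And>t. 0 \<le> t \<Longrightarrow> expectation (X t) = x" "h \<in> span (e ` {0..})"
  shows "expectation (\<lambda>\<omega>. iexp (W h \<omega>)) = complex_of_real (exp (- (norm h)\<^sup>2 / 2))"
proof -
  note [measurable] = wiener_measurable
  obtain T c where T: "finite T" "T \<subseteq> {0..}" "h = (\<Sum>t\<in>T. c t *\<^sub>R e t)"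
    "AE \<omega> in M. W h \<omega> = (\<Sum>t\<in>T. c t * (X t \<omega> - x))"
    by (rule wiener_span[OF assms(3)])
  define Y where "Y \<omega> = (\<Sum>t\<in>T. c t * X t \<omega>)" for \<omega>
  define m where "m = (\<Sum>t\<in>T. c t * x)"
  have gY: "gaussian_rv M Y"
    using assms(1) T unfolding gaussian_process_def Y_def by blast
  then have [measurable]: "Y \<in> borel_measurable M" by (simp add: gaussian_rv_def)
  have WY: "AE \<omega> in M. W h \<omega> = Y \<omega> - m"
    using T(4) by eventually_elim (simp add: Y_def m_def right_diff_distrib sum_subtractf)
  then have YW: "AE \<omega> in M. Y \<omega> = W h \<omega> + m" by eventually_elim simp
  have int_W: "integrable M (W h)"
    using expectation_abs_le(1)[of "W h"] wiener_square_integrable[of h]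
    by (simp add: square_integrable_def)
  have int_X: "integrable M (X t)" and EX: "expectation (X t) = x" if "t \<in> T" for t
  proof -
    show "expectation (X t) = x" using that T assms by auto
    have "gaussian_rv M (\<lambda>\<omega>. \<Sum>s\<in>{t}. 1 * X s \<omega>)"
      using assms(1)[unfolded gaussian_process_def, rule_format, of "{t}" "\<lambda>_. 1"] that T(2) by auto
    then have Xm: "X t \<in> borel_measurable M" by (simp add: gaussian_rv_def)
    have ae: "AE \<omega> in M. W (e t) \<omega> + x = X t \<omega>"
      using wiener that T(2) unfolding wiener_isometry_def by force
    have "integrable M (\<lambda>\<omega>. W (e t) \<omega> + x)"
      using expectation_abs_le(1)[of "W (e t)"] wiener_square_integrable[of "e t"]
      by (simp add: square_integrable_def)
    then show "integrable M (X t)"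
      by (rule integrable_cong_AE_imp[OF _ Xm ae])
  qed
  have EY: "expectation Y = m"
    unfolding Y_def m_def by (subst Bochner_Integration.integral_sum) (auto simp: int_X EX)
  have VY: "variance Y = (norm h)\<^sup>2"
  proof -
    have "variance Y = expectation (\<lambda>\<omega>. W h \<omega> * W h \<omega>)"
      unfolding EY by (rule integral_cong_AE) (use WY in \<open>auto simp: power2_eq_square\<close>)
    then show ?thesis by (simp add: wiener_inner power2_norm_eq_inner)
  qed
  have E_eq: "expectation (\<lambda>\<omega>. iexp (W h \<omega>)) = expectation (\<lambda>\<omega>. iexp (Y \<omega> - m))"
    by (rule integral_cong_AE) (use WY in auto)
  from gY consider (c) m' where "AE \<omega> in M. Y \<omega> = m'"
    | (n) m' \<sigma> where "0 < \<sigma>" "distributed M lborel Y (\<lambda>x. ennreal (normal_density m' \<sigma> x))"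
    unfolding gaussian_rv_def by blast
  then show ?thesis
  proof cases
    case c
    then have "expectation Y = expectation (\<lambda>\<omega>. m')"
      by (intro integral_cong_AE) auto
    then have "m' = m" using EY by (simp add: prob_space)
    with c have "expectation (\<lambda>\<omega>. (Y \<omega> - m)\<^sup>2) = expectation (\<lambda>\<omega>. 0)"
      by (intro integral_cong_AE) auto
    then have "norm h = 0" using VY EY by simp
    moreover have "expectation (\<lambda>\<omega>. iexp (Y \<omega> - m)) = expectation (\<lambda>\<omega>. 1)"
      using c \<open>m' = m\<close> by (intro integral_cong_AE) auto
    ultimately show ?thesis unfolding E_eq by (simp add: prob_space)
  next
    case n
    have m': "m' = m" using normal_distributed_expectation[OF n] EY by simp
    have \<sigma>: "\<sigma> = norm h"
      using normal_distributed_variance[OF n] VY n(1) by (simp add: power2_eq_iff_nonneg)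
    have D: "distributed M lborel (\<lambda>\<omega>. (Y \<omega> - m) / \<sigma>) (\<lambda>x. ennreal (std_normal_density x))"
      using n(2) normal_standard_normal_convert[OF n(1), of Y m'] by (simp add: m')
    then have d: "distr M lborel (\<lambda>\<omega>. (Y \<omega> - m) / \<sigma>) = std_normal_distribution"
      by (simp add: distributed_def)
    have "expectation (\<lambda>\<omega>. iexp (Y \<omega> - m)) = expectation (\<lambda>\<omega>. iexp (\<sigma> * ((Y \<omega> - m) / \<sigma>)))"
      using n(1) by simp
    also have "\<dots> = (\<integral>z. iexp (\<sigma> * z) \<partial>distr M lborel (\<lambda>\<omega>. (Y \<omega> - m) / \<sigma>))"
      by (subst integral_distr) auto
    also have "\<dots> = complex_of_real (exp (- \<sigma>\<^sup>2 / 2))"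
      unfolding d using fun_cong[OF char_std_normal_distribution, of \<sigma>] by (simp add: char_def)
    finally show ?thesis by (simp add: E_eq \<sigma>)
  qed
qed

end

end

text \<open>Independence is given for the two processes, not for the families \<open>W1\<close> and
  \<open>W2\<close>. On the span both are functions of the processes, so the characteristic function
  factors; density of the span carries the formula over to the whole space.\<close>

theorem isonormal_of_fbm:
  fixes B :: "real \<Rightarrow> 'a \<Rightarrow> complex" and e :: "real \<Rightarrow> 'h::{real_inner, banach, second_countable_topology}"
  assumes "prob_space M" and B: "complex_fbm M H z0 B" and e: "fbm_hilbert_space H e"
    and W1: "wiener_isometry M e (Re z0) (\<lambda>t \<omega>. Re (B t \<omega>)) W1"
    and W2: "wiener_isometry M e (Im z0) (\<lambda>t \<omega>. Im (B t \<omega>)) W2"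
  shows "isonormal M (\<lambda>k \<omega>. W1 (fst k) \<omega> + W2 (snd k) \<omega>)"
proof -
  interpret prob_space M by fact
  note [measurable] = wiener_measurable[OF W1] wiener_measurable[OF W2]
  have Re_B: "real_fbm M H (Re z0) (\<lambda>t \<omega>. Re (B t \<omega>))" and Im_B: "real_fbm M H (Im z0) (\<lambda>t \<omega>. Im (B t \<omega>))"
    and indep: "indep_var (\<Pi>\<^sub>M t\<in>{0..}. borel) (\<lambda>\<omega>. \<lambda>t\<in>{0..}. Re (B t \<omega>))
       (\<Pi>\<^sub>M t\<in>{0..}. borel) (\<lambda>\<omega>. \<lambda>t\<in>{0..}. Im (B t \<omega>))"
    using B by (auto simp: complex_fbm_def)
  have span: "expectation (\<lambda>\<omega>. iexp (W1 a \<omega> + W2 b \<omega>)) =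
      complex_of_real (exp (- ((norm a)\<^sup>2 + (norm b)\<^sup>2) / 2))"
    if a: "a \<in> span (e ` {0..})" and b: "b \<in> span (e ` {0..})" for a b
  proof -
    obtain S c where S: "finite S" "S \<subseteq> {0..}" "a = (\<Sum>t\<in>S. c t *\<^sub>R e t)"
      "AE \<omega> in M. W1 a \<omega> = (\<Sum>t\<in>S. c t * (Re (B t \<omega>) - Re z0))"
      by (rule wiener_span[OF W1 a])
    obtain T d where T: "finite T" "T \<subseteq> {0..}" "b = (\<Sum>t\<in>T. d t *\<^sub>R e t)"
      "AE \<omega> in M. W2 b \<omega> = (\<Sum>t\<in>T. d t * (Im (B t \<omega>) - Im z0))"
      by (rule wiener_span[OF W2 b])
    define f where "f y = (\<Sum>t\<in>S. c t * (y t - Re z0))" for y :: "real \<Rightarrow> real"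
    define g where "g y = (\<Sum>t\<in>T. d t * (y t - Im z0))" for y :: "real \<Rightarrow> real"
    let ?X = "\<lambda>\<omega>. \<lambda>t\<in>{0..}. Re (B t \<omega>)" and ?Y = "\<lambda>\<omega>. \<lambda>t\<in>{0..}. Im (B t \<omega>)"
    have fg: "f \<in> borel_measurable (\<Pi>\<^sub>M t\<in>{0..}. borel)" "g \<in> borel_measurable (\<Pi>\<^sub>M t\<in>{0..}. borel)"
      unfolding f_def[abs_def] g_def[abs_def] using S(2) T(2)
      by (auto intro!: borel_measurable_sum borel_measurable_times borel_measurable_diff
          measurable_component_singleton)
    have [measurable]: "?X \<in> measurable M (\<Pi>\<^sub>M t\<in>{0..}. borel)" "?Y \<in> measurable M (\<Pi>\<^sub>M t\<in>{0..}. borel)"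
      using indep by (auto dest: indep_var_rv1 indep_var_rv2)
    have [measurable]: "(\<lambda>\<omega>. f (?X \<omega>)) \<in> borel_measurable M" "(\<lambda>\<omega>. g (?Y \<omega>)) \<in> borel_measurable M"
      by (rule measurable_compose[OF _ fg(1)], simp) (rule measurable_compose[OF _ fg(2)], simp)
    have "f (?X \<omega>) = (\<Sum>t\<in>S. c t * (Re (B t \<omega>) - Re z0))" "g (?Y \<omega>) = (\<Sum>t\<in>T. d t * (Im (B t \<omega>) - Im z0))" for \<omega>
      unfolding f_def g_def using S(2) T(2) by (auto intro!: sum.cong)
    with S(4) T(4) have W: "AE \<omega> in M. W1 a \<omega> = f (?X \<omega>)" "AE \<omega> in M. W2 b \<omega> = g (?Y \<omega>)" by simp_all
    have iv: "indep_var borel (\<lambda>\<omega>. iexp (f (?X \<omega>))) borel (\<lambda>\<omega>. iexp (g (?Y \<omega>)))"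
      using indep_var_compose[OF indep, of "\<lambda>y. iexp (f y)" borel "\<lambda>y. iexp (g y)" borel] fg
      by (simp add: comp_def)
    have "expectation (\<lambda>\<omega>. iexp (W1 a \<omega> + W2 b \<omega>)) = expectation (\<lambda>\<omega>. iexp (f (?X \<omega>)) * iexp (g (?Y \<omega>)))"
    proof (rule integral_cong_AE)
      show "AE \<omega> in M. iexp (W1 a \<omega> + W2 b \<omega>) = iexp (f (?X \<omega>)) * iexp (g (?Y \<omega>))"
        using W by eventually_elim (simp add: exp_add[symmetric] distrib_left)
    qed simp_all
    also have "\<dots> = expectation (\<lambda>\<omega>. iexp (f (?X \<omega>))) * expectation (\<lambda>\<omega>. iexp (g (?Y \<omega>)))"
      by (rule indep_var_lebesgue_integral[OF iv]) (auto intro!: integrable_iexp)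
    also have "expectation (\<lambda>\<omega>. iexp (f (?X \<omega>))) = expectation (\<lambda>\<omega>. iexp (W1 a \<omega>))"
      by (rule integral_cong_AE) (use W(1) in auto)
    also have "expectation (\<lambda>\<omega>. iexp (g (?Y \<omega>))) = expectation (\<lambda>\<omega>. iexp (W2 b \<omega>))"
      by (rule integral_cong_AE) (use W(2) in auto)
    also have "expectation (\<lambda>\<omega>. iexp (W1 a \<omega>)) = complex_of_real (exp (- (norm a)\<^sup>2 / 2))"
      using Re_B a by (intro wiener_iexp_span[OF W1]) (auto simp: real_fbm_def)
    also have "expectation (\<lambda>\<omega>. iexp (W2 b \<omega>)) = complex_of_real (exp (- (norm b)\<^sup>2 / 2))"
      using Im_B b by (intro wiener_iexp_span[OF W2]) (auto simp: real_fbm_def)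
    finally show ?thesis
      by (simp only: of_real_mult[symmetric] exp_add[symmetric]) (simp add: field_simps)
  qed
  have iexp: "expectation (\<lambda>\<omega>. iexp (W1 a \<omega> + W2 b \<omega>)) =
      complex_of_real (exp (- ((norm a)\<^sup>2 + (norm b)\<^sup>2) / 2))" for a b
  proof -
    have dense: "closure (span (e ` {0..})) = UNIV" using e by (simp add: fbm_hilbert_space_def)
    then have "a \<in> closure (span (e ` {0..}))" "b \<in> closure (span (e ` {0..}))" by simp_all
    then obtain as bs where as: "\<And>n. as n \<in> span (e ` {0..})" "as \<longlonglongrightarrow> a"
      and bs: "\<And>n. bs n \<in> span (e ` {0..})" "bs \<longlonglongrightarrow> b"
      unfolding closure_sequential by blast
    have abs_dist: "integrable M (\<lambda>\<omega>. \<bar>W h \<omega> - W k \<omega>\<bar>)" "expectation (\<lambda>\<omega>. \<bar>W h \<omega> - W k \<omega>\<bar>) \<le> norm (h - k)"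
      if "wiener_isometry M e x X W" for h k x X and W :: "'h \<Rightarrow> 'a \<Rightarrow> real"
    proof -
      have [measurable]: "(\<lambda>\<omega>. W h \<omega> - W k \<omega>) \<in> borel_measurable M"
        using wiener_measurable[OF that] by simp
      show "integrable M (\<lambda>\<omega>. \<bar>W h \<omega> - W k \<omega>\<bar>)"
        using expectation_abs_le(1)[of "\<lambda>\<omega>. W h \<omega> - W k \<omega>"] wiener_dist(1)[OF that] by simp
      have "(expectation (\<lambda>\<omega>. \<bar>W h \<omega> - W k \<omega>\<bar>))\<^sup>2 \<le> (norm (h - k))\<^sup>2"
        using expectation_abs_le(2)[of "\<lambda>\<omega>. W h \<omega> - W k \<omega>"] wiener_dist[OF that] by simp
      then show "expectation (\<lambda>\<omega>. \<bar>W h \<omega> - W k \<omega>\<bar>) \<le> norm (h - k)"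
        by (rule power2_le_imp_le) simp
    qed
    \<comment> \<open>The map x to \<open>iexp x\<close> is 1-Lipschitz and the isometry controls
      first absolute moments, so the characteristic function depends continuously on the
      vectors.\<close>
    have bd: "norm (expectation (\<lambda>\<omega>. iexp (W1 (as n) \<omega> + W2 (bs n) \<omega>)) - expectation (\<lambda>\<omega>. iexp (W1 a \<omega> + W2 b \<omega>)))
        \<le> norm (as n - a) + norm (bs n - b)" for n
    proof -
      have "norm (expectation (\<lambda>\<omega>. iexp (W1 (as n) \<omega> + W2 (bs n) \<omega>)) - expectation (\<lambda>\<omega>. iexp (W1 a \<omega> + W2 b \<omega>)))
        = norm (expectation (\<lambda>\<omega>. iexp (W1 (as n) \<omega> + W2 (bs n) \<omega>) - iexp (W1 a \<omega> + W2 b \<omega>)))"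
        by (subst Bochner_Integration.integral_diff) (auto intro!: integrable_iexp)
      also have "\<dots> \<le> expectation (\<lambda>\<omega>. norm (iexp (W1 (as n) \<omega> + W2 (bs n) \<omega>) - iexp (W1 a \<omega> + W2 b \<omega>)))"
        by (rule integral_norm_bound)
      also have "\<dots> \<le> expectation (\<lambda>\<omega>. \<bar>W1 (as n) \<omega> - W1 a \<omega>\<bar> + \<bar>W2 (bs n) \<omega> - W2 b \<omega>\<bar>)"
      proof (rule integral_mono)
        show "integrable M (\<lambda>\<omega>. norm (iexp (W1 (as n) \<omega> + W2 (bs n) \<omega>) - iexp (W1 a \<omega> + W2 b \<omega>)))"
          by (intro integrable_norm Bochner_Integration.integrable_diff integrable_iexp) auto
        show "integrable M (\<lambda>\<omega>. \<bar>W1 (as n) \<omega> - W1 a \<omega>\<bar> + \<bar>W2 (bs n) \<omega> - W2 b \<omega>\<bar>)"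
          using abs_dist[OF W1] abs_dist[OF W2] by simp
        show "norm (iexp (W1 (as n) \<omega> + W2 (bs n) \<omega>) - iexp (W1 a \<omega> + W2 b \<omega>)) \<le>
            \<bar>W1 (as n) \<omega> - W1 a \<omega>\<bar> + \<bar>W2 (bs n) \<omega> - W2 b \<omega>\<bar>" for \<omega>
          using cmod_iexp_diff_le[of "W1 (as n) \<omega> + W2 (bs n) \<omega>" "W1 a \<omega> + W2 b \<omega>"] by linarith
      qed
      also have "\<dots> \<le> norm (as n - a) + norm (bs n - b)"
        using abs_dist[OF W1, of "as n" a] abs_dist[OF W2, of "bs n" b]
        by (subst Bochner_Integration.integral_add) auto
      finally show ?thesis .
    qed
    have lm: "(\<lambda>n. norm (as n - a) + norm (bs n - b)) \<longlonglongrightarrow> 0"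
      using as(2) bs(2) by (auto simp: LIM_zero_iff tendsto_norm_zero_iff intro!: tendsto_add_zero tendsto_norm_zero)
    have "(\<lambda>n. expectation (\<lambda>\<omega>. iexp (W1 (as n) \<omega> + W2 (bs n) \<omega>)) -
        expectation (\<lambda>\<omega>. iexp (W1 a \<omega> + W2 b \<omega>))) \<longlonglongrightarrow> 0"
      by (rule Lim_null_comparison[OF always_eventually[OF allI[OF bd]] lm])
    then have "(\<lambda>n. complex_of_real (exp (- ((norm (as n))\<^sup>2 + (norm (bs n))\<^sup>2) / 2))) \<longlonglongrightarrow>
        expectation (\<lambda>\<omega>. iexp (W1 a \<omega> + W2 b \<omega>))"
      by (simp only: span[OF as(1) bs(1)] LIM_zero_iff)
    moreover have "(\<lambda>n. complex_of_real (exp (- ((norm (as n))\<^sup>2 + (norm (bs n))\<^sup>2) / 2))) \<longlonglongrightarrow>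
        complex_of_real (exp (- ((norm a)\<^sup>2 + (norm b)\<^sup>2) / 2))"
      by (intro tendsto_intros as bs) auto
    ultimately show ?thesis by (rule LIMSEQ_unique)
  qed
  show ?thesis
  proof unfold_locales
    fix k l :: "'h \<times> 'h" and c :: real
    show "(\<lambda>\<omega>. W1 (fst k) \<omega> + W2 (snd k) \<omega>) \<in> borel_measurable M" by simp
    show "AE \<omega> in M. W1 (fst (c *\<^sub>R k + l)) \<omega> + W2 (snd (c *\<^sub>R k + l)) \<omega> =
        c * (W1 (fst k) \<omega> + W2 (snd k) \<omega>) + (W1 (fst l) \<omega> + W2 (snd l) \<omega>)"
      using wiener_linear[OF W1, of c "fst k" "fst l"] wiener_linear[OF W2, of c "snd k" "snd l"]
      by eventually_elim (simp add: algebra_simps)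
    show "expectation (\<lambda>\<omega>. iexp (W1 (fst k) \<omega> + W2 (snd k) \<omega>)) = complex_of_real (exp (- (norm k)\<^sup>2 / 2))"
      unfolding iexp by (simp add: norm_prod_def)
  qed
qed

section \<open>Dyadic step functions\<close>

definition grid :: "real \<Rightarrow> nat \<Rightarrow> nat \<Rightarrow> real" where
  "grid t N k = real k * t / 2 ^ N"

lemma grid_0 [simp]: "grid t N 0 = 0" and grid_last [simp]: "grid t N (2 ^ N) = t"
  by (simp_all add: grid_def)

lemma grid_nonneg: "0 \<le> t \<Longrightarrow> 0 \<le> grid t N k"
  by (simp add: grid_def)

lemma grid_mono: "0 \<le> t \<Longrightarrow> k \<le> l \<Longrightarrow> grid t N k \<le> grid t N l"
  by (simp add: grid_def divide_right_mono mult_right_mono)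

lemma grid_le: "0 \<le> t \<Longrightarrow> k \<le> 2 ^ N \<Longrightarrow> grid t N k \<le> t"
  using grid_mono[of t k "2 ^ N" N] by simp

lemma grid_step: "grid t N (Suc k) - grid t N k = t / 2 ^ N"
  by (simp add: grid_def field_simps)

lemma grid_refine: "grid t (N + d) (k * 2 ^ d) = grid t N k"
  by (simp add: grid_def power_add)

text \<open>\<open>j div 2 ^ d\<close> is the index of the coarse cell that contains the fine point
  j, so the coarse left end is at most one coarse cell away.\<close>

lemma grid_coarse_dist:
  assumes "0 \<le> t"
  shows "grid t N (j div 2 ^ d) \<le> grid t (N + d) j"
    "grid t (N + d) j - grid t N (j div 2 ^ d) \<le> t / 2 ^ N"
proof -
  have "grid t N (j div 2 ^ d) = grid t (N + d) (j div 2 ^ d * 2 ^ d)" by (simp add: grid_refine)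
  also have "\<dots> \<le> grid t (N + d) j" using assms by (intro grid_mono) auto
  finally show "grid t N (j div 2 ^ d) \<le> grid t (N + d) j" .
  have "j < 2 ^ d + 2 ^ d * (j div 2 ^ d)" by (rule dividend_less_times_div) simp
  then have "grid t (N + d) j \<le> grid t (N + d) (Suc (j div 2 ^ d) * 2 ^ d)"
    using assms by (intro grid_mono) (auto simp: mult.commute)
  also have "\<dots> = grid t N (Suc (j div 2 ^ d))" by (rule grid_refine)
  finally show "grid t (N + d) j - grid t N (j div 2 ^ d) \<le> t / 2 ^ N"
    using grid_step[of t N "j div 2 ^ d"] by linarith
qed

text \<open>Cells are open on the left and closed on the right, to match differences of the
  indicators of \<open>{0..s}\<close>.\<close>

lemma grid_cell:
  assumes "0 < t" "0 < r" "r \<le> t"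
  obtains k where "k < 2 ^ N" "grid t N k < r" "r \<le> grid t N (Suc k)"
proof -
  define k where "k = nat (\<lceil>r * 2 ^ N / t\<rceil> - 1)"
  have pos: "0 < r * 2 ^ N / t" using assms by simp
  then have c: "1 \<le> \<lceil>r * 2 ^ N / t\<rceil>" by linarith
  then have k: "real k = real_of_int \<lceil>r * 2 ^ N / t\<rceil> - 1" by (simp add: k_def)
  have "r * 2 ^ N / t \<le> 2 ^ N" using assms by (simp add: divide_le_eq)
  have 1: "real k < r * 2 ^ N / t" "r * 2 ^ N / t \<le> real k + 1"
    unfolding k by linarith+
  show thesis
  proof (rule that[of k])
    have "real k < 2 ^ N" using 1(1) \<open>r * 2 ^ N / t \<le> 2 ^ N\<close> by linarith
    then show "k < 2 ^ N" by (metis of_nat_less_iff of_nat_numeral of_nat_power)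
    show "grid t N k < r" "r \<le> grid t N (Suc k)"
      using 1 assms by (simp_all add: grid_def field_simps)
  qed
qed

context fbm_space
begin

definition incr :: "real \<Rightarrow> nat \<Rightarrow> nat \<Rightarrow> 'h" where
  "incr t N k = e (grid t N (Suc k)) - e (grid t N k)"

lemma incr_inner_nonneg:
  assumes "0 \<le> t" shows "0 \<le> incr t N k \<bullet> incr t N l"
proof -
  have *: "0 \<le> incr t N k \<bullet> incr t N l" if "k < l" for k l
    unfolding incr_def using assms that
    by (intro fbm_increments_nonneg grid_nonneg grid_mono) auto
  consider "k < l" | "l < k" | "k = l" by linarith
  then show ?thesis using *[of k l] *[of l k] by cases (auto simp: inner_commute)
qed

lemma sum_incr: "(\<Sum>k<2 ^ N. incr t N k) = e t"
proof -
  have "(\<Sum>k<2 ^ N. incr t N k) = e (grid t N (2 ^ N)) - e (grid t N 0)"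
    unfolding incr_def by (rule sum_lessThan_telescope)
  then show ?thesis by (simp only: grid_0 grid_last fbm_e_zero diff_zero)
qed

lemma sum_incr_inner:
  assumes "0 \<le> t"
  shows "(\<Sum>k<2 ^ N. \<Sum>l<2 ^ N. incr t N k \<bullet> incr t N l) = t powr (2 * H)"
proof -
  have "(\<Sum>k<2 ^ N. \<Sum>l<2 ^ N. incr t N k \<bullet> incr t N l) = e t \<bullet> e t"
    by (simp only: inner_sum_left[symmetric] inner_sum_right[symmetric] sum_incr)
  then show ?thesis using assms by (simp add: fbm_inner) (simp add: fbm_cov_def)
qed

text \<open>A coarse increment is the sum of the fine increments inside its cell. The summand
  \<open>A k\<close> is an arbitrary additive map, so the same rule refines vector sums as well as
  each variable of a double sum.\<close>

lemma incr_refine: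
  fixes A :: "nat \<Rightarrow> 'h \<Rightarrow> 'b::ab_group_add"
  assumes "\<And>k x y. A k (x + y) = A k x + A k y"
  shows "(\<Sum>k<2 ^ N. A k (incr t N k)) = (\<Sum>j<2 ^ (N + d). A (j div 2 ^ d) (incr t (N + d) j))"
proof -
  have A0: "A k 0 = 0" for k using assms[of k 0 0] by simp
  have A_sum: "A k (sum f I) = (\<Sum>i\<in>I. A k (f i))" for k f and I :: "nat set"
    by (induction I rule: infinite_finite_induct) (simp_all add: A0 assms)
  have "incr t N k = (\<Sum>j = k * 2 ^ d..<k * 2 ^ d + 2 ^ d. incr t (N + d) j)" for k
  proof -
    have "(\<Sum>j = k * 2 ^ d..<k * 2 ^ d + 2 ^ d. incr t (N + d) j) =
        e (grid t (N + d) (k * 2 ^ d + 2 ^ d)) - e (grid t (N + d) (k * 2 ^ d))"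
      unfolding incr_def by (rule sum_Suc_diff') simp
    also have "\<dots> = e (grid t (N + d) (Suc k * 2 ^ d)) - e (grid t (N + d) (k * 2 ^ d))"
      by (simp add: add.commute)
    also have "\<dots> = incr t N k"
      unfolding grid_refine by (simp only: incr_def)
    finally show ?thesis by (rule sym)
  qed
  then have "(\<Sum>k<2 ^ N. A k (incr t N k)) =
      (\<Sum>k<2 ^ N. \<Sum>j = k * 2 ^ d..<k * 2 ^ d + 2 ^ d. A k (incr t (N + d) j))"
    by (simp add: A_sum)
  also have "\<dots> = (\<Sum>k<2 ^ N. \<Sum>j = k * 2 ^ d..<k * 2 ^ d + 2 ^ d. A (j div 2 ^ d) (incr t (N + d) j))"
  proof (intro sum.cong refl)
    fix k j :: nat assume "j \<in> {k * 2 ^ d..<k * 2 ^ d + 2 ^ d}"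
    then have "j div 2 ^ d = k" by (intro div_nat_eqI) (auto simp: mult.commute)
    then show "A k (incr t (N + d) j) = A (j div 2 ^ d) (incr t (N + d) j)" by simp
  qed
  also have "\<dots> = (\<Sum>j<2 ^ N * 2 ^ d. A (j div 2 ^ d) (incr t (N + d) j))"
    by (rule sum.nat_group)
  finally show ?thesis by (simp add: power_add)
qed

text \<open>The inequality 2 x y <= x^2 + y^2, applied to the coefficients, is preserved because
  scalar products of increments are nonnegative. What remains contains only squared norms, so no
  joint moments of different coefficients have to be computed.\<close>

lemma incr_quadratic_le:
  fixes U :: "nat \<Rightarrow> 'b::real_inner"
  assumes "0 \<le> t"
  shows "(\<Sum>k<2 ^ N. \<Sum>l<2 ^ N. (U k \<bullet> U l) * (incr t N k \<bullet> incr t N l)) \<le>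
    (\<Sum>k<2 ^ N. \<Sum>l<2 ^ N. ((norm (U k))\<^sup>2 + (norm (U l))\<^sup>2) / 2 * (incr t N k \<bullet> incr t N l))"
proof (intro sum_mono mult_right_mono incr_inner_nonneg assms)
  fix k l
  have "0 \<le> (norm (U k - U l))\<^sup>2" by simp
  then show "U k \<bullet> U l \<le> ((norm (U k))\<^sup>2 + (norm (U l))\<^sup>2) / 2"
    by (simp add: power2_norm_eq_inner inner_diff_left inner_diff_right inner_commute)
qed

text \<open>For positively correlated increments the Hilbert norm of a step function is dominated by
  its supremum, since all increments together have norm \<open>t powr H\<close>. Uniform
  approximation of coefficients is therefore enough.\<close>

lemma norm_sum_incr_le:
  assumes "0 \<le> t" "\<And>k. k < 2 ^ N \<Longrightarrow> \<bar>a k\<bar> \<le> c"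
  shows "norm (\<Sum>k<2 ^ N. a k *\<^sub>R incr t N k) \<le> c * t powr H"
proof (rule power2_le_imp_le)
  have "0 \<le> c" using assms(2)[of 0] by simp
  then show "0 \<le> c * t powr H" by simp
  have sq: "(norm (a k))\<^sup>2 \<le> c\<^sup>2" if "k < 2 ^ N" for k
    using assms(2)[OF that] by (simp add: abs_le_square_iff[symmetric] \<open>0 \<le> c\<close>)
  have "(norm (\<Sum>k<2 ^ N. a k *\<^sub>R incr t N k))\<^sup>2 =
      (\<Sum>k<2 ^ N. \<Sum>l<2 ^ N. (a k \<bullet> a l) * (incr t N k \<bullet> incr t N l))"
    unfolding power2_norm_eq_inner inner_sum_left inner_sum_right
    by (subst sum.swap) (simp add: mult_ac inner_commute)
  also have "\<dots> \<le> (\<Sum>k<2 ^ N. \<Sum>l<2 ^ N. ((norm (a k))\<^sup>2 + (norm (a l))\<^sup>2) / 2 * (incr t N k \<bullet> incr t N l))"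
    by (rule incr_quadratic_le[OF assms(1)])
  also have "\<dots> \<le> (\<Sum>k<2 ^ N. \<Sum>l<2 ^ N. c\<^sup>2 * (incr t N k \<bullet> incr t N l))"
  proof (intro sum_mono mult_right_mono incr_inner_nonneg assms(1))
    fix k l :: nat assume "k \<in> {..<2 ^ N}" "l \<in> {..<2 ^ N}"
    then show "((norm (a k))\<^sup>2 + (norm (a l))\<^sup>2) / 2 \<le> c\<^sup>2"
      using sq[of k] sq[of l] by simp
  qed
  also have "\<dots> = c\<^sup>2 * t powr (2 * H)"
    by (simp add: sum_distrib_left[symmetric] sum_incr_inner assms(1))
  also have "\<dots> = (c * t powr H)\<^sup>2"
    by (simp add: power2_eq_square powr_add[symmetric])
  finally show "(norm (\<Sum>k<2 ^ N. a k *\<^sub>R incr t N k))\<^sup>2 \<le> (c * t powr H)\<^sup>2" .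
qed

definition left_sum :: "(real \<Rightarrow> real) \<Rightarrow> real \<Rightarrow> nat \<Rightarrow> 'h" where
  "left_sum \<phi> t N = (\<Sum>k<2 ^ N. \<phi> (grid t N k) *\<^sub>R incr t N k)"

text \<open>Written on the finer of two grids, the difference of two left sums has coefficients
  bounded by the modulus of continuity of \<phi> at the coarse mesh; the supremum bound then gives
  the Cauchy property.\<close>

lemma left_sum_convergent:
  assumes t: "0 \<le> t" and cont: "continuous_on {0..t} \<phi>"
  shows "convergent (left_sum \<phi> t)"
proof (rule Cauchy_convergent, rule metric_CauchyI)
  fix \<epsilon> :: real assume "0 < \<epsilon>"
  define \<epsilon>' where "\<epsilon>' = \<epsilon> / (2 * (t powr H + 1))"
  have pos: "0 < t powr H + 1" by (simp add: add_nonneg_pos)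
  have "0 < \<epsilon>'" using \<open>0 < \<epsilon>\<close> pos by (simp add: \<epsilon>'_def)
  have "uniformly_continuous_on {0..t} \<phi>"
    using cont by (intro compact_uniformly_continuous) auto
  then obtain \<delta> where "0 < \<delta>" and \<delta>: "\<And>x y. x \<in> {0..t} \<Longrightarrow> y \<in> {0..t} \<Longrightarrow> \<bar>y - x\<bar> < \<delta> \<Longrightarrow> \<bar>\<phi> y - \<phi> x\<bar> < \<epsilon>'"
    using \<open>0 < \<epsilon>'\<close> unfolding uniformly_continuous_on_def dist_real_def by metis
  obtain N where N: "t / 2 ^ N < \<delta>"
  proof -
    obtain N where "t / \<delta> < 2 ^ N" using real_arch_pow[of 2 "t / \<delta>"] by auto
    then show thesis using \<open>0 < \<delta>\<close> by (intro that[of N]) (simp add: field_simps)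
  qed
  have near: "dist (left_sum \<phi> t N) (left_sum \<phi> t M) < \<epsilon> / 2" if "N \<le> M" for M
  proof -
    from le_Suc_ex[OF that] obtain d where M: "M = N + d" ..
    have "left_sum \<phi> t N = (\<Sum>j<2 ^ (N + d). \<phi> (grid t N (j div 2 ^ d)) *\<^sub>R incr t (N + d) j)"
      unfolding left_sum_def
      by (rule incr_refine[of "\<lambda>k x. \<phi> (grid t N k) *\<^sub>R x"]) (simp add: scaleR_add_right)
    then have diff: "left_sum \<phi> t M - left_sum \<phi> t N =
        (\<Sum>j<2 ^ (N + d). (\<phi> (grid t (N + d) j) - \<phi> (grid t N (j div 2 ^ d))) *\<^sub>R incr t (N + d) j)"
      by (simp add: left_sum_def M sum_subtractf scaleR_diff_left)
    have bnd: "\<bar>\<phi> (grid t (N + d) j) - \<phi> (grid t N (j div 2 ^ d))\<bar> \<le> \<epsilon>'" if "j < 2 ^ (N + d)" for j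
    proof -
      have "grid t (N + d) j \<le> t" using that t by (intro grid_le) auto
      then have "grid t (N + d) j \<in> {0..t}" "grid t N (j div 2 ^ d) \<in> {0..t}"
        using grid_coarse_dist(1)[OF t, of N j d] grid_nonneg[OF t] by auto
      moreover have "\<bar>grid t (N + d) j - grid t N (j div 2 ^ d)\<bar> < \<delta>"
        using grid_coarse_dist(1)[OF t, of N j d] grid_coarse_dist(2)[OF t, of N d j] N by linarith
      ultimately show ?thesis using \<delta> by (intro less_imp_le) blast
    qed
    have "norm (left_sum \<phi> t M - left_sum \<phi> t N) \<le> \<epsilon>' * t powr H"
      unfolding diff by (rule norm_sum_incr_le[OF t bnd])
    also have "\<dots> < \<epsilon>' * (t powr H + 1)" using \<open>0 < \<epsilon>'\<close> by simp
    also have "\<dots> = \<epsilon> / 2"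
    proof -
      have "\<epsilon> / (2 * x) * x = \<epsilon> / 2" if "0 < x" for x using that by simp
      from this[OF pos] show ?thesis by (simp only: \<epsilon>'_def)
    qed
    finally show ?thesis by (simp add: dist_norm norm_minus_commute)
  qed
  show "\<exists>N0. \<forall>m\<ge>N0. \<forall>n\<ge>N0. dist (left_sum \<phi> t m) (left_sum \<phi> t n) < \<epsilon>"
  proof (intro exI allI impI)
    fix m n assume "N \<le> m" "N \<le> n"
    then show "dist (left_sum \<phi> t m) (left_sum \<phi> t n) < \<epsilon>"
      using near[of m] near[of n] dist_triangle3[of "left_sum \<phi> t m" "left_sum \<phi> t n" "left_sum \<phi> t N"]
      by linarith
  qed
qed

text \<open>The exponent 2H - 2 exceeds -1, so the kernel is integrable across its singularity at q
  = r, uniformly in r.\<close>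

lemma nn_integral_kernel_le:
  assumes "0 \<le> t" "r \<in> {0..t}"
  shows "(\<integral>\<^sup>+q. ennreal (indicator {0..t} q * \<bar>r - q\<bar> powr (2 * H - 2)) \<partial>lborel) \<le>
    ennreal (2 * (t powr (2 * H - 1) / (2 * H - 1)))"
proof -
  \<comment> \<open>The kernel on one side of its singularity. The part with q < r is covered by a
    reflected copy of \<open>g\<close>, the part with q > r by a translated one; this produces the
    factor 2.\<close>
  define g where "g u = indicator {0..t} u * u powr (2 * H - 2)" for u :: real
  have [measurable]: "g \<in> borel_measurable borel" unfolding g_def by measurable
  have "((\<lambda>u. u powr (2 * H - 2)) has_integral t powr (2 * H - 2 + 1) / (2 * H - 2 + 1)) {0..t}"
    using H_gt_half assms by (intro has_integral_powr_from_0) auto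
  then have g: "(\<integral>\<^sup>+u. ennreal (g u) \<partial>lborel) = ennreal (t powr (2 * H - 1) / (2 * H - 1))"
    using nn_integral_has_integral_lebesgue[of "{0..t}" "\<lambda>u. u powr (2 * H - 2)"]
    by (simp add: g_def)
  have shift: "(\<integral>\<^sup>+q. ennreal (g (r + c * q)) \<partial>lborel) = (\<integral>\<^sup>+u. ennreal (g u) \<partial>lborel)"
    "(\<integral>\<^sup>+q. ennreal (g (- r + c * q)) \<partial>lborel) = (\<integral>\<^sup>+u. ennreal (g u) \<partial>lborel)" if "\<bar>c\<bar> = 1" for c
  proof -
    have "c \<noteq> 0" using that by auto
    then show "(\<integral>\<^sup>+q. ennreal (g (r + c * q)) \<partial>lborel) = (\<integral>\<^sup>+u. ennreal (g u) \<partial>lborel)"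
      "(\<integral>\<^sup>+q. ennreal (g (- r + c * q)) \<partial>lborel) = (\<integral>\<^sup>+u. ennreal (g u) \<partial>lborel)"
      using nn_integral_real_affine[of "\<lambda>u. ennreal (g u)" c r]
        nn_integral_real_affine[of "\<lambda>u. ennreal (g u)" c "- r"] that by simp_all
  qed
  have "(\<integral>\<^sup>+q. ennreal (indicator {0..t} q * \<bar>r - q\<bar> powr (2 * H - 2)) \<partial>lborel) \<le>
      (\<integral>\<^sup>+q. ennreal (g (r + (-1) * q)) + ennreal (g (- r + 1 * q)) \<partial>lborel)"
  proof (rule nn_integral_mono)
    fix q
    have "indicator {0..t} q * \<bar>r - q\<bar> powr (2 * H - 2) \<le> g (r + (-1) * q) + g (- r + 1 * q)"
      using assms by (auto simp: g_def indicator_def abs_if)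
    then have "ennreal (indicator {0..t} q * \<bar>r - q\<bar> powr (2 * H - 2)) \<le>
        ennreal (g (r + (-1) * q) + g (- r + 1 * q))"
      by (rule ennreal_leI)
    also have "\<dots> = ennreal (g (r + (-1) * q)) + ennreal (g (- r + 1 * q))"
      by (rule ennreal_plus) (simp_all add: g_def)
    finally show "ennreal (indicator {0..t} q * \<bar>r - q\<bar> powr (2 * H - 2)) \<le>
        ennreal (g (r + (-1) * q)) + ennreal (g (- r + 1 * q))" .
  qed
  also have "\<dots> = ennreal (t powr (2 * H - 1) / (2 * H - 1)) + ennreal (t powr (2 * H - 1) / (2 * H - 1))"
    using shift(1)[of "-1"] shift(2)[of 1] by (subst nn_integral_add) (simp_all add: g)
  also have "\<dots> = ennreal (2 * (t powr (2 * H - 1) / (2 * H - 1)))"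
    using H_gt_half by (subst ennreal_plus[symmetric]) simp_all
  finally show ?thesis .
qed

text \<open>The bound on f is required only almost everywhere because, at the endpoint t, the left
  step functions keep their last value while the indicator of the open interval is 0.\<close>

lemma abs_energy_le:
  assumes t: "0 \<le> t" and f: "AE r in lborel. \<bar>f r\<bar> \<le> c * indicator {0..t} r" and "0 \<le> c"
  shows "abs_energy H f \<le> ennreal (c\<^sup>2 * (2 * t powr (2 * H) / (2 * H - 1)))"
proof -
  have "abs_energy H f \<le> (\<integral>\<^sup>+ r. ennreal (c\<^sup>2 * (2 * (t powr (2 * H - 1) / (2 * H - 1)))) * indicator {0..t} r \<partial>lborel)"
    unfolding abs_energy_def
  proof (rule nn_integral_mono_AE, use f in eventually_elim)
    fix r assume r: "\<bar>f r\<bar> \<le> c * indicator {0..t} r"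
    show "(\<integral>\<^sup>+ q\<in>{0..}. ennreal (\<bar>f r\<bar> * \<bar>f q\<bar> * \<bar>r - q\<bar> powr (2 * H - 2)) \<partial>lborel) * indicator {0..} r
        \<le> ennreal (c\<^sup>2 * (2 * (t powr (2 * H - 1) / (2 * H - 1)))) * indicator {0..t} r"
    proof (cases "r \<in> {0..t}")
      case True
      have "(\<integral>\<^sup>+ q\<in>{0..}. ennreal (\<bar>f r\<bar> * \<bar>f q\<bar> * \<bar>r - q\<bar> powr (2 * H - 2)) \<partial>lborel) \<le>
          (\<integral>\<^sup>+ q. ennreal (c\<^sup>2) * ennreal (indicator {0..t} q * \<bar>r - q\<bar> powr (2 * H - 2)) \<partial>lborel)"
      proof (rule nn_integral_mono_AE, use f in eventually_elim)
        fix q assume q: "\<bar>f q\<bar> \<le> c * indicator {0..t} q"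
        have "\<bar>f r\<bar> * \<bar>f q\<bar> * \<bar>r - q\<bar> powr (2 * H - 2) \<le>
            c * (c * indicator {0..t} q) * \<bar>r - q\<bar> powr (2 * H - 2)"
          using r q True \<open>0 \<le> c\<close> by (intro mult_right_mono mult_mono) auto
        then have "ennreal (\<bar>f r\<bar> * \<bar>f q\<bar> * \<bar>r - q\<bar> powr (2 * H - 2)) \<le>
            ennreal (c\<^sup>2) * ennreal (indicator {0..t} q * \<bar>r - q\<bar> powr (2 * H - 2))"
          by (subst ennreal_mult[symmetric]) (auto simp: power2_eq_square mult.assoc intro!: ennreal_leI)
        then show "ennreal (\<bar>f r\<bar> * \<bar>f q\<bar> * \<bar>r - q\<bar> powr (2 * H - 2)) * indicator {0..} q \<le>
            ennreal (c\<^sup>2) * ennreal (indicator {0..t} q * \<bar>r - q\<bar> powr (2 * H - 2))"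
          by (auto simp: indicator_def)
      qed
      also have "\<dots> = ennreal (c\<^sup>2) * (\<integral>\<^sup>+ q. ennreal (indicator {0..t} q * \<bar>r - q\<bar> powr (2 * H - 2)) \<partial>lborel)"
        by (rule nn_integral_cmult) measurable
      also have "\<dots> \<le> ennreal (c\<^sup>2) * ennreal (2 * (t powr (2 * H - 1) / (2 * H - 1)))"
        by (intro mult_left_mono nn_integral_kernel_le t True) simp
      also have "\<dots> = ennreal (c\<^sup>2 * (2 * (t powr (2 * H - 1) / (2 * H - 1))))"
        using H_gt_half by (intro ennreal_mult[symmetric]) auto
      finally show ?thesis using True by simp
    next
      case False
      then have "f r = 0" using r by auto
      then show ?thesis by simp
    qed
  qed
  also have "\<dots> = ennreal (c\<^sup>2 * (2 * (t powr (2 * H - 1) / (2 * H - 1)))) * ennreal t"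
    using t by (simp add: nn_integral_cmult_indicator)
  also have "\<dots> = ennreal (c\<^sup>2 * (2 * (t * t powr (2 * H - 1)) / (2 * H - 1)))"
    using H_gt_half t by (subst ennreal_mult[symmetric]) (auto simp: mult_ac)
  also have "t * t powr (2 * H - 1) = t powr (2 * H)"
    using t by (cases "t = 0") (simp_all add: powr_mult_base)
  finally show ?thesis by simp
qed

lemma sum_list_pairs:
  fixes F :: "'a::uminus \<Rightarrow> 'c \<Rightarrow> 'b::ab_group_add"
  shows "(\<Sum>(c, s)\<leftarrow>concat (map (\<lambda>k. [(a k, b k), (- a k, d k)]) ks). F c s) =
    (\<Sum>k\<leftarrow>ks. F (a k) (b k) + F (- a k) (d k))"
  by (induction ks) (simp_all add: add.assoc)

text \<open>Links the limit of left sums in the abstract Hilbert space with the function it stands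
  for: left step functions approximate uniformly off the endpoint, and the energy norm is controlled
  by the supremum.\<close>

theorem left_sum_represents:
  assumes t: "0 \<le> t" and cont: "continuous_on {0..t} \<phi>"
  shows "represents H e (\<lambda>s. \<phi> s * indicator {0<..<t} s) (lim (left_sum \<phi> t))"
proof -
  \<comment> \<open>A cell with ends s < r is the difference of \<open>{0..r}\<close> and
    \<open>{0..s}\<close>, so it contributes two list entries with opposite coefficients.\<close>
  define cs where "cs N = concat (map (\<lambda>k. [(\<phi> (grid t N k), grid t N (Suc k)), (- \<phi> (grid t N k), grid t N k)])
    [0..<2 ^ N])" for N
  have elem: "step_elem e (cs N) = left_sum \<phi> t N" for N
    unfolding step_elem_def cs_def sum_list_pairs
    by (simp add: interv_sum_list_conv_sum_set_nat left_sum_def incr_def scaleR_diff_right lessThan_atLeast0)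
  have step_eq: "step_fun (cs N) r = (\<Sum>k<2 ^ N. \<phi> (grid t N k) * (indicator {0..grid t N (Suc k)} r - indicator {0..grid t N k} r))" for N r
    unfolding step_fun_def cs_def sum_list_pairs
    by (simp add: interv_sum_list_conv_sum_set_nat right_diff_distrib lessThan_atLeast0)
  have step_0: "step_fun (cs N) r = 0" if "r \<le> 0 \<or> t < r" for N r
    unfolding step_eq
  proof (rule sum.neutral, rule ballI)
    fix k :: nat assume "k \<in> {..<2 ^ N}"
    then have "grid t N (Suc k) \<le> t" "grid t N k \<le> t" using t by (auto intro!: grid_le)
    then show "\<phi> (grid t N k) * (indicator {0..grid t N (Suc k)} r - indicator {0..grid t N k} r) = 0"
      using that t grid_nonneg[OF t, of N] by (auto simp: indicator_def)
  qed
  have step_cell: "step_fun (cs N) r = \<phi> (grid t N k)"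
    if k: "k < 2 ^ N" "grid t N k < r" "r \<le> grid t N (Suc k)" for N r k
  proof -
    have "step_fun (cs N) r = (\<Sum>j<2 ^ N. if j = k then \<phi> (grid t N k) else 0)"
      unfolding step_eq
    proof (intro sum.cong refl)
      fix j
      consider "j = k" | "j < k" | "k < j" by linarith
      then show "\<phi> (grid t N j) * (indicator {0..grid t N (Suc j)} r - indicator {0..grid t N j} r) =
          (if j = k then \<phi> (grid t N k) else 0)"
      proof cases
        case 1
        then show ?thesis using k grid_nonneg[OF t, of N k] by (auto simp: indicator_def)
      next
        case 2
        then have "grid t N (Suc j) \<le> grid t N k" "grid t N j \<le> grid t N k"
          using t by (auto intro!: grid_mono)
        then show ?thesis using 2 k by (auto simp: indicator_def)
      next
        case 3
        then have "grid t N (Suc k) \<le> grid t N j" "grid t N (Suc k) \<le> grid t N (Suc j)"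
          using t by (auto intro!: grid_mono)
        then show ?thesis using 3 k grid_nonneg[OF t, of N k] by (auto simp: indicator_def)
      qed
    qed
    then show ?thesis using k by simp
  qed
  have energy: "(\<lambda>N. abs_energy H (\<lambda>r. \<phi> r * indicator {0<..<t} r - step_fun (cs N) r)) \<longlonglongrightarrow> 0"
  proof (rule tendsto_0_if_Limsup_eq_0_ennreal, rule antisym)
    define K where "K = 2 * t powr (2 * H) / (2 * H - 1)"
    have "0 \<le> K" using H_gt_half by (simp add: K_def)
    show "Limsup sequentially (\<lambda>N. abs_energy H (\<lambda>r. \<phi> r * indicator {0<..<t} r - step_fun (cs N) r)) \<le> 0"
    proof (rule ennreal_le_epsilon)
      fix \<epsilon> :: real assume "0 < \<epsilon>"
      \<comment> \<open>The largest deviation allowed on a cell, chosen so that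
        \<open>c\<^sup>2 * K\<close> is at most \<epsilon>; adding 1 to K covers K = 0.\<close>
      define c where "c = sqrt (\<epsilon> / (K + 1))"
      have "0 < c" using \<open>0 < \<epsilon>\<close> \<open>0 \<le> K\<close> by (simp add: c_def)
      have "c\<^sup>2 * K \<le> \<epsilon>"
        using \<open>0 < \<epsilon>\<close> \<open>0 \<le> K\<close> by (simp add: c_def field_simps)
      have "uniformly_continuous_on {0..t} \<phi>"
        using cont by (intro compact_uniformly_continuous) auto
      then obtain \<delta> where "0 < \<delta>" and \<delta>: "\<And>x y. x \<in> {0..t} \<Longrightarrow> y \<in> {0..t} \<Longrightarrow> \<bar>y - x\<bar> < \<delta> \<Longrightarrow> \<bar>\<phi> y - \<phi> x\<bar> < c"
        using \<open>0 < c\<close> unfolding uniformly_continuous_on_def dist_real_def by metis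
      obtain N0 where N0: "t / \<delta> < 2 ^ N0" using real_arch_pow[of 2 "t / \<delta>"] by auto
      have "abs_energy H (\<lambda>r. \<phi> r * indicator {0<..<t} r - step_fun (cs N) r) \<le> ennreal \<epsilon>" if "N0 \<le> N" for N
      proof -
        have "(2::real) ^ N0 \<le> 2 ^ N" using that by simp
        then have "t / \<delta> < 2 ^ N" using N0 by linarith
        then have N: "t / 2 ^ N < \<delta>" using \<open>0 < \<delta>\<close> by (simp add: field_simps)
        have "abs_energy H (\<lambda>r. \<phi> r * indicator {0<..<t} r - step_fun (cs N) r) \<le> ennreal (c\<^sup>2 * K)"
          unfolding K_def
        proof (rule abs_energy_le[OF t])
          show "AE r in lborel. \<bar>\<phi> r * indicator {0<..<t} r - step_fun (cs N) r\<bar> \<le> c * indicator {0..t} r"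
            using AE_lborel_singleton[of t]
          proof eventually_elim
            fix r assume "r \<noteq> t"
            show "\<bar>\<phi> r * indicator {0<..<t} r - step_fun (cs N) r\<bar> \<le> c * indicator {0..t} r"
            proof (cases "0 < r \<and> r < t")
              case True
              then obtain k where k: "k < 2 ^ N" "grid t N k < r" "r \<le> grid t N (Suc k)"
                using grid_cell[of t r N] by auto
              have "\<bar>\<phi> r - \<phi> (grid t N k)\<bar> < c"
                using k True grid_nonneg[OF t, of N k] grid_step[of t N k] N by (intro \<delta>) auto
              then show ?thesis using True step_cell[OF k] by simp
            next
              case False
              then show ?thesis using \<open>r \<noteq> t\<close> step_0[of r N] \<open>0 < c\<close> by auto
            qed
          qed
        qed (use \<open>0 < c\<close> in simp)
        also have "\<dots> \<le> ennreal \<epsilon>" using \<open>c\<^sup>2 * K \<le> \<epsilon>\<close> by (rule ennreal_leI)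
        finally show ?thesis .
      qed
      then have "\<forall>\<^sub>F N in sequentially. abs_energy H (\<lambda>r. \<phi> r * indicator {0<..<t} r - step_fun (cs N) r) \<le> ennreal \<epsilon>"
        unfolding eventually_sequentially by blast
      from Limsup_bounded[OF this] show "Limsup sequentially (\<lambda>N. abs_energy H (\<lambda>r. \<phi> r * indicator {0<..<t} r - step_fun (cs N) r)) \<le> 0 + ennreal \<epsilon>"
        by simp
    qed
  qed simp
  have lim: "(\<lambda>N. step_elem e (cs N)) \<longlonglongrightarrow> lim (left_sum \<phi> t)"
    using left_sum_convergent[OF assms] unfolding elem by (simp add: convergent_LIMSEQ_iff)
  have nonneg: "\<forall>N. \<forall>(c, s)\<in>set (cs N). 0 \<le> s"
    using grid_nonneg[OF t] by (auto simp: cs_def)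
  have "(\<lambda>s. \<phi> s * indicator {0<..<t} s) \<in> borel_measurable borel"
  proof -
    have "continuous_on {0<..<t} \<phi>" by (rule continuous_on_subset[OF cont]) auto
    then show ?thesis
      using borel_measurable_continuous_on_indicator[of "{0<..<t}" \<phi>] by (simp add: mult.commute)
  qed
  with nonneg energy lim show ?thesis
    unfolding represents_def by (intro conjI exI[of _ cs])
qed

end

section \<open>Divergence of smooth fields along the path\<close>

lemma Cb_infinity_dep: "g \<in> Cb_infinity m \<Longrightarrow> (\<And>i. i < m \<Longrightarrow> x i = y i) \<Longrightarrow> g x = g y"
  by (simp add: Cb_infinity_def)

lemma Cb_infinity_continuous: "g \<in> Cb_infinity m \<Longrightarrow> continuous_on UNIV g"
  unfolding Cb_infinity_def iterated_partial_def by (auto dest!: spec[of _ "[]"])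

lemma Cb_infinity_borel: "g \<in> Cb_infinity m \<Longrightarrow> g \<in> borel_measurable borel"
  by (intro borel_measurable_continuous_onI Cb_infinity_continuous)

lemma Cb_infinity_bounded:
  assumes "g \<in> Cb_infinity m"
  obtains C where "0 < C" "\<And>x. \<bar>g x\<bar> \<le> C"
proof -
  have "bounded (range g)"
    using assms unfolding Cb_infinity_def iterated_partial_def by (auto dest!: spec[of _ "[]"])
  then obtain C where "0 < C" "\<And>x. norm (g x) \<le> C"
    unfolding bounded_pos by blast
  then show thesis using that by simp
qed

lemma Cb_infinity_deriv:
  assumes "g \<in> Cb_infinity m" "i < m"
  shows "((\<lambda>r. g (x(i := r))) has_real_derivative partial_deriv i g x) (at (x i))"
proof -
  have "(\<lambda>r. g (x(i := r))) differentiable (at (x i))"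
    using assms unfolding Cb_infinity_def iterated_partial_def by (auto dest!: spec[of _ "[]"])
  then show ?thesis
    unfolding partial_deriv_def by (simp add: DERIV_deriv_iff_real_differentiable)
qed

lemma Cb_infinity_partial_deriv:
  assumes g: "g \<in> Cb_infinity m" and i: "i < m"
  shows "partial_deriv i g \<in> Cb_infinity m"
proof -
  have it: "iterated_partial is (partial_deriv i g) = iterated_partial (is @ [i]) g" for "is"
    by (simp add: iterated_partial_def)
  have "partial_deriv i g x = partial_deriv i g y" if "\<forall>i<m. x i = y i" for x y
  proof -
    have "g (x(i := r)) = g (y(i := r))" for r
      using that by (intro Cb_infinity_dep[OF g]) auto
    then show ?thesis using that i by (simp add: partial_deriv_def)
  qed
  moreover have "set (is @ [i]) \<subseteq> {..<m}" if "set is \<subseteq> {..<m}" for "is"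
    using that i by simp
  ultimately show ?thesis
    using g unfolding Cb_infinity_def mem_Collect_eq it by meson
qed

lemma Cb_infinity_2_lipschitz:
  assumes f: "f \<in> Cb_infinity 2"
  obtains L where "0 < L" "\<And>x y. \<bar>f x - f y\<bar> \<le> L * (\<bar>x 0 - y 0\<bar> + \<bar>x 1 - y 1\<bar>)"
proof -
  obtain C0 where C0: "0 < C0" "\<And>x. \<bar>partial_deriv 0 f x\<bar> \<le> C0"
    using Cb_infinity_bounded[OF Cb_infinity_partial_deriv[OF f]] by (metis pos2)
  obtain C1 where C1: "0 < C1" "\<And>x. \<bar>partial_deriv 1 f x\<bar> \<le> C1"
    using Cb_infinity_bounded[OF Cb_infinity_partial_deriv[OF f]] by (metis one_less_numeral_iff semiring_norm(76))
  define L where "L = C0 + C1"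
  have step: "\<bar>f (x(i := r)) - f (x(i := s))\<bar> \<le> L * \<bar>r - s\<bar>" if i: "i < 2" for i x r s
  proof -
    have "norm (f (x(i := r)) - f (x(i := s))) \<le> L * norm (r - s)"
    proof (rule field_differentiable_bound[of UNIV])
      fix z :: real
      show "((\<lambda>r. f (x(i := r))) has_field_derivative partial_deriv i f (x(i := z))) (at z within UNIV)"
        using Cb_infinity_deriv[OF f i, of "x(i := z)"] by simp
      consider "i = 0" | "i = 1" using less_2_cases[OF i] by auto
      then show "norm (partial_deriv i f (x(i := z))) \<le> L"
        using C0(1) C1(1) C0(2)[of "x(i := z)"] C1(2)[of "x(i := z)"] by cases (auto simp: L_def)
    qed auto
    then show ?thesis by simp
  qed
  show thesis
  proof (rule that[of L])
    show "0 < L" using C0 C1 by (simp add: L_def)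
    fix x y
    have "f y = f (x(0 := y 0, 1 := y 1))"
      by (rule Cb_infinity_dep[OF f]) (auto simp: numeral_2_eq_2 less_Suc_eq)
    then have "f x - f y = (f (x(0 := x 0)) - f (x(0 := y 0))) +
        (f ((x(0 := y 0))(1 := x 1)) - f ((x(0 := y 0))(1 := y 1)))"
      by (simp add: fun_upd_idem)
    also have "\<bar>\<dots>\<bar> \<le> L * \<bar>x 0 - y 0\<bar> + L * \<bar>x 1 - y 1\<bar>"
      using step[of 0 x "x 0" "y 0"] step[of 1 "x(0 := y 0)" "x 1" "y 1"] by linarith
    finally show "\<bar>f x - f y\<bar> \<le> L * (\<bar>x 0 - y 0\<bar> + \<bar>x 1 - y 1\<bar>)" by (simp add: distrib_left)
  qed
qed

lemma square_integrable_diff: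
  fixes f g :: "'a \<Rightarrow> 'b::{real_inner, second_countable_topology}"
  assumes "square_integrable M f" "square_integrable M g"
  shows "square_integrable M (\<lambda>\<omega>. f \<omega> - g \<omega>)"
  unfolding square_integrable_def
proof
  show [measurable]: "(\<lambda>\<omega>. f \<omega> - g \<omega>) \<in> borel_measurable M"
    using assms by (auto simp: square_integrable_def)
  show "integrable M (\<lambda>\<omega>. (norm (f \<omega> - g \<omega>))\<^sup>2)"
  proof (rule Bochner_Integration.integrable_bound)
    show "integrable M (\<lambda>\<omega>. 2 * (norm (f \<omega>))\<^sup>2 + 2 * (norm (g \<omega>))\<^sup>2)"
      using assms by (simp add: square_integrable_def)
    show "AE \<omega> in M. norm ((norm (f \<omega> - g \<omega>))\<^sup>2) \<le> norm (2 * (norm (f \<omega>))\<^sup>2 + 2 * (norm (g \<omega>))\<^sup>2)"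
    proof (rule AE_I2)
      fix \<omega>
      have "0 \<le> (norm (f \<omega> + g \<omega>))\<^sup>2" by simp
      then have "(norm (f \<omega> - g \<omega>))\<^sup>2 \<le> 2 * (norm (f \<omega>))\<^sup>2 + 2 * (norm (g \<omega>))\<^sup>2"
        by (simp add: power2_norm_eq_inner inner_simps inner_commute)
      then show "norm ((norm (f \<omega> - g \<omega>))\<^sup>2) \<le> norm (2 * (norm (f \<omega>))\<^sup>2 + 2 * (norm (g \<omega>))\<^sup>2)" by simp
    qed
  qed simp
qed

lemma abs_inner_le_weighted:
  fixes x y :: "'b::real_inner"
  assumes "0 < \<epsilon>"
  shows "\<bar>x \<bullet> y\<bar> \<le> ((norm x)\<^sup>2 / \<epsilon> + \<epsilon> * (norm y)\<^sup>2) / 2"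
proof -
  have "0 \<le> (norm x / sqrt \<epsilon> - sqrt \<epsilon> * norm y)\<^sup>2" by simp
  also have "\<dots> = (norm x)\<^sup>2 / \<epsilon> + \<epsilon> * (norm y)\<^sup>2 - 2 * (norm x * norm y)"
    using assms by (simp add: power2_diff power_divide power_mult_distrib)
  finally have "0 \<le> (norm x)\<^sup>2 / \<epsilon> + \<epsilon> * (norm y)\<^sup>2 - 2 * (norm x * norm y)" .
  moreover have "c \<le> s / 2" if "0 \<le> s - 2 * d" "c \<le> d" for c d s :: real
    using that by linarith
  ultimately show ?thesis using Cauchy_Schwarz_ineq2[of x y] by blast
qed

lemma square_integrable_inner:
  fixes f g :: "'a \<Rightarrow> 'b::{real_inner, second_countable_topology}"
  assumes "square_integrable M f" "square_integrable M g"
  shows "integrable M (\<lambda>\<omega>. f \<omega> \<bullet> g \<omega>)"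
proof (rule Bochner_Integration.integrable_bound)
  show "integrable M (\<lambda>\<omega>. ((norm (f \<omega>))\<^sup>2 / 1 + 1 * (norm (g \<omega>))\<^sup>2) / 2)"
    using assms by (simp add: square_integrable_def)
  show "AE \<omega> in M. norm (f \<omega> \<bullet> g \<omega>) \<le> norm (((norm (f \<omega>))\<^sup>2 / 1 + 1 * (norm (g \<omega>))\<^sup>2) / 2)"
    using abs_inner_le_weighted[of 1] by (auto intro!: AE_I2 order_trans[OF _ abs_ge_self])
qed (use assms in \<open>auto simp: square_integrable_def\<close>)

lemma L2_tendsto_inner:
  fixes f :: "nat \<Rightarrow> 'a \<Rightarrow> 'b::{real_inner, second_countable_topology}"
  assumes L2: "L2_tendsto M f g" and h: "square_integrable M h"
  shows "(\<lambda>n. \<integral>\<omega>. f n \<omega> \<bullet> h \<omega> \<partial>M) \<longlonglongrightarrow> (\<integral>\<omega>. g \<omega> \<bullet> h \<omega> \<partial>M)"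
proof (rule LIMSEQ_I)
  fix \<eta> :: real assume "0 < \<eta>"
  have f: "square_integrable M (f n)" and g: "square_integrable M g" for n
    using L2 by (auto simp: L2_tendsto_def)
  define b where "b = (\<integral>\<omega>. (norm (h \<omega>))\<^sup>2 \<partial>M)"
  have "0 \<le> b" by (simp add: b_def)
  \<comment> \<open>Balances the two terms of the weighted inequality. The term with h stays below
    \<eta>, and the other one falls below \<eta> as soon as the squared distance drops below \<eta>
    times \<epsilon>; their mean is then less than \<eta>.\<close>
  define \<epsilon> where "\<epsilon> = \<eta> / (b + 1)"
  have "0 < \<epsilon>" using \<open>0 < \<eta>\<close> \<open>0 \<le> b\<close> by (simp add: \<epsilon>_def)
  have "\<epsilon> * b < \<eta>"
    using \<open>0 < \<eta>\<close> \<open>0 \<le> b\<close> by (simp add: \<epsilon>_def divide_less_eq)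
  have "\<forall>\<^sub>F n in sequentially. (\<integral>\<omega>. (norm (f n \<omega> - g \<omega>))\<^sup>2 \<partial>M) < \<eta> * \<epsilon>"
    using L2 \<open>0 < \<eta>\<close> \<open>0 < \<epsilon>\<close> unfolding L2_tendsto_def by (intro order_tendstoD(2)) auto
  then obtain N where N: "\<And>n. N \<le> n \<Longrightarrow> (\<integral>\<omega>. (norm (f n \<omega> - g \<omega>))\<^sup>2 \<partial>M) < \<eta> * \<epsilon>"
    unfolding eventually_sequentially by blast
  show "\<exists>N. \<forall>n\<ge>N. norm ((\<integral>\<omega>. f n \<omega> \<bullet> h \<omega> \<partial>M) - (\<integral>\<omega>. g \<omega> \<bullet> h \<omega> \<partial>M)) < \<eta>"
  proof (intro exI allI impI)
    fix n assume "N \<le> n"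
    let ?a = "\<integral>\<omega>. (norm (f n \<omega> - g \<omega>))\<^sup>2 \<partial>M"
    note d = square_integrable_diff[OF f g, of n]
    have "(\<integral>\<omega>. f n \<omega> \<bullet> h \<omega> \<partial>M) - (\<integral>\<omega>. g \<omega> \<bullet> h \<omega> \<partial>M) = (\<integral>\<omega>. (f n \<omega> - g \<omega>) \<bullet> h \<omega> \<partial>M)"
      using square_integrable_inner[OF f h] square_integrable_inner[OF g h]
      by (simp add: inner_diff_left)
    also have "norm \<dots> \<le> (\<integral>\<omega>. norm ((f n \<omega> - g \<omega>) \<bullet> h \<omega>) \<partial>M)"
      by (rule integral_norm_bound)
    also have "\<dots> \<le> (\<integral>\<omega>. ((norm (f n \<omega> - g \<omega>))\<^sup>2 / \<epsilon> + \<epsilon> * (norm (h \<omega>))\<^sup>2) / 2 \<partial>M)"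
    proof (rule integral_mono)
      show "integrable M (\<lambda>\<omega>. norm ((f n \<omega> - g \<omega>) \<bullet> h \<omega>))"
        using square_integrable_inner[OF d h] by (rule integrable_norm)
      show "integrable M (\<lambda>\<omega>. ((norm (f n \<omega> - g \<omega>))\<^sup>2 / \<epsilon> + \<epsilon> * (norm (h \<omega>))\<^sup>2) / 2)"
        using d h by (simp add: square_integrable_def)
      show "norm ((f n \<omega> - g \<omega>) \<bullet> h \<omega>) \<le> ((norm (f n \<omega> - g \<omega>))\<^sup>2 / \<epsilon> + \<epsilon> * (norm (h \<omega>))\<^sup>2) / 2" for \<omega>
        using abs_inner_le_weighted[OF \<open>0 < \<epsilon>\<close>] by simp
    qed
    also have "\<dots> = (?a / \<epsilon> + \<epsilon> * b) / 2"
      using d h by (simp add: square_integrable_def b_def)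
    also have "\<dots> < \<eta>"
    proof -
      have "?a / \<epsilon> < \<eta>" using N[OF \<open>N \<le> n\<close>] \<open>0 < \<epsilon>\<close> by (simp add: divide_less_eq)
      then show ?thesis using \<open>\<epsilon> * b < \<eta>\<close> by simp
    qed
    finally show "norm ((\<integral>\<omega>. f n \<omega> \<bullet> h \<omega> \<partial>M) - (\<integral>\<omega>. g \<omega> \<bullet> h \<omega> \<partial>M)) < \<eta>" .
  qed
qed

text \<open>Geometric decay of the expectations makes the expected sum finite, so the sum is finite
  almost surely. Both the mean square limits and the bounds on dyadic increments rest on
  this.\<close>

lemma
  fixes a :: "nat \<Rightarrow> 'a \<Rightarrow> real"
  assumes a: "\<And>n \<omega>. 0 \<le> a n \<omega>" "\<And>n. integrable M (a n)"
    and Ea: "\<And>n. (\<integral>\<omega>. a n \<omega> \<partial>M) \<le> K * r ^ n" and r: "0 \<le> r" "r < 1"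
  shows nn_integral_suminf_geometric: "(\<integral>\<^sup>+\<omega>. (\<Sum>n. ennreal (a n \<omega>)) \<partial>M) < \<infinity>"
    and AE_summable_geometric: "AE \<omega> in M. summable (\<lambda>n. a n \<omega>)"
proof -
  have [measurable]: "a n \<in> borel_measurable M" for n using a(2) by simp
  have "0 \<le> (\<integral>\<omega>. a 0 \<omega> \<partial>M)" by (simp add: a(1))
  then have "0 \<le> K" using Ea[of 0] by simp
  have "(\<integral>\<^sup>+\<omega>. (\<Sum>n. ennreal (a n \<omega>)) \<partial>M) = (\<Sum>n. \<integral>\<^sup>+\<omega>. ennreal (a n \<omega>) \<partial>M)"
    by (rule nn_integral_suminf) measurable
  also have "\<dots> = (\<Sum>n. ennreal (\<integral>\<omega>. a n \<omega> \<partial>M))"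
    using a by (simp add: nn_integral_eq_integral)
  also have "\<dots> \<le> (\<Sum>n. ennreal (K * r ^ n))"
    using Ea by (intro suminf_le) (auto intro: ennreal_leI)
  also have "\<dots> = ennreal (\<Sum>n. K * r ^ n)"
    using \<open>0 \<le> K\<close> r by (intro suminf_ennreal2 summable_mult summable_geometric) auto
  also have "\<dots> < \<infinity>" by simp
  finally show fin: "(\<integral>\<^sup>+\<omega>. (\<Sum>n. ennreal (a n \<omega>)) \<partial>M) < \<infinity>" .
  then have "AE \<omega> in M. (\<Sum>n. ennreal (a n \<omega>)) \<noteq> \<infinity>"
    by (intro nn_integral_noteq_infinite) auto
  then show "AE \<omega> in M. summable (\<lambda>n. a n \<omega>)"
  proof eventually_elim
    fix \<omega> assume "(\<Sum>n. ennreal (a n \<omega>)) \<noteq> \<infinity>"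
    then show "summable (\<lambda>n. a n \<omega>)" using a(1) by (intro summable_suminf_not_top) auto
  qed
qed

text \<open>The squared increments are divided by powers of r, the square root of q. Their sum
  \<open>R\<close> is still integrable, and Cauchy-Schwarz with weights r^n bounds every
  \<open>(J M \<omega> - J N \<omega>)\<^sup>2\<close> by r^N / (1 - r) times \<open>R\<close>.
  Almost sure and mean square convergence come out together. The limit Y is any measurable version,
  which leaves it free to be measurable with respect to a smaller algebra.\<close>

lemma L2_tendsto_geometric:
  fixes J :: "nat \<Rightarrow> 'a \<Rightarrow> real"
  assumes sq: "\<And>N. square_integrable M (J N)"
    and bound: "\<And>N. (\<integral>\<omega>. (J (Suc N) \<omega> - J N \<omega>)\<^sup>2 \<partial>M) \<le> K * q ^ N"
    and q: "0 < q" "q < 1"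
  shows "AE \<omega> in M. convergent (\<lambda>N. J N \<omega>)"
    and "\<And>Y. Y \<in> borel_measurable M \<Longrightarrow> AE \<omega> in M. (\<lambda>N. J N \<omega>) \<longlonglongrightarrow> Y \<omega> \<Longrightarrow> L2_tendsto M J Y"
proof -
  have [measurable]: "J N \<in> borel_measurable M" for N using sq by (simp add: square_integrable_def)
  define r where "r = sqrt q"
  have r: "0 < r" "r < 1" using q by (simp_all add: r_def real_sqrt_lt_1_iff)
  have "r\<^sup>2 = q" using q by (simp add: r_def)
  define a where "a n \<omega> = (J (Suc n) \<omega> - J n \<omega>)\<^sup>2 / r ^ n" for n \<omega>
  have a_nonneg: "0 \<le> a n \<omega>" for n \<omega> using r by (simp add: a_def)
  have [measurable]: "a n \<in> borel_measurable M" for n unfolding a_def by measurable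
  have "integrable M (\<lambda>\<omega>. (J (Suc n) \<omega> - J n \<omega>)\<^sup>2)" for n
    using square_integrable_diff[OF sq sq, of "Suc n" n] by (simp add: square_integrable_def)
  then have a_int: "integrable M (a n)" for n unfolding a_def by simp
  have Ea: "(\<integral>\<omega>. a n \<omega> \<partial>M) \<le> K * r ^ n" for n
  proof -
    have "(\<integral>\<omega>. a n \<omega> \<partial>M) = (\<integral>\<omega>. (J (Suc n) \<omega> - J n \<omega>)\<^sup>2 \<partial>M) / r ^ n" by (simp add: a_def)
    also have "\<dots> \<le> K * q ^ n / r ^ n" using bound r by (intro divide_right_mono) auto
    also have "\<dots> = K * r ^ n"
      using r by (simp add: \<open>r\<^sup>2 = q\<close>[symmetric] power2_eq_square power_mult_distrib)
    finally show ?thesis .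
  qed
  define R where "R \<omega> = (\<Sum>n. ennreal (a n \<omega>))" for \<omega>
  have [measurable]: "R \<in> borel_measurable M" unfolding R_def by measurable
  have R_fin: "integral\<^sup>N M R < \<infinity>" and sum_AE: "AE \<omega> in M. summable (\<lambda>n. a n \<omega>)"
    unfolding R_def
    using nn_integral_suminf_geometric[OF a_nonneg a_int Ea] AE_summable_geometric[OF a_nonneg a_int Ea] r
    by auto
  show conv: "AE \<omega> in M. convergent (\<lambda>N. J N \<omega>)"
    using sum_AE
  proof eventually_elim
    fix \<omega> assume sa: "summable (\<lambda>n. a n \<omega>)"
    have "summable (\<lambda>n. J (Suc n) \<omega> - J n \<omega>)"
    proof (rule summable_comparison_test'[of "\<lambda>n. (r ^ n + a n \<omega>) / 2" 0])
      show "summable (\<lambda>n. (r ^ n + a n \<omega>) / 2)"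
        using sa r by (intro summable_divide summable_add summable_geometric) auto
      show "norm (J (Suc n) \<omega> - J n \<omega>) \<le> (r ^ n + a n \<omega>) / 2" for n
        using abs_inner_le_weighted[of "r ^ n" "J (Suc n) \<omega> - J n \<omega>" "1::real"] r
        by (simp add: a_def add.commute)
    qed
    then have "(\<lambda>N. \<Sum>n<N. J (Suc n) \<omega> - J n \<omega>) \<longlonglongrightarrow> (\<Sum>n. J (Suc n) \<omega> - J n \<omega>)"
      by (rule summable_LIMSEQ)
    then have "(\<lambda>N. J N \<omega> - J 0 \<omega>) \<longlonglongrightarrow> (\<Sum>n. J (Suc n) \<omega> - J n \<omega>)"
      by (simp only: sum_lessThan_telescope[of "\<lambda>n. J n \<omega>"])
    from tendsto_add[OF this tendsto_const[of "J 0 \<omega>"]] show "convergent (\<lambda>N. J N \<omega>)"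
      by (auto simp: convergent_def)
  qed
  fix Y assume [measurable]: "Y \<in> borel_measurable M" and Y: "AE \<omega> in M. (\<lambda>N. J N \<omega>) \<longlonglongrightarrow> Y \<omega>"
  have key: "AE \<omega> in M. ennreal ((Y \<omega> - J N \<omega>)\<^sup>2) \<le> ennreal (r ^ N / (1 - r)) * R \<omega>" for N
    using sum_AE Y
  proof eventually_elim
    fix \<omega> assume sa: "summable (\<lambda>n. a n \<omega>)" and lim: "(\<lambda>N. J N \<omega>) \<longlonglongrightarrow> Y \<omega>"
    have R_eq: "R \<omega> = ennreal (\<Sum>n. a n \<omega>)"
      unfolding R_def using sa a_nonneg by (intro suminf_ennreal2) auto
    have "(J M \<omega> - J N \<omega>)\<^sup>2 \<le> r ^ N / (1 - r) * (\<Sum>n. a n \<omega>)" if "N \<le> M" for M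
    proof -
      have "(J M \<omega> - J N \<omega>)\<^sup>2 = (\<Sum>n=N..<M. sqrt (r ^ n) * ((J (Suc n) \<omega> - J n \<omega>) / sqrt (r ^ n)))\<^sup>2"
        using sum_Suc_diff'[OF that, of "\<lambda>n. J n \<omega>"] r by simp
      also have "\<dots> \<le> (\<Sum>n=N..<M. (sqrt (r ^ n))\<^sup>2) * (\<Sum>n=N..<M. ((J (Suc n) \<omega> - J n \<omega>) / sqrt (r ^ n))\<^sup>2)"
        by (rule Cauchy_Schwarz_ineq_sum)
      also have "\<dots> = (\<Sum>n=N..<M. r ^ n) * (\<Sum>n=N..<M. a n \<omega>)"
        using r by (simp add: a_def power_divide)
      also have "\<dots> \<le> r ^ N / (1 - r) * (\<Sum>n. a n \<omega>)"
      proof (rule mult_mono)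
        have "(\<Sum>n=N..<M. r ^ n) = r ^ N * (\<Sum>n<M - N. r ^ n)"
          using sum.shift_bounds_nat_ivl[of "\<lambda>n. r ^ n" 0 N "M - N"] that
          by (simp add: power_add sum_distrib_left lessThan_atLeast0 mult.commute)
        also have "\<dots> \<le> r ^ N * (1 / (1 - r))"
        proof (rule mult_left_mono)
          have "(\<Sum>n<M - N. r ^ n) \<le> (\<Sum>n. r ^ n)"
            using r by (intro sum_le_suminf summable_geometric) auto
          then show "(\<Sum>n<M - N. r ^ n) \<le> 1 / (1 - r)" using r by (simp add: suminf_geometric)
        qed (use r in simp)
        finally show "(\<Sum>n=N..<M. r ^ n) \<le> r ^ N / (1 - r)" by simp
        show "(\<Sum>n=N..<M. a n \<omega>) \<le> (\<Sum>n. a n \<omega>)"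
          using sa a_nonneg by (intro sum_le_suminf) auto
      qed (use r a_nonneg in \<open>auto intro!: sum_nonneg\<close>)
      finally show ?thesis .
    qed
    then have "(Y \<omega> - J N \<omega>)\<^sup>2 \<le> r ^ N / (1 - r) * (\<Sum>n. a n \<omega>)"
      by (intro LIMSEQ_le_const2[OF tendsto_power[OF tendsto_diff[OF lim tendsto_const]]]) auto
    then show "ennreal ((Y \<omega> - J N \<omega>)\<^sup>2) \<le> ennreal (r ^ N / (1 - r)) * R \<omega>"
      unfolding R_eq using r suminf_nonneg[OF sa] a_nonneg
      by (subst ennreal_mult[symmetric]) (auto intro: ennreal_leI)
  qed
  obtain Q where Q: "integral\<^sup>N M R = ennreal Q" "0 \<le> Q"
    using R_fin by (cases "integral\<^sup>N M R") auto
  have nn: "(\<integral>\<^sup>+\<omega>. ennreal ((Y \<omega> - J N \<omega>)\<^sup>2) \<partial>M) \<le> ennreal (r ^ N / (1 - r) * Q)" for N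
  proof -
    have "(\<integral>\<^sup>+\<omega>. ennreal ((Y \<omega> - J N \<omega>)\<^sup>2) \<partial>M) \<le> (\<integral>\<^sup>+\<omega>. ennreal (r ^ N / (1 - r)) * R \<omega> \<partial>M)"
      by (rule nn_integral_mono_AE) (rule key)
    also have "\<dots> = ennreal (r ^ N / (1 - r)) * ennreal Q"
      by (simp add: nn_integral_cmult Q)
    also have "\<dots> = ennreal (r ^ N / (1 - r) * Q)"
      using r Q by (intro ennreal_mult[symmetric]) auto
    finally show ?thesis .
  qed
  have int: "integrable M (\<lambda>\<omega>. (Y \<omega> - J N \<omega>)\<^sup>2)" for N
    using nn[of N] by (intro integrableI_bounded) (auto simp: le_less_trans)
  have "square_integrable M (\<lambda>\<omega>. Y \<omega> - J 0 \<omega>)"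
    using int[of 0] by (simp add: square_integrable_def)
  moreover have "square_integrable M (\<lambda>\<omega>. - J 0 \<omega>)"
    using sq[of 0] by (simp add: square_integrable_def)
  ultimately have "square_integrable M (\<lambda>\<omega>. (Y \<omega> - J 0 \<omega>) - (- J 0 \<omega>))"
    by (rule square_integrable_diff)
  then have sqY: "square_integrable M Y" by simp
  have "(\<lambda>N. \<integral>\<omega>. (J N \<omega> - Y \<omega>)\<^sup>2 \<partial>M) \<longlonglongrightarrow> 0"
  proof (rule tendsto_sandwich[of "\<lambda>_. 0"])
    have "(\<integral>\<omega>. (J N \<omega> - Y \<omega>)\<^sup>2 \<partial>M) \<le> r ^ N / (1 - r) * Q" for N
    proof -
      have "ennreal (\<integral>\<omega>. (Y \<omega> - J N \<omega>)\<^sup>2 \<partial>M) \<le> ennreal (r ^ N / (1 - r) * Q)"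
        using nn[of N] nn_integral_eq_integral[OF int[of N]] by simp
      then have "(\<integral>\<omega>. (Y \<omega> - J N \<omega>)\<^sup>2 \<partial>M) \<le> r ^ N / (1 - r) * Q"
        using r Q by (subst (asm) ennreal_le_iff) auto
      then show ?thesis by (simp add: power2_commute)
    qed
    then show "\<forall>\<^sub>F N in sequentially. (\<integral>\<omega>. (J N \<omega> - Y \<omega>)\<^sup>2 \<partial>M) \<le> r ^ N / (1 - r) * Q" by simp
    have "(\<lambda>N. r ^ N / (1 - r) * Q) \<longlonglongrightarrow> 0 / (1 - r) * Q"
      using r by (intro tendsto_intros LIMSEQ_realpow_zero) auto
    then show "(\<lambda>N. r ^ N / (1 - r) * Q) \<longlonglongrightarrow> 0" by simp
  qed auto
  then show "L2_tendsto M J Y"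
    using sq sqY by (simp add: L2_tendsto_def)
qed

lemma sum_lessThan_double:
  fixes f :: "nat \<Rightarrow> 'b::comm_monoid_add"
  shows "(\<Sum>j<2 * n. f j) = (\<Sum>j<n. f (2 * j) + f (2 * j + 1))"
  by (induction n) (simp_all add: add.assoc)

lemma integrable_bounded_mult:
  fixes X Y :: "'a \<Rightarrow> real"
  assumes X: "integrable M X" and Y: "Y \<in> borel_measurable M" "\<And>\<omega>. \<bar>Y \<omega>\<bar> \<le> C"
  shows "integrable M (\<lambda>\<omega>. Y \<omega> * X \<omega>)"
proof (rule Bochner_Integration.integrable_bound)
  show "integrable M (\<lambda>\<omega>. C * X \<omega>)" using X by simp
  show "(\<lambda>\<omega>. Y \<omega> * X \<omega>) \<in> borel_measurable M" using X Y(1) by simp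
  show "AE \<omega> in M. norm (Y \<omega> * X \<omega>) \<le> norm (C * X \<omega>)"
  proof (rule AE_I2)
    fix \<omega>
    have "\<bar>Y \<omega>\<bar> * \<bar>X \<omega>\<bar> \<le> \<bar>C\<bar> * \<bar>X \<omega>\<bar>"
      using Y(2)[of \<omega>] by (intro mult_right_mono) auto
    then show "norm (Y \<omega> * X \<omega>) \<le> norm (C * X \<omega>)" by (simp add: abs_mult)
  qed
qed

section \<open>Cylindrical variables of the complex process\<close>

locale fbm_setting = prob_space M + fbm_space H e
  for M :: "'a measure" and H :: real and e :: "real \<Rightarrow> 'h::{real_inner, banach, second_countable_topology}" +
  fixes z0 :: complex and B :: "real \<Rightarrow> 'a \<Rightarrow> complex" and W1 W2 :: "'h \<Rightarrow> 'a \<Rightarrow> real"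
  assumes H_less_1: "H < 1" and fbm: "complex_fbm M H z0 B"
    and wiener1: "wiener_isometry M e (Re z0) (\<lambda>t \<omega>. Re (B t \<omega>)) W1"
    and wiener2: "wiener_isometry M e (Im z0) (\<lambda>t \<omega>. Im (B t \<omega>)) W2"
begin

sublocale iso: isonormal M "\<lambda>k \<omega>. W1 (fst k) \<omega> + W2 (snd k) \<omega>"
  by (rule isonormal_of_fbm[OF prob_space_axioms fbm hilbert wiener1 wiener2])

lemma W_measurable [measurable]: "W1 h \<in> borel_measurable M" "W2 h \<in> borel_measurable M"
  using wiener_measurable[OF wiener1] wiener_measurable[OF wiener2] .

lemma W_zero: "AE \<omega> in M. W1 0 \<omega> = 0" "AE \<omega> in M. W2 0 \<omega> = 0"
  using wiener_linear[OF wiener1, of 1 0 0] wiener_linear[OF wiener2, of 1 0 0] by simp_all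

lemma W_diff: "AE \<omega> in M. W1 (h - k) \<omega> = W1 h \<omega> - W1 k \<omega>" "AE \<omega> in M. W2 (h - k) \<omega> = W2 h \<omega> - W2 k \<omega>"
  using wiener_linear[OF wiener1, of "-1" k h] wiener_linear[OF wiener2, of "-1" k h] by simp_all

lemma W_at:
  assumes "0 \<le> s"
  shows "AE \<omega> in M. W1 (e s) \<omega> = Re (B s \<omega>) - Re z0" "AE \<omega> in M. W2 (e s) \<omega> = Im (B s \<omega>) - Im z0"
  using wiener1 wiener2 assms by (auto simp: wiener_isometry_def)

lemma W_moment:
  "integrable M (\<lambda>\<omega>. W1 h \<omega> ^ n)" "integrable M (\<lambda>\<omega>. W2 h \<omega> ^ n)"
  "expectation (\<lambda>\<omega>. W1 h \<omega> ^ (2 * p)) = fact (2 * p) / (2 ^ p * fact p) * norm h ^ (2 * p)"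
  "expectation (\<lambda>\<omega>. W2 h \<omega> ^ (2 * p)) = fact (2 * p) / (2 ^ p * fact p) * norm h ^ (2 * p)"
proof -
  have ae: "AE \<omega> in M. (W1 (fst (h, 0::'h)) \<omega> + W2 (snd (h, 0::'h)) \<omega>) ^ k = W1 h \<omega> ^ k"
    "AE \<omega> in M. (W1 (fst (0::'h, h)) \<omega> + W2 (snd (0::'h, h)) \<omega>) ^ k = W2 h \<omega> ^ k" for k
    using W_zero by auto
  show "integrable M (\<lambda>\<omega>. W1 h \<omega> ^ n)"
    by (rule integrable_cong_AE_imp[OF iso.integrable_W_power _ ae(1)]) simp
  show "integrable M (\<lambda>\<omega>. W2 h \<omega> ^ n)"
    by (rule integrable_cong_AE_imp[OF iso.integrable_W_power _ ae(2)]) simp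
  have "expectation (\<lambda>\<omega>. (W1 (fst (h, 0::'h)) \<omega> + W2 (snd (h, 0::'h)) \<omega>) ^ (2 * p)) = expectation (\<lambda>\<omega>. W1 h \<omega> ^ (2 * p))"
    by (rule integral_cong_AE[OF _ _ ae(1)]) simp_all
  then show "expectation (\<lambda>\<omega>. W1 h \<omega> ^ (2 * p)) = fact (2 * p) / (2 ^ p * fact p) * norm h ^ (2 * p)"
    unfolding iso.expectation_W_power_even by (simp add: norm_prod_def)
  have "expectation (\<lambda>\<omega>. (W1 (fst (0::'h, h)) \<omega> + W2 (snd (0::'h, h)) \<omega>) ^ (2 * p)) = expectation (\<lambda>\<omega>. W2 h \<omega> ^ (2 * p))"
    by (rule integral_cong_AE[OF _ _ ae(2)]) simp_all
  then show "expectation (\<lambda>\<omega>. W2 h \<omega> ^ (2 * p)) = fact (2 * p) / (2 ^ p * fact p) * norm h ^ (2 * p)"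
    unfolding iso.expectation_W_power_even by (simp add: norm_prod_def)
qed

lemma W_integrable: "integrable M (W1 h)" "integrable M (W2 h)"
  using W_moment(1,2)[of h 1] by simp_all

lemma cyl_point_measurable [measurable]: "cyl_point W1 W2 \<phi> \<in> borel_measurable M"
proof (rule measurable_coordinatewise_then_product)
  show "(\<lambda>\<omega>. cyl_point W1 W2 \<phi> \<omega> i) \<in> borel_measurable M" for i
    by (cases "even i") (simp_all add: cyl_point_def)
qed

lemma Cb_cyl_measurable:
  assumes "g \<in> Cb_infinity m"
  shows "(\<lambda>\<omega>. g (cyl_point W1 W2 \<phi> \<omega>)) \<in> borel_measurable M"
  by (rule measurable_compose[OF cyl_point_measurable Cb_infinity_borel[OF assms]])

lemma smooth_cylindrical_bounded:
  assumes "smooth_cylindrical W1 W2 F U"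
  shows "F \<in> borel_measurable M" "U \<in> borel_measurable M"
    "\<exists>C. \<forall>\<omega>. \<bar>F \<omega>\<bar> \<le> C" "\<exists>C. \<forall>\<omega>. norm (U \<omega>) \<le> C"
proof -
  obtain n g \<phi> where g: "g \<in> Cb_infinity (2 * n)" and F: "F = (\<lambda>\<omega>. g (cyl_point W1 W2 \<phi> \<omega>))"
    and U: "U = (\<lambda>\<omega>. \<Sum>j<n.
               (partial_deriv (2 * j) g (cyl_point W1 W2 \<phi> \<omega>) *\<^sub>R fst (\<phi> j),
                partial_deriv (2 * j + 1) g (cyl_point W1 W2 \<phi> \<omega>) *\<^sub>R snd (\<phi> j)))"
    using assms unfolding smooth_cylindrical_def by blast
  show "F \<in> borel_measurable M" unfolding F by (rule Cb_cyl_measurable[OF g])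
  obtain C where "\<And>x. \<bar>g x\<bar> \<le> C" using Cb_infinity_bounded[OF g] by blast
  then show "\<exists>C. \<forall>\<omega>. \<bar>F \<omega>\<bar> \<le> C" unfolding F by blast
  have part: "partial_deriv (2 * j) g \<in> Cb_infinity (2 * n)" "partial_deriv (2 * j + 1) g \<in> Cb_infinity (2 * n)"
    if "j < n" for j
    using that by (auto intro!: Cb_infinity_partial_deriv[OF g])
  have part_m: "(\<lambda>\<omega>. partial_deriv (2 * j) g (cyl_point W1 W2 \<phi> \<omega>)) \<in> borel_measurable M"
    "(\<lambda>\<omega>. partial_deriv (2 * j + 1) g (cyl_point W1 W2 \<phi> \<omega>)) \<in> borel_measurable M" if "j < n" for j
    using Cb_cyl_measurable[OF part(1)[OF that]] Cb_cyl_measurable[OF part(2)[OF that]] .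
  show "U \<in> borel_measurable M"
    unfolding U
    by (intro borel_measurable_sum borel_measurable_Pair borel_measurable_scaleR borel_measurable_const
        part_m) simp_all
  have "\<exists>C. \<forall>\<omega>. norm (partial_deriv (2 * j) g (cyl_point W1 W2 \<phi> \<omega>) *\<^sub>R fst (\<phi> j),
                partial_deriv (2 * j + 1) g (cyl_point W1 W2 \<phi> \<omega>) *\<^sub>R snd (\<phi> j)) \<le> C" if jn: "j < n" for j
  proof -
    obtain C1 where C1: "\<And>x. \<bar>partial_deriv (2 * j) g x\<bar> \<le> C1" using Cb_infinity_bounded[OF part(1)[OF jn]] by blast
    obtain C2 where C2: "\<And>x. \<bar>partial_deriv (2 * j + 1) g x\<bar> \<le> C2" using Cb_infinity_bounded[OF part(2)[OF jn]] by blast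
    have "norm (partial_deriv (2 * j) g x *\<^sub>R fst (\<phi> j), partial_deriv (2 * j + 1) g x *\<^sub>R snd (\<phi> j))
      \<le> C1 * norm (fst (\<phi> j)) + C2 * norm (snd (\<phi> j))" for x
      using C1[of x] C2[of x]
      by (intro order_trans[OF norm_Pair_le] add_mono) (simp_all add: mult_right_mono)
    then show ?thesis by blast
  qed
  then obtain C where C: "\<And>j \<omega>. j < n \<Longrightarrow> norm (partial_deriv (2 * j) g (cyl_point W1 W2 \<phi> \<omega>) *\<^sub>R fst (\<phi> j),
                partial_deriv (2 * j + 1) g (cyl_point W1 W2 \<phi> \<omega>) *\<^sub>R snd (\<phi> j)) \<le> C j"
    by metis
  have "norm (U \<omega>) \<le> (\<Sum>j<n. C j)" for \<omega>
    unfolding U by (rule sum_norm_le) (use C in auto)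
  then show "\<exists>C. \<forall>\<omega>. norm (U \<omega>) \<le> C" by blast
qed

text \<open>The centred position of the path at time s, as a cylindrical evaluation. All even
  entries coincide, as do all odd ones; a function in \<open>Cb_infinity 2\<close> reads only
  entries 0 and 1.\<close>

definition pt :: "real \<Rightarrow> 'a \<Rightarrow> nat \<Rightarrow> real" where
  "pt s = cyl_point W1 W2 (\<lambda>_. (e s, e s))"

lemma pt_eq: "pt s \<omega> i = (if even i then W1 (e s) \<omega> else W2 (e s) \<omega>)"
  by (simp add: pt_def cyl_point_def)

lemma pt_measurable [measurable]: "g \<in> Cb_infinity m \<Longrightarrow> (\<lambda>\<omega>. g (pt s \<omega>)) \<in> borel_measurable M"
  unfolding pt_def by (rule Cb_cyl_measurable)

text \<open>Gaussian integration by parts for a product: F uses 2n Gaussian coordinates, and two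
  more are appended for the position at time s. The product rule separates the derivative of F from
  that of f.\<close>

lemma cylindrical_ibp:
  assumes smooth: "smooth_cylindrical W1 W2 F U" and f: "f \<in> Cb_infinity 2"
  shows "expectation (\<lambda>\<omega>. (W1 a \<omega> + W2 b \<omega>) * (F \<omega> * f (pt s \<omega>))) =
    expectation (\<lambda>\<omega>. f (pt s \<omega>) * (U \<omega> \<bullet> (a, b)) +
      F \<omega> * (partial_deriv 0 f (pt s \<omega>) * (e s \<bullet> a) + partial_deriv 1 f (pt s \<omega>) * (e s \<bullet> b)))"
proof -
  obtain n g \<phi> where g: "g \<in> Cb_infinity (2 * n)" and F: "F = (\<lambda>\<omega>. g (cyl_point W1 W2 \<phi> \<omega>))"
    and U: "U = (\<lambda>\<omega>. \<Sum>j<n.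
               (partial_deriv (2 * j) g (cyl_point W1 W2 \<phi> \<omega>) *\<^sub>R fst (\<phi> j),
                partial_deriv (2 * j + 1) g (cyl_point W1 W2 \<phi> \<omega>) *\<^sub>R snd (\<phi> j)))"
    using smooth unfolding smooth_cylindrical_def by blast
  define m where "m = 2 * n + 2"
  \<comment> \<open>Each vector has one component 0, so the isonormal family reduces to
    \<open>W1\<close> or \<open>W2\<close> alone, up to the variables \<open>W1 0\<close> and
    \<open>W2 0\<close>. The last two indices carry the position at time s.\<close>
  define \<psi> where "\<psi> j = (if j < 2 * n then (if even j then (fst (\<phi> (j div 2)), 0) else (0, snd (\<phi> (j div 2))))
      else if j = 2 * n then (e s, 0) else (0, e s))" for j
  define V where "V \<omega> j = W1 (fst (\<psi> j)) \<omega> + W2 (snd (\<psi> j)) \<omega>" for \<omega> j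
  define sh where "sh x = (\<lambda>i. x (2 * n + i))" for x :: "nat \<Rightarrow> real"
  define G where "G x = g x * f (sh x)" for x
  define G' where "G' j x = (if j < 2 * n then partial_deriv j g x * f (sh x)
      else g x * partial_deriv (j - 2 * n) f (sh x))" for j x
  have part_g: "partial_deriv j g \<in> Cb_infinity (2 * n)" if "j < 2 * n" for j
    by (rule Cb_infinity_partial_deriv[OF g that])
  have part_f: "partial_deriv (j - 2 * n) f \<in> Cb_infinity 2" if "j < m" "\<not> j < 2 * n" for j
    by (rule Cb_infinity_partial_deriv[OF f]) (use that in \<open>simp add: m_def\<close>)
  have sh_cont: "continuous_on UNIV (\<lambda>x. h (sh x))" if "h \<in> Cb_infinity 2" for h
  proof -
    have "continuous_on UNIV sh"
      unfolding sh_def by (intro continuous_on_coordinatewise_then_product continuous_on_product_coordinates)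
    then show ?thesis
      using continuous_on_compose2[OF Cb_infinity_continuous[OF that]] by blast
  qed
  have G'_cont: "continuous_on UNIV (G' j)" if "j < m" for j
  proof (cases "j < 2 * n")
    case True
    then have "G' j = (\<lambda>x. partial_deriv j g x * f (sh x))" by (auto simp: G'_def)
    then show ?thesis
      by (simp only:) (intro continuous_on_mult Cb_infinity_continuous[OF part_g[OF True]] sh_cont[OF f])
  next
    case False
    then have "G' j = (\<lambda>x. g x * partial_deriv (j - 2 * n) f (sh x))" by (auto simp: G'_def)
    then show ?thesis
      by (simp only:) (intro continuous_on_mult Cb_infinity_continuous[OF g] sh_cont[OF part_f[OF that False]])
  qed
  have G_cont: "continuous_on UNIV G"
    unfolding G_def by (intro continuous_on_mult Cb_infinity_continuous[OF g] sh_cont[OF f])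
  have prod_bnd: "\<exists>C. \<forall>x. \<bar>p x * q (sh x)\<bar> \<le> C" if pq: "p \<in> Cb_infinity (2 * n)" "q \<in> Cb_infinity 2" for p q
  proof -
    obtain C1 where C1: "0 < C1" "\<And>x. \<bar>p x\<bar> \<le> C1" using Cb_infinity_bounded[OF pq(1)] by blast
    obtain C2 where C2: "0 < C2" "\<And>x. \<bar>q x\<bar> \<le> C2" using Cb_infinity_bounded[OF pq(2)] by blast
    have "\<bar>p x * q (sh x)\<bar> \<le> C1 * C2" for x
      unfolding abs_mult using C1(1) by (intro mult_mono C1(2) C2(2)) auto
    then show ?thesis by blast
  qed
  obtain CG where CG: "\<And>x. \<bar>G x\<bar> \<le> CG" using prod_bnd[OF g f] unfolding G_def by blast
  have "\<exists>C. \<forall>x. \<bar>G' j x\<bar> \<le> C" if "j < m" for j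
    using prod_bnd[OF part_g f, of j] prod_bnd[OF g part_f, of j] that unfolding G'_def by (cases "j < 2 * n") simp_all
  then obtain CG' where CG': "\<And>j x. j < m \<Longrightarrow> \<bar>G' j x\<bar> \<le> CG' j" by metis
  have CG'_nonneg: "0 \<le> CG' j" if "j < m" for j
    using CG'[OF that, of undefined] by linarith
  define C where "C = CG + (\<Sum>j<m. CG' j)"
  have "0 \<le> CG" using CG[of undefined] by linarith
  have bnd: "\<bar>G x\<bar> \<le> C" "j < m \<Longrightarrow> \<bar>G' j x\<bar> \<le> C" for j x
  proof -
    have "0 \<le> (\<Sum>j<m. CG' j)" using CG'_nonneg by (intro sum_nonneg) auto
    then show "\<bar>G x\<bar> \<le> C" using CG[of x] by (simp add: C_def)
    assume "j < m"
    then have "CG' j \<le> (\<Sum>j<m. CG' j)" using CG'_nonneg by (intro member_le_sum) auto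
    then show "\<bar>G' j x\<bar> \<le> C" using CG'[OF \<open>j < m\<close>, of x] \<open>0 \<le> CG\<close> by (simp add: C_def)
  qed
  have G_dep: "G x = G y" if "\<And>i. i < m \<Longrightarrow> x i = y i" for x y
  proof -
    have "g x = g y" by (rule Cb_infinity_dep[OF g]) (simp add: that m_def)
    moreover have "f (sh x) = f (sh y)" by (rule Cb_infinity_dep[OF f]) (simp add: that m_def sh_def)
    ultimately show ?thesis by (simp add: G_def)
  qed
  have G_der: "((\<lambda>r. G (x(j := r))) has_real_derivative G' j x) (at (x j))" if "j < m" for j x
  proof (cases "j < 2 * n")
    case True
    have "sh (x(j := r)) = sh x" for r using True by (auto simp: sh_def)
    then show ?thesis
      using DERIV_mult[OF Cb_infinity_deriv[OF g True, of x] DERIV_const[of "f (sh x)"]] True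
      by (simp add: G_def G'_def)
  next
    case False
    have j: "j - 2 * n < 2" using that False by (simp add: m_def)
    have "sh (x(j := r)) = (sh x)(j - 2 * n := r)" for r
      by (rule ext) (use False in \<open>auto simp: sh_def\<close>)
    moreover have "g (x(j := r)) = g x" for r by (rule Cb_infinity_dep[OF g]) (use False in auto)
    moreover have "sh x (j - 2 * n) = x j" using False by (simp add: sh_def)
    ultimately show ?thesis
      using DERIV_mult[OF DERIV_const[of "g x"] Cb_infinity_deriv[OF f j, of "sh x"]] False
      by (simp add: G_def G'_def mult.commute)
  qed
  have V_m: "V \<in> borel_measurable M"
    unfolding V_def by (rule measurable_coordinatewise_then_product) simp
  have G_m: "(\<lambda>\<omega>. G (V \<omega>)) \<in> borel_measurable M"
    by (rule measurable_compose[OF V_m borel_measurable_continuous_onI[OF G_cont]])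
  have F_m: "F \<in> borel_measurable M" "(\<lambda>\<omega>. f (pt s \<omega>)) \<in> borel_measurable M"
    using smooth_cylindrical_bounded(1)[OF smooth] pt_measurable[OF f] by auto
  have G'V_int: "integrable M (\<lambda>\<omega>. G' j (V \<omega>))" if "j < m" for j
  proof (rule integrable_const_bound[of _ C])
    show "(\<lambda>\<omega>. G' j (V \<omega>)) \<in> borel_measurable M"
      by (rule measurable_compose[OF V_m borel_measurable_continuous_onI[OF G'_cont[OF that]]])
  qed (use bnd(2)[OF that] in simp)
  \<comment> \<open>The two descriptions of the coordinates agree only where \<open>W1 0\<close> and
    \<open>W2 0\<close> vanish, which is almost everywhere; hence these hypotheses at the point
    \<omega>.\<close>
  have V_g: "p (V \<omega>) = p (cyl_point W1 W2 \<phi> \<omega>)"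
    if p: "p \<in> Cb_infinity (2 * n)" and "W1 0 \<omega> = 0" "W2 0 \<omega> = 0" for p \<omega>
    by (rule Cb_infinity_dep[OF p]) (simp add: V_def \<psi>_def cyl_point_def that)
  have V_f: "p (sh (V \<omega>)) = p (pt s \<omega>)"
    if p: "p \<in> Cb_infinity 2" and "W1 0 \<omega> = 0" "W2 0 \<omega> = 0" for p \<omega>
  proof (rule Cb_infinity_dep[OF p])
    show "sh (V \<omega>) i = pt s \<omega> i" if "i < 2" for i
      using less_2_cases[OF that] \<open>W1 0 \<omega> = 0\<close> \<open>W2 0 \<omega> = 0\<close>
      by (auto simp: sh_def V_def \<psi>_def pt_eq)
  qed
  have "expectation (\<lambda>\<omega>. (W1 (fst (a, b)) \<omega> + W2 (snd (a, b)) \<omega>) * G (V \<omega>)) =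
      (\<Sum>j<m. (\<psi> j \<bullet> (a, b)) * expectation (\<lambda>\<omega>. G' j (V \<omega>)))"
    unfolding V_def by (rule iso.gaussian_ibp[OF G_dep G_der G_cont G'_cont bnd])
  also have "\<dots> = expectation (\<lambda>\<omega>. \<Sum>j<m. (\<psi> j \<bullet> (a, b)) * G' j (V \<omega>))"
    using G'V_int by simp
  also have "expectation (\<lambda>\<omega>. (W1 (fst (a, b)) \<omega> + W2 (snd (a, b)) \<omega>) * G (V \<omega>)) =
      expectation (\<lambda>\<omega>. (W1 a \<omega> + W2 b \<omega>) * (F \<omega> * f (pt s \<omega>)))"
  proof (rule integral_cong_AE)
    show "AE \<omega> in M. (W1 (fst (a, b)) \<omega> + W2 (snd (a, b)) \<omega>) * G (V \<omega>) = (W1 a \<omega> + W2 b \<omega>) * (F \<omega> * f (pt s \<omega>))"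
      using W_zero
    proof eventually_elim
      case (elim \<omega>)
      then show ?case
        using V_g[OF g elim] V_f[OF f elim] by (simp add: G_def F)
    qed
  qed (use F_m V_m G_m in simp_all)
  also have "expectation (\<lambda>\<omega>. \<Sum>j<m. (\<psi> j \<bullet> (a, b)) * G' j (V \<omega>)) =
    expectation (\<lambda>\<omega>. f (pt s \<omega>) * (U \<omega> \<bullet> (a, b)) +
      F \<omega> * (partial_deriv 0 f (pt s \<omega>) * (e s \<bullet> a) + partial_deriv 1 f (pt s \<omega>) * (e s \<bullet> b)))"
  proof (rule integral_cong_AE)
    show "(\<lambda>\<omega>. \<Sum>j<m. (\<psi> j \<bullet> (a, b)) * G' j (V \<omega>)) \<in> borel_measurable M"
      using G'V_int by (intro borel_measurable_sum borel_measurable_times borel_measurable_const) auto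
    have [measurable]: "(\<lambda>\<omega>. partial_deriv 0 f (pt s \<omega>)) \<in> borel_measurable M"
      "(\<lambda>\<omega>. partial_deriv 1 f (pt s \<omega>)) \<in> borel_measurable M" "(\<lambda>\<omega>. f (pt s \<omega>)) \<in> borel_measurable M"
      "U \<in> borel_measurable M" "F \<in> borel_measurable M"
      using smooth_cylindrical_bounded(1,2)[OF smooth] f
      by (auto intro!: pt_measurable Cb_infinity_partial_deriv)
    show "(\<lambda>\<omega>. f (pt s \<omega>) * (U \<omega> \<bullet> (a, b)) +
        F \<omega> * (partial_deriv 0 f (pt s \<omega>) * (e s \<bullet> a) + partial_deriv 1 f (pt s \<omega>) * (e s \<bullet> b)))
        \<in> borel_measurable M"
      by measurable
    show "AE \<omega> in M. (\<Sum>j<m. (\<psi> j \<bullet> (a, b)) * G' j (V \<omega>)) = f (pt s \<omega>) * (U \<omega> \<bullet> (a, b)) +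
        F \<omega> * (partial_deriv 0 f (pt s \<omega>) * (e s \<bullet> a) + partial_deriv 1 f (pt s \<omega>) * (e s \<bullet> b))"
      using W_zero
    proof eventually_elim
      case (elim \<omega>)
      note Vg = V_g[OF _ elim] and Vf = V_f[OF _ elim]
      have "(\<Sum>j<2 * n. (\<psi> j \<bullet> (a, b)) * G' j (V \<omega>)) =
          (\<Sum>j<n. f (pt s \<omega>) * (partial_deriv (2 * j) g (cyl_point W1 W2 \<phi> \<omega>) * (fst (\<phi> j) \<bullet> a) +
            partial_deriv (2 * j + 1) g (cyl_point W1 W2 \<phi> \<omega>) * (snd (\<phi> j) \<bullet> b)))"
        unfolding sum_lessThan_double
      proof (intro sum.cong refl)
        fix j assume "j \<in> {..<n}"
        then have j: "2 * j < 2 * n" "2 * j + 1 < 2 * n" by auto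
        show "\<psi> (2 * j) \<bullet> (a, b) * G' (2 * j) (V \<omega>) + \<psi> (2 * j + 1) \<bullet> (a, b) * G' (2 * j + 1) (V \<omega>) =
            f (pt s \<omega>) * (partial_deriv (2 * j) g (cyl_point W1 W2 \<phi> \<omega>) * (fst (\<phi> j) \<bullet> a) +
            partial_deriv (2 * j + 1) g (cyl_point W1 W2 \<phi> \<omega>) * (snd (\<phi> j) \<bullet> b))"
          using j Vg[OF part_g[OF j(1)]] Vg[OF part_g[OF j(2)]] Vf[OF f]
          by (simp add: \<psi>_def G'_def algebra_simps)
      qed
      also have "\<dots> = f (pt s \<omega>) * (U \<omega> \<bullet> (a, b))"
        by (simp add: U inner_sum_left sum_distrib_left)
      finally have 1: "(\<Sum>j<2 * n. (\<psi> j \<bullet> (a, b)) * G' j (V \<omega>)) = f (pt s \<omega>) * (U \<omega> \<bullet> (a, b))" .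
      have "G' (2 * n) (V \<omega>) = F \<omega> * partial_deriv 0 f (pt s \<omega>)"
        using Vg[OF g] Vf[OF Cb_infinity_partial_deriv[OF f, of 0]] by (simp add: G'_def F)
      moreover have "G' (2 * n + 1) (V \<omega>) = F \<omega> * partial_deriv 1 f (pt s \<omega>)"
        using Vg[OF g] Vf[OF Cb_infinity_partial_deriv[OF f, of 1]] by (simp add: G'_def F)
      moreover have "\<psi> (2 * n) = (e s, 0)" "\<psi> (2 * n + 1) = (0, e s)" by (simp_all add: \<psi>_def)
      moreover have "(\<Sum>j<m. (\<psi> j \<bullet> (a, b)) * G' j (V \<omega>)) = (\<Sum>j<2 * n. (\<psi> j \<bullet> (a, b)) * G' j (V \<omega>)) +
          (\<psi> (2 * n) \<bullet> (a, b)) * G' (2 * n) (V \<omega>) + (\<psi> (2 * n + 1) \<bullet> (a, b)) * G' (2 * n + 1) (V \<omega>)"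
        by (simp add: m_def)
      ultimately show ?case
        unfolding 1 by (simp add: algebra_simps)
    qed
  qed
  finally show ?thesis .
qed


text \<open>The Malliavin derivative of f evaluated at the position at time s.\<close>

definition deriv_elem :: "((nat \<Rightarrow> real) \<Rightarrow> real) \<Rightarrow> real \<Rightarrow> 'a \<Rightarrow> 'h \<times> 'h" where
  "deriv_elem f s \<omega> = (partial_deriv 0 f (pt s \<omega>) *\<^sub>R e s, partial_deriv 1 f (pt s \<omega>) *\<^sub>R e s)"

lemma smooth_cylindrical_pt:
  assumes "f \<in> Cb_infinity 2"
  shows "smooth_cylindrical W1 W2 (\<lambda>\<omega>. f (pt s \<omega>)) (deriv_elem f s)"
proof -
  have "deriv_elem f s = (\<lambda>\<omega>. \<Sum>j<1::nat.
      (partial_deriv (2 * j) f (cyl_point W1 W2 (\<lambda>_. (e s, e s)) \<omega>) *\<^sub>R fst (e s, e s),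
       partial_deriv (2 * j + 1) f (cyl_point W1 W2 (\<lambda>_. (e s, e s)) \<omega>) *\<^sub>R snd (e s, e s)))"
    by (rule ext) (simp add: deriv_elem_def pt_def)
  moreover have "f \<in> Cb_infinity (2 * 1)" using assms by simp
  ultimately show ?thesis
    unfolding smooth_cylindrical_def pt_def by blast
qed

lemma smooth_cylindrical_square_integrable:
  assumes "smooth_cylindrical W1 W2 F U"
  shows "square_integrable M F" "square_integrable M U"
proof -
  note sc = smooth_cylindrical_bounded[OF assms]
  note [measurable] = sc(1,2)
  obtain C D where C: "\<And>\<omega>. \<bar>F \<omega>\<bar> \<le> C" and D: "\<And>\<omega>. norm (U \<omega>) \<le> D" using sc(3,4) by blast
  have "integrable M (\<lambda>\<omega>. (norm (F \<omega>))\<^sup>2)"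
  proof (rule integrable_const_bound[of _ "C\<^sup>2"])
    show "AE \<omega> in M. norm ((norm (F \<omega>))\<^sup>2) \<le> C\<^sup>2"
      using power_mono[OF C abs_ge_zero, of _ 2] by simp
  qed simp
  then show "square_integrable M F" by (simp add: square_integrable_def)
  have "integrable M (\<lambda>\<omega>. (norm (U \<omega>))\<^sup>2)"
  proof (rule integrable_const_bound[of _ "D\<^sup>2"])
    show "AE \<omega> in M. norm ((norm (U \<omega>))\<^sup>2) \<le> D\<^sup>2"
      using power_mono[OF D norm_ge_zero, of _ 2] by simp
  qed simp
  then show "square_integrable M U" by (simp add: square_integrable_def)
qed

lemma W_increment_square:
  assumes "0 \<le> s" "0 \<le> r"
  shows "integrable M (\<lambda>\<omega>. (W1 (e r) \<omega> - W1 (e s) \<omega>)\<^sup>2)" "integrable M (\<lambda>\<omega>. (W2 (e r) \<omega> - W2 (e s) \<omega>)\<^sup>2)"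
    "expectation (\<lambda>\<omega>. (W1 (e r) \<omega> - W1 (e s) \<omega>)\<^sup>2) = \<bar>r - s\<bar> powr (2 * H)"
    "expectation (\<lambda>\<omega>. (W2 (e r) \<omega> - W2 (e s) \<omega>)\<^sup>2) = \<bar>r - s\<bar> powr (2 * H)"
  using wiener_dist[OF wiener1, of "e r" "e s"] wiener_dist[OF wiener2, of "e r" "e s"]
    fbm_increment_norm[OF assms] by (simp_all add: power2_eq_square powr_add[symmetric])

text \<open>Along time, the derivative of f(B) is Hoelder continuous of order H in mean square:
  either the coefficient moves, which is controlled by the Lipschitz bound and the increments of the
  two coordinates, or the vector \<open>e s\<close> moves.\<close>

lemma deriv_elem_increment:
  assumes f: "f \<in> Cb_infinity 2" and t: "0 \<le> t"
  shows "\<exists>C\<ge>0. \<forall>r s. 0 \<le> s \<longrightarrow> s \<le> t \<longrightarrow> 0 \<le> r \<longrightarrow> r \<le> t \<longrightarrow>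
    integrable M (\<lambda>\<omega>. (norm (deriv_elem f r \<omega> - deriv_elem f s \<omega>))\<^sup>2) \<and>
    expectation (\<lambda>\<omega>. (norm (deriv_elem f r \<omega> - deriv_elem f s \<omega>))\<^sup>2) \<le> C * \<bar>r - s\<bar> powr (2 * H)"
proof -
  have one: "\<exists>C\<ge>0. \<forall>r s \<omega>. 0 \<le> s \<longrightarrow> s \<le> t \<longrightarrow> 0 \<le> r \<longrightarrow> r \<le> t \<longrightarrow>
      (norm (g (pt r \<omega>) *\<^sub>R e r - g (pt s \<omega>) *\<^sub>R e s))\<^sup>2 \<le>
        C * ((W1 (e r) \<omega> - W1 (e s) \<omega>)\<^sup>2 + (W2 (e r) \<omega> - W2 (e s) \<omega>)\<^sup>2 + \<bar>r - s\<bar> powr (2 * H))"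
    if g: "g \<in> Cb_infinity 2" for g
  proof -
    obtain K where K: "0 < K" "\<And>x. \<bar>g x\<bar> \<le> K" using Cb_infinity_bounded[OF g] by blast
    obtain L where L: "0 < L" "\<And>x y. \<bar>g x - g y\<bar> \<le> L * (\<bar>x 0 - y 0\<bar> + \<bar>x 1 - y 1\<bar>)"
      using Cb_infinity_2_lipschitz[OF g] by blast
    define A where "A = L * t powr H"
    have "0 \<le> A" using L by (simp add: A_def)
    have "(norm (g (pt r \<omega>) *\<^sub>R e r - g (pt s \<omega>) *\<^sub>R e s))\<^sup>2 \<le>
        3 * (A\<^sup>2 + K\<^sup>2) * ((W1 (e r) \<omega> - W1 (e s) \<omega>)\<^sup>2 + (W2 (e r) \<omega> - W2 (e s) \<omega>)\<^sup>2 + \<bar>r - s\<bar> powr (2 * H))"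
      if "0 \<le> s" "s \<le> t" "0 \<le> r" "r \<le> t" for r s \<omega>
    proof -
      define X where "X = \<bar>W1 (e r) \<omega> - W1 (e s) \<omega>\<bar>"
      define Y where "Y = \<bar>W2 (e r) \<omega> - W2 (e s) \<omega>\<bar>"
      define Z where "Z = \<bar>r - s\<bar> powr H"
      have "norm (g (pt r \<omega>) *\<^sub>R e r - g (pt s \<omega>) *\<^sub>R e s) \<le>
          \<bar>g (pt r \<omega>) - g (pt s \<omega>)\<bar> * norm (e r) + \<bar>g (pt s \<omega>)\<bar> * norm (e r - e s)"
      proof -
        have "g (pt r \<omega>) *\<^sub>R e r - g (pt s \<omega>) *\<^sub>R e s =
            (g (pt r \<omega>) - g (pt s \<omega>)) *\<^sub>R e r + g (pt s \<omega>) *\<^sub>R (e r - e s)"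
          by (simp add: algebra_simps)
        then show ?thesis using norm_triangle_ineq by (metis norm_scaleR)
      qed
      also have "\<dots> \<le> (L * (X + Y)) * t powr H + K * Z"
      proof (intro add_mono mult_mono)
        show "\<bar>g (pt r \<omega>) - g (pt s \<omega>)\<bar> \<le> L * (X + Y)"
          using L(2)[of "pt r \<omega>" "pt s \<omega>"] by (simp add: pt_eq X_def Y_def)
        show "norm (e r) \<le> t powr H" "norm (e r - e s) \<le> Z"
          using that H_gt_half by (auto simp: fbm_norm fbm_increment_norm Z_def intro!: powr_mono2)
      qed (use L K in \<open>auto simp: X_def Y_def\<close>)
      also have "\<dots> = A * X + A * Y + K * Z" by (simp add: A_def algebra_simps)
      finally have "(norm (g (pt r \<omega>) *\<^sub>R e r - g (pt s \<omega>) *\<^sub>R e s))\<^sup>2 \<le> (A * X + A * Y + K * Z)\<^sup>2"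
        by (rule power_mono) simp
      also have "\<dots> \<le> 3 * ((A * X)\<^sup>2 + (A * Y)\<^sup>2 + (K * Z)\<^sup>2)"
      proof -
        have "(a + b + c)\<^sup>2 \<le> 3 * (a\<^sup>2 + b\<^sup>2 + c\<^sup>2)" for a b c :: real
        proof -
          have "0 \<le> (a - b)\<^sup>2 + (b - c)\<^sup>2 + (a - c)\<^sup>2" by simp
          then show ?thesis by (simp add: power2_eq_square algebra_simps)
        qed
        then show ?thesis .
      qed
      also have "\<dots> = 3 * (A\<^sup>2 * X\<^sup>2 + A\<^sup>2 * Y\<^sup>2 + K\<^sup>2 * Z\<^sup>2)" by (simp add: power_mult_distrib)
      also have "\<dots> \<le> 3 * ((A\<^sup>2 + K\<^sup>2) * X\<^sup>2 + (A\<^sup>2 + K\<^sup>2) * Y\<^sup>2 + (A\<^sup>2 + K\<^sup>2) * Z\<^sup>2)"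
        by (intro mult_left_mono add_mono mult_right_mono) auto
      also have "\<dots> = 3 * (A\<^sup>2 + K\<^sup>2) * (X\<^sup>2 + Y\<^sup>2 + Z\<^sup>2)" by (simp add: algebra_simps)
      also have "Z\<^sup>2 = \<bar>r - s\<bar> powr (2 * H)" by (simp add: Z_def power2_eq_square powr_add[symmetric])
      finally show ?thesis by (simp add: X_def Y_def)
    qed
    then show ?thesis by (intro exI[of _ "3 * (A\<^sup>2 + K\<^sup>2)"]) auto
  qed
  have p: "partial_deriv 0 f \<in> Cb_infinity 2" "partial_deriv 1 f \<in> Cb_infinity 2"
    by (auto intro!: Cb_infinity_partial_deriv f)
  obtain C0 where C0: "C0 \<ge> 0" "\<And>r s \<omega>. 0 \<le> s \<Longrightarrow> s \<le> t \<Longrightarrow> 0 \<le> r \<Longrightarrow> r \<le> t \<Longrightarrow>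
      (norm (partial_deriv 0 f (pt r \<omega>) *\<^sub>R e r - partial_deriv 0 f (pt s \<omega>) *\<^sub>R e s))\<^sup>2 \<le>
        C0 * ((W1 (e r) \<omega> - W1 (e s) \<omega>)\<^sup>2 + (W2 (e r) \<omega> - W2 (e s) \<omega>)\<^sup>2 + \<bar>r - s\<bar> powr (2 * H))"
    using one[OF p(1)] by blast
  obtain C1 where C1: "C1 \<ge> 0" "\<And>r s \<omega>. 0 \<le> s \<Longrightarrow> s \<le> t \<Longrightarrow> 0 \<le> r \<Longrightarrow> r \<le> t \<Longrightarrow>
      (norm (partial_deriv 1 f (pt r \<omega>) *\<^sub>R e r - partial_deriv 1 f (pt s \<omega>) *\<^sub>R e s))\<^sup>2 \<le>
        C1 * ((W1 (e r) \<omega> - W1 (e s) \<omega>)\<^sup>2 + (W2 (e r) \<omega> - W2 (e s) \<omega>)\<^sup>2 + \<bar>r - s\<bar> powr (2 * H))"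
    using one[OF p(2)] by blast
  show ?thesis
  proof (intro exI[of _ "(C0 + C1) * 3"] conjI[of "0 \<le> (C0 + C1) * 3"] allI impI)
    show "0 \<le> (C0 + C1) * 3" using C0 C1 by simp
    fix r s assume rs: "0 \<le> s" "s \<le> t" "0 \<le> r" "r \<le> t"
    let ?R = "\<lambda>\<omega>. (C0 + C1) * ((W1 (e r) \<omega> - W1 (e s) \<omega>)\<^sup>2 + (W2 (e r) \<omega> - W2 (e s) \<omega>)\<^sup>2 + \<bar>r - s\<bar> powr (2 * H))"
    have le: "(norm (deriv_elem f r \<omega> - deriv_elem f s \<omega>))\<^sup>2 \<le> ?R \<omega>" for \<omega>
      using add_mono[OF C0(2)[OF rs, of \<omega>] C1(2)[OF rs, of \<omega>]]
      by (simp add: deriv_elem_def norm_prod_def distrib_right)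
    note inc = W_increment_square[OF rs(1,3)]
    have iR: "integrable M ?R" using inc(1,2) by simp
    have [measurable]: "deriv_elem f s \<in> borel_measurable M" for s
      using smooth_cylindrical_bounded(2)[OF smooth_cylindrical_pt[OF f]] .
    have int: "integrable M (\<lambda>\<omega>. (norm (deriv_elem f r \<omega> - deriv_elem f s \<omega>))\<^sup>2)"
      by (rule Bochner_Integration.integrable_bound[OF iR]) (use le in \<open>auto intro: order_trans[OF _ abs_ge_self]\<close>)
    moreover have "expectation (\<lambda>\<omega>. (norm (deriv_elem f r \<omega> - deriv_elem f s \<omega>))\<^sup>2) \<le> expectation ?R"
      by (rule integral_mono[OF int iR le])
    moreover have "expectation ?R = (C0 + C1) * 3 * \<bar>r - s\<bar> powr (2 * H)"
      using inc by (simp add: prob_space)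
    ultimately show "integrable M (\<lambda>\<omega>. (norm (deriv_elem f r \<omega> - deriv_elem f s \<omega>))\<^sup>2) \<and>
      expectation (\<lambda>\<omega>. (norm (deriv_elem f r \<omega> - deriv_elem f s \<omega>))\<^sup>2) \<le> (C0 + C1) * 3 * \<bar>r - s\<bar> powr (2 * H)"
      by simp
  qed
qed

text \<open>The left Riemann sum of the field (f1, f2) along the path on the dyadic grid, as a
  smooth vector valued variable together with the derivatives of its coefficients.\<close>

definition field_rep :: "((nat \<Rightarrow> real) \<Rightarrow> real) \<Rightarrow> ((nat \<Rightarrow> real) \<Rightarrow> real) \<Rightarrow> real \<Rightarrow> nat \<Rightarrow> ('a, 'h \<times> 'h) smooth_rep" where
  "field_rep f1 f2 t N =
     map (\<lambda>k. (\<lambda>\<omega>. f1 (pt (grid t N k) \<omega>), deriv_elem f1 (grid t N k), (incr t N k, 0))) [0..<2 ^ N] @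
     map (\<lambda>k. (\<lambda>\<omega>. f2 (pt (grid t N k) \<omega>), deriv_elem f2 (grid t N k), (0, incr t N k))) [0..<2 ^ N]"

lemma field_rep_smooth:
  assumes "f1 \<in> Cb_infinity 2" "f2 \<in> Cb_infinity 2"
  shows "\<forall>(F, U, v)\<in>set (field_rep f1 f2 t N). smooth_cylindrical W1 W2 F U"
  using assms by (auto simp: field_rep_def smooth_cylindrical_pt)

lemma smooth_val_field_rep:
  "smooth_val (field_rep f1 f2 t N) \<omega> =
    (left_sum (\<lambda>s. f1 (pt s \<omega>)) t N, left_sum (\<lambda>s. f2 (pt s \<omega>)) t N)"
proof -
  have "(\<Sum>k<n. (a k, 0::'h)) = (\<Sum>k<n. a k, 0)" "(\<Sum>k<n. (0::'h, a k)) = (0, \<Sum>k<n. a k)" for a :: "nat \<Rightarrow> 'h" and n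
    by (induction n) (simp_all add: zero_prod_def)
  then show ?thesis
    unfolding smooth_val_def field_rep_def left_sum_def
    by (simp add: comp_def interv_sum_list_conv_sum_set_nat lessThan_atLeast0)
qed

text \<open>The bilinear form that polarizes \<open>deriv_normsq\<close>, in which a difference of
  two Riemann sums can be expanded.\<close>

definition rep_pairing :: "('a, 'h \<times> 'h) smooth_rep \<Rightarrow> ('a, 'h \<times> 'h) smooth_rep \<Rightarrow> 'a \<Rightarrow> real" where
  "rep_pairing S T \<omega> = (\<Sum>(F, U, v)\<leftarrow>S. \<Sum>(F', U', v')\<leftarrow>T. (U \<omega> \<bullet> U' \<omega>) * (v \<bullet> v'))"

lemma deriv_normsq_diff:
  "deriv_normsq (smooth_diff S T) \<omega> = rep_pairing S S \<omega> - rep_pairing S T \<omega> - rep_pairing T S \<omega> + rep_pairing T T \<omega>"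
proof -
  have neg: "(\<Sum>(F', U', v')\<leftarrow>map (\<lambda>(F, U, v). (F, U, - v)) T. (x \<bullet> U' \<omega>) * (y \<bullet> v')) =
      - (\<Sum>(F', U', v')\<leftarrow>T. (x \<bullet> U' \<omega>) * (y \<bullet> v'))" for x y and T :: "('a, 'h \<times> 'h) smooth_rep"
    by (induction T) (simp_all add: case_prod_unfold)
  have app: "(\<Sum>(F, U, v)\<leftarrow>S'. (\<Sum>(F', U', v')\<leftarrow>S @ map (\<lambda>(F, U, v). (F, U, - v)) T. (U \<omega> \<bullet> U' \<omega>) * (v \<bullet> v'))) =
      rep_pairing S' S \<omega> - rep_pairing S' T \<omega>" for S'
    unfolding map_append sum_list_append neg rep_pairing_def
    by (induction S') (simp_all add: case_prod_unfold)
  have neg2: "(\<Sum>(F, U, v)\<leftarrow>map (\<lambda>(F, U, v). (F, U, - v)) T'. (\<Sum>(F', U', v')\<leftarrow>R. (U \<omega> \<bullet> U' \<omega>) * (v \<bullet> v'))) =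
      - (\<Sum>(F, U, v)\<leftarrow>T'. (\<Sum>(F', U', v')\<leftarrow>R. (U \<omega> \<bullet> U' \<omega>) * (v \<bullet> v')))" for T' R
    by (induction T') (simp_all add: case_prod_unfold uminus_sum_list_map comp_def)
  have split: "(\<Sum>x\<leftarrow>xs @ ys. h x) = (\<Sum>x\<leftarrow>xs. h x) + (\<Sum>x\<leftarrow>ys. h x)" for xs ys and h :: "_ \<Rightarrow> real"
    by simp
  let ?A = "\<lambda>S'. \<Sum>(F, U, v)\<leftarrow>S'. (\<Sum>(F', U', v')\<leftarrow>S @ map (\<lambda>(F, U, v). (F, U, - v)) T. (U \<omega> \<bullet> U' \<omega>) * (v \<bullet> v'))"
  have "deriv_normsq (smooth_diff S T) \<omega> = ?A (S @ map (\<lambda>(F, U, v). (F, U, - v)) T)"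
    by (simp only: deriv_normsq_def smooth_diff_def)
  also have "\<dots> = ?A S + ?A (map (\<lambda>(F, U, v). (F, U, - v)) T)"
    by (rule split)
  also have "?A (map (\<lambda>(F, U, v). (F, U, - v)) T) = - ?A T"
    by (rule neg2)
  finally show ?thesis unfolding app by simp
qed

lemma rep_pairing_field_rep:
  "rep_pairing (field_rep f1 f2 t N) (field_rep f1 f2 t K) \<omega> =
    (\<Sum>k<2 ^ N. \<Sum>l<2 ^ K. (deriv_elem f1 (grid t N k) \<omega> \<bullet> deriv_elem f1 (grid t K l) \<omega>) * (incr t N k \<bullet> incr t K l)) +
    (\<Sum>k<2 ^ N. \<Sum>l<2 ^ K. (deriv_elem f2 (grid t N k) \<omega> \<bullet> deriv_elem f2 (grid t K l) \<omega>) * (incr t N k \<bullet> incr t K l))"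
  unfolding rep_pairing_def field_rep_def
  by (simp add: comp_def interv_sum_list_conv_sum_set_nat lessThan_atLeast0)

lemma pairing_refine:
  fixes u w :: "nat \<Rightarrow> 'b::real_inner"
  shows "(\<Sum>k<2 ^ N. \<Sum>l<2 ^ K. (u k \<bullet> w l) * (incr t N k \<bullet> incr t K l)) =
    (\<Sum>j<2 ^ (N + d). \<Sum>l<2 ^ K. (u (j div 2 ^ d) \<bullet> w l) * (incr t (N + d) j \<bullet> incr t K l))"
  by (rule incr_refine[of "\<lambda>k x. \<Sum>l<2 ^ K. (u k \<bullet> w l) * (x \<bullet> incr t K l)"])
     (simp add: inner_add_left distrib_left sum.distrib)

lemma pairing_swap:
  fixes u w :: "nat \<Rightarrow> 'b::real_inner"
  shows "(\<Sum>k<2 ^ N. \<Sum>l<2 ^ K. (u k \<bullet> w l) * (incr t N k \<bullet> incr t K l)) =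
    (\<Sum>l<2 ^ K. \<Sum>k<2 ^ N. (w l \<bullet> u k) * (incr t K l \<bullet> incr t N k))"
  by (subst sum.swap) (simp add: inner_commute)

text \<open>Once both arguments are written on the finer grid, the four pairings collapse into one
  quadratic form in the differences between fine and coarse coefficients.\<close>

lemma pairing_diff:
  fixes u :: "nat \<Rightarrow> nat \<Rightarrow> 'b::real_inner"
  shows "(\<Sum>k<2 ^ (N + d). \<Sum>l<2 ^ (N + d). (u (N + d) k \<bullet> u (N + d) l) * (incr t (N + d) k \<bullet> incr t (N + d) l))
     - (\<Sum>k<2 ^ (N + d). \<Sum>l<2 ^ N. (u (N + d) k \<bullet> u N l) * (incr t (N + d) k \<bullet> incr t N l))
     - (\<Sum>k<2 ^ N. \<Sum>l<2 ^ (N + d). (u N k \<bullet> u (N + d) l) * (incr t N k \<bullet> incr t (N + d) l))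
     + (\<Sum>k<2 ^ N. \<Sum>l<2 ^ N. (u N k \<bullet> u N l) * (incr t N k \<bullet> incr t N l)) =
    (\<Sum>k<2 ^ (N + d). \<Sum>l<2 ^ (N + d). ((u (N + d) k - u N (k div 2 ^ d)) \<bullet> (u (N + d) l - u N (l div 2 ^ d))) *
      (incr t (N + d) k \<bullet> incr t (N + d) l))"
proof -
  have 1: "(\<Sum>k<2 ^ N. \<Sum>l<2 ^ (N + d). (u N k \<bullet> u (N + d) l) * (incr t N k \<bullet> incr t (N + d) l)) =
    (\<Sum>k<2 ^ (N + d). \<Sum>l<2 ^ (N + d). (u N (k div 2 ^ d) \<bullet> u (N + d) l) * (incr t (N + d) k \<bullet> incr t (N + d) l))"
    by (rule pairing_refine)
  have 2: "(\<Sum>k<2 ^ (N + d). \<Sum>l<2 ^ N. (u (N + d) k \<bullet> u N l) * (incr t (N + d) k \<bullet> incr t N l)) =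
    (\<Sum>k<2 ^ (N + d). \<Sum>l<2 ^ (N + d). (u (N + d) k \<bullet> u N (l div 2 ^ d)) * (incr t (N + d) k \<bullet> incr t (N + d) l))"
    by (subst pairing_swap, subst pairing_refine[of _ _ _ _ _ d], subst pairing_swap) (rule refl)
  have 3: "(\<Sum>k<2 ^ N. \<Sum>l<2 ^ N. (u N k \<bullet> u N l) * (incr t N k \<bullet> incr t N l)) =
    (\<Sum>k<2 ^ (N + d). \<Sum>l<2 ^ (N + d). (u N (k div 2 ^ d) \<bullet> u N (l div 2 ^ d)) * (incr t (N + d) k \<bullet> incr t (N + d) l))"
    by (subst pairing_refine[of _ _ _ _ _ d], subst pairing_swap, subst pairing_refine[of _ _ _ _ _ d], subst pairing_swap) (rule refl)
  show ?thesis
    unfolding 1 2 3 sum_subtractf[symmetric] sum.distrib[symmetric]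
    by (intro sum.cong refl) (simp add: inner_diff_left inner_diff_right algebra_simps)
qed

lemma deriv_normsq_commute:
  fixes S T :: "('a, 'h \<times> 'h) smooth_rep"
  shows "deriv_normsq (smooth_diff S T) \<omega> = deriv_normsq (smooth_diff T S) \<omega>"
  unfolding deriv_normsq_diff by simp

text \<open>The derivatives at a fine point and at its coarse left end differ by the mesh to the
  power 2H in squared mean. Positivity of the scalar products reduces the quadratic form to these
  squared means, and the scalar products sum to \<open>t powr (2 * H)\<close>.\<close>

lemma deriv_normsq_field_rep:
  assumes f: "f1 \<in> Cb_infinity 2" "f2 \<in> Cb_infinity 2" and t: "0 \<le> t"
  obtains C where "0 \<le> C" "\<And>N d. (\<integral>\<^sup>+ \<omega>. ennreal (deriv_normsq (smooth_diff (field_rep f1 f2 t (N + d)) (field_rep f1 f2 t N)) \<omega>) \<partial>M)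
     \<le> ennreal (C * (t / 2 ^ N) powr (2 * H))"
proof -
  obtain C1 where C1: "0 \<le> C1" "\<And>r s. 0 \<le> s \<Longrightarrow> s \<le> t \<Longrightarrow> 0 \<le> r \<Longrightarrow> r \<le> t \<Longrightarrow>
    integrable M (\<lambda>\<omega>. (norm (deriv_elem f1 r \<omega> - deriv_elem f1 s \<omega>))\<^sup>2) \<and>
    expectation (\<lambda>\<omega>. (norm (deriv_elem f1 r \<omega> - deriv_elem f1 s \<omega>))\<^sup>2) \<le> C1 * \<bar>r - s\<bar> powr (2 * H)"
    using deriv_elem_increment[OF f(1) t] by blast
  obtain C2 where C2: "0 \<le> C2" "\<And>r s. 0 \<le> s \<Longrightarrow> s \<le> t \<Longrightarrow> 0 \<le> r \<Longrightarrow> r \<le> t \<Longrightarrow>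
    integrable M (\<lambda>\<omega>. (norm (deriv_elem f2 r \<omega> - deriv_elem f2 s \<omega>))\<^sup>2) \<and>
    expectation (\<lambda>\<omega>. (norm (deriv_elem f2 r \<omega> - deriv_elem f2 s \<omega>))\<^sup>2) \<le> C2 * \<bar>r - s\<bar> powr (2 * H)"
    using deriv_elem_increment[OF f(2) t] by blast
  define D where "D f N d k \<omega> = deriv_elem f (grid t (N + d) k) \<omega> - deriv_elem f (grid t N (k div 2 ^ d)) \<omega>" for f N d k \<omega>
  define Q where "Q f N d \<omega> = (\<Sum>k<2 ^ (N + d). \<Sum>l<2 ^ (N + d). ((norm (D f N d k \<omega>))\<^sup>2 + (norm (D f N d l \<omega>))\<^sup>2) / 2 *
      (incr t (N + d) k \<bullet> incr t (N + d) l))" for f N d \<omega>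
  have Q: "integrable M (Q f N d)" "expectation (Q f N d) \<le> C * (t / 2 ^ N) powr (2 * H) * t powr (2 * H)"
    if C: "0 \<le> C" "\<And>r s. 0 \<le> s \<Longrightarrow> s \<le> t \<Longrightarrow> 0 \<le> r \<Longrightarrow> r \<le> t \<Longrightarrow>
    integrable M (\<lambda>\<omega>. (norm (deriv_elem f r \<omega> - deriv_elem f s \<omega>))\<^sup>2) \<and>
    expectation (\<lambda>\<omega>. (norm (deriv_elem f r \<omega> - deriv_elem f s \<omega>))\<^sup>2) \<le> C * \<bar>r - s\<bar> powr (2 * H)" for f C N d
  proof -
    have ID: "integrable M (\<lambda>\<omega>. (norm (D f N d k \<omega>))\<^sup>2)"
      and ED: "expectation (\<lambda>\<omega>. (norm (D f N d k \<omega>))\<^sup>2) \<le> C * (t / 2 ^ N) powr (2 * H)" if "k < 2 ^ (N + d)" for k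
    proof -
      have r: "0 \<le> grid t (N + d) k" "grid t (N + d) k \<le> t" "0 \<le> grid t N (k div 2 ^ d)"
        using t that by (auto intro!: grid_nonneg grid_le)
      have s: "grid t N (k div 2 ^ d) \<le> grid t (N + d) k" "grid t (N + d) k - grid t N (k div 2 ^ d) \<le> t / 2 ^ N"
        by (rule grid_coarse_dist[OF t])+
      note c = C(2)[OF r(3) order_trans[OF s(1) r(2)] r(1,2)]
      show "integrable M (\<lambda>\<omega>. (norm (D f N d k \<omega>))\<^sup>2)" using c by (simp add: D_def)
      have "expectation (\<lambda>\<omega>. (norm (D f N d k \<omega>))\<^sup>2) \<le> C * \<bar>grid t (N + d) k - grid t N (k div 2 ^ d)\<bar> powr (2 * H)"
        using c by (simp add: D_def)
      also have "\<dots> \<le> C * (t / 2 ^ N) powr (2 * H)"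
        using s C(1) H_gt_half by (intro mult_left_mono powr_mono2) auto
      finally show "expectation (\<lambda>\<omega>. (norm (D f N d k \<omega>))\<^sup>2) \<le> C * (t / 2 ^ N) powr (2 * H)" .
    qed
    have IQ: "integrable M (\<lambda>\<omega>. ((norm (D f N d k \<omega>))\<^sup>2 + (norm (D f N d l \<omega>))\<^sup>2) / 2 *
        (incr t (N + d) k \<bullet> incr t (N + d) l))" if "k < 2 ^ (N + d)" "l < 2 ^ (N + d)" for k l
      by (intro integrable_mult_left integrable_divide Bochner_Integration.integrable_add ID that)
    show "integrable M (Q f N d)"
      unfolding Q_def by (intro Bochner_Integration.integrable_sum IQ) simp_all
    have "expectation (Q f N d) = (\<Sum>k<2 ^ (N + d). \<Sum>l<2 ^ (N + d). (expectation (\<lambda>\<omega>. (norm (D f N d k \<omega>))\<^sup>2) +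
        expectation (\<lambda>\<omega>. (norm (D f N d l \<omega>))\<^sup>2)) / 2 * (incr t (N + d) k \<bullet> incr t (N + d) l))"
      unfolding Q_def
    proof (subst Bochner_Integration.integral_sum)
      show "integrable M (\<lambda>\<omega>. \<Sum>l<2 ^ (N + d). ((norm (D f N d k \<omega>))\<^sup>2 + (norm (D f N d l \<omega>))\<^sup>2) / 2 *
        (incr t (N + d) k \<bullet> incr t (N + d) l))" if "k \<in> {..<2 ^ (N + d)}" for k
        using that by (intro Bochner_Integration.integrable_sum IQ) simp_all
    qed (intro sum.cong refl, subst Bochner_Integration.integral_sum, simp_all add: IQ ID)
    also have "\<dots> \<le> (\<Sum>k<2 ^ (N + d). \<Sum>l<2 ^ (N + d). C * (t / 2 ^ N) powr (2 * H) * (incr t (N + d) k \<bullet> incr t (N + d) l))"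
    proof (intro sum_mono mult_right_mono incr_inner_nonneg t)
      fix k l :: nat assume "k \<in> {..<2 ^ (N + d)}" "l \<in> {..<2 ^ (N + d)}"
      then show "(expectation (\<lambda>\<omega>. (norm (D f N d k \<omega>))\<^sup>2) + expectation (\<lambda>\<omega>. (norm (D f N d l \<omega>))\<^sup>2)) / 2 \<le> C * (t / 2 ^ N) powr (2 * H)"
        using ED[of k] ED[of l] by simp
    qed
    also have "\<dots> = C * (t / 2 ^ N) powr (2 * H) * t powr (2 * H)"
      by (simp add: sum_distrib_left[symmetric] sum_incr_inner t)
    finally show "expectation (Q f N d) \<le> C * (t / 2 ^ N) powr (2 * H) * t powr (2 * H)" .
  qed
  note Q1 = Q[of C1 f1, OF C1] and Q2 = Q[of C2 f2, OF C2]
  have Q_nonneg: "0 \<le> Q f N d \<omega>" for f N d \<omega>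
    unfolding Q_def by (intro sum_nonneg mult_nonneg_nonneg incr_inner_nonneg t) auto
  have le: "deriv_normsq (smooth_diff (field_rep f1 f2 t (N + d)) (field_rep f1 f2 t N)) \<omega> \<le> Q f1 N d \<omega> + Q f2 N d \<omega>" for N d \<omega>
  proof -
    have "deriv_normsq (smooth_diff (field_rep f1 f2 t (N + d)) (field_rep f1 f2 t N)) \<omega> =
      (\<Sum>k<2 ^ (N + d). \<Sum>l<2 ^ (N + d). (D f1 N d k \<omega> \<bullet> D f1 N d l \<omega>) * (incr t (N + d) k \<bullet> incr t (N + d) l)) +
      (\<Sum>k<2 ^ (N + d). \<Sum>l<2 ^ (N + d). (D f2 N d k \<omega> \<bullet> D f2 N d l \<omega>) * (incr t (N + d) k \<bullet> incr t (N + d) l))"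
      unfolding deriv_normsq_diff rep_pairing_field_rep D_def
      using pairing_diff[where N=N and d=d and t=t and u="\<lambda>N k. deriv_elem f1 (grid t N k) \<omega>"]
        pairing_diff[where N=N and d=d and t=t and u="\<lambda>N k. deriv_elem f2 (grid t N k) \<omega>"]
      by linarith
    also have "\<dots> \<le> Q f1 N d \<omega> + Q f2 N d \<omega>"
      unfolding Q_def by (intro add_mono incr_quadratic_le t)
    finally show ?thesis .
  qed
  show thesis
  proof (rule that[of "(C1 + C2) * t powr (2 * H)"])
    show "0 \<le> (C1 + C2) * t powr (2 * H)" using C1(1) C2(1) by simp
    fix N d
    have "(\<integral>\<^sup>+ \<omega>. ennreal (deriv_normsq (smooth_diff (field_rep f1 f2 t (N + d)) (field_rep f1 f2 t N)) \<omega>) \<partial>M)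
        \<le> (\<integral>\<^sup>+ \<omega>. ennreal (Q f1 N d \<omega> + Q f2 N d \<omega>) \<partial>M)"
      by (intro nn_integral_mono ennreal_leI le)
    also have "\<dots> = ennreal (expectation (\<lambda>\<omega>. Q f1 N d \<omega> + Q f2 N d \<omega>))"
      using Q1(1) Q2(1) Q_nonneg by (intro nn_integral_eq_integral Bochner_Integration.integrable_add) auto
    also have "\<dots> \<le> ennreal ((C1 + C2) * t powr (2 * H) * (t / 2 ^ N) powr (2 * H))"
    proof (rule ennreal_leI)
      have "expectation (\<lambda>\<omega>. Q f1 N d \<omega> + Q f2 N d \<omega>) = expectation (Q f1 N d) + expectation (Q f2 N d)"
        using Q1(1) Q2(1) by (intro Bochner_Integration.integral_add) auto
      then show "expectation (\<lambda>\<omega>. Q f1 N d \<omega> + Q f2 N d \<omega>) \<le> (C1 + C2) * t powr (2 * H) * (t / 2 ^ N) powr (2 * H)"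
        using Q1(2)[of N d] Q2(2)[of N d] by (simp add: algebra_simps)
    qed
    finally show "(\<integral>\<^sup>+ \<omega>. ennreal (deriv_normsq (smooth_diff (field_rep f1 f2 t (N + d)) (field_rep f1 f2 t N)) \<omega>) \<partial>M)
        \<le> ennreal ((C1 + C2) * t powr (2 * H) * (t / 2 ^ N) powr (2 * H))" .
  qed
qed

end

lemma square_integrable_add:
  fixes f g :: "'a \<Rightarrow> 'b::{real_inner, second_countable_topology}"
  assumes "square_integrable M f" "square_integrable M g"
  shows "square_integrable M (\<lambda>\<omega>. f \<omega> + g \<omega>)"
proof -
  have "square_integrable M (\<lambda>\<omega>. - g \<omega>)" using assms(2) by (simp add: square_integrable_def)
  from square_integrable_diff[OF assms(1) this] show ?thesis by simp
qed

lemma square_integrable_sum: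
  fixes f :: "nat \<Rightarrow> 'a \<Rightarrow> real"
  assumes "\<And>k. k < n \<Longrightarrow> square_integrable M (f k)"
  shows "square_integrable M (\<lambda>\<omega>. \<Sum>k<n. f k \<omega>)"
  using assms
proof (induction n)
  case 0
  then show ?case by (simp add: square_integrable_def)
next
  case (Suc n)
  then show ?case using square_integrable_add[OF Suc.IH, of "f n"] by simp
qed

lemma square_integrable_bounded_mult:
  fixes X Y :: "'a \<Rightarrow> real"
  assumes X: "square_integrable M X" and [measurable]: "Y \<in> borel_measurable M" and Y: "\<And>\<omega>. \<bar>Y \<omega>\<bar> \<le> C"
  shows "square_integrable M (\<lambda>\<omega>. Y \<omega> * X \<omega>)"
proof -
  have [measurable]: "X \<in> borel_measurable M" using X by (simp add: square_integrable_def)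
  have "integrable M (\<lambda>\<omega>. (Y \<omega>)\<^sup>2 * (X \<omega>)\<^sup>2)"
  proof (rule integrable_bounded_mult[of _ _ _ "C\<^sup>2"])
    show "\<bar>(Y \<omega>)\<^sup>2\<bar> \<le> C\<^sup>2" for \<omega> using power_mono[OF Y abs_ge_zero, of \<omega> 2] by simp
  qed (use X in \<open>auto simp: square_integrable_def\<close>)
  then show ?thesis by (simp add: square_integrable_def power_mult_distrib)
qed

lemma sum_power2_le:
  fixes x :: "nat \<Rightarrow> real"
  shows "(\<Sum>k<n. x k)\<^sup>2 \<le> real n * (\<Sum>k<n. (x k)\<^sup>2)"
  using Cauchy_Schwarz_ineq_sum[of "\<lambda>_. 1" x "{..<n}"] by simp

lemma sum3_power2_le:
  fixes a b c :: real
  shows "(a + b + c)\<^sup>2 \<le> 3 * (a\<^sup>2 + b\<^sup>2 + c\<^sup>2)"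
proof -
  have "0 \<le> (a - b)\<^sup>2 + (b - c)\<^sup>2 + (a - c)\<^sup>2" by simp
  then show ?thesis by (simp add: power2_eq_square algebra_simps)
qed

lemma sum2_power2_le: "(a + b)\<^sup>2 \<le> 2 * (a\<^sup>2 + b\<^sup>2)" for a b :: real
  using sum_squares_bound[of a b] by (simp add: power2_sum)

lemma product_square_le_fourth_powers:
  fixes a b c d :: real
  shows "((a + b) * (c + d))\<^sup>2 \<le> 4 * (a ^ 4 + b ^ 4 + c ^ 4 + d ^ 4)"
proof -
  have four: "((x + y)\<^sup>2)\<^sup>2 \<le> 8 * (x ^ 4 + y ^ 4)" for x y :: real
  proof -
    have "((x + y)\<^sup>2)\<^sup>2 \<le> (2 * (x\<^sup>2 + y\<^sup>2))\<^sup>2" by (intro power_mono sum2_power2_le) simp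
    also have "\<dots> = 4 * (x\<^sup>2 + y\<^sup>2)\<^sup>2" unfolding power_mult_distrib by simp
    also have "\<dots> \<le> 4 * (2 * ((x\<^sup>2)\<^sup>2 + (y\<^sup>2)\<^sup>2))" by (intro mult_left_mono sum2_power2_le) simp
    finally show ?thesis by simp
  qed
  have "((a + b) * (c + d))\<^sup>2 = (a + b)\<^sup>2 * (c + d)\<^sup>2" by (rule power_mult_distrib)
  also have "\<dots> \<le> (((a + b)\<^sup>2)\<^sup>2 + ((c + d)\<^sup>2)\<^sup>2) / 2"
  proof -
    have "x * y \<le> (x\<^sup>2 + y\<^sup>2) / 2" for x y :: real using sum_squares_bound[of x y] by simp
    then show ?thesis .
  qed
  also have "\<dots> \<le> 4 * (a ^ 4 + b ^ 4 + c ^ 4 + d ^ 4)"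
  proof -
    have "(p + q) / 2 \<le> 4 * (x + y + z + w)" if "p \<le> 8 * (x + y)" "q \<le> 8 * (z + w)"
      for p q x y z w :: real
    proof -
      have "p + q \<le> 8 * (x + y) + 8 * (z + w)" by (intro add_mono that)
      then show ?thesis by (simp add: algebra_simps)
    qed
    from this[OF four four] show ?thesis .
  qed
  finally show ?thesis .
qed

context fbm_setting
begin

definition divg :: "((nat \<Rightarrow> real) \<Rightarrow> real) \<Rightarrow> ((nat \<Rightarrow> real) \<Rightarrow> real) \<Rightarrow> (nat \<Rightarrow> real) \<Rightarrow> real" where
  "divg f1 f2 x = partial_deriv 0 f1 x + partial_deriv 1 f2 x"

text \<open>The divergence of the Riemann sum, by the rule that the divergence of F times h is F
  W(h) minus the pairing of DF with h. The pairing is a partial derivative times the covariance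
  \<open>e s \<bullet> h\<close>, equal for both coordinates, so the two partial derivatives merge
  into \<open>divg\<close>.\<close>

definition skorokhod_sum :: "((nat \<Rightarrow> real) \<Rightarrow> real) \<Rightarrow> ((nat \<Rightarrow> real) \<Rightarrow> real) \<Rightarrow> real \<Rightarrow> nat \<Rightarrow> 'a \<Rightarrow> real" where
  "skorokhod_sum f1 f2 t N \<omega> = (\<Sum>k<2 ^ N. f1 (pt (grid t N k) \<omega>) * W1 (incr t N k) \<omega> +
     f2 (pt (grid t N k) \<omega>) * W2 (incr t N k) \<omega> -
     divg f1 f2 (pt (grid t N k) \<omega>) * (e (grid t N k) \<bullet> incr t N k))"

lemma divg_Cb:
  assumes "f1 \<in> Cb_infinity 2" "f2 \<in> Cb_infinity 2"
  shows "(\<lambda>\<omega>. divg f1 f2 (pt s \<omega>)) \<in> borel_measurable M" "\<exists>C. \<forall>x. \<bar>divg f1 f2 x\<bar> \<le> C"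
    "\<exists>L\<ge>0. \<forall>x y. \<bar>divg f1 f2 x - divg f1 f2 y\<bar> \<le> L * (\<bar>x 0 - y 0\<bar> + \<bar>x 1 - y 1\<bar>)"
proof -
  have p: "partial_deriv 0 f1 \<in> Cb_infinity 2" "partial_deriv 1 f2 \<in> Cb_infinity 2"
    using assms by (auto intro!: Cb_infinity_partial_deriv)
  show "(\<lambda>\<omega>. divg f1 f2 (pt s \<omega>)) \<in> borel_measurable M"
    unfolding divg_def using pt_measurable[OF p(1)] pt_measurable[OF p(2)] by simp
  obtain C1 where C1: "\<And>x. \<bar>partial_deriv 0 f1 x\<bar> \<le> C1" using Cb_infinity_bounded[OF p(1)] by blast
  obtain C2 where C2: "\<And>x. \<bar>partial_deriv 1 f2 x\<bar> \<le> C2" using Cb_infinity_bounded[OF p(2)] by blast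
  have "\<bar>divg f1 f2 x\<bar> \<le> C1 + C2" for x
    using C1[of x] C2[of x] unfolding divg_def by linarith
  then show "\<exists>C. \<forall>x. \<bar>divg f1 f2 x\<bar> \<le> C" by blast
  obtain L1 where L1: "0 < L1" "\<And>x y. \<bar>partial_deriv 0 f1 x - partial_deriv 0 f1 y\<bar> \<le> L1 * (\<bar>x 0 - y 0\<bar> + \<bar>x 1 - y 1\<bar>)"
    using Cb_infinity_2_lipschitz[OF p(1)] by blast
  obtain L2 where L2: "0 < L2" "\<And>x y. \<bar>partial_deriv 1 f2 x - partial_deriv 1 f2 y\<bar> \<le> L2 * (\<bar>x 0 - y 0\<bar> + \<bar>x 1 - y 1\<bar>)"
    using Cb_infinity_2_lipschitz[OF p(2)] by blast
  have "\<bar>divg f1 f2 x - divg f1 f2 y\<bar> \<le> (L1 + L2) * (\<bar>x 0 - y 0\<bar> + \<bar>x 1 - y 1\<bar>)" for x y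
    using L1(2)[of x y] L2(2)[of x y] unfolding divg_def distrib_right by linarith
  then show "\<exists>L\<ge>0. \<forall>x y. \<bar>divg f1 f2 x - divg f1 f2 y\<bar> \<le> L * (\<bar>x 0 - y 0\<bar> + \<bar>x 1 - y 1\<bar>)"
    using L1(1) L2(1) by (intro exI[of _ "L1 + L2"]) auto
qed

lemma W_square_integrable: "square_integrable M (W1 h)" "square_integrable M (W2 h)"
  using wiener_square_integrable[OF wiener1] wiener_square_integrable[OF wiener2] .

lemma skorokhod_sum_square_integrable:
  assumes f: "f1 \<in> Cb_infinity 2" "f2 \<in> Cb_infinity 2"
  shows "square_integrable M (skorokhod_sum f1 f2 t N)"
proof -
  obtain C1 where C1: "\<And>x. \<bar>f1 x\<bar> \<le> C1" using Cb_infinity_bounded[OF f(1)] by blast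
  obtain C2 where C2: "\<And>x. \<bar>f2 x\<bar> \<le> C2" using Cb_infinity_bounded[OF f(2)] by blast
  obtain C3 where C3: "\<And>x. \<bar>divg f1 f2 x\<bar> \<le> C3" using divg_Cb(2)[OF f] by blast
  have const: "square_integrable M (\<lambda>_. c :: real)" for c by (simp add: square_integrable_def)
  show ?thesis
    unfolding skorokhod_sum_def[abs_def]
    by (intro square_integrable_sum square_integrable_diff square_integrable_add
        square_integrable_bounded_mult[OF W_square_integrable(1) pt_measurable[OF f(1)] C1]
        square_integrable_bounded_mult[OF W_square_integrable(2) pt_measurable[OF f(2)] C2]
        square_integrable_bounded_mult[OF const divg_Cb(1)[OF f] C3])
qed

text \<open>Integration by parts is applied cell by cell, with direction (h, 0) for f1 and (0, h)
  for f2. The term in which the field is differentiated is exactly what the trace correction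
  subtracts.\<close>

lemma skorokhod_sum_duality:
  assumes f: "f1 \<in> Cb_infinity 2" "f2 \<in> Cb_infinity 2" and F: "smooth_cylindrical W1 W2 F U"
  shows "expectation (\<lambda>\<omega>. F \<omega> * skorokhod_sum f1 f2 t N \<omega>) =
    expectation (\<lambda>\<omega>. U \<omega> \<bullet> smooth_val (field_rep f1 f2 t N) \<omega>)"
proof -
  note sc = smooth_cylindrical_bounded[OF F]
  note [measurable] = sc(1,2) pt_measurable[OF f(1)] pt_measurable[OF f(2)]
  have p: "partial_deriv 0 f1 \<in> Cb_infinity 2" "partial_deriv 1 f1 \<in> Cb_infinity 2"
    "partial_deriv 0 f2 \<in> Cb_infinity 2" "partial_deriv 1 f2 \<in> Cb_infinity 2"
    using f by (auto intro!: Cb_infinity_partial_deriv)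
  note [measurable] = p[THEN pt_measurable]
  obtain C where C: "\<And>\<omega>. \<bar>F \<omega>\<bar> \<le> C" using sc(3) by blast
  obtain D where D: "\<And>\<omega>. norm (U \<omega>) \<le> D" using sc(4) by blast
  have bnd_int: "integrable M (\<lambda>\<omega>. g (pt s \<omega>) * X \<omega>)" if gX: "g \<in> Cb_infinity 2" "integrable M X" for g s X
  proof -
    obtain C where "\<And>x. \<bar>g x\<bar> \<le> C" using Cb_infinity_bounded[OF gX(1)] by blast
    then show ?thesis by (rule integrable_bounded_mult[OF gX(2) pt_measurable[OF gX(1)]])
  qed
  have F_int: "integrable M F"
    by (rule integrable_const_bound[of _ C]) (use C in auto)
  have FW_int: "integrable M (\<lambda>\<omega>. F \<omega> * X \<omega>)" if "integrable M X" for X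
    by (rule integrable_bounded_mult[OF that sc(1) C])
  have U_int: "integrable M (\<lambda>\<omega>. U \<omega> \<bullet> c)" for c
  proof (rule integrable_const_bound[of _ "D * norm c"])
    show "AE \<omega> in M. norm (U \<omega> \<bullet> c) \<le> D * norm c"
    proof (rule AE_I2)
      fix \<omega>
      have "norm (U \<omega>) * norm c \<le> D * norm c" using D by (intro mult_right_mono) auto
      then show "norm (U \<omega> \<bullet> c) \<le> D * norm c"
        using Cauchy_Schwarz_ineq2[of "U \<omega>" c] by simp
    qed
  qed simp
  have W_int: "integrable M (\<lambda>\<omega>. W1 h \<omega> + W2 k \<omega>)" for h k using W_integrable by simp
  have term1: "expectation (\<lambda>\<omega>. F \<omega> * (f1 (pt s \<omega>) * W1 h \<omega> + f2 (pt s \<omega>) * W2 h \<omega> - divg f1 f2 (pt s \<omega>) * (e s \<bullet> h))) =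
      expectation (\<lambda>\<omega>. U \<omega> \<bullet> (f1 (pt s \<omega>) *\<^sub>R h, f2 (pt s \<omega>) *\<^sub>R h))" for s h
  proof -
    define A1 where "A1 \<omega> = (W1 h \<omega> + W2 0 \<omega>) * (F \<omega> * f1 (pt s \<omega>))" for \<omega>
    define A2 where "A2 \<omega> = (W1 0 \<omega> + W2 h \<omega>) * (F \<omega> * f2 (pt s \<omega>))" for \<omega>
    define B1 where "B1 \<omega> = f1 (pt s \<omega>) * (U \<omega> \<bullet> (h, 0))" for \<omega>
    define B2 where "B2 \<omega> = f2 (pt s \<omega>) * (U \<omega> \<bullet> (0, h))" for \<omega>
    define D1 where "D1 \<omega> = F \<omega> * (partial_deriv 0 f1 (pt s \<omega>) * (e s \<bullet> h))" for \<omega>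
    define D2 where "D2 \<omega> = F \<omega> * (partial_deriv 1 f2 (pt s \<omega>) * (e s \<bullet> h))" for \<omega>
    have intA: "integrable M A1" "integrable M A2"
      using FW_int[OF bnd_int[OF f(1) W_int[of h 0], of s]] FW_int[OF bnd_int[OF f(2) W_int[of 0 h], of s]]
      unfolding A1_def A2_def by (simp_all add: mult_ac)
    have intB: "integrable M B1" "integrable M B2"
      unfolding B1_def B2_def by (intro bnd_int f U_int)+
    have intD: "integrable M D1" "integrable M D2"
      unfolding D1_def D2_def by (intro FW_int bnd_int p; simp)+
    have "expectation A1 = expectation B1 + expectation D1"
      using cylindrical_ibp[OF F f(1), of h 0 s] intB intD
      by (simp add: A1_def[abs_def] B1_def[symmetric] D1_def[symmetric])
    moreover have "expectation A2 = expectation B2 + expectation D2"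
    proof -
      have "(\<lambda>\<omega>. f2 (pt s \<omega>) * (U \<omega> \<bullet> (0, h)) + F \<omega> * (partial_deriv 0 f2 (pt s \<omega>) * (e s \<bullet> 0) +
          partial_deriv 1 f2 (pt s \<omega>) * (e s \<bullet> h))) = (\<lambda>\<omega>. B2 \<omega> + D2 \<omega>)"
        by (simp add: B2_def D2_def)
      then show ?thesis
        using cylindrical_ibp[OF F f(2), of 0 h s] intB intD by (simp add: A2_def[abs_def])
    qed
    moreover have "expectation (\<lambda>\<omega>. F \<omega> * (f1 (pt s \<omega>) * W1 h \<omega> + f2 (pt s \<omega>) * W2 h \<omega> - divg f1 f2 (pt s \<omega>) * (e s \<bullet> h))) =
        expectation (\<lambda>\<omega>. A1 \<omega> + A2 \<omega> - (D1 \<omega> + D2 \<omega>))"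
    proof (rule integral_cong_AE)
      show "AE \<omega> in M. F \<omega> * (f1 (pt s \<omega>) * W1 h \<omega> + f2 (pt s \<omega>) * W2 h \<omega> - divg f1 f2 (pt s \<omega>) * (e s \<bullet> h)) =
          A1 \<omega> + A2 \<omega> - (D1 \<omega> + D2 \<omega>)"
        using W_zero by eventually_elim (simp add: A1_def A2_def D1_def D2_def divg_def algebra_simps)
      show "(\<lambda>\<omega>. A1 \<omega> + A2 \<omega> - (D1 \<omega> + D2 \<omega>)) \<in> borel_measurable M"
        using intA intD by simp
      show "(\<lambda>\<omega>. F \<omega> * (f1 (pt s \<omega>) * W1 h \<omega> + f2 (pt s \<omega>) * W2 h \<omega> - divg f1 f2 (pt s \<omega>) * (e s \<bullet> h))) \<in> borel_measurable M"
        unfolding divg_def by measurable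
    qed
    moreover have "(\<lambda>\<omega>. U \<omega> \<bullet> (f1 (pt s \<omega>) *\<^sub>R h, f2 (pt s \<omega>) *\<^sub>R h)) = (\<lambda>\<omega>. B1 \<omega> + B2 \<omega>)"
      unfolding B1_def B2_def by (auto simp: inner_prod_def)
    ultimately show ?thesis using intA intB intD by simp
  qed
  have intT: "integrable M (\<lambda>\<omega>. F \<omega> * (f1 (pt s \<omega>) * W1 h \<omega> + f2 (pt s \<omega>) * W2 h \<omega> - divg f1 f2 (pt s \<omega>) * (e s \<bullet> h)))" for s h
    unfolding divg_def distrib_right
    by (intro FW_int Bochner_Integration.integrable_diff Bochner_Integration.integrable_add bnd_int f p W_integrable) simp_all
  have intU: "integrable M (\<lambda>\<omega>. U \<omega> \<bullet> (f1 (pt s \<omega>) *\<^sub>R h, f2 (pt s \<omega>) *\<^sub>R h))" for s h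
  proof -
    have "(\<lambda>\<omega>. U \<omega> \<bullet> (f1 (pt s \<omega>) *\<^sub>R h, f2 (pt s \<omega>) *\<^sub>R h)) =
        (\<lambda>\<omega>. f1 (pt s \<omega>) * (U \<omega> \<bullet> (h, 0)) + f2 (pt s \<omega>) * (U \<omega> \<bullet> (0, h)))"
      by (auto simp: inner_prod_def)
    then show ?thesis by (simp only:) (intro Bochner_Integration.integrable_add bnd_int f U_int)
  qed
  have val: "smooth_val (field_rep f1 f2 t N) \<omega> = (\<Sum>k<2 ^ N. (f1 (pt (grid t N k) \<omega>) *\<^sub>R incr t N k, f2 (pt (grid t N k) \<omega>) *\<^sub>R incr t N k))" for \<omega>
    by (simp add: smooth_val_field_rep left_sum_def sum_prod)
  show ?thesis
    unfolding val skorokhod_sum_def sum_distrib_left inner_sum_right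
    by (subst (1 2) Bochner_Integration.integral_sum) (simp_all only: intT intU term1)
qed

lemma W_increment_fourth:
  assumes "0 \<le> s" "0 \<le> r"
  shows "integrable M (\<lambda>\<omega>. (W1 (e r) \<omega> - W1 (e s) \<omega>) ^ 4)" "integrable M (\<lambda>\<omega>. (W2 (e r) \<omega> - W2 (e s) \<omega>) ^ 4)"
    "expectation (\<lambda>\<omega>. (W1 (e r) \<omega> - W1 (e s) \<omega>) ^ 4) = 3 * \<bar>r - s\<bar> powr (4 * H)"
    "expectation (\<lambda>\<omega>. (W2 (e r) \<omega> - W2 (e s) \<omega>) ^ 4) = 3 * \<bar>r - s\<bar> powr (4 * H)"
proof -
  have ae1: "AE \<omega> in M. W1 (e r - e s) \<omega> ^ 4 = (W1 (e r) \<omega> - W1 (e s) \<omega>) ^ 4"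
    using W_diff(1)[of "e r" "e s"] by eventually_elim simp
  have ae2: "AE \<omega> in M. W2 (e r - e s) \<omega> ^ 4 = (W2 (e r) \<omega> - W2 (e s) \<omega>) ^ 4"
    using W_diff(2)[of "e r" "e s"] by eventually_elim simp
  show "integrable M (\<lambda>\<omega>. (W1 (e r) \<omega> - W1 (e s) \<omega>) ^ 4)"
    by (rule integrable_cong_AE_imp[OF W_moment(1) _ ae1]) simp
  show "integrable M (\<lambda>\<omega>. (W2 (e r) \<omega> - W2 (e s) \<omega>) ^ 4)"
    by (rule integrable_cong_AE_imp[OF W_moment(2) _ ae2]) simp
  have n: "norm (e r - e s) ^ 4 = \<bar>r - s\<bar> powr (4 * H)"
    unfolding fbm_increment_norm[OF assms]
    by (simp add: power4_eq_xxxx powr_add[symmetric])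
  have "fact (2 * 2) / (2 ^ 2 * fact 2) = (3::real)" by (simp add: fact_numeral)
  note m = W_moment(3)[of "e r - e s" 2, unfolded this] W_moment(4)[of "e r - e s" 2, unfolded this]
  have "expectation (\<lambda>\<omega>. W1 (e r - e s) \<omega> ^ 4) = expectation (\<lambda>\<omega>. (W1 (e r) \<omega> - W1 (e s) \<omega>) ^ 4)"
    by (rule integral_cong_AE[OF _ _ ae1]) simp_all
  then show "expectation (\<lambda>\<omega>. (W1 (e r) \<omega> - W1 (e s) \<omega>) ^ 4) = 3 * \<bar>r - s\<bar> powr (4 * H)"
    using m(1) n by simp
  have "expectation (\<lambda>\<omega>. W2 (e r - e s) \<omega> ^ 4) = expectation (\<lambda>\<omega>. (W2 (e r) \<omega> - W2 (e s) \<omega>) ^ 4)"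
    by (rule integral_cong_AE[OF _ _ ae2]) simp_all
  then show "expectation (\<lambda>\<omega>. (W2 (e r) \<omega> - W2 (e s) \<omega>) ^ 4) = 3 * \<bar>r - s\<bar> powr (4 * H)"
    using m(2) n by simp
qed


text \<open>Let m be the midpoint of the cell from s to r. First order terms over the left half
  cancel, and what remains is a product of two increments or a difference of trace terms. The latter
  splits into the change of \<open>divg\<close> and the scalar product of the two half
  increments.\<close>

lemma skorokhod_sum_refine_AE:
  assumes t: "0 \<le> t"
  shows "AE \<omega> in M. skorokhod_sum f1 f2 t (Suc N) \<omega> - skorokhod_sum f1 f2 t N \<omega> =
    (\<Sum>k<2 ^ N. let s = grid t N k; m = grid t (Suc N) (2 * k + 1); r = grid t N (Suc k) in
      (f1 (pt m \<omega>) - f1 (pt s \<omega>)) * (W1 (e r) \<omega> - W1 (e m) \<omega>) +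
      (f2 (pt m \<omega>) - f2 (pt s \<omega>)) * (W2 (e r) \<omega> - W2 (e m) \<omega>) -
      (divg f1 f2 (pt m \<omega>) - divg f1 f2 (pt s \<omega>)) * (e m \<bullet> (e r - e m)) -
      divg f1 f2 (pt s \<omega>) * ((e m - e s) \<bullet> (e r - e m)))"
proof -
  have "AE \<omega> in M. \<forall>N k. W1 (incr t N k) \<omega> = W1 (e (grid t N (Suc k))) \<omega> - W1 (e (grid t N k)) \<omega>"
    "AE \<omega> in M. \<forall>N k. W2 (incr t N k) \<omega> = W2 (e (grid t N (Suc k))) \<omega> - W2 (e (grid t N k)) \<omega>"
    unfolding AE_all_countable incr_def using W_diff by auto
  then show ?thesis
  proof eventually_elim
    case (elim \<omega>)
    define T where "T N k = f1 (pt (grid t N k) \<omega>) * W1 (incr t N k) \<omega> +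
     f2 (pt (grid t N k) \<omega>) * W2 (incr t N k) \<omega> -
     divg f1 f2 (pt (grid t N k) \<omega>) * (e (grid t N k) \<bullet> incr t N k)" for N k
    have g: "grid t (Suc N) (2 * k) = grid t N k" "grid t (Suc N) (Suc (Suc (2 * k))) = grid t N (Suc k)" for k
      by (simp_all add: grid_def field_simps)
    have "skorokhod_sum f1 f2 t (Suc N) \<omega> = (\<Sum>j<2 * 2 ^ N. T (Suc N) j)"
      by (simp add: skorokhod_sum_def T_def)
    also have "\<dots> = (\<Sum>k<2 ^ N. T (Suc N) (2 * k) + T (Suc N) (2 * k + 1))"
      by (rule sum_lessThan_double)
    finally have "skorokhod_sum f1 f2 t (Suc N) \<omega> - skorokhod_sum f1 f2 t N \<omega> =
        (\<Sum>k<2 ^ N. T (Suc N) (2 * k) + T (Suc N) (2 * k + 1) - T N k)"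
      by (simp add: skorokhod_sum_def T_def[of N] sum_subtractf)
    also have "\<dots> = (\<Sum>k<2 ^ N. let s = grid t N k; m = grid t (Suc N) (2 * k + 1); r = grid t N (Suc k) in
      (f1 (pt m \<omega>) - f1 (pt s \<omega>)) * (W1 (e r) \<omega> - W1 (e m) \<omega>) +
      (f2 (pt m \<omega>) - f2 (pt s \<omega>)) * (W2 (e r) \<omega> - W2 (e m) \<omega>) -
      (divg f1 f2 (pt m \<omega>) - divg f1 f2 (pt s \<omega>)) * (e m \<bullet> (e r - e m)) -
      divg f1 f2 (pt s \<omega>) * ((e m - e s) \<bullet> (e r - e m)))"
    proof (intro sum.cong refl)
      fix k
      show "T (Suc N) (2 * k) + T (Suc N) (2 * k + 1) - T N k =
        (let s = grid t N k; m = grid t (Suc N) (2 * k + 1); r = grid t N (Suc k) in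
        (f1 (pt m \<omega>) - f1 (pt s \<omega>)) * (W1 (e r) \<omega> - W1 (e m) \<omega>) +
        (f2 (pt m \<omega>) - f2 (pt s \<omega>)) * (W2 (e r) \<omega> - W2 (e m) \<omega>) -
        (divg f1 f2 (pt m \<omega>) - divg f1 f2 (pt s \<omega>)) * (e m \<bullet> (e r - e m)) -
        divg f1 f2 (pt s \<omega>) * ((e m - e s) \<bullet> (e r - e m)))"
        unfolding T_def Let_def
        unfolding elim(1)[rule_format] elim(2)[rule_format]
        unfolding incr_def
        by (simp add: g inner_diff_left inner_diff_right; simp add: algebra_simps)
    qed
    finally show ?case .
  qed
qed

text \<open>Every one of the \<open>2 ^ N\<close> terms has second moment of order \<Delta> to the
  power 4H. Bounding the square of the sum by \<open>2 ^ N\<close> times the sum of squares gives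
  \<open>4 ^ N\<close> times that order, hence the ratio \<open>2 powr (2 - 4 * H)\<close>, which is
  below 1 for H > 1/2.\<close>

lemma skorokhod_sum_increment:
  assumes f: "f1 \<in> Cb_infinity 2" "f2 \<in> Cb_infinity 2" and t: "0 \<le> t"
  shows "\<exists>K. \<forall>N. expectation (\<lambda>\<omega>. (skorokhod_sum f1 f2 t (Suc N) \<omega> - skorokhod_sum f1 f2 t N \<omega>)\<^sup>2) \<le> K * (2 powr (2 - 4 * H)) ^ N"
proof -
  obtain L1 where L1: "0 < L1" "\<And>x y. \<bar>f1 x - f1 y\<bar> \<le> L1 * (\<bar>x 0 - y 0\<bar> + \<bar>x 1 - y 1\<bar>)"
    using Cb_infinity_2_lipschitz[OF f(1)] by blast
  obtain L2 where L2: "0 < L2" "\<And>x y. \<bar>f2 x - f2 y\<bar> \<le> L2 * (\<bar>x 0 - y 0\<bar> + \<bar>x 1 - y 1\<bar>)"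
    using Cb_infinity_2_lipschitz[OF f(2)] by blast
  obtain L3 where L3: "0 \<le> L3" "\<And>x y. \<bar>divg f1 f2 x - divg f1 f2 y\<bar> \<le> L3 * (\<bar>x 0 - y 0\<bar> + \<bar>x 1 - y 1\<bar>)"
    using divg_Cb(3)[OF f] by blast
  obtain C where C: "\<And>x. \<bar>divg f1 f2 x\<bar> \<le> C" using divg_Cb(2)[OF f] by blast
  have C0: "0 \<le> C" using C[of undefined] by linarith
  define L where "L = L1 + L2"
  define h where "h = H * t powr (2 * H - 1)"
  have h0: "0 \<le> h" using H_gt_half by (simp add: h_def)
  have L0: "0 \<le> L" using L1 L2 by (simp add: L_def)
  \<comment> \<open>The factor 3 comes from squaring three terms. Four fourth moments, each 3 times
    \<Delta> to the power 4H, give 4 * 12 = 48. The variation of the trace factor is of order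
    \<Delta> to the power 2 + 2H, which is absorbed with \<open>t powr (2 - 2 * H)\<close> because H
    < 1.\<close>
  define K where "K = 3 * (48 * L\<^sup>2 + 4 * (L3 * h)\<^sup>2 * t powr (2 - 2 * H) + C\<^sup>2)"
  have K0: "0 \<le> K" by (simp add: K_def)
  have main: "expectation (\<lambda>\<omega>. (skorokhod_sum f1 f2 t (Suc N) \<omega> - skorokhod_sum f1 f2 t N \<omega>)\<^sup>2) \<le>
      4 ^ N * (K * (t / 2 ^ Suc N) powr (4 * H))" for N
  proof -
    define s where "s k = grid t N k" for k
    define m where "m k = grid t (Suc N) (2 * k + 1)" for k
    define r where "r k = grid t N (Suc k)" for k
    define \<Delta> where "\<Delta> = t / 2 ^ Suc N"
    have \<Delta>: "0 \<le> \<Delta>" "\<Delta> \<le> t"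
    proof -
      show "0 \<le> \<Delta>" using t by (simp add: \<Delta>_def)
      have "t / 2 ^ Suc N \<le> t / 1" using t by (intro divide_left_mono one_le_power) auto
      then show "\<Delta> \<le> t" by (simp only: \<Delta>_def div_by_1)
    qed
    have sm: "m k - s k = \<Delta>" "r k - m k = \<Delta>" for k
      by (simp_all add: s_def m_def r_def \<Delta>_def grid_def field_simps)
    have pos: "0 \<le> s k" "0 \<le> m k" "0 \<le> r k" for k
      using t by (simp_all add: s_def m_def r_def grid_nonneg)
    have le: "s k \<le> m k" "m k \<le> r k" for k using sm[of k] \<Delta> by linarith+
    have rt: "r k \<le> t" if "k < 2 ^ N" for k
      unfolding r_def using t that by (intro grid_le) auto
    define X where "X k \<omega> = (f1 (pt (m k) \<omega>) - f1 (pt (s k) \<omega>)) * (W1 (e (r k)) \<omega> - W1 (e (m k)) \<omega>) +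
      (f2 (pt (m k) \<omega>) - f2 (pt (s k) \<omega>)) * (W2 (e (r k)) \<omega> - W2 (e (m k)) \<omega>) -
      (divg f1 f2 (pt (m k) \<omega>) - divg f1 f2 (pt (s k) \<omega>)) * (e (m k) \<bullet> (e (r k) - e (m k))) -
      divg f1 f2 (pt (s k) \<omega>) * ((e (m k) - e (s k)) \<bullet> (e (r k) - e (m k)))" for k \<omega>
    define R where "R k \<omega> = 3 * (4 * L\<^sup>2 * ((W1 (e (m k)) \<omega> - W1 (e (s k)) \<omega>) ^ 4 + (W2 (e (m k)) \<omega> - W2 (e (s k)) \<omega>) ^ 4 +
        (W1 (e (r k)) \<omega> - W1 (e (m k)) \<omega>) ^ 4 + (W2 (e (r k)) \<omega> - W2 (e (m k)) \<omega>) ^ 4) +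
      2 * (L3 * h * \<Delta>)\<^sup>2 * ((W1 (e (m k)) \<omega> - W1 (e (s k)) \<omega>)\<^sup>2 + (W2 (e (m k)) \<omega> - W2 (e (s k)) \<omega>)\<^sup>2) +
      (C * \<Delta> powr (2 * H))\<^sup>2)" for k \<omega>
    have X_le: "(X k \<omega>)\<^sup>2 \<le> R k \<omega>" if "k < 2 ^ N" for k \<omega>
    proof -
      define D1 where "D1 = \<bar>W1 (e (m k)) \<omega> - W1 (e (s k)) \<omega>\<bar>"
      define D2 where "D2 = \<bar>W2 (e (m k)) \<omega> - W2 (e (s k)) \<omega>\<bar>"
      define E1 where "E1 = \<bar>W1 (e (r k)) \<omega> - W1 (e (m k)) \<omega>\<bar>"
      define E2 where "E2 = \<bar>W2 (e (r k)) \<omega> - W2 (e (m k)) \<omega>\<bar>"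
      have nn: "0 \<le> D1" "0 \<le> D2" "0 \<le> E1" "0 \<le> E2" by (simp_all add: D1_def D2_def E1_def E2_def)
      have df: "\<bar>f1 (pt (m k) \<omega>) - f1 (pt (s k) \<omega>)\<bar> \<le> L * (D1 + D2)"
        "\<bar>f2 (pt (m k) \<omega>) - f2 (pt (s k) \<omega>)\<bar> \<le> L * (D1 + D2)"
        "\<bar>divg f1 f2 (pt (m k) \<omega>) - divg f1 f2 (pt (s k) \<omega>)\<bar> \<le> L3 * (D1 + D2)"
      proof -
        have "\<bar>f1 (pt (m k) \<omega>) - f1 (pt (s k) \<omega>)\<bar> \<le> L1 * (D1 + D2)"
          "\<bar>f2 (pt (m k) \<omega>) - f2 (pt (s k) \<omega>)\<bar> \<le> L2 * (D1 + D2)"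
          using L1(2)[of "pt (m k) \<omega>" "pt (s k) \<omega>"] L2(2)[of "pt (m k) \<omega>" "pt (s k) \<omega>"]
          by (simp_all add: pt_eq D1_def D2_def)
        moreover have "L1 * (D1 + D2) \<le> L * (D1 + D2)" "L2 * (D1 + D2) \<le> L * (D1 + D2)"
          using L1(1) L2(1) nn by (auto simp: L_def intro!: mult_right_mono)
        ultimately show "\<bar>f1 (pt (m k) \<omega>) - f1 (pt (s k) \<omega>)\<bar> \<le> L * (D1 + D2)"
          "\<bar>f2 (pt (m k) \<omega>) - f2 (pt (s k) \<omega>)\<bar> \<le> L * (D1 + D2)" by linarith+
        show "\<bar>divg f1 f2 (pt (m k) \<omega>) - divg f1 f2 (pt (s k) \<omega>)\<bar> \<le> L3 * (D1 + D2)"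
          using L3(2)[of "pt (m k) \<omega>" "pt (s k) \<omega>"] by (simp add: pt_eq D1_def D2_def)
      qed
      have i1: "\<bar>e (m k) \<bullet> (e (r k) - e (m k))\<bar> \<le> h * \<Delta>"
        using fbm_increment_inner_bound[OF pos(2) le(2) rt[OF that]] sm(2)[of k] by (simp add: h_def)
      have i2: "\<bar>(e (m k) - e (s k)) \<bullet> (e (r k) - e (m k))\<bar> \<le> \<Delta> powr (2 * H)"
      proof -
        have "\<bar>(e (m k) - e (s k)) \<bullet> (e (r k) - e (m k))\<bar> \<le> norm (e (m k) - e (s k)) * norm (e (r k) - e (m k))"
          by (rule Cauchy_Schwarz_ineq2)
        also have "\<dots> = \<Delta> powr (2 * H)"
          using \<Delta> by (simp add: fbm_increment_norm pos sm powr_add[symmetric])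
        finally show ?thesis .
      qed
      have "\<bar>X k \<omega>\<bar> \<le> \<bar>(f1 (pt (m k) \<omega>) - f1 (pt (s k) \<omega>)) * (W1 (e (r k)) \<omega> - W1 (e (m k)) \<omega>)\<bar> +
          \<bar>(f2 (pt (m k) \<omega>) - f2 (pt (s k) \<omega>)) * (W2 (e (r k)) \<omega> - W2 (e (m k)) \<omega>)\<bar> +
          \<bar>(divg f1 f2 (pt (m k) \<omega>) - divg f1 f2 (pt (s k) \<omega>)) * (e (m k) \<bullet> (e (r k) - e (m k)))\<bar> +
          \<bar>divg f1 f2 (pt (s k) \<omega>) * ((e (m k) - e (s k)) \<bullet> (e (r k) - e (m k)))\<bar>"
        unfolding X_def by linarith
      also have "\<dots> \<le> (L * (D1 + D2)) * E1 + (L * (D1 + D2)) * E2 + (L3 * (D1 + D2)) * (h * \<Delta>) + C * \<Delta> powr (2 * H)"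
        unfolding abs_mult E1_def[symmetric] E2_def[symmetric]
        using df i1 i2 C[of "pt (s k) \<omega>"] nn L0 L3(1) C0
        by (intro add_mono mult_mono) auto
      also have "\<dots> = L * ((D1 + D2) * (E1 + E2)) + L3 * h * \<Delta> * (D1 + D2) + C * \<Delta> powr (2 * H)"
        by (simp add: algebra_simps)
      finally have "(X k \<omega>)\<^sup>2 \<le> (L * ((D1 + D2) * (E1 + E2)) + L3 * h * \<Delta> * (D1 + D2) + C * \<Delta> powr (2 * H))\<^sup>2"
        using power_mono[OF _ abs_ge_zero, of "X k \<omega>" _ 2] by simp
      also have "\<dots> \<le> 3 * ((L * ((D1 + D2) * (E1 + E2)))\<^sup>2 + (L3 * h * \<Delta> * (D1 + D2))\<^sup>2 + (C * \<Delta> powr (2 * H))\<^sup>2)"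
        by (rule sum3_power2_le)
      also have "\<dots> \<le> 3 * (4 * L\<^sup>2 * (D1 ^ 4 + D2 ^ 4 + E1 ^ 4 + E2 ^ 4) + 2 * (L3 * h * \<Delta>)\<^sup>2 * (D1\<^sup>2 + D2\<^sup>2) + (C * \<Delta> powr (2 * H))\<^sup>2)"
      proof (intro mult_left_mono add_mono order_refl)
        have "(L * ((D1 + D2) * (E1 + E2)))\<^sup>2 = L\<^sup>2 * ((D1 + D2) * (E1 + E2))\<^sup>2" by (rule power_mult_distrib)
        also have "\<dots> \<le> L\<^sup>2 * (4 * (D1 ^ 4 + D2 ^ 4 + E1 ^ 4 + E2 ^ 4))"
          by (intro mult_left_mono product_square_le_fourth_powers) simp
        also have "\<dots> = 4 * L\<^sup>2 * (D1 ^ 4 + D2 ^ 4 + E1 ^ 4 + E2 ^ 4)"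
          by (simp only: mult_ac)
        finally show "(L * ((D1 + D2) * (E1 + E2)))\<^sup>2 \<le> 4 * L\<^sup>2 * (D1 ^ 4 + D2 ^ 4 + E1 ^ 4 + E2 ^ 4)" .
        have "(L3 * h * \<Delta> * (D1 + D2))\<^sup>2 = (L3 * h * \<Delta>)\<^sup>2 * (D1 + D2)\<^sup>2" by (rule power_mult_distrib)
        also have "\<dots> \<le> (L3 * h * \<Delta>)\<^sup>2 * (2 * (D1\<^sup>2 + D2\<^sup>2))"
          by (intro mult_left_mono sum2_power2_le) simp
        also have "\<dots> = 2 * (L3 * h * \<Delta>)\<^sup>2 * (D1\<^sup>2 + D2\<^sup>2)"
          by (simp only: mult_ac)
        finally show "(L3 * h * \<Delta> * (D1 + D2))\<^sup>2 \<le> 2 * (L3 * h * \<Delta>)\<^sup>2 * (D1\<^sup>2 + D2\<^sup>2)" .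
      qed simp
      also have "\<dots> = R k \<omega>"
        by (simp add: R_def D1_def D2_def E1_def E2_def)
      finally show ?thesis .
    qed
    note w4 = W_increment_fourth[OF pos(1,2)] W_increment_fourth[OF pos(2,3)]
      and w2 = W_increment_square[OF pos(1,2)]
    have R_int: "integrable M (R k)" for k
      unfolding R_def[abs_def]
      by (intro integrable_mult_right Bochner_Integration.integrable_add w4(1,2,5,6) w2(1,2) integrable_const)
    have ER: "expectation (R k) \<le> K * \<Delta> powr (4 * H)" for k
    proof -
      have E_eq: "expectation (R k) = 3 * (4 * L\<^sup>2 * (12 * \<Delta> powr (4 * H)) + 2 * (L3 * h * \<Delta>)\<^sup>2 * (2 * \<Delta> powr (2 * H)) + (C * \<Delta> powr (2 * H))\<^sup>2)"
        unfolding R_def[abs_def] using \<Delta>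
        by (simp add: w4 w2 sm prob_space)
      have C_eq: "(C * \<Delta> powr (2 * H))\<^sup>2 = C\<^sup>2 * \<Delta> powr (4 * H)"
        by (simp add: power_mult_distrib power2_eq_square[of "\<Delta> powr _"] powr_add[symmetric])
      have mid: "(L3 * h * \<Delta>)\<^sup>2 * (2 * \<Delta> powr (2 * H)) \<le> (L3 * h)\<^sup>2 * (2 * (t powr (2 - 2 * H) * \<Delta> powr (4 * H)))"
      proof -
        have "\<Delta>\<^sup>2 * \<Delta> powr (2 * H) \<le> t powr (2 - 2 * H) * \<Delta> powr (4 * H)"
        proof (cases "\<Delta> = 0")
          case False
          then have "0 < \<Delta>" using \<Delta> by simp
          then have "\<Delta>\<^sup>2 * \<Delta> powr (2 * H) = \<Delta> powr (2 - 2 * H) * \<Delta> powr (4 * H)"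
            by (simp add: powr_numeral[symmetric] powr_add[symmetric] add.commute del: powr_numeral)
          also have "\<dots> \<le> t powr (2 - 2 * H) * \<Delta> powr (4 * H)"
            using \<Delta> H_less_1 by (intro mult_right_mono powr_mono2) auto
          finally show ?thesis .
        qed simp
        then have "(L3 * h)\<^sup>2 * (2 * (\<Delta>\<^sup>2 * \<Delta> powr (2 * H))) \<le> (L3 * h)\<^sup>2 * (2 * (t powr (2 - 2 * H) * \<Delta> powr (4 * H)))"
          by (intro mult_left_mono) auto
        then show ?thesis by (simp add: power_mult_distrib mult_ac)
      qed
      have "expectation (R k) = 3 * (4 * L\<^sup>2 * (12 * \<Delta> powr (4 * H)) + 2 * ((L3 * h * \<Delta>)\<^sup>2 * (2 * \<Delta> powr (2 * H))) + C\<^sup>2 * \<Delta> powr (4 * H))"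
        unfolding E_eq C_eq by simp
      also have "\<dots> \<le> 3 * (4 * L\<^sup>2 * (12 * \<Delta> powr (4 * H)) + 2 * ((L3 * h)\<^sup>2 * (2 * (t powr (2 - 2 * H) * \<Delta> powr (4 * H)))) + C\<^sup>2 * \<Delta> powr (4 * H))"
        by (intro mult_left_mono add_mono mid order_refl) simp_all
      also have "\<dots> = K * \<Delta> powr (4 * H)"
        by (simp add: K_def algebra_simps)
      finally show ?thesis .
    qed
    have "expectation (\<lambda>\<omega>. (skorokhod_sum f1 f2 t (Suc N) \<omega> - skorokhod_sum f1 f2 t N \<omega>)\<^sup>2) \<le>
        expectation (\<lambda>\<omega>. real (2 ^ N) * (\<Sum>k<2 ^ N. R k \<omega>))"
    proof (rule integral_mono_AE)
      show "integrable M (\<lambda>\<omega>. (skorokhod_sum f1 f2 t (Suc N) \<omega> - skorokhod_sum f1 f2 t N \<omega>)\<^sup>2)"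
        using square_integrable_diff[OF skorokhod_sum_square_integrable[OF f] skorokhod_sum_square_integrable[OF f], of t "Suc N" t N]
        by (simp add: square_integrable_def)
      show "integrable M (\<lambda>\<omega>. real (2 ^ N) * (\<Sum>k<2 ^ N. R k \<omega>))"
        by (intro integrable_mult_right Bochner_Integration.integrable_sum R_int)
      show "AE \<omega> in M. (skorokhod_sum f1 f2 t (Suc N) \<omega> - skorokhod_sum f1 f2 t N \<omega>)\<^sup>2 \<le> real (2 ^ N) * (\<Sum>k<2 ^ N. R k \<omega>)"
        using skorokhod_sum_refine_AE[OF t, of f1 f2 N]
      proof eventually_elim
        case (elim \<omega>)
        then have eq: "skorokhod_sum f1 f2 t (Suc N) \<omega> - skorokhod_sum f1 f2 t N \<omega> = (\<Sum>k<2 ^ N. X k \<omega>)"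
          by (simp add: X_def s_def m_def r_def Let_def)
        have "(\<Sum>k<2 ^ N. X k \<omega>)\<^sup>2 \<le> real (2 ^ N) * (\<Sum>k<2 ^ N. (X k \<omega>)\<^sup>2)"
          by (rule sum_power2_le)
        also have "\<dots> \<le> real (2 ^ N) * (\<Sum>k<2 ^ N. R k \<omega>)"
          by (intro mult_left_mono sum_mono X_le) auto
        finally show ?case unfolding eq .
      qed
    qed
    also have "\<dots> = 2 ^ N * (\<Sum>k<2 ^ N. expectation (R k))"
      by (simp add: R_int Bochner_Integration.integral_sum)
    also have "\<dots> \<le> 2 ^ N * (\<Sum>k<(2::nat) ^ N. K * \<Delta> powr (4 * H))"
      by (intro mult_left_mono sum_mono ER) auto
    also have "\<dots> = 4 ^ N * (K * \<Delta> powr (4 * H))"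
      by (simp add: power_mult_distrib[symmetric])
    finally show ?thesis by (simp add: \<Delta>_def)
  qed
  have "4 ^ N * (K * (t / 2 ^ Suc N) powr (4 * H)) \<le> K * t powr (4 * H) * (2 powr (2 - 4 * H)) ^ N" for N
  proof -
    have "(t / 2 ^ Suc N) powr (4 * H) \<le> (t / 2 ^ N) powr (4 * H)"
      using t H_gt_half by (intro powr_mono2 divide_left_mono) auto
    also have "\<dots> = t powr (4 * H) * (2 powr (- (4 * H))) ^ N"
      using t by (simp add: powr_divide powr_realpow[symmetric] powr_powr powr_minus_divide field_simps)
    finally have "4 ^ N * (K * (t / 2 ^ Suc N) powr (4 * H)) \<le> 4 ^ N * (K * (t powr (4 * H) * (2 powr (- (4 * H))) ^ N))"
      using K0 by (intro mult_left_mono) auto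
    also have "\<dots> = K * t powr (4 * H) * (4 * 2 powr (- (4 * H))) ^ N"
      by (simp add: power_mult_distrib)
    also have "4 * 2 powr (- (4 * H)) = 2 powr (2 - 4 * H)"
      by (simp add: powr_diff powr_minus_divide)
    finally show ?thesis .
  qed
  with main show ?thesis by (intro exI[of _ "K * t powr (4 * H)"] allI) (rule order_trans)
qed


section \<open>Riemann sums as functionals of the path\<close>

abbreviation \<G> :: "'a measure" where "\<G> \<equiv> generated_algebra M B"

lemma B_measurable [measurable]:
  assumes "0 \<le> s" shows "B s \<in> borel_measurable M"
proof -
  have "gaussian_process M (\<lambda>t \<omega>. Re (B t \<omega>))" "gaussian_process M (\<lambda>t \<omega>. Im (B t \<omega>))"
    using fbm by (auto simp: complex_fbm_def real_fbm_def)
  from this[unfolded gaussian_process_def, rule_format, of "{s}" "\<lambda>_. 1"] assms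
  have "(\<lambda>\<omega>. Re (B s \<omega>)) \<in> borel_measurable M" "(\<lambda>\<omega>. Im (B s \<omega>)) \<in> borel_measurable M"
    by (auto simp: gaussian_rv_def)
  then show ?thesis by (simp add: borel_measurable_complex_iff)
qed

lemma B_measurable_generated:
  assumes "0 \<le> s" shows "B s \<in> borel_measurable \<G>"
proof -
  let ?f = "\<lambda>\<omega>. \<lambda>t\<in>{0..}. B t \<omega>"
  have "?f \<in> measurable \<G> (\<Pi>\<^sub>M t\<in>{0..}. borel)"
    unfolding generated_algebra_def
    by (rule measurable_vimage_algebra1) (auto simp: space_PiM)
  from measurable_compose[OF this measurable_component_singleton[of s]] assms show ?thesis by simp
qed

lemma continuous_paths: "AE \<omega> in M. continuous_on {0..} (\<lambda>t. B t \<omega>)"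
proof -
  have "AE \<omega> in M. continuous_on {0..} (\<lambda>t. Re (B t \<omega>))" "AE \<omega> in M. continuous_on {0..} (\<lambda>t. Im (B t \<omega>))"
    using fbm by (auto simp: complex_fbm_def real_fbm_def)
  then show ?thesis
  proof eventually_elim
    case (elim \<omega>)
    then have "continuous_on {0..} (\<lambda>t. Complex (Re (B t \<omega>)) (Im (B t \<omega>)))"
      by (intro continuous_on_Complex)
    then show ?case by simp
  qed
qed

text \<open>The centred coordinates of a point of the plane, in the format expected by functions in
  \<open>Cb_infinity 2\<close>. On a grid they agree almost surely with \<open>pt\<close>.\<close>

definition coords :: "complex \<Rightarrow> nat \<Rightarrow> real" where
  "coords z = (\<lambda>i. if even i then Re z - Re z0 else Im z - Im z0)"

lemma coords_continuous: "continuous_on UNIV coords"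
  unfolding coords_def
proof (rule continuous_on_coordinatewise_then_product)
  show "continuous_on UNIV (\<lambda>z. if even i then Re z - Re z0 else Im z - Im z0)" for i
    by (cases "even i") (auto intro!: continuous_intros)
qed

text \<open>The version of \<open>skorokhod_sum\<close> built from the values of B itself. Its limit
  is measurable with respect to the generated algebra, as required of a divergence;
  \<open>W1\<close> and \<open>W2\<close> are mere versions and need not be.\<close>

definition path_sum :: "((nat \<Rightarrow> real) \<Rightarrow> real) \<Rightarrow> ((nat \<Rightarrow> real) \<Rightarrow> real) \<Rightarrow> real \<Rightarrow> nat \<Rightarrow> 'a \<Rightarrow> real" where
  "path_sum f1 f2 t N \<omega> = (\<Sum>k<2 ^ N.
     f1 (coords (B (grid t N k) \<omega>)) * (Re (B (grid t N (Suc k)) \<omega>) - Re (B (grid t N k) \<omega>)) +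
     f2 (coords (B (grid t N k) \<omega>)) * (Im (B (grid t N (Suc k)) \<omega>) - Im (B (grid t N k) \<omega>)) -
     divg f1 f2 (coords (B (grid t N k) \<omega>)) * (e (grid t N k) \<bullet> incr t N k))"

lemma grid_AE:
  assumes t: "0 \<le> t"
  shows "AE \<omega> in M. \<forall>N k. pt (grid t N k) \<omega> = coords (B (grid t N k) \<omega>) \<and>
    W1 (incr t N k) \<omega> = Re (B (grid t N (Suc k)) \<omega>) - Re (B (grid t N k) \<omega>) \<and>
    W2 (incr t N k) \<omega> = Im (B (grid t N (Suc k)) \<omega>) - Im (B (grid t N k) \<omega>)"
  unfolding AE_all_countable
proof (intro allI)
  fix N k
  have g: "0 \<le> grid t N k" "0 \<le> grid t N (Suc k)" using t by (auto intro: grid_nonneg)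
  show "AE \<omega> in M. pt (grid t N k) \<omega> = coords (B (grid t N k) \<omega>) \<and>
    W1 (incr t N k) \<omega> = Re (B (grid t N (Suc k)) \<omega>) - Re (B (grid t N k) \<omega>) \<and>
    W2 (incr t N k) \<omega> = Im (B (grid t N (Suc k)) \<omega>) - Im (B (grid t N k) \<omega>)"
    using W_at[OF g(1)] W_at[OF g(2)] W_diff[of "e (grid t N (Suc k))" "e (grid t N k)"]
    by eventually_elim (auto simp: incr_def coords_def pt_eq fun_eq_iff)
qed

lemma skorokhod_sum_AE:
  assumes t: "0 \<le> t"
  shows "AE \<omega> in M. \<forall>N. skorokhod_sum f1 f2 t N \<omega> = path_sum f1 f2 t N \<omega>"
  using grid_AE[OF t] by eventually_elim (simp add: skorokhod_sum_def path_sum_def)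

lemma path_sum_measurable:
  assumes f: "f1 \<in> Cb_infinity 2" "f2 \<in> Cb_infinity 2" and t: "0 \<le> t"
    and K: "\<And>s. 0 \<le> s \<Longrightarrow> B s \<in> borel_measurable K"
  shows "path_sum f1 f2 t N \<in> borel_measurable K"
proof -
  have m: "(\<lambda>\<omega>. g (coords (B (grid t N k) \<omega>))) \<in> borel_measurable K" if "g \<in> Cb_infinity 2" for g k
    using measurable_compose[OF measurable_compose[OF K[OF grid_nonneg[OF t]] borel_measurable_continuous_onI[OF coords_continuous]]
      Cb_infinity_borel[OF that]] .
  have p: "partial_deriv 0 f1 \<in> Cb_infinity 2" "partial_deriv 1 f2 \<in> Cb_infinity 2"
    using f by (auto intro!: Cb_infinity_partial_deriv)
  note [measurable] = m[OF f(1)] m[OF f(2)] m[OF p(1)] m[OF p(2)] K[OF grid_nonneg[OF t]]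
  show ?thesis unfolding path_sum_def[abs_def] divg_def by measurable
qed

lemma smooth_val_AE:
  assumes t: "0 \<le> t"
  shows "AE \<omega> in M. \<forall>N. smooth_val (field_rep f1 f2 t N) \<omega> =
    (left_sum (\<lambda>s. f1 (coords (B s \<omega>))) t N, left_sum (\<lambda>s. f2 (coords (B s \<omega>))) t N)"
  using grid_AE[OF t] by eventually_elim (simp add: smooth_val_field_rep left_sum_def)

lemma left_sum_path_convergent:
  assumes f: "f \<in> Cb_infinity 2" and t: "0 \<le> t" and \<omega>: "continuous_on {0..} (\<lambda>t. B t \<omega>)"
  shows "convergent (left_sum (\<lambda>s. f (coords (B s \<omega>))) t)"
proof (rule left_sum_convergent[OF t])
  have "continuous_on {0..t} (\<lambda>t. B t \<omega>)" by (rule continuous_on_subset[OF \<omega>]) auto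
  then have "continuous_on {0..t} (\<lambda>s. coords (B s \<omega>))"
    by (rule continuous_on_compose2[OF coords_continuous]) auto
  then show "continuous_on {0..t} (\<lambda>s. f (coords (B s \<omega>)))"
    by (rule continuous_on_compose2[OF Cb_infinity_continuous[OF f]]) auto
qed

text \<open>Continuous paths give pointwise convergence in the Hilbert space, and the supremum bound
  on left sums is uniform in N and \<omega>, so dominated convergence applies.\<close>

lemma smooth_val_L2:
  assumes f: "f1 \<in> Cb_infinity 2" "f2 \<in> Cb_infinity 2" and t: "0 \<le> t"
  shows "AE \<omega> in M. (\<lambda>N. smooth_val (field_rep f1 f2 t N) \<omega>) \<longlonglongrightarrow> lim (\<lambda>N. smooth_val (field_rep f1 f2 t N) \<omega>)"
    and "L2_tendsto M (\<lambda>N. smooth_val (field_rep f1 f2 t N)) (\<lambda>\<omega>. lim (\<lambda>N. smooth_val (field_rep f1 f2 t N) \<omega>))"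
proof -
  show conv: "AE \<omega> in M. (\<lambda>N. smooth_val (field_rep f1 f2 t N) \<omega>) \<longlonglongrightarrow> lim (\<lambda>N. smooth_val (field_rep f1 f2 t N) \<omega>)"
    using smooth_val_AE[OF t, of f1 f2] continuous_paths
  proof eventually_elim
    case (elim \<omega>)
    have "convergent (\<lambda>N. smooth_val (field_rep f1 f2 t N) \<omega>)"
      unfolding elim(1)[rule_format]
      using left_sum_path_convergent[OF f(1) t elim(2)] left_sum_path_convergent[OF f(2) t elim(2)]
      unfolding convergent_def by (blast intro: tendsto_Pair)
    then show ?case by (simp add: convergent_LIMSEQ_iff)
  qed
  note [measurable] = pt_measurable[OF f(1)] pt_measurable[OF f(2)]
  have [measurable]: "smooth_val (field_rep f1 f2 t N) \<in> borel_measurable M" for N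
    unfolding smooth_val_field_rep[abs_def] left_sum_def by measurable
  have lim_m [measurable]: "(\<lambda>\<omega>. lim (\<lambda>N. smooth_val (field_rep f1 f2 t N) \<omega>)) \<in> borel_measurable M"
    by measurable
  obtain C1 where C1: "\<And>x. \<bar>f1 x\<bar> \<le> C1" using Cb_infinity_bounded[OF f(1)] by blast
  obtain C2 where C2: "\<And>x. \<bar>f2 x\<bar> \<le> C2" using Cb_infinity_bounded[OF f(2)] by blast
  define D where "D = C1 * t powr H + C2 * t powr H"
  have bnd: "norm (smooth_val (field_rep f1 f2 t N) \<omega>) \<le> D" for N \<omega>
    unfolding smooth_val_field_rep left_sum_def D_def
    by (intro order_trans[OF norm_Pair_le] add_mono norm_sum_incr_le t C1 C2)
  have bnd_lim: "AE \<omega> in M. norm (lim (\<lambda>N. smooth_val (field_rep f1 f2 t N) \<omega>)) \<le> D"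
    using conv
  proof eventually_elim
    case (elim \<omega>)
    show ?case by (rule LIMSEQ_le_const2[OF tendsto_norm[OF elim]]) (use bnd in auto)
  qed
  have D0: "0 \<le> D" using bnd[of 0 undefined] norm_ge_zero order_trans by blast
  have sq: "square_integrable M (smooth_val (field_rep f1 f2 t N))" for N
    unfolding square_integrable_def
  proof
    show "integrable M (\<lambda>\<omega>. (norm (smooth_val (field_rep f1 f2 t N) \<omega>))\<^sup>2)"
    proof (rule integrable_const_bound[of _ "D\<^sup>2"])
      show "AE \<omega> in M. norm ((norm (smooth_val (field_rep f1 f2 t N) \<omega>))\<^sup>2) \<le> D\<^sup>2"
        using power_mono[OF bnd norm_ge_zero, of N _ 2] by simp
    qed simp
  qed simp
  have sq_lim: "square_integrable M (\<lambda>\<omega>. lim (\<lambda>N. smooth_val (field_rep f1 f2 t N) \<omega>))"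
    unfolding square_integrable_def
  proof
    show "integrable M (\<lambda>\<omega>. (norm (lim (\<lambda>N. smooth_val (field_rep f1 f2 t N) \<omega>)))\<^sup>2)"
    proof (rule integrable_const_bound[of _ "D\<^sup>2"])
      show "AE \<omega> in M. norm ((norm (lim (\<lambda>N. smooth_val (field_rep f1 f2 t N) \<omega>)))\<^sup>2) \<le> D\<^sup>2"
        using bnd_lim by eventually_elim (simp add: power_mono)
    qed simp
  qed simp
  have "(\<lambda>N. \<integral>\<omega>. (norm (smooth_val (field_rep f1 f2 t N) \<omega> - lim (\<lambda>N. smooth_val (field_rep f1 f2 t N) \<omega>)))\<^sup>2 \<partial>M) \<longlonglongrightarrow> (\<integral>\<omega>. 0 \<partial>M)"
  proof (rule integral_dominated_convergence[where w="\<lambda>_. (2 * D)\<^sup>2"])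
    show "AE \<omega> in M. (\<lambda>N. (norm (smooth_val (field_rep f1 f2 t N) \<omega> - lim (\<lambda>N. smooth_val (field_rep f1 f2 t N) \<omega>)))\<^sup>2) \<longlonglongrightarrow> 0"
      using conv
    proof eventually_elim
      case (elim \<omega>)
      have "(\<lambda>N. norm (smooth_val (field_rep f1 f2 t N) \<omega> - lim (\<lambda>N. smooth_val (field_rep f1 f2 t N) \<omega>))) \<longlonglongrightarrow> 0"
        by (rule tendsto_norm_zero) (rule LIM_zero[OF elim])
      from tendsto_power[OF this, of 2] show ?case by simp
    qed
    show "AE \<omega> in M. norm ((norm (smooth_val (field_rep f1 f2 t N) \<omega> - lim (\<lambda>N. smooth_val (field_rep f1 f2 t N) \<omega>)))\<^sup>2) \<le> (2 * D)\<^sup>2" for N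
      using bnd_lim
    proof eventually_elim
      case (elim \<omega>)
      have "norm (smooth_val (field_rep f1 f2 t N) \<omega> - lim (\<lambda>N. smooth_val (field_rep f1 f2 t N) \<omega>)) \<le> 2 * D"
        by (rule order_trans[OF norm_triangle_ineq4]) (use bnd[of N \<omega>] elim in linarith)
      from power_mono[OF this norm_ge_zero, of 2] show ?case by simp
    qed
  qed simp_all
  then show "L2_tendsto M (\<lambda>N. smooth_val (field_rep f1 f2 t N)) (\<lambda>\<omega>. lim (\<lambda>N. smooth_val (field_rep f1 f2 t N) \<omega>))"
    using sq sq_lim by (simp add: L2_tendsto_def)
qed

lemma field_D12:
  assumes f: "f1 \<in> Cb_infinity 2" "f2 \<in> Cb_infinity 2" and t: "0 \<le> t"
  shows "(\<lambda>\<omega>. lim (\<lambda>N. smooth_val (field_rep f1 f2 t N) \<omega>)) \<in> D12_H2 M W1 W2"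
proof -
  obtain C where C: "0 \<le> C" "\<And>N d. (\<integral>\<^sup>+ \<omega>. ennreal (deriv_normsq (smooth_diff (field_rep f1 f2 t (N + d)) (field_rep f1 f2 t N)) \<omega>) \<partial>M)
     \<le> ennreal (C * (t / 2 ^ N) powr (2 * H))"
    using deriv_normsq_field_rep[OF f t] by blast
  have cauchy: "\<exists>N. \<forall>m\<ge>N. \<forall>n\<ge>N. (\<integral>\<^sup>+ \<omega>. ennreal (deriv_normsq (smooth_diff (field_rep f1 f2 t m) (field_rep f1 f2 t n)) \<omega>) \<partial>M) < ennreal \<epsilon>"
    if "0 < \<epsilon>" for \<epsilon>
  proof -
    have "(\<lambda>N. C * (t * (1 / 2) ^ N) powr (2 * H)) \<longlonglongrightarrow> C * (t * 0) powr (2 * H)"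
      using H_gt_half t by (intro tendsto_intros LIMSEQ_power_zero) (auto intro!: always_eventually)
    then have "\<forall>\<^sub>F N in sequentially. C * (t * (1 / 2) ^ N) powr (2 * H) < \<epsilon>"
      using that by (intro order_tendstoD(2)) auto
    then obtain N where N: "C * (t / 2 ^ N) powr (2 * H) < \<epsilon>"
      unfolding eventually_sequentially by (auto simp: power_one_over)
    have small: "C * (t / 2 ^ n) powr (2 * H) < \<epsilon>" if "N \<le> n" for n
    proof -
      have "C * (t / 2 ^ n) powr (2 * H) \<le> C * (t / 2 ^ N) powr (2 * H)"
        using t C(1) H_gt_half that by (intro mult_left_mono powr_mono2 divide_left_mono) auto
      then show ?thesis using N by simp
    qed
    have one: "(\<integral>\<^sup>+ \<omega>. ennreal (deriv_normsq (smooth_diff (field_rep f1 f2 t m) (field_rep f1 f2 t n)) \<omega>) \<partial>M) < ennreal \<epsilon>"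
      if "N \<le> n" "n \<le> m" for m n
    proof -
      from le_Suc_ex[OF that(2)] obtain d where m: "m = n + d" ..
      show ?thesis
        unfolding m by (rule le_less_trans[OF C(2)]) (use small[OF that(1)] C(1) in \<open>simp add: ennreal_less_iff\<close>)
    qed
    show ?thesis
    proof (intro exI allI impI)
      fix m n assume "N \<le> m" "N \<le> n"
      then show "(\<integral>\<^sup>+ \<omega>. ennreal (deriv_normsq (smooth_diff (field_rep f1 f2 t m) (field_rep f1 f2 t n)) \<omega>) \<partial>M) < ennreal \<epsilon>"
        using one[of n m] one[of m n] deriv_normsq_commute[of "field_rep f1 f2 t m" "field_rep f1 f2 t n"]
        by (cases "n \<le> m") auto
    qed
  qed
  show ?thesis
    unfolding D12_H2_def mem_Collect_eq
    by (intro exI[of _ "field_rep f1 f2 t"] conjI allI impI field_rep_smooth[OF f] smooth_val_L2(2)[OF f t] cauchy)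
qed

text \<open>The duality passes to the limit twice: in the grid level for a fixed cylindrical F, then
  along cylindrical variables that approximate F together with its derivative. The limits are also
  identified pathwise, which is what localization compares.\<close>

theorem field_divergence:
  assumes f: "f1 \<in> Cb_infinity 2" "f2 \<in> Cb_infinity 2" and t: "0 \<le> t"
  obtains v Y where "v \<in> D12_H2 M W1 W2" "has_divergence M \<G> W1 W2 v Y"
    "AE \<omega> in M. (\<lambda>N. (left_sum (\<lambda>s. f1 (coords (B s \<omega>))) t N, left_sum (\<lambda>s. f2 (coords (B s \<omega>))) t N)) \<longlonglongrightarrow> v \<omega>"
    "AE \<omega> in M. (\<lambda>N. path_sum f1 f2 t N \<omega>) \<longlonglongrightarrow> Y \<omega>"
proof -
  define v where "v \<omega> = lim (\<lambda>N. smooth_val (field_rep f1 f2 t N) \<omega>)" for \<omega>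
  define Y where "Y \<omega> = lim (\<lambda>N. path_sum f1 f2 t N \<omega>)" for \<omega>
  have v_L2: "L2_tendsto M (\<lambda>N. smooth_val (field_rep f1 f2 t N)) v"
    unfolding v_def by (rule smooth_val_L2(2)[OF f t])
  have v_D12: "v \<in> D12_H2 M W1 W2"
    unfolding v_def by (rule field_D12[OF f t])
  have v_lim: "AE \<omega> in M. (\<lambda>N. (left_sum (\<lambda>s. f1 (coords (B s \<omega>))) t N, left_sum (\<lambda>s. f2 (coords (B s \<omega>))) t N)) \<longlonglongrightarrow> v \<omega>"
    using smooth_val_L2(1)[OF f t] smooth_val_AE[OF t, of f1 f2] by eventually_elim (simp add: v_def)
  obtain K where K: "\<And>N. expectation (\<lambda>\<omega>. (skorokhod_sum f1 f2 t (Suc N) \<omega> - skorokhod_sum f1 f2 t N \<omega>)\<^sup>2) \<le> K * (2 powr (2 - 4 * H)) ^ N"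
    using skorokhod_sum_increment[OF f t] by blast
  have q: "0 < 2 powr (2 - 4 * H)" "2 powr (2 - 4 * H) < 1"
    using H_gt_half powr_less_mono[of "2 - 4 * H" 0 2] by auto
  note geo = L2_tendsto_geometric[OF skorokhod_sum_square_integrable[OF f] K q]
  have Y_lim: "AE \<omega> in M. (\<lambda>N. path_sum f1 f2 t N \<omega>) \<longlonglongrightarrow> Y \<omega>"
    using geo(1) skorokhod_sum_AE[OF t, of f1 f2]
    by eventually_elim (simp add: Y_def convergent_LIMSEQ_iff)
  have Y_G: "Y \<in> borel_measurable \<G>"
    unfolding Y_def
    by (intro borel_measurable_lim_metric path_sum_measurable[OF f t B_measurable_generated])
  have [measurable]: "Y \<in> borel_measurable M"
    unfolding Y_def
    by (intro borel_measurable_lim_metric path_sum_measurable[OF f t B_measurable])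
  have Y_L2: "L2_tendsto M (skorokhod_sum f1 f2 t) Y"
  proof (rule geo(2))
    show "AE \<omega> in M. (\<lambda>N. skorokhod_sum f1 f2 t N \<omega>) \<longlonglongrightarrow> Y \<omega>"
      using Y_lim skorokhod_sum_AE[OF t, of f1 f2] by eventually_elim simp
  qed simp
  have sqY: "square_integrable M Y" and sqv: "square_integrable M v"
    using Y_L2 v_L2 by (auto simp: L2_tendsto_def)
  have smooth: "expectation (\<lambda>\<omega>. F \<omega> * Y \<omega>) = expectation (\<lambda>\<omega>. U \<omega> \<bullet> v \<omega>)"
    if FU: "smooth_cylindrical W1 W2 F U" for F U
  proof -
    note sq = smooth_cylindrical_square_integrable[OF FU]
    have "(\<lambda>N. expectation (\<lambda>\<omega>. skorokhod_sum f1 f2 t N \<omega> \<bullet> F \<omega>)) \<longlonglongrightarrow> expectation (\<lambda>\<omega>. Y \<omega> \<bullet> F \<omega>)"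
      by (rule L2_tendsto_inner[OF Y_L2 sq(1)])
    moreover have "(\<lambda>N. expectation (\<lambda>\<omega>. smooth_val (field_rep f1 f2 t N) \<omega> \<bullet> U \<omega>)) \<longlonglongrightarrow> expectation (\<lambda>\<omega>. v \<omega> \<bullet> U \<omega>)"
      by (rule L2_tendsto_inner[OF v_L2 sq(2)])
    moreover have "expectation (\<lambda>\<omega>. skorokhod_sum f1 f2 t N \<omega> \<bullet> F \<omega>) =
        expectation (\<lambda>\<omega>. smooth_val (field_rep f1 f2 t N) \<omega> \<bullet> U \<omega>)" for N
      using skorokhod_sum_duality[OF f FU, of t N] by (simp add: inner_commute mult.commute)
    ultimately have "expectation (\<lambda>\<omega>. Y \<omega> \<bullet> F \<omega>) = expectation (\<lambda>\<omega>. v \<omega> \<bullet> U \<omega>)"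
      by (simp only:) (rule LIMSEQ_unique)
    then show ?thesis by (simp add: inner_commute mult.commute)
  qed
  have "has_divergence M \<G> W1 W2 v Y"
    unfolding has_divergence_def
  proof (intro conjI sqv sqY Y_G allI impI)
    fix F U assume "malliavin_deriv M W1 W2 F U"
    then obtain Fs Us where FU: "\<And>n. smooth_cylindrical W1 W2 (Fs n) (Us n)" "L2_tendsto M Fs F" "L2_tendsto M Us U"
      unfolding malliavin_deriv_def by blast
    have "(\<lambda>n. expectation (\<lambda>\<omega>. Fs n \<omega> \<bullet> Y \<omega>)) \<longlonglongrightarrow> expectation (\<lambda>\<omega>. F \<omega> \<bullet> Y \<omega>)"
      by (rule L2_tendsto_inner[OF FU(2) sqY])
    moreover have "(\<lambda>n. expectation (\<lambda>\<omega>. Us n \<omega> \<bullet> v \<omega>)) \<longlonglongrightarrow> expectation (\<lambda>\<omega>. U \<omega> \<bullet> v \<omega>)"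
      by (rule L2_tendsto_inner[OF FU(3) sqv])
    moreover have "expectation (\<lambda>\<omega>. Fs n \<omega> \<bullet> Y \<omega>) = expectation (\<lambda>\<omega>. Us n \<omega> \<bullet> v \<omega>)" for n
      using smooth[OF FU(1)[of n]] by simp
    ultimately have "expectation (\<lambda>\<omega>. F \<omega> \<bullet> Y \<omega>) = expectation (\<lambda>\<omega>. U \<omega> \<bullet> v \<omega>)"
      by (simp only:) (rule LIMSEQ_unique)
    then show "expectation (\<lambda>\<omega>. F \<omega> * Y \<omega>) = expectation (\<lambda>\<omega>. U \<omega> \<bullet> v \<omega>)" by simp
  qed
  then show thesis by (rule that[OF v_D12 _ v_lim Y_lim])
qed

end

section \<open>Logarithms of Hoelder paths\<close>

text \<open>The deterministic half of the Kolmogorov continuity criterion. A point is reached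
  through its dyadic roundings, whose steps form a geometric series, and two points are compared at
  the level of their distance.\<close>

lemma dyadic_hoelder:
  fixes f :: "real \<Rightarrow> 'b::real_normed_vector"
  assumes T: "0 < T" and cont: "continuous_on {0..T} f" and \<gamma>: "0 < \<gamma>" and C: "0 \<le> C"
    and inc: "\<And>N k. k < 2 ^ N \<Longrightarrow> norm (f (grid T N (Suc k)) - f (grid T N k)) \<le> C * (2 powr (- \<gamma>)) ^ N"
  shows "\<exists>K\<ge>0. \<forall>s\<in>{0..T}. \<forall>t\<in>{0..T}. norm (f t - f s) \<le> K * \<bar>t - s\<bar> powr \<gamma>"
proof -
  define q where "q = 2 powr (- \<gamma>)"
  have q: "0 < q" "q < 1" using \<gamma> powr_less_mono[of "- \<gamma>" 0 2] by (auto simp: q_def)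
  \<comment> \<open>The index of the grid point of level n obtained by rounding x down.\<close>
  define j where "j x n = nat \<lfloor>x * 2 ^ n / T\<rfloor>" for x n
  have j_real: "real (j x n) = of_int \<lfloor>x * 2 ^ n / T\<rfloor>" if "0 \<le> x" for x n
    using that T by (simp add: j_def)
  have j_bounds: "grid T n (j x n) \<le> x" "x - T / 2 ^ n < grid T n (j x n)" if "0 \<le> x" for x n
  proof -
    have "real (j x n) \<le> x * 2 ^ n / T" "x * 2 ^ n / T < real (j x n) + 1"
      unfolding j_real[OF that] by linarith+
    then have "real (j x n) * (T / 2 ^ n) \<le> x" "x < (real (j x n) + 1) * (T / 2 ^ n)"
      using T by (simp_all add: pos_le_divide_eq pos_divide_le_eq pos_less_divide_eq pos_divide_less_eq mult.commute)
    then show "grid T n (j x n) \<le> x" "x - T / 2 ^ n < grid T n (j x n)"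
      by (simp_all add: grid_def distrib_right add_divide_distrib)
  qed
  have j_le: "j x n \<le> 2 ^ n" if "x \<in> {0..T}" for x n
  proof -
    have "x * 2 ^ n / T \<le> 2 ^ n" using that T by (simp add: divide_le_eq)
    moreover have "real (j x n) \<le> x * 2 ^ n / T" using j_real[of x n] that by simp
    ultimately have "real (j x n) \<le> 2 ^ n" by linarith
    then show ?thesis by (metis of_nat_le_iff of_nat_numeral of_nat_power)
  qed
  have j_Suc: "j x (Suc n) = 2 * j x n \<or> j x (Suc n) = Suc (2 * j x n)" if "0 \<le> x" for x n
  proof -
    define y where "y = x * 2 ^ n / T"
    have "0 \<le> y" using that T by (simp add: y_def)
    have "x * 2 ^ Suc n / T = 2 * y" by (simp add: y_def)
    moreover have "\<lfloor>2 * y\<rfloor> = 2 * \<lfloor>y\<rfloor> \<or> \<lfloor>2 * y\<rfloor> = 2 * \<lfloor>y\<rfloor> + 1" by linarith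
    moreover have "0 \<le> \<lfloor>y\<rfloor>" using \<open>0 \<le> y\<close> by simp
    ultimately show ?thesis unfolding j_def y_def[symmetric] by (auto simp: nat_mult_distrib nat_add_distrib)
  qed
  have step: "norm (f (grid T (Suc n) (j x (Suc n))) - f (grid T n (j x n))) \<le> C * q ^ Suc n" if x: "x \<in> {0..T}" for x n
  proof -
    have g: "grid T (Suc n) (2 * j x n) = grid T n (j x n)" by (simp add: grid_def)
    from j_Suc[of x n] x consider "j x (Suc n) = 2 * j x n" | "j x (Suc n) = Suc (2 * j x n)" by auto
    then show ?thesis
    proof cases
      case 1
      then show ?thesis using C q by (simp add: g)
    next
      case 2
      then have "2 * j x n < 2 ^ Suc n" using j_le[OF x, of "Suc n"] by simp
      from inc[OF this] show ?thesis by (simp only: 2 g q_def)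
    qed
  qed
  have chain: "norm (f (grid T (n + m) (j x (n + m))) - f (grid T n (j x n))) \<le> C * q ^ n * (\<Sum>i<m. q ^ Suc i)"
    if x: "x \<in> {0..T}" for x n m
  proof (induction m)
    case (Suc m)
    have "norm (f (grid T (n + Suc m) (j x (n + Suc m))) - f (grid T n (j x n))) \<le>
        norm (f (grid T (Suc (n + m)) (j x (Suc (n + m)))) - f (grid T (n + m) (j x (n + m)))) +
        norm (f (grid T (n + m) (j x (n + m))) - f (grid T n (j x n)))"
      using norm_triangle_ineq[of "f (grid T (Suc (n + m)) (j x (Suc (n + m)))) - f (grid T (n + m) (j x (n + m)))"
          "f (grid T (n + m) (j x (n + m))) - f (grid T n (j x n))"] by simp
    also have "\<dots> \<le> C * q ^ Suc (n + m) + C * q ^ n * (\<Sum>i<m. q ^ Suc i)"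
      by (rule add_mono[OF step[OF x] Suc])
    also have "\<dots> = C * q ^ n * (\<Sum>i<Suc m. q ^ Suc i)" by (simp add: power_add algebra_simps)
    finally show ?case .
  qed simp
  have geo: "(\<Sum>i<m. q ^ Suc i) \<le> 1 / (1 - q)" for m
  proof -
    have "(\<Sum>i<m. q ^ Suc i) \<le> (\<Sum>i<m. q ^ i)" using q by (intro sum_mono power_decreasing) auto
    also have "\<dots> \<le> (\<Sum>i. q ^ i)" using q by (intro sum_le_suminf summable_geometric) auto
    also have "\<dots> = 1 / (1 - q)" using q by (simp add: suminf_geometric)
    finally show ?thesis .
  qed
  have approx: "norm (f x - f (grid T n (j x n))) \<le> C * q ^ n / (1 - q)" if x: "x \<in> {0..T}" for x n
  proof -
    have "(\<lambda>m. grid T (n + m) (j x (n + m))) \<longlonglongrightarrow> x"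
    proof (rule tendsto_sandwich)
      show "\<forall>\<^sub>F m in sequentially. x - T / 2 ^ (n + m) \<le> grid T (n + m) (j x (n + m))"
        "\<forall>\<^sub>F m in sequentially. grid T (n + m) (j x (n + m)) \<le> x"
        using j_bounds[of x] x by (auto intro!: always_eventually less_imp_le)
      have "(\<lambda>m. x - T / 2 ^ n * (1 / 2) ^ m) \<longlonglongrightarrow> x - T / 2 ^ n * 0"
        by (intro tendsto_intros LIMSEQ_power_zero) simp
      then show "(\<lambda>m. x - T / 2 ^ (n + m)) \<longlonglongrightarrow> x"
        by (simp add: power_add power_one_over field_simps)
    qed simp
    moreover have "grid T (n + m) (j x (n + m)) \<in> {0..T}" for m
      using T j_bounds(1)[of x "n + m"] x grid_nonneg[of T "n + m"] by auto
    ultimately have "(\<lambda>m. f (grid T (n + m) (j x (n + m)))) \<longlonglongrightarrow> f x"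
      using cont x by (intro continuous_on_tendsto_compose[OF cont]) auto
    then have lim: "(\<lambda>m. norm (f (grid T (n + m) (j x (n + m))) - f (grid T n (j x n)))) \<longlonglongrightarrow> norm (f x - f (grid T n (j x n)))"
      by (intro tendsto_intros)
    have "norm (f (grid T (n + m) (j x (n + m))) - f (grid T n (j x n))) \<le> C * q ^ n / (1 - q)" for m
    proof -
      have "C * q ^ n * (\<Sum>i<m. q ^ Suc i) \<le> C * q ^ n * (1 / (1 - q))"
        using C q by (intro mult_left_mono geo) auto
      then show ?thesis using chain[OF x, of n m] by simp
    qed
    then show ?thesis by (intro LIMSEQ_le_const2[OF lim]) auto
  qed
  \<comment> \<open>One step of size C q^n between the two roundings and two chains of length C q^n
    / (1 - q), where q^n is at most the \<gamma>-th power of 2 (t - s) / T.\<close>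
  define K where "K = C * (1 + 2 / (1 - q)) * (2 / T) powr \<gamma>"
  have K0: "0 \<le> K" using C q by (simp add: K_def)
  have main: "norm (f t - f s) \<le> K * (t - s) powr \<gamma>" if st: "s \<in> {0..T}" "t \<in> {0..T}" "s < t" for s t
  proof -
    define A where "A = {n::nat. t - s \<le> T / 2 ^ n}"
    have "0 \<in> A" using st by (simp add: A_def)
    have "\<exists>n. T / (t - s) < 2 ^ n" using real_arch_pow[of 2 "T / (t - s)"] by auto
    then obtain n0 where n0: "T / 2 ^ n0 < t - s" using st by (auto simp: field_simps)
    have "n < n0" if "n \<in> A" for n
    proof (rule ccontr)
      assume "\<not> n < n0"
      then have "T / 2 ^ n \<le> T / 2 ^ n0" using T by (intro divide_left_mono) auto
      then show False using that n0 by (simp add: A_def)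
    qed
    then have fin: "finite A" by (meson finite_nat_set_iff_bounded)
    \<comment> \<open>Cells of level n are at least as long as t - s and shorter than twice that.
      The roundings of s and t at this level are therefore equal or adjacent, and q^n is comparable
      with the \<gamma>-th power of t - s.\<close>
    define n where "n = Max A"
    have "n \<in> A" unfolding n_def using fin \<open>0 \<in> A\<close> by (intro Max_in) auto
    have "Suc n \<notin> A" using Max_ge[OF fin, of "Suc n"] by (auto simp: n_def)
    have n1: "t - s \<le> T / 2 ^ n" and n2: "T / 2 ^ n < 2 * (t - s)"
      using \<open>n \<in> A\<close> \<open>Suc n \<notin> A\<close> by (auto simp: A_def)
    have "j t n = j s n \<or> j t n = Suc (j s n)"
    proof -
      have "s * 2 ^ n / T \<le> t * 2 ^ n / T" using st T by (intro divide_right_mono mult_right_mono) auto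
      moreover have "t * 2 ^ n / T \<le> s * 2 ^ n / T + 1" using n1 T by (simp add: field_simps)
      ultimately have "\<lfloor>t * 2 ^ n / T\<rfloor> = \<lfloor>s * 2 ^ n / T\<rfloor> \<or> \<lfloor>t * 2 ^ n / T\<rfloor> = \<lfloor>s * 2 ^ n / T\<rfloor> + 1" by linarith
      moreover have "0 \<le> \<lfloor>s * 2 ^ n / T\<rfloor>" using st T by simp
      ultimately show ?thesis unfolding j_def by (auto simp: nat_add_distrib)
    qed
    then have mid: "norm (f (grid T n (j t n)) - f (grid T n (j s n))) \<le> C * q ^ n"
    proof
      assume eq: "j t n = Suc (j s n)"
      then have "j s n < 2 ^ n" using j_le[OF st(2), of n] by simp
      from inc[OF this] show ?thesis by (simp only: eq q_def)
    qed (use C q in simp)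
    have "f t - f s = (f t - f (grid T n (j t n))) + (f (grid T n (j t n)) - f (grid T n (j s n))) - (f s - f (grid T n (j s n)))"
      by simp
    also have "norm \<dots> \<le> norm (f t - f (grid T n (j t n))) + norm (f (grid T n (j t n)) - f (grid T n (j s n))) + norm (f s - f (grid T n (j s n)))"
      by (rule order_trans[OF norm_triangle_ineq4 add_right_mono[OF norm_triangle_ineq]])
    also have "\<dots> \<le> C * q ^ n / (1 - q) + C * q ^ n + C * q ^ n / (1 - q)"
      by (intro add_mono approx st mid)
    also have "\<dots> = C * (1 + 2 / (1 - q)) * q ^ n" by (simp only: divide_inverse) (simp add: algebra_simps)
    also have "\<dots> \<le> C * (1 + 2 / (1 - q)) * ((2 / T) powr \<gamma> * (t - s) powr \<gamma>)"
    proof (rule mult_left_mono)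
      have "q ^ n = (1 / 2 ^ n) powr \<gamma>"
        by (simp add: q_def powr_realpow[symmetric] powr_powr powr_divide powr_minus_divide mult.commute)
      also have "\<dots> \<le> (2 / T * (t - s)) powr \<gamma>"
        using n2 T \<gamma> by (intro powr_mono2) (auto simp: field_simps)
      also have "(2 / T * (t - s)) powr \<gamma> = (2 / T) powr \<gamma> * (t - s) powr \<gamma>"
        by (rule powr_mult)
      finally show "q ^ n \<le> (2 / T) powr \<gamma> * (t - s) powr \<gamma>" .
    qed (use C q in simp)
    finally show ?thesis by (simp add: K_def mult.assoc)
  qed
  show ?thesis
  proof (intro exI[of _ K] conjI K0 ballI)
    fix s t assume st: "s \<in> {0..T}" "t \<in> {0..T}"
    consider "s < t" | "t < s" | "s = t" by linarith
    then show "norm (f t - f s) \<le> K * \<bar>t - s\<bar> powr \<gamma>"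
      using main[OF st] main[OF st(2,1)] by cases (auto simp: norm_minus_commute)
  qed
qed

text \<open>Taylor's formula with remainder. For norm at most 1/4 the quadratic remainder is at most
  half of the norm of w, which can be absorbed to bound w by exp w - 1.\<close>

lemma exp_quadratic_bound:
  fixes w :: complex
  assumes "norm w \<le> 1 / 4"
  shows "norm (exp w - 1 - w) \<le> 2 * (norm w)\<^sup>2" "norm w \<le> 2 * norm (exp w - 1)"
proof -
  have "exp \<bar>Re w\<bar> \<le> 2"
  proof -
    have "\<bar>Re w\<bar> \<le> 1 / 4" using abs_Re_le_cmod[of w] assms by linarith
    then show ?thesis using exp_bound_half[of "\<bar>Re w\<bar>"] by simp
  qed
  have "norm (exp w - (\<Sum>i\<le>1. w ^ i / fact i)) \<le> exp \<bar>Re w\<bar> * norm w ^ Suc 1 / fact 1"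
    by (rule Taylor_exp)
  also have "\<dots> \<le> 2 * (norm w)\<^sup>2"
    using \<open>exp \<bar>Re w\<bar> \<le> 2\<close> by (simp add: power2_eq_square mult_right_mono)
  finally show 1: "norm (exp w - 1 - w) \<le> 2 * (norm w)\<^sup>2" by (simp add: diff_diff_eq)
  have "2 * (norm w)\<^sup>2 \<le> norm w / 2"
    using assms mult_right_mono[OF assms norm_ge_zero[of w]] by (simp add: power2_eq_square)
  moreover have "norm w \<le> norm (exp w - 1) + norm (exp w - 1 - w)"
    using norm_triangle_ineq4[of "exp w - 1" "exp w - 1 - w"] by simp
  ultimately show "norm w \<le> 2 * norm (exp w - 1)" using 1 by linarith
qed

text \<open>With w the increment of L from the tag x, exp w - 1 is the relative increment of g, of
  order \<gamma> since g stays away from 0 on the compact interval. Both ends are compared with the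
  tag, which may lie anywhere in the cell, as Riemann-Stieltjes sums demand.\<close>

lemma log_increment_bound:
  fixes g L :: "real \<Rightarrow> complex"
  assumes L: "continuous_on {0..t} L" and gL: "\<And>s. s \<in> {0..t} \<Longrightarrow> g s = z * exp (L s)" and z: "z \<noteq> 0"
    and hoelder: "\<And>r s. r \<in> {0..t} \<Longrightarrow> s \<in> {0..t} \<Longrightarrow> norm (g s - g r) \<le> C * \<bar>s - r\<bar> powr \<gamma>"
    and C: "0 \<le> C" and \<gamma>: "0 < \<gamma>"
  obtains K \<delta> where "0 \<le> K" "0 < \<delta>" "\<And>a b x. 0 \<le> a \<Longrightarrow> a \<le> x \<Longrightarrow> x \<le> b \<Longrightarrow> b \<le> t \<Longrightarrow> b - a < \<delta> \<Longrightarrow>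
    norm (1 / g x * (g b - g a) - (L b - L a)) \<le> K * (b - a) powr (2 * \<gamma>)"
proof (cases "0 \<le> t")
  case True
  have g_cont: "continuous_on {0..t} g"
  proof -
    have "continuous_on {0..t} (\<lambda>s. z * exp (L s))" by (intro continuous_intros L)
    then show ?thesis by (rule continuous_on_eq) (simp add: gL)
  qed
  have "\<exists>x\<in>{0..t}. \<forall>y\<in>{0..t}. norm (g x) \<le> norm (g y)"
    using True by (intro continuous_attains_inf continuous_intros g_cont) auto
  then obtain x0 where x0: "x0 \<in> {0..t}" "\<And>y. y \<in> {0..t} \<Longrightarrow> norm (g x0) \<le> norm (g y)" by blast
  define m where "m = norm (g x0)"
  have m: "0 < m" using gL[OF x0(1)] z by (simp add: m_def)
  have "uniformly_continuous_on {0..t} L" using L by (intro compact_uniformly_continuous) auto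
  then obtain \<delta> where \<delta>: "0 < \<delta>" "\<And>x y. x \<in> {0..t} \<Longrightarrow> y \<in> {0..t} \<Longrightarrow> dist y x < \<delta> \<Longrightarrow> dist (L y) (L x) < 1 / 4"
    \<comment> \<open>Below this mesh the increments of L have norm less than 1/4, the range of the
      exponential estimates.\<close>
    unfolding uniformly_continuous_on_def by (metis divide_pos_pos zero_less_numeral zero_less_one)
  have one: "norm ((g b - g x) / g x - (L b - L x)) \<le> 8 * C\<^sup>2 / m\<^sup>2 * \<bar>b - x\<bar> powr (2 * \<gamma>)"
    if bx: "b \<in> {0..t}" "x \<in> {0..t}" "\<bar>b - x\<bar> < \<delta>" for b x
  proof -
    define w where "w = L b - L x"
    have "norm w < 1 / 4" using \<delta>(2)[OF bx(2,1)] bx(3) by (simp add: w_def dist_norm)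
    then have w: "norm w \<le> 1 / 4" by simp
    have g0: "g x \<noteq> 0" using gL[OF bx(2)] z by simp
    have ew: "exp w - 1 = (g b - g x) / g x"
      using g0 z by (simp add: w_def exp_diff gL[OF bx(1)] gL[OF bx(2)] diff_divide_distrib)
    have "norm w \<le> 2 * (norm (g b - g x) / norm (g x))"
      using exp_quadratic_bound(2)[OF w] unfolding ew norm_divide .
    also have "\<dots> \<le> 2 * (C * \<bar>b - x\<bar> powr \<gamma> / m)"
      using hoelder[OF bx(2,1)] x0(2)[OF bx(2)] m C by (intro mult_left_mono frac_le) (auto simp: m_def)
    finally have "(norm w)\<^sup>2 \<le> (2 * (C * \<bar>b - x\<bar> powr \<gamma> / m))\<^sup>2" by (rule power_mono) simp
    also have "\<dots> = 4 * C\<^sup>2 / m\<^sup>2 * \<bar>b - x\<bar> powr (2 * \<gamma>)"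
      by (simp add: power_mult_distrib power_divide power2_eq_square[of "_ powr _"] powr_add[symmetric])
    finally have "2 * (norm w)\<^sup>2 \<le> 8 * C\<^sup>2 / m\<^sup>2 * \<bar>b - x\<bar> powr (2 * \<gamma>)" by simp
    then show ?thesis
      using exp_quadratic_bound(1)[OF w] unfolding ew by (simp add: w_def)
  qed
  show thesis
  proof (rule that[of "16 * C\<^sup>2 / m\<^sup>2" \<delta>])
    fix a b x assume ab: "0 \<le> a" "a \<le> x" "x \<le> b" "b \<le> t" "b - a < \<delta>"
    have "1 / g x * (g b - g a) - (L b - L a) = ((g b - g x) / g x - (L b - L x)) - ((g a - g x) / g x - (L a - L x))"
      by (simp add: diff_divide_distrib)
    also have "norm \<dots> \<le> norm ((g b - g x) / g x - (L b - L x)) + norm ((g a - g x) / g x - (L a - L x))"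
      by (rule norm_triangle_ineq4)
    also have "\<dots> \<le> 8 * C\<^sup>2 / m\<^sup>2 * \<bar>b - x\<bar> powr (2 * \<gamma>) + 8 * C\<^sup>2 / m\<^sup>2 * \<bar>a - x\<bar> powr (2 * \<gamma>)"
      using ab by (intro add_mono one) auto
    also have "\<dots> \<le> 8 * C\<^sup>2 / m\<^sup>2 * (b - a) powr (2 * \<gamma>) + 8 * C\<^sup>2 / m\<^sup>2 * (b - a) powr (2 * \<gamma>)"
      using ab \<gamma> by (intro add_mono mult_left_mono powr_mono2) auto
    finally show "norm (1 / g x * (g b - g a) - (L b - L a)) \<le> 16 * C\<^sup>2 / m\<^sup>2 * (b - a) powr (2 * \<gamma>)" by simp
  qed (use \<delta> in auto)
next
  case False
  then show thesis by (intro that[of 0 1]) auto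
qed

lemma powr_le_mult_powr:
  fixes x \<eta> p :: real
  assumes "0 \<le> x" "x \<le> \<eta>" "1 < p"
  shows "x powr p \<le> \<eta> powr (p - 1) * x"
proof (cases "x = 0")
  case False
  then have "x powr p = x powr (p - 1) * x" using assms by (simp add: powr_mult_base mult.commute)
  also have "\<dots> \<le> \<eta> powr (p - 1) * x" using assms by (intro mult_right_mono powr_mono2) auto
  finally show ?thesis .
qed simp

text \<open>The increments of L telescope exactly over any division, so only the errors of the cells
  matter. Each is at most a constant times the length to the power 2\<gamma>, hence at most \<eta>
  to the power 2\<gamma> - 1 times the length; the total tends to 0 with the mesh as 2\<gamma> > 1.
  The dyadic left sums obey the same estimate.\<close>

lemma has_RS_integral_log:
  fixes g L :: "real \<Rightarrow> complex"
  assumes t: "0 \<le> t" and L: "continuous_on {0..t} L" and gL: "\<And>s. s \<in> {0..t} \<Longrightarrow> g s = z * exp (L s)" and z: "z \<noteq> 0"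
    and hoelder: "\<And>r s. r \<in> {0..t} \<Longrightarrow> s \<in> {0..t} \<Longrightarrow> norm (g s - g r) \<le> C * \<bar>s - r\<bar> powr \<gamma>"
    and C: "0 \<le> C" and \<gamma>: "1 / 2 < \<gamma>"
  shows "has_RS_integral (\<lambda>s. 1 / g s) g 0 t (L t - L 0)"
    and "(\<lambda>N. \<Sum>k<2 ^ N. 1 / g (grid t N k) * (g (grid t N (Suc k)) - g (grid t N k))) \<longlonglongrightarrow> L t - L 0"
proof -
  have \<gamma>0: "0 < \<gamma>" using \<gamma> by simp
  obtain K \<delta> where K: "0 \<le> K" "0 < \<delta>" and bound: "\<And>a b x. 0 \<le> a \<Longrightarrow> a \<le> x \<Longrightarrow> x \<le> b \<Longrightarrow> b \<le> t \<Longrightarrow> b - a < \<delta> \<Longrightarrow>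
    norm (1 / g x * (g b - g a) - (L b - L a)) \<le> K * (b - a) powr (2 * \<gamma>)"
    using log_increment_bound[OF L gL z hoelder C \<gamma>0] by blast
  have lim: "((\<lambda>\<eta>. K * (\<eta> powr (2 * \<gamma> - 1) * t)) \<longlongrightarrow> 0) (at_right 0)"
  proof -
    have "((\<lambda>\<eta>::real. \<eta> powr (2 * \<gamma> - 1)) \<longlongrightarrow> 0 powr (2 * \<gamma> - 1)) (at_right 0)"
      using \<gamma> by (intro tendsto_powr') (auto simp: eventually_at_filter intro!: tendsto_ident_at)
    from tendsto_mult[OF tendsto_const[of K] tendsto_mult[OF this tendsto_const[of t]]] show ?thesis by simp
  qed
  have small: "\<exists>\<eta>. 0 < \<eta> \<and> \<eta> < \<delta> \<and> K * (\<eta> powr (2 * \<gamma> - 1) * t) < \<epsilon>" if "0 < \<epsilon>" for \<epsilon>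
  proof -
    have "\<forall>\<^sub>F \<eta> in at_right 0. K * (\<eta> powr (2 * \<gamma> - 1) * t) < \<epsilon>" using lim that by (rule order_tendstoD(2))
    moreover have "\<forall>\<^sub>F \<eta> in at_right 0. \<eta> < \<delta>" using order_tendstoD(2)[OF tendsto_ident_at K(2)] .
    moreover have "\<forall>\<^sub>F \<eta> in at_right (0::real). 0 < \<eta>" by (simp add: eventually_at_filter)
    ultimately have "\<forall>\<^sub>F \<eta> in at_right 0. 0 < \<eta> \<and> \<eta> < \<delta> \<and> K * (\<eta> powr (2 * \<gamma> - 1) * t) < \<epsilon>"
      by eventually_elim simp
    then show ?thesis using eventually_happens'[OF trivial_limit_at_right_real] by blast
  qed
  have cell: "norm (1 / g x * (g b - g a) - (L b - L a)) \<le> K * (\<eta> powr (2 * \<gamma> - 1) * (b - a))"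
    if "0 \<le> a" "a \<le> x" "x \<le> b" "b \<le> t" "b - a \<le> \<eta>" "\<eta> < \<delta>" for a b x \<eta>
  proof -
    have "K * (b - a) powr (2 * \<gamma>) \<le> K * (\<eta> powr (2 * \<gamma> - 1) * (b - a))"
      using that K \<gamma> by (intro mult_left_mono powr_le_mult_powr) auto
    then show ?thesis using bound[of a x b] that by simp
  qed
  show "has_RS_integral (\<lambda>s. 1 / g s) g 0 t (L t - L 0)"
    unfolding has_RS_integral_def
  proof (intro allI impI)
    fix \<epsilon> :: real assume "0 < \<epsilon>"
    then obtain \<eta> where \<eta>: "0 < \<eta>" "\<eta> < \<delta>" "K * (\<eta> powr (2 * \<gamma> - 1) * t) < \<epsilon>" using small by blast
    show "\<exists>\<eta>>0. \<forall>p. p tagged_division_of {0..t} \<longrightarrow> (\<forall>(x, K)\<in>p. diameter K < \<eta>) \<longrightarrow>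
        norm ((\<Sum>(x, K)\<in>p. 1 / g x * (g (Sup K) - g (Inf K))) - (L t - L 0)) < \<epsilon>"
    proof (intro exI[of _ \<eta>] conjI \<eta>(1) allI impI)
      fix p assume p: "p tagged_division_of {0..t}" and fine: "\<forall>(x, K)\<in>p. diameter K < \<eta>"
      have cellp: "norm (1 / g x * (g (Sup J) - g (Inf J)) - (L (Sup J) - L (Inf J))) \<le> K * (\<eta> powr (2 * \<gamma> - 1) * measure lborel J)"
        if "(x, J) \<in> p" for x J
      proof -
        from tagged_division_ofD(2-4)[OF p that] obtain a b where J: "J = cbox a b" "x \<in> J" "J \<subseteq> {0..t}" by blast
        then have ab: "a \<le> x" "x \<le> b" and J': "J = {a..b}" by auto
        then have abt: "0 \<le> a" "b \<le> t" using J(3) by auto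
        have "diameter J < \<eta>" using fine that by auto
        then have "b - a < \<eta>" using ab by (simp add: J' dist_real_def)
        then show ?thesis using cell[OF abt(1) ab abt(2), of \<eta>] \<eta>(2) ab by (simp add: J')
      qed
      have "(\<Sum>(x, J)\<in>p. 1 / g x * (g (Sup J) - g (Inf J))) - (L t - L 0) =
          (\<Sum>(x, J)\<in>p. 1 / g x * (g (Sup J) - g (Inf J))) - (\<Sum>(x, J)\<in>p. L (Sup J) - L (Inf J))"
        using additive_tagged_division_1[OF t p, of L] by simp
      also have "\<dots> = (\<Sum>(x, J)\<in>p. 1 / g x * (g (Sup J) - g (Inf J)) - (L (Sup J) - L (Inf J)))"
        by (simp add: sum_subtractf[symmetric] case_prod_unfold)
      also have "norm \<dots> \<le> (\<Sum>(x, J)\<in>p. K * (\<eta> powr (2 * \<gamma> - 1) * measure lborel J))"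
        by (rule sum_norm_le) (use cellp in auto)
      also have "\<dots> = K * (\<eta> powr (2 * \<gamma> - 1) * (\<Sum>(x, J)\<in>p. measure lborel J))"
        by (simp add: sum_distrib_left case_prod_unfold)
      also have "(\<Sum>(x, J)\<in>p. measure lborel J) = t"
        using additive_content_tagged_division[of p 0 t] p t by simp
      finally show "norm ((\<Sum>(x, K)\<in>p. 1 / g x * (g (Sup K) - g (Inf K))) - (L t - L 0)) < \<epsilon>"
        using \<eta>(3) by simp
    qed
  qed
  show "(\<lambda>N. \<Sum>k<2 ^ N. 1 / g (grid t N k) * (g (grid t N (Suc k)) - g (grid t N k))) \<longlonglongrightarrow> L t - L 0"
  proof (rule LIMSEQ_I)
    fix \<epsilon> :: real assume "0 < \<epsilon>"
    then obtain \<eta> where \<eta>: "0 < \<eta>" "\<eta> < \<delta>" "K * (\<eta> powr (2 * \<gamma> - 1) * t) < \<epsilon>" using small by blast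
    obtain N0 where N0: "t / \<eta> < 2 ^ N0" using real_arch_pow[of 2 "t / \<eta>"] by auto
    show "\<exists>N0. \<forall>N\<ge>N0. norm ((\<Sum>k<2 ^ N. 1 / g (grid t N k) * (g (grid t N (Suc k)) - g (grid t N k))) - (L t - L 0)) < \<epsilon>"
    proof (intro exI allI impI)
      fix N assume "N0 \<le> N"
      then have "(2::real) ^ N0 \<le> 2 ^ N" by simp
      then have "t / \<eta> < 2 ^ N" using N0 by linarith
      then have mesh: "t / 2 ^ N \<le> \<eta>" using \<eta>(1) by (simp add: field_simps)
      have tel: "(\<Sum>k<2 ^ N. L (grid t N (Suc k)) - L (grid t N k)) = L t - L 0"
        using sum_lessThan_telescope[of "\<lambda>k. L (grid t N k)" "2 ^ N"] by simp
      have "(\<Sum>k<2 ^ N. 1 / g (grid t N k) * (g (grid t N (Suc k)) - g (grid t N k))) - (L t - L 0) =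
          (\<Sum>k<2 ^ N. 1 / g (grid t N k) * (g (grid t N (Suc k)) - g (grid t N k)) - (L (grid t N (Suc k)) - L (grid t N k)))"
        unfolding tel[symmetric] by (simp add: sum_subtractf)
      also have "norm \<dots> \<le> (\<Sum>k<(2::nat) ^ N. K * (\<eta> powr (2 * \<gamma> - 1) * (t / 2 ^ N)))"
      proof (rule sum_norm_le)
        fix k :: nat assume "k \<in> {..<2 ^ N}"
        then have "grid t N (Suc k) \<le> t" using t by (intro grid_le) auto
        moreover have "grid t N k \<le> grid t N (Suc k)" using t by (intro grid_mono) auto
        ultimately show "norm (1 / g (grid t N k) * (g (grid t N (Suc k)) - g (grid t N k)) - (L (grid t N (Suc k)) - L (grid t N k)))
            \<le> K * (\<eta> powr (2 * \<gamma> - 1) * (t / 2 ^ N))"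
          using cell[of "grid t N k" "grid t N k" "grid t N (Suc k)" \<eta>] grid_nonneg[OF t] mesh \<eta>(2)
          by (simp add: grid_step)
      qed
      also have "\<dots> = K * (\<eta> powr (2 * \<gamma> - 1) * t)" by simp
      finally show "norm ((\<Sum>k<2 ^ N. 1 / g (grid t N k) * (g (grid t N (Suc k)) - g (grid t N k))) - (L t - L 0)) < \<epsilon>"
        using \<eta>(3) by simp
    qed
  qed
qed

section \<open>Path regularity and avoidance of the origin\<close>

text \<open>The first bound handles an arbitrary centre. The second expresses that a coordinate
  starting away from 0 seldom visits 0 while its variance is small.\<close>

lemma std_normal_density_le:
  "std_normal_density z \<le> 1" "z \<noteq> 0 \<Longrightarrow> std_normal_density z \<le> 2 / z\<^sup>2"
proof -
  have "1 \<le> sqrt (2 * pi)" using pi_ge_two by (simp add: real_le_rsqrt)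
  then have "std_normal_density z \<le> 1 * exp (- z\<^sup>2 / 2)"
    unfolding std_normal_density_def by (intro mult_right_mono) (auto simp: divide_le_eq)
  then have *: "std_normal_density z \<le> exp (- z\<^sup>2 / 2)" by simp
  have "exp (- z\<^sup>2 / 2) \<le> 1" by simp
  then show "std_normal_density z \<le> 1" using * by linarith
  assume z: "z \<noteq> 0"
  have "z\<^sup>2 / 2 \<le> exp (z\<^sup>2 / 2)" using exp_ge_add_one_self[of "z\<^sup>2 / 2"] by linarith
  then have "1 / exp (z\<^sup>2 / 2) \<le> 1 / (z\<^sup>2 / 2)" using z by (intro divide_left_mono) auto
  then have "exp (- z\<^sup>2 / 2) \<le> 2 / z\<^sup>2" by (simp add: exp_minus inverse_eq_divide)
  then show "std_normal_density z \<le> 2 / z\<^sup>2" using * by linarith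
qed

lemma (in isonormal) small_ball:
  assumes k: "k \<noteq> 0" and r: "0 \<le> r"
    and D: "0 \<le> D" "\<And>z. \<bar>x + norm k * z\<bar> \<le> r \<Longrightarrow> std_normal_density z \<le> D"
  shows "prob {\<omega>\<in>space M. \<bar>x + W k \<omega>\<bar> \<le> r} \<le> D * (2 * r / norm k)"
proof -
  define u where "u = k /\<^sub>R norm k"
  have u: "norm u = 1" "k = norm k *\<^sub>R u" using k by (simp_all add: u_def)
  define A where "A = {(- r - x) / norm k..(r - x) / norm k}"
  have A: "z \<in> A \<longleftrightarrow> \<bar>x + norm k * z\<bar> \<le> r" for z
    using k by (auto simp: A_def abs_le_iff pos_divide_le_eq pos_le_divide_eq mult.commute)
  have "AE \<omega> in M. W k \<omega> = norm k * W u \<omega>"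
    using W_scale[of "norm k" u] u(2) by simp
  then have "AE \<omega> in M. \<omega> \<in> {\<omega>\<in>space M. \<bar>x + W k \<omega>\<bar> \<le> r} \<longleftrightarrow> \<omega> \<in> W u -` A \<inter> space M"
    by eventually_elim (auto simp: A)
  then have "prob {\<omega>\<in>space M. \<bar>x + W k \<omega>\<bar> \<le> r} = prob (W u -` A \<inter> space M)"
    by (intro finite_measure_eq_AE) (auto simp: A_def)
  also have "\<dots> = measure (distr M borel (W u)) A"
    by (subst measure_distr) (auto simp: A_def)
  also have "\<dots> = measure std_normal_distribution A"
    unfolding distr_W_unit[OF u(1)] ..
  also have "\<dots> \<le> D * (2 * r / norm k)"
  proof -
    have "emeasure std_normal_distribution A = (\<integral>\<^sup>+z. ennreal (std_normal_density z) * indicator A z \<partial>lborel)"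
      by (intro emeasure_density) (auto simp: A_def)
    also have "\<dots> \<le> (\<integral>\<^sup>+z. ennreal D * indicator A z \<partial>lborel)"
      by (intro nn_integral_mono) (auto simp: A intro!: ennreal_leI D(2) split: split_indicator)
    also have "\<dots> = ennreal D * emeasure lborel A"
      by (intro nn_integral_cmult_indicator) (auto simp: A_def)
    also have "emeasure lborel A = ennreal (2 * r / norm k)"
      using r k by (simp add: A_def divide_right_mono diff_divide_distrib[symmetric])
    also have "ennreal D * \<dots> = ennreal (D * (2 * r / norm k))"
      using D r by (intro ennreal_mult[symmetric]) auto
    finally show ?thesis
      using D r by (simp add: measure_def enn2real_leI)
  qed
  finally show ?thesis .
qed

context fbm_setting
begin

lemma incr_norm: "0 \<le> t \<Longrightarrow> norm (incr t N k) = (t / 2 ^ N) powr H"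
  unfolding incr_def by (subst fbm_increment_norm) (auto simp: grid_nonneg grid_step)

text \<open>The \<open>2 ^ N\<close> normalized increments of level N, raised to the power 2p and
  summed, have an expectation that decays geometrically once (H - \<gamma>) 2p > 1. Their sum over
  all levels is then finite almost surely and bounds each increment.\<close>

lemma increments_bounded:
  assumes W: "W = W1 \<or> W = W2" and \<gamma>: "\<gamma> < H" and t: "0 \<le> t"
  shows "AE \<omega> in M. \<exists>C\<ge>0. \<forall>N. \<forall>k<2 ^ N. \<bar>W (incr t N k) \<omega>\<bar> \<le> C * (2 powr (- \<gamma>)) ^ N"
proof -
  obtain p :: nat where "1 / (2 * (H - \<gamma>)) < p" using reals_Archimedean2 by blast
  then have p: "1 < (H - \<gamma>) * (2 * p)" using \<gamma> by (simp add: divide_less_eq algebra_simps)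
  then have p0: "0 < p" by (cases "p = 0") auto
  define r where "r = 2 powr (- \<gamma>)"
  have r: "0 < r" by (simp add: r_def)
  define c where "c = fact (2 * p) / (2 ^ p * fact p) * (t powr H) ^ (2 * p)"
  \<comment> \<open>The factor 2 counts the growing number of cells, the power the moment of one
    normalized increment; the choice of p makes the product less than 1.\<close>
  define q where "q = 2 * (2 powr (\<gamma> - H)) ^ (2 * p)"
  have int: "integrable M (\<lambda>\<omega>. W h \<omega> ^ n)"
    and E: "expectation (\<lambda>\<omega>. W h \<omega> ^ (2 * p)) = fact (2 * p) / (2 ^ p * fact p) * norm h ^ (2 * p)" for h n
    using W W_moment by auto
  have q: "0 \<le> q" "q < 1"
  proof -
    have "(2 powr (\<gamma> - H)) ^ (2 * p) = (2 powr (\<gamma> - H)) powr real (2 * p)"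
      by (rule powr_realpow[symmetric]) simp
    then have "q = 2 powr (1 + (\<gamma> - H) * (2 * p))"
      unfolding q_def by (simp only: powr_powr powr_add) simp
    also have "\<dots> < 2 powr 0" using p by (intro powr_less_mono) (auto simp: algebra_simps)
    finally show "q < 1" by simp
  qed (simp add: q_def)
  define a where "a N \<omega> = (\<Sum>k<(2::nat) ^ N. (W (incr t N k) \<omega> / r ^ N) ^ (2 * p))" for N \<omega>
  have a_nonneg: "0 \<le> a N \<omega>" for N \<omega> unfolding a_def by (intro sum_nonneg) simp
  have a_int: "integrable M (a N)" for N
    unfolding a_def[abs_def] using int by (simp add: power_divide)
  have ratio: "(t / 2 ^ N) powr H / r ^ N = t powr H * (2 powr (\<gamma> - H)) ^ N" for N
  proof -
    have "(t / 2 ^ N) powr H = t powr H / (2 powr H) ^ N"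
      using t by (simp add: powr_divide powr_realpow[symmetric] powr_powr mult.commute)
    moreover have "2 powr (\<gamma> - H) = 1 / (2 powr H * r)"
      by (simp add: r_def powr_diff powr_minus_divide)
    ultimately show ?thesis by (simp add: power_divide power_mult_distrib)
  qed
  have Ea: "expectation (a N) \<le> c * q ^ N" for N
  proof -
    have "expectation (a N) = (\<Sum>k<(2::nat) ^ N. fact (2 * p) / (2 ^ p * fact p) * ((t / 2 ^ N) powr H / r ^ N) ^ (2 * p))"
      unfolding a_def[abs_def] using int by (simp add: power_divide E incr_norm[OF t])
    also have "\<dots> = c * q ^ N"
      unfolding ratio by (simp add: c_def q_def power_mult_distrib power_mult[symmetric] mult.commute mult.left_commute)
    finally show ?thesis by simp
  qed
  have "AE \<omega> in M. summable (\<lambda>N. a N \<omega>)"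
    by (rule AE_summable_geometric[OF a_nonneg a_int Ea q])
  then show ?thesis
  proof eventually_elim
    fix \<omega> assume sum: "summable (\<lambda>N. a N \<omega>)"
    \<comment> \<open>With C at least 1, C is at most \<open>C ^ (2 * p)\<close>, so a root of order
      2p can be taken without changing the constant.\<close>
    define C where "C = max 1 (\<Sum>N. a N \<omega>)"
    have C: "1 \<le> C" by (simp add: C_def)
    have "\<bar>W (incr t N k) \<omega>\<bar> \<le> C * r ^ N" if k: "k < 2 ^ N" for N k
    proof -
      have "(W (incr t N k) \<omega> / r ^ N) ^ (2 * p) \<le> a N \<omega>"
        unfolding a_def using k by (intro member_le_sum) auto
      also have "\<dots> \<le> (\<Sum>N. a N \<omega>)"
        using sum_le_suminf[OF sum, of "{N}"] a_nonneg by simp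
      also have "\<dots> \<le> C" by (simp add: C_def)
      also have "\<dots> \<le> C ^ (2 * p)" using C p0 by (intro self_le_power) auto
      finally have "\<bar>W (incr t N k) \<omega> / r ^ N\<bar> ^ (2 * p) \<le> C ^ (2 * p)" by (subst power_even_abs) simp_all
      then have "\<bar>W (incr t N k) \<omega> / r ^ N\<bar> \<le> C"
        using C p0 by (subst (asm) power_mono_iff) auto
      then show ?thesis using r by (simp add: divide_le_eq)
    qed
    then show "\<exists>C\<ge>0. \<forall>N. \<forall>k<2 ^ N. \<bar>W (incr t N k) \<omega>\<bar> \<le> C * (2 powr (- \<gamma>)) ^ N"
      using C unfolding r_def by (intro exI[of _ C]) auto
  qed
qed

lemma hoelder_paths:
  assumes \<gamma>: "0 < \<gamma>" "\<gamma> < H"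
  shows "AE \<omega> in M. \<forall>T::nat. \<exists>C\<ge>0. \<forall>s\<in>{0..real T}. \<forall>t\<in>{0..real T}. norm (B t \<omega> - B s \<omega>) \<le> C * \<bar>t - s\<bar> powr \<gamma>"
  unfolding AE_all_countable
proof
  fix T :: nat
  have T: "0 \<le> real T" by simp
  show "AE \<omega> in M. \<exists>C\<ge>0. \<forall>s\<in>{0..real T}. \<forall>t\<in>{0..real T}. norm (B t \<omega> - B s \<omega>) \<le> C * \<bar>t - s\<bar> powr \<gamma>"
    using increments_bounded[of W1, OF disjI1[OF refl] \<gamma>(2) T] increments_bounded[of W2, OF disjI2[OF refl] \<gamma>(2) T] grid_AE[OF T] continuous_paths
  proof eventually_elim
    case (elim \<omega>)
    obtain C1 where C1: "0 \<le> C1" "\<And>N k. k < 2 ^ N \<Longrightarrow> \<bar>W1 (incr T N k) \<omega>\<bar> \<le> C1 * (2 powr (- \<gamma>)) ^ N" using elim(1) by blast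
    obtain C2 where C2: "0 \<le> C2" "\<And>N k. k < 2 ^ N \<Longrightarrow> \<bar>W2 (incr T N k) \<omega>\<bar> \<le> C2 * (2 powr (- \<gamma>)) ^ N" using elim(2) by blast
    show ?case
    proof (cases "T = 0")
      case False
      show ?thesis
      proof (rule dyadic_hoelder[where C="C1 + C2"])
        show "continuous_on {0..real T} (\<lambda>t. B t \<omega>)" by (rule continuous_on_subset[OF elim(4)]) auto
        fix N k assume k: "k < (2::nat) ^ N"
        have "norm (B (grid T N (Suc k)) \<omega> - B (grid T N k) \<omega>) \<le> \<bar>W1 (incr T N k) \<omega>\<bar> + \<bar>W2 (incr T N k) \<omega>\<bar>"
          using cmod_le[of "B (grid T N (Suc k)) \<omega> - B (grid T N k) \<omega>"] elim(3) by simp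
        then show "norm (B (grid T N (Suc k)) \<omega> - B (grid T N k) \<omega>) \<le> (C1 + C2) * (2 powr (- \<gamma>)) ^ N"
          using C1(2)[OF k] C2(2)[OF k] by (simp add: distrib_right)
      qed (use False \<gamma> C1(1) C2(1) in auto)
    qed (use elim in \<open>auto intro: exI[of _ 0]\<close>)
  qed
qed

lemma B_0: "AE \<omega> in M. B 0 \<omega> = z0"
  using W_at[OF order_refl] W_zero by eventually_elim (simp add: fbm_e_zero complex_eq_iff)

lemma B_indep:
  assumes s: "0 \<le> s"
  shows "prob {\<omega>\<in>space M. \<bar>Re (B s \<omega>)\<bar> \<le> r \<and> \<bar>Im (B s \<omega>)\<bar> \<le> r} =
    prob {\<omega>\<in>space M. \<bar>Re (B s \<omega>)\<bar> \<le> r} * prob {\<omega>\<in>space M. \<bar>Im (B s \<omega>)\<bar> \<le> r}"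
proof -
  have "indep_var (\<Pi>\<^sub>M t\<in>{0..}. borel) (\<lambda>\<omega>. \<lambda>t\<in>{0..}. Re (B t \<omega>)) (\<Pi>\<^sub>M t\<in>{0..}. borel) (\<lambda>\<omega>. \<lambda>t\<in>{0..}. Im (B t \<omega>))"
    using fbm by (simp add: complex_fbm_def)
  moreover have "(\<lambda>x. x s) \<in> (\<Pi>\<^sub>M t\<in>{0::real..}. borel :: real measure) \<rightarrow>\<^sub>M borel"
    using s by (intro measurable_component_singleton) auto
  ultimately have "indep_var borel ((\<lambda>x. x s) \<circ> (\<lambda>\<omega>. \<lambda>t\<in>{0..}. Re (B t \<omega>))) borel ((\<lambda>x. x s) \<circ> (\<lambda>\<omega>. \<lambda>t\<in>{0..}. Im (B t \<omega>)))"
    by (intro indep_var_compose) auto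
  then have "indep_var borel (\<lambda>\<omega>. Re (B s \<omega>)) borel (\<lambda>\<omega>. Im (B s \<omega>))"
    using s by (simp add: comp_def)
  from indep_varD[OF this, of "{- r..r}" "{- r..r}"]
  show ?thesis by (simp add: vimage_def Int_def abs_le_iff conj_commute minus_le_iff conj_ac)
qed

text \<open>The variance degenerates as s tends to 0. Without information on the centre the bound
  blows up like s to the power -H, whereas a coordinate with nonzero start obeys one that decays
  like s to the power H. In the product of the two, s disappears.\<close>

lemma prob_coordinate_le:
  assumes s: "0 < s" and r: "0 \<le> r"
  shows "prob {\<omega>\<in>space M. \<bar>Re (B s \<omega>)\<bar> \<le> r} \<le> 2 * r / s powr H"
    "prob {\<omega>\<in>space M. \<bar>Im (B s \<omega>)\<bar> \<le> r} \<le> 2 * r / s powr H"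
    "Re z0 \<noteq> 0 \<Longrightarrow> 2 * r \<le> \<bar>Re z0\<bar> \<Longrightarrow> prob {\<omega>\<in>space M. \<bar>Re (B s \<omega>)\<bar> \<le> r} \<le> 16 * r * s powr H / (Re z0)\<^sup>2"
    "Im z0 \<noteq> 0 \<Longrightarrow> 2 * r \<le> \<bar>Im z0\<bar> \<Longrightarrow> prob {\<omega>\<in>space M. \<bar>Im (B s \<omega>)\<bar> \<le> r} \<le> 16 * r * s powr H / (Im z0)\<^sup>2"
proof -
  define \<sigma> where "\<sigma> = s powr H"
  have \<sigma>: "0 < \<sigma>" using s by (simp add: \<sigma>_def)
  have norm: "norm (e s, 0::'h) = \<sigma>" "norm (0::'h, e s) = \<sigma>"
    using s by (simp_all add: norm_prod_def fbm_norm \<sigma>_def)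
  have s0: "0 \<le> s" using s by simp
  note [measurable] = B_measurable[OF s0]
  have ae: "AE \<omega> in M. Re z0 + (W1 (fst (e s, 0::'h)) \<omega> + W2 (snd (e s, 0::'h)) \<omega>) = Re (B s \<omega>)"
    "AE \<omega> in M. Im z0 + (W1 (fst (0::'h, e s)) \<omega> + W2 (snd (0::'h, e s)) \<omega>) = Im (B s \<omega>)"
    using W_zero W_at[OF s0] by (auto elim: eventually_elim2)
  have eq: "prob {\<omega>\<in>space M. \<bar>Re z0 + (W1 (fst (e s, 0::'h)) \<omega> + W2 (snd (e s, 0::'h)) \<omega>)\<bar> \<le> r} = prob {\<omega>\<in>space M. \<bar>Re (B s \<omega>)\<bar> \<le> r}"
    "prob {\<omega>\<in>space M. \<bar>Im z0 + (W1 (fst (0::'h, e s)) \<omega> + W2 (snd (0::'h, e s)) \<omega>)\<bar> \<le> r} = prob {\<omega>\<in>space M. \<bar>Im (B s \<omega>)\<bar> \<le> r}"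
  proof -
    have "AE \<omega> in M. \<omega> \<in> {\<omega>\<in>space M. \<bar>Re z0 + (W1 (fst (e s, 0::'h)) \<omega> + W2 (snd (e s, 0::'h)) \<omega>)\<bar> \<le> r} \<longleftrightarrow>
        \<omega> \<in> {\<omega>\<in>space M. \<bar>Re (B s \<omega>)\<bar> \<le> r}"
      using ae(1) by eventually_elim (simp only: mem_Collect_eq)
    then show "prob {\<omega>\<in>space M. \<bar>Re z0 + (W1 (fst (e s, 0::'h)) \<omega> + W2 (snd (e s, 0::'h)) \<omega>)\<bar> \<le> r} = prob {\<omega>\<in>space M. \<bar>Re (B s \<omega>)\<bar> \<le> r}"
      by (rule finite_measure_eq_AE) measurable
    have "AE \<omega> in M. \<omega> \<in> {\<omega>\<in>space M. \<bar>Im z0 + (W1 (fst (0::'h, e s)) \<omega> + W2 (snd (0::'h, e s)) \<omega>)\<bar> \<le> r} \<longleftrightarrow>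
        \<omega> \<in> {\<omega>\<in>space M. \<bar>Im (B s \<omega>)\<bar> \<le> r}"
      using ae(2) by eventually_elim (simp only: mem_Collect_eq)
    then show "prob {\<omega>\<in>space M. \<bar>Im z0 + (W1 (fst (0::'h, e s)) \<omega> + W2 (snd (0::'h, e s)) \<omega>)\<bar> \<le> r} = prob {\<omega>\<in>space M. \<bar>Im (B s \<omega>)\<bar> \<le> r}"
      by (rule finite_measure_eq_AE) measurable
  qed
  have nz: "(e s, 0::'h) \<noteq> 0" "(0::'h, e s) \<noteq> 0" using norm \<sigma> by (metis norm_zero less_irrefl)+
  show "prob {\<omega>\<in>space M. \<bar>Re (B s \<omega>)\<bar> \<le> r} \<le> 2 * r / s powr H"
    using iso.small_ball[OF nz(1) r, of 1 "Re z0"] std_normal_density_le(1) unfolding eq norm by (simp add: \<sigma>_def)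
  show "prob {\<omega>\<in>space M. \<bar>Im (B s \<omega>)\<bar> \<le> r} \<le> 2 * r / s powr H"
    using iso.small_ball[OF nz(2) r, of 1 "Im z0"] std_normal_density_le(1) unfolding eq norm by (simp add: \<sigma>_def)
  \<comment> \<open>If x + \<sigma>z is within half of the modulus of x, then the modulus of z is at
    least that of x divided by 2\<sigma>; inserting this in 2 / z^2 gives the constant 8.\<close>
  have dens: "std_normal_density z \<le> 8 * \<sigma>\<^sup>2 / x\<^sup>2" if x: "x \<noteq> 0" "2 * r \<le> \<bar>x\<bar>" "\<bar>x + \<sigma> * z\<bar> \<le> r" for x z
  proof -
    have "\<bar>x\<bar> \<le> 2 * (\<sigma> * \<bar>z\<bar>)"
      using x \<sigma> abs_mult[of \<sigma> z] by linarith
    then have "\<bar>x\<bar>\<^sup>2 \<le> (2 * (\<sigma> * \<bar>z\<bar>))\<^sup>2" by (intro power_mono) auto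
    then have sq: "x\<^sup>2 \<le> 4 * \<sigma>\<^sup>2 * z\<^sup>2" by (simp add: power_mult_distrib)
    then have z: "z \<noteq> 0" using x by auto
    have "2 / z\<^sup>2 \<le> 8 * \<sigma>\<^sup>2 / x\<^sup>2"
      using sq x z by (simp add: divide_le_eq le_divide_eq mult_ac)
    then show ?thesis using std_normal_density_le(2)[OF z] by linarith
  qed
  have fin: "8 * \<sigma>\<^sup>2 / x\<^sup>2 * (2 * r / \<sigma>) = 16 * r * s powr H / x\<^sup>2" for x :: real
    using \<sigma> by (simp add: \<sigma>_def[symmetric] power2_eq_square field_simps)
  show "prob {\<omega>\<in>space M. \<bar>Re (B s \<omega>)\<bar> \<le> r} \<le> 16 * r * s powr H / (Re z0)\<^sup>2" if "Re z0 \<noteq> 0" "2 * r \<le> \<bar>Re z0\<bar>"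
    using iso.small_ball[OF nz(1) r, of "8 * \<sigma>\<^sup>2 / (Re z0)\<^sup>2" "Re z0"] dens[OF that] unfolding eq norm fin by simp
  show "prob {\<omega>\<in>space M. \<bar>Im (B s \<omega>)\<bar> \<le> r} \<le> 16 * r * s powr H / (Im z0)\<^sup>2" if "Im z0 \<noteq> 0" "2 * r \<le> \<bar>Im z0\<bar>"
    using iso.small_ball[OF nz(2) r, of "8 * \<sigma>\<^sup>2 / (Im z0)\<^sup>2" "Im z0"] dens[OF that] unfolding eq norm fin by simp
qed

text \<open>Some coordinate of z0 is nonzero. By independence the decaying bound for it multiplies
  the general bound for the other, and the powers of s cancel: the estimate of order r^2 is uniform
  in time, down to time 0.\<close>

lemma prob_near_zero:
  assumes m: "m = \<bar>Re z0\<bar> \<or> m = \<bar>Im z0\<bar>" "0 < m" and r: "0 \<le> r" "2 * r \<le> m" and s: "0 \<le> s"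
  shows "prob {\<omega>\<in>space M. \<bar>Re (B s \<omega>)\<bar> \<le> r \<and> \<bar>Im (B s \<omega>)\<bar> \<le> r} \<le> 32 * r\<^sup>2 / m\<^sup>2"
proof (cases "s = 0")
  case True
  note [measurable] = B_measurable[OF s]
  have "AE \<omega> in M. \<not> (\<bar>Re (B s \<omega>)\<bar> \<le> r \<and> \<bar>Im (B s \<omega>)\<bar> \<le> r)"
    using B_0 m r by (auto simp: True elim!: eventually_mono)
  then have "prob {\<omega>\<in>space M. \<bar>Re (B s \<omega>)\<bar> \<le> r \<and> \<bar>Im (B s \<omega>)\<bar> \<le> r} = 0"
    by (subst prob_Collect_eq_0) auto
  then show ?thesis by simp
next
  case False
  then have s': "0 < s" using s by simp
  note P = prob_coordinate_le[OF s' r(1)]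
  have prod: "16 * r * s powr H / m\<^sup>2 * (2 * r / s powr H) = 32 * r\<^sup>2 / m\<^sup>2"
    using s' by (simp add: power2_eq_square)
  from m(1) show ?thesis
  proof
    assume m': "m = \<bar>Re z0\<bar>"
    have "prob {\<omega>\<in>space M. \<bar>Re (B s \<omega>)\<bar> \<le> r} * prob {\<omega>\<in>space M. \<bar>Im (B s \<omega>)\<bar> \<le> r} \<le> 16 * r * s powr H / m\<^sup>2 * (2 * r / s powr H)"
      using P(2,3) m' m r by (intro mult_mono) auto
    then show ?thesis unfolding B_indep[OF s] prod .
  next
    assume m': "m = \<bar>Im z0\<bar>"
    have "prob {\<omega>\<in>space M. \<bar>Im (B s \<omega>)\<bar> \<le> r} * prob {\<omega>\<in>space M. \<bar>Re (B s \<omega>)\<bar> \<le> r} \<le> 16 * r * s powr H / m\<^sup>2 * (2 * r / s powr H)"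
      using P(1,4) m' m r by (intro mult_mono) auto
    then show ?thesis unfolding B_indep[OF s] prod by (simp add: mult.commute)
  qed
qed

text \<open>At level N there are \<open>2 ^ N + 1\<close> points, and each comes within the radius
  \<open>r N\<close>, of order 2 to the power -\<gamma>N, with probability of order
  \<open>(r N)\<^sup>2\<close>. The union bound has ratio \<open>2 powr (1 - 2 * \<gamma>)\<close>
  and tends to 0. Since a single good level is asked for, the bad event is the intersection over all
  N, which is null.\<close>

lemma nonvanishing_on_grid:
  assumes z0: "z0 \<noteq> 0" and \<gamma>: "1 / 2 < \<gamma>" and t: "0 \<le> t" and C: "0 \<le> C"
  shows "AE \<omega> in M. \<exists>N. \<forall>k\<le>2 ^ N. C * (2 powr (- \<gamma>)) ^ N < norm (B (grid t N k) \<omega>)"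
proof -
  define r where "r N = C * (2 powr (- \<gamma>)) ^ N" for N
  have q: "0 < 2 powr (- \<gamma>)" "2 powr (- \<gamma>) < 1" using \<gamma> powr_less_mono[of "- \<gamma>" 0 2] by auto
  define m where "m = (if Re z0 = 0 then \<bar>Im z0\<bar> else \<bar>Re z0\<bar>)"
  have m: "m = \<bar>Re z0\<bar> \<or> m = \<bar>Im z0\<bar>" "0 < m" using z0 by (auto simp: m_def complex_eq_iff)
  define S where "S N = {\<omega>\<in>space M. \<exists>k\<in>{..2 ^ N}. \<bar>Re (B (grid t N k) \<omega>)\<bar> \<le> r N \<and> \<bar>Im (B (grid t N k) \<omega>)\<bar> \<le> r N}" for N
  note [measurable] = B_measurable[OF grid_nonneg[OF t]]
  have S_eq: "S N = (\<Union>k\<in>{..2 ^ N}. {\<omega>\<in>space M. \<bar>Re (B (grid t N k) \<omega>)\<bar> \<le> r N \<and> \<bar>Im (B (grid t N k) \<omega>)\<bar> \<le> r N})" for N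
    by (auto simp: S_def)
  have [measurable]: "S N \<in> sets M" for N unfolding S_eq by measurable
  have r0: "0 \<le> r N" for N using C by (simp add: r_def)
  have "r \<longlonglongrightarrow> C * 0"
    unfolding r_def using q by (intro tendsto_intros LIMSEQ_power_zero) auto
  then have "\<forall>\<^sub>F N in sequentially. r N < m / 2" using m by (intro order_tendstoD(2)) auto
  then have S_le: "\<forall>\<^sub>F N in sequentially. prob (S N) \<le> 64 * C\<^sup>2 / m\<^sup>2 * (2 powr (1 - 2 * \<gamma>)) ^ N"
  proof eventually_elim
    fix N assume "r N < m / 2"
    then have rm: "2 * r N \<le> m" by simp
    have "prob (S N) \<le> (\<Sum>k\<in>{..2 ^ N}. prob {\<omega>\<in>space M. \<bar>Re (B (grid t N k) \<omega>)\<bar> \<le> r N \<and> \<bar>Im (B (grid t N k) \<omega>)\<bar> \<le> r N})"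
      unfolding S_eq by (intro finite_measure_subadditive_finite) auto
    also have "\<dots> \<le> (\<Sum>k\<in>{..(2::nat) ^ N}. 32 * (r N)\<^sup>2 / m\<^sup>2)"
      by (intro sum_mono prob_near_zero m r0 rm grid_nonneg t)
    also have "\<dots> = (2 ^ N + 1) * (32 * (r N)\<^sup>2 / m\<^sup>2)" by simp
    also have "\<dots> \<le> (2 * 2 ^ N) * (32 * (r N)\<^sup>2 / m\<^sup>2)" by (intro mult_right_mono) auto
    also have "\<dots> = 64 * C\<^sup>2 / m\<^sup>2 * (2 * (2 powr (- \<gamma>))\<^sup>2) ^ N"
      by (simp add: r_def power_mult_distrib power_mult[symmetric] mult.commute)
    also have "2 * (2 powr (- \<gamma>))\<^sup>2 = 2 powr (1 - 2 * \<gamma>)"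
      by (simp add: power2_eq_square powr_add[symmetric] powr_mult_base)
    finally show "prob (S N) \<le> 64 * C\<^sup>2 / m\<^sup>2 * (2 powr (1 - 2 * \<gamma>)) ^ N" .
  qed
  have lim: "(\<lambda>N. 64 * C\<^sup>2 / m\<^sup>2 * (2 powr (1 - 2 * \<gamma>)) ^ N) \<longlonglongrightarrow> 64 * C\<^sup>2 / m\<^sup>2 * 0"
    using \<gamma> powr_less_mono[of "1 - 2 * \<gamma>" 0 2] by (intro tendsto_intros LIMSEQ_power_zero) auto
  have "prob (\<Inter>N. S N) \<le> 64 * C\<^sup>2 / m\<^sup>2 * 0"
  proof (rule tendsto_lowerbound[OF lim])
    show "\<forall>\<^sub>F N in sequentially. prob (\<Inter>N. S N) \<le> 64 * C\<^sup>2 / m\<^sup>2 * (2 powr (1 - 2 * \<gamma>)) ^ N"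
      using S_le
    proof eventually_elim
      fix N assume "prob (S N) \<le> 64 * C\<^sup>2 / m\<^sup>2 * (2 powr (1 - 2 * \<gamma>)) ^ N"
      moreover have "prob (\<Inter>N. S N) \<le> prob (S N)" by (intro finite_measure_mono) auto
      ultimately show "prob (\<Inter>N. S N) \<le> 64 * C\<^sup>2 / m\<^sup>2 * (2 powr (1 - 2 * \<gamma>)) ^ N" by linarith
    qed
  qed simp
  then have "prob (\<Inter>N. S N) = 0" by (simp add: measure_le_0_iff)
  then have "AE \<omega> in M. \<omega> \<notin> (\<Inter>N. S N)" by (subst (asm) prob_eq_0) auto
  with AE_space show ?thesis
  proof eventually_elim
    fix \<omega> assume "\<omega> \<in> space M" "\<omega> \<notin> (\<Inter>N. S N)"
    then obtain N where N: "\<And>k. k \<le> 2 ^ N \<Longrightarrow> \<not> (\<bar>Re (B (grid t N k) \<omega>)\<bar> \<le> r N \<and> \<bar>Im (B (grid t N k) \<omega>)\<bar> \<le> r N)"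
      by (auto simp: S_def)
    have "r N < norm (B (grid t N k) \<omega>)" if "k \<le> 2 ^ N" for k
      using N[OF that] abs_Re_le_cmod[of "B (grid t N k) \<omega>"] abs_Im_le_cmod[of "B (grid t N k) \<omega>"] by linarith
    then show "\<exists>N. \<forall>k\<le>2 ^ N. C * (2 powr (- \<gamma>)) ^ N < norm (B (grid t N k) \<omega>)"
      unfolding r_def by blast
  qed
qed

text \<open>A zero of the path would make it small at a neighbouring grid point at every level, by
  Hoelder continuity, against the lower bound at one good level. The Hoelder constant depends on
  \<omega>, so the grid statement is first secured for all integers C and T at once.\<close>

lemma nonvanishing_paths:
  assumes z0: "z0 \<noteq> 0"
  shows "AE \<omega> in M. \<forall>s\<ge>0. B s \<omega> \<noteq> 0"
proof -
  define \<gamma> where "\<gamma> = (1 / 2 + H) / 2"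
  have \<gamma>: "1 / 2 < \<gamma>" "0 < \<gamma>" "\<gamma> < H" using H_gt_half by (auto simp: \<gamma>_def)
  have "AE \<omega> in M. \<forall>T C :: nat. \<exists>N. \<forall>k\<le>2 ^ N. real C * (2 powr (- \<gamma>)) ^ N < norm (B (grid (real T) N k) \<omega>)"
    unfolding AE_all_countable by (intro allI nonvanishing_on_grid z0 \<gamma>) auto
  with hoelder_paths[OF \<gamma>(2,3)] show ?thesis
  proof eventually_elim
    case (elim \<omega>)
    show ?case
    proof (intro allI impI notI)
      fix s :: real assume s: "0 \<le> s" "B s \<omega> = 0"
      obtain T :: nat where T: "s < real T" using reals_Archimedean2 by blast
      then have T0: "0 < real T" using s by linarith
      obtain K where K: "0 \<le> K" "\<And>u v. u \<in> {0..real T} \<Longrightarrow> v \<in> {0..real T} \<Longrightarrow> norm (B v \<omega> - B u \<omega>) \<le> K * \<bar>v - u\<bar> powr \<gamma>"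
        using elim(1) by blast
      \<comment> \<open>An integer dominating the random constant, including the rescaling from unit
        length to T.\<close>
      obtain C :: nat where C: "K * real T powr \<gamma> < C" using reals_Archimedean2 by blast
      obtain N where N: "\<And>k. k \<le> 2 ^ N \<Longrightarrow> real C * (2 powr (- \<gamma>)) ^ N < norm (B (grid (real T) N k) \<omega>)"
        using elim(2) by blast
      have "\<exists>k\<le>2 ^ N. \<bar>grid (real T) N k - s\<bar> \<le> real T / 2 ^ N"
      proof (cases "s = 0")
        case False
        then obtain k where k: "k < 2 ^ N" "grid (real T) N k < s" "s \<le> grid (real T) N (Suc k)"
          using grid_cell[OF T0, of s N] s T by force
        then show ?thesis using grid_step[of "real T" N k] by (intro exI[of _ k]) auto
      qed (auto intro!: exI[of _ 0])
      then obtain k where k: "k \<le> 2 ^ N" "\<bar>grid (real T) N k - s\<bar> \<le> real T / 2 ^ N" by blast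
      have "norm (B (grid (real T) N k) \<omega> - B s \<omega>) \<le> K * \<bar>grid (real T) N k - s\<bar> powr \<gamma>"
        using s T k T0 by (intro K(2)) (auto simp: grid_nonneg grid_le)
      also have "\<dots> \<le> K * (real T / 2 ^ N) powr \<gamma>"
        using k(2) K(1) \<gamma> by (intro mult_left_mono powr_mono2) auto
      also have "(real T / 2 ^ N) powr \<gamma> = real T powr \<gamma> * (2 powr (- \<gamma>)) ^ N"
        by (simp add: powr_divide powr_realpow[symmetric] powr_powr powr_minus_divide mult.commute)
      also have "K * (real T powr \<gamma> * (2 powr (- \<gamma>)) ^ N) \<le> real C * (2 powr (- \<gamma>)) ^ N"
        using C by (simp add: mult.assoc[symmetric] mult_right_mono)
      finally show False using N[OF k(1)] s(2) by simp
    qed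
  qed
qed


section \<open>Localization\<close>

definition log_sum :: "real \<Rightarrow> nat \<Rightarrow> 'a \<Rightarrow> complex" where
  "log_sum t N \<omega> = (\<Sum>k<2 ^ N. 1 / B (grid t N k) \<omega> * (B (grid t N (Suc k)) \<omega> - B (grid t N k) \<omega>))"

text \<open>Defined by the dyadic limit, not by choosing a logarithm path by path: this makes it
  measurable at every t, while for almost every path it is the continuous logarithm.\<close>

definition log_integral :: "real \<Rightarrow> 'a \<Rightarrow> complex" where
  "log_integral t \<omega> = lim (\<lambda>N. log_sum t N \<omega>)"

lemma log_integral_measurable:
  assumes "0 \<le> t" shows "log_integral t \<in> borel_measurable M"
proof -
  note [measurable] = B_measurable[OF grid_nonneg[OF assms]]
  show ?thesis
    unfolding log_integral_def[abs_def]
    by (intro borel_measurable_lim_metric) (unfold log_sum_def, measurable)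
qed

text \<open>A nowhere vanishing continuous path on a contractible time set has a continuous
  logarithm, and the dyadic sums recover it. The exceptional null set is fixed before t is
  chosen.\<close>

lemma log_integral_paths:
  assumes z0: "z0 \<noteq> 0"
  shows "AE \<omega> in M. continuous_on {0..} (\<lambda>t. log_integral t \<omega>) \<and>
    (\<forall>t\<ge>0. (\<lambda>N. log_sum t N \<omega>) \<longlonglongrightarrow> log_integral t \<omega> \<and> B t \<omega> = z0 * exp (log_integral t \<omega>) \<and>
       has_RS_integral (\<lambda>s. 1 / B s \<omega>) (\<lambda>s. B s \<omega>) 0 t (log_integral t \<omega>))"
proof -
  define \<gamma> where "\<gamma> = (1 / 2 + H) / 2"
  have \<gamma>: "1 / 2 < \<gamma>" "0 < \<gamma>" "\<gamma> < H" using H_gt_half by (auto simp: \<gamma>_def)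
  show ?thesis
    using continuous_paths nonvanishing_paths[OF z0] B_0 hoelder_paths[OF \<gamma>(2,3)]
  proof eventually_elim
    case (elim \<omega>)
    have "contractible {0::real..}" by (intro convex_imp_contractible) simp
    then obtain G where G: "continuous_on {0..} G" "\<And>s. 0 \<le> s \<Longrightarrow> B s \<omega> = exp (G s)"
      using continuous_logarithm_on_contractible[OF elim(1)] elim(2) by (metis atLeast_iff)
    \<comment> \<open>Normalizing the logarithm to vanish at time 0 moves the initial value into the
      factor z0.\<close>
    define L where "L s = G s - G 0" for s
    have L: "continuous_on {0..} L" unfolding L_def by (intro continuous_intros G)
    have BL: "B s \<omega> = z0 * exp (L s)" if "0 \<le> s" for s
      using G(2)[OF that] G(2)[of 0] elim(3) by (simp add: L_def exp_diff)
    have main: "has_RS_integral (\<lambda>s. 1 / B s \<omega>) (\<lambda>s. B s \<omega>) 0 t (L t)" "(\<lambda>N. log_sum t N \<omega>) \<longlonglongrightarrow> L t" if t: "0 \<le> t" for t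
    proof -
      obtain T :: nat where T: "t < real T" using reals_Archimedean2 by blast
      obtain C where C: "0 \<le> C" "\<And>r s. r \<in> {0..real T} \<Longrightarrow> s \<in> {0..real T} \<Longrightarrow> norm (B s \<omega> - B r \<omega>) \<le> C * \<bar>s - r\<bar> powr \<gamma>"
        using elim(4) by blast
      have Lt: "continuous_on {0..t} L" by (rule continuous_on_subset[OF L]) auto
      have BLt: "B s \<omega> = z0 * exp (L s)" if "s \<in> {0..t}" for s using that BL by simp
      have hoelder: "norm (B s \<omega> - B r \<omega>) \<le> C * \<bar>s - r\<bar> powr \<gamma>" if "r \<in> {0..t}" "s \<in> {0..t}" for r s
        using that T by (intro C(2)) auto
      have "L 0 = 0" by (simp add: L_def)
      then show "has_RS_integral (\<lambda>s. 1 / B s \<omega>) (\<lambda>s. B s \<omega>) 0 t (L t)" "(\<lambda>N. log_sum t N \<omega>) \<longlonglongrightarrow> L t"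
        using has_RS_integral_log[OF t Lt BLt z0 hoelder C(1) \<gamma>(1)] by (simp_all add: log_sum_def)
    qed
    have eq: "log_integral t \<omega> = L t" if "0 \<le> t" for t
      unfolding log_integral_def using main(2)[OF that] by (rule limI)
    have "continuous_on {0..} (\<lambda>t. log_integral t \<omega>)"
      by (rule continuous_on_eq[OF L]) (simp add: eq)
    then show ?case using main BL by (simp add: eq)
  qed
qed

text \<open>On the n-th localizing set the cut-off field coincides with (a, b) wherever the Riemann
  sums look, so both limits coincide: the Hilbert space element and, because the divergence of the
  field is 0 there, the plain Riemann sums without trace term.\<close>

lemma divergence_integral_by_cutoff:
  fixes a b :: "complex \<Rightarrow> real"
  assumes t: "0 \<le> t" and z0: "z0 \<noteq> 0" and X: "X \<in> borel_measurable M"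
    and cont: "continuous_on (- {0}) a" "continuous_on (- {0}) b"
    and cutoff: "\<And>n::nat. \<exists>f1\<in>Cb_infinity 2. \<exists>f2\<in>Cb_infinity 2. \<forall>z. 1 / (real n + 1) \<le> norm z \<and> norm z \<le> real n + 1 \<longrightarrow>
      f1 (coords z) = a z \<and> f2 (coords z) = b z \<and> divg f1 f2 (coords z) = 0"
    and lim: "AE \<omega> in M. (\<lambda>N. \<Sum>k<2 ^ N. a (B (grid t N k) \<omega>) * (Re (B (grid t N (Suc k)) \<omega>) - Re (B (grid t N k) \<omega>)) +
      b (B (grid t N k) \<omega>) * (Im (B (grid t N (Suc k)) \<omega>) - Im (B (grid t N k) \<omega>))) \<longlonglongrightarrow> X \<omega>"
  shows "has_real_divergence_integral M \<G> H e W1 W2 (\<lambda>s \<omega>. a (B s \<omega>)) (\<lambda>s \<omega>. b (B s \<omega>)) t X"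
proof -
  define u where "u \<omega> = (lim (left_sum (\<lambda>s. a (B s \<omega>)) t), lim (left_sum (\<lambda>s. b (B s \<omega>)) t))" for \<omega>
  \<comment> \<open>Only left grid points are constrained, where the integrands are evaluated. The
    countably many constraints keep the set measurable and suffice for the sums of every level,
    hence for their limits. A path that is continuous and avoids 0 on the compact interval lies in
    some \<open>A n\<close>.\<close>
  define A where "A n = {\<omega>\<in>space M. \<forall>N. \<forall>k\<in>{..<2 ^ N}. 1 / (real n + 1) \<le> norm (B (grid t N k) \<omega>) \<and> norm (B (grid t N k) \<omega>) \<le> real n + 1}" for n :: nat
  note [measurable] = B_measurable[OF grid_nonneg[OF t]]
  have A_sets: "A n \<in> sets M" for n unfolding A_def by measurable
  have A_mono: "incseq A"
  proof (rule incseq_SucI, rule subsetI)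
    fix n \<omega> assume \<omega>: "\<omega> \<in> A n"
    have "1 / (real (Suc n) + 1) \<le> 1 / (real n + 1)" by (intro divide_left_mono) auto
    moreover have "real n + 1 \<le> real (Suc n) + 1" by simp
    ultimately show "\<omega> \<in> A (Suc n)"
      using \<omega> order_trans unfolding A_def mem_Collect_eq by meson
  qed
  have paths: "AE \<omega> in M. continuous_on {0..t} (\<lambda>s. B s \<omega>) \<and> (\<forall>s\<in>{0..t}. B s \<omega> \<noteq> 0)"
    using continuous_paths nonvanishing_paths[OF z0]
    by eventually_elim (auto intro: continuous_on_subset)
  then have ab_cont: "AE \<omega> in M. continuous_on {0..t} (\<lambda>s. a (B s \<omega>)) \<and> continuous_on {0..t} (\<lambda>s. b (B s \<omega>))"
    by eventually_elim (auto intro!: continuous_on_compose2[OF cont(1)] continuous_on_compose2[OF cont(2)])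
  have A_cover: "AE \<omega> in M. \<omega> \<in> (\<Union>n. A n)"
    using paths AE_space
  proof eventually_elim
    case (elim \<omega>)
    then have c: "continuous_on {0..t} (\<lambda>s. norm (B s \<omega>))" by (intro continuous_intros) auto
    obtain x where x: "x \<in> {0..t}" "\<And>s. s \<in> {0..t} \<Longrightarrow> norm (B x \<omega>) \<le> norm (B s \<omega>)"
      using continuous_attains_inf[OF compact_Icc _ c] t by auto
    obtain y where y: "y \<in> {0..t}" "\<And>s. s \<in> {0..t} \<Longrightarrow> norm (B s \<omega>) \<le> norm (B y \<omega>)"
      using continuous_attains_sup[OF compact_Icc _ c] t by auto
    obtain n :: nat where n: "max (1 / norm (B x \<omega>)) (norm (B y \<omega>)) < n" using reals_Archimedean2 by blast
    have "0 < norm (B x \<omega>)" using elim x(1) by simp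
    then have "1 < real n * norm (B x \<omega>)" using n by (simp add: divide_less_eq)
    then have "1 \<le> (real n + 1) * norm (B x \<omega>)"
      using \<open>0 < norm (B x \<omega>)\<close> unfolding distrib_right by linarith
    then have "1 / (real n + 1) \<le> norm (B x \<omega>)" by (simp add: divide_le_eq mult.commute)
    moreover have "norm (B y \<omega>) \<le> real n + 1" using n by simp
    moreover have "grid t N k \<in> {0..t}" if "k < 2 ^ N" for N k
      using that t by (simp add: grid_nonneg grid_le)
    ultimately have "1 / (real n + 1) \<le> norm (B (grid t N k) \<omega>) \<and> norm (B (grid t N k) \<omega>) \<le> real n + 1" if "k < 2 ^ N" for N k
      using x(2) y(2) that by (meson order_trans)
    then have "\<omega> \<in> A n" using elim(2) by (simp add: A_def)
    then show ?case by blast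
  qed
  have "\<exists>v Y. v \<in> D12_H2 M W1 W2 \<and> has_divergence M \<G> W1 W2 v Y \<and> (AE \<omega> in M. \<omega> \<in> A n \<longrightarrow> u \<omega> = v \<omega> \<and> X \<omega> = Y \<omega>)" for n
  proof -
    obtain f1 f2 where f: "f1 \<in> Cb_infinity 2" "f2 \<in> Cb_infinity 2"
      and eq: "\<And>z. 1 / (real n + 1) \<le> norm z \<Longrightarrow> norm z \<le> real n + 1 \<Longrightarrow>
        f1 (coords z) = a z \<and> f2 (coords z) = b z \<and> divg f1 f2 (coords z) = 0"
      using cutoff[of n] by blast
    obtain v Y where v: "v \<in> D12_H2 M W1 W2" and div: "has_divergence M \<G> W1 W2 v Y"
      and v_lim: "AE \<omega> in M. (\<lambda>N. (left_sum (\<lambda>s. f1 (coords (B s \<omega>))) t N, left_sum (\<lambda>s. f2 (coords (B s \<omega>))) t N)) \<longlonglongrightarrow> v \<omega>"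
      and Y_lim: "AE \<omega> in M. (\<lambda>N. path_sum f1 f2 t N \<omega>) \<longlonglongrightarrow> Y \<omega>"
      using field_divergence[OF f t] by blast
    have "AE \<omega> in M. \<omega> \<in> A n \<longrightarrow> u \<omega> = v \<omega> \<and> X \<omega> = Y \<omega>"
      using v_lim Y_lim lim ab_cont
    proof eventually_elim
      case (elim \<omega>)
      show ?case
      proof
        assume "\<omega> \<in> A n"
        then have on_grid: "f1 (coords (B (grid t N k) \<omega>)) = a (B (grid t N k) \<omega>)" "f2 (coords (B (grid t N k) \<omega>)) = b (B (grid t N k) \<omega>)"
          "divg f1 f2 (coords (B (grid t N k) \<omega>)) = 0" if "k < 2 ^ N" for N k
          using that eq[of "B (grid t N k) \<omega>"] by (auto simp: A_def)
        have "left_sum (\<lambda>s. f1 (coords (B s \<omega>))) t N = left_sum (\<lambda>s. a (B s \<omega>)) t N"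
          "left_sum (\<lambda>s. f2 (coords (B s \<omega>))) t N = left_sum (\<lambda>s. b (B s \<omega>)) t N" for N
          unfolding left_sum_def by (auto intro!: sum.cong simp: on_grid)
        then have "(\<lambda>N. (left_sum (\<lambda>s. a (B s \<omega>)) t N, left_sum (\<lambda>s. b (B s \<omega>)) t N)) \<longlonglongrightarrow> v \<omega>"
          using elim(1) by simp
        moreover have "(\<lambda>N. (left_sum (\<lambda>s. a (B s \<omega>)) t N, left_sum (\<lambda>s. b (B s \<omega>)) t N)) \<longlonglongrightarrow> u \<omega>"
          unfolding u_def using left_sum_convergent[OF t] elim(4)
          by (intro tendsto_Pair) (auto simp: convergent_LIMSEQ_iff)
        ultimately have "v \<omega> = u \<omega>" by (rule LIMSEQ_unique)
        \<comment> \<open>The trace term drops out here, since \<open>divg\<close> vanishes at every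
          left grid point.\<close>
        have "path_sum f1 f2 t N \<omega> = (\<Sum>k<2 ^ N. a (B (grid t N k) \<omega>) * (Re (B (grid t N (Suc k)) \<omega>) - Re (B (grid t N k) \<omega>)) +
            b (B (grid t N k) \<omega>) * (Im (B (grid t N (Suc k)) \<omega>) - Im (B (grid t N k) \<omega>)))" for N
          unfolding path_sum_def by (intro sum.cong) (auto simp: on_grid)
        then have "X \<omega> = Y \<omega>" using elim(2,3) LIMSEQ_unique by simp
        then show "u \<omega> = v \<omega> \<and> X \<omega> = Y \<omega>" using \<open>v \<omega> = u \<omega>\<close> by simp
      qed
    qed
    then show ?thesis using v div by blast
  qed
  then have "\<forall>n. \<exists>v Y. v \<in> D12_H2 M W1 W2 \<and> has_divergence M \<G> W1 W2 v Y \<and> (AE \<omega> in M. \<omega> \<in> A n \<longrightarrow> u \<omega> = v \<omega> \<and> X \<omega> = Y \<omega>)"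
    by (intro allI)
  from choice[OF this] obtain v
    where "\<forall>n. \<exists>Y. v n \<in> D12_H2 M W1 W2 \<and> has_divergence M \<G> W1 W2 (v n) Y \<and> (AE \<omega> in M. \<omega> \<in> A n \<longrightarrow> u \<omega> = v n \<omega> \<and> X \<omega> = Y \<omega>)" ..
  from choice[OF this] obtain Y
    where vY: "\<forall>n. v n \<in> D12_H2 M W1 W2 \<and> has_divergence M \<G> W1 W2 (v n) (Y n) \<and> (AE \<omega> in M. \<omega> \<in> A n \<longrightarrow> u \<omega> = v n \<omega> \<and> X \<omega> = Y n \<omega>)" ..
  have "has_local_divergence M \<G> W1 W2 u X"
    unfolding has_local_divergence_def
    by (intro conjI X exI[of _ A] exI[of _ v] exI[of _ Y] allI A_sets A_mono A_cover vY[rule_format])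
  moreover have "AE \<omega> in M. represents H e (\<lambda>s. a (B s \<omega>) * indicator {0<..<t} s) (fst (u \<omega>)) \<and>
      represents H e (\<lambda>s. b (B s \<omega>) * indicator {0<..<t} s) (snd (u \<omega>))"
    using ab_cont
  proof eventually_elim
    case (elim \<omega>)
    then show ?case
      using left_sum_represents[OF t] unfolding u_def fst_conv snd_conv by blast
  qed
  ultimately show ?thesis
    unfolding has_real_divergence_integral_def by blast
qed

text \<open>With p and q the cut-off parts of 1/z, the real part uses the field (p, -q) and the
  imaginary part the field (q, p). Their planar divergences vanish by the two Cauchy-Riemann
  equations.\<close>

lemma has_divergence_integral_log:
  assumes t: "0 \<le> t" and z0: "z0 \<noteq> 0"
  shows "has_divergence_integral M \<G> H e W1 W2 (\<lambda>s \<omega>. 1 / B s \<omega>) t (log_integral t)"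
proof -
  note [measurable] = log_integral_measurable[OF t]
  have lim: "AE \<omega> in M. (\<lambda>N. log_sum t N \<omega>) \<longlonglongrightarrow> log_integral t \<omega>"
    using log_integral_paths[OF z0] by eventually_elim (simp add: t)
  have cutoff: "\<exists>p q. p \<in> Cb_infinity 2 \<and> q \<in> Cb_infinity 2 \<and> (\<lambda>w. - q w) \<in> Cb_infinity 2 \<and>
      (\<forall>z. 1 / (real n + 1) \<le> norm z \<and> norm z \<le> real n + 1 \<longrightarrow>
        p (coords z) = Re (1 / z) \<and> q (coords z) = Im (1 / z) \<and>
        divg p (\<lambda>w. - q w) (coords z) = 0 \<and> divg q p (coords z) = 0)" for n :: nat
  proof -
    \<comment> \<open>The radii use n + 2 where the localizing sets use n + 1, so the closed annulus
      of the latter lies inside the open one on which the cutoff is exact.\<close>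
    define \<delta> R where "\<delta> = (1 / (real n + 2))\<^sup>2" and "R = (real n + 2)\<^sup>2"
    have "\<delta> < 1" unfolding \<delta>_def by (rule power_less_one_iff[THEN iffD2]) auto
    moreover have "1 < R" unfolding R_def by (rule one_less_power) auto
    ultimately have \<delta>R: "0 < \<delta>" "\<delta> < R" by (auto simp: \<delta>_def)
    obtain p q where pq: "p \<in> Cb_infinity 2" "q \<in> Cb_infinity 2" "(\<lambda>w. - q w) \<in> Cb_infinity 2"
      and p: "\<And>w. \<delta> < (w 0 + Re z0)\<^sup>2 + (w 1 + Im z0)\<^sup>2 \<Longrightarrow> (w 0 + Re z0)\<^sup>2 + (w 1 + Im z0)\<^sup>2 < R \<Longrightarrow> p w = (w 0 + Re z0) / ((w 0 + Re z0)\<^sup>2 + (w 1 + Im z0)\<^sup>2)"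
      and q: "\<And>w. \<delta> < (w 0 + Re z0)\<^sup>2 + (w 1 + Im z0)\<^sup>2 \<Longrightarrow> (w 0 + Re z0)\<^sup>2 + (w 1 + Im z0)\<^sup>2 < R \<Longrightarrow> q w = - (w 1 + Im z0) / ((w 0 + Re z0)\<^sup>2 + (w 1 + Im z0)\<^sup>2)"
      and d1: "\<And>w. \<delta> < (w 0 + Re z0)\<^sup>2 + (w 1 + Im z0)\<^sup>2 \<Longrightarrow> (w 0 + Re z0)\<^sup>2 + (w 1 + Im z0)\<^sup>2 < R \<Longrightarrow> partial_deriv 0 p w + partial_deriv 1 (\<lambda>w. - q w) w = 0"
      and d2: "\<And>w. \<delta> < (w 0 + Re z0)\<^sup>2 + (w 1 + Im z0)\<^sup>2 \<Longrightarrow> (w 0 + Re z0)\<^sup>2 + (w 1 + Im z0)\<^sup>2 < R \<Longrightarrow> partial_deriv 0 q w + partial_deriv 1 p w = 0"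
      using reciprocal_cutoff[OF \<delta>R, of "Re z0" "Im z0"] by blast
    have "p (coords z) = Re (1 / z) \<and> q (coords z) = Im (1 / z) \<and>
        divg p (\<lambda>w. - q w) (coords z) = 0 \<and> divg q p (coords z) = 0"
      if z: "1 / (real n + 1) \<le> norm z" "norm z \<le> real n + 1" for z
    proof -
      have c: "coords z 0 + Re z0 = Re z" "coords z 1 + Im z0 = Im z" by (simp_all add: coords_def)
      have "1 / (real n + 2) < 1 / (real n + 1)" by (intro divide_strict_left_mono) auto
      then have "1 / (real n + 2) < norm z" "norm z < real n + 2" using z by linarith+
      then have "\<delta> < (norm z)\<^sup>2" "(norm z)\<^sup>2 < R"
        unfolding \<delta>_def R_def by (auto intro!: power_strict_mono)
      then have range: "\<delta> < (coords z 0 + Re z0)\<^sup>2 + (coords z 1 + Im z0)\<^sup>2" "(coords z 0 + Re z0)\<^sup>2 + (coords z 1 + Im z0)\<^sup>2 < R"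
        unfolding c cmod_power2 .
      show ?thesis
        using p[OF range] q[OF range] d1[OF range] d2[OF range] unfolding c
        by (simp add: divg_def Re_divide Im_divide)
    qed
    then show ?thesis using pq by blast
  qed
  have Re_cont: "continuous_on (- {0}) (\<lambda>z::complex. Re (1 / z))" "continuous_on (- {0}) (\<lambda>z::complex. Im (1 / z))"
    "continuous_on (- {0}) (\<lambda>z::complex. - Im (1 / z))"
    by (auto intro!: continuous_intros)
  have "has_real_divergence_integral M \<G> H e W1 W2 (\<lambda>s \<omega>. Re (1 / B s \<omega>)) (\<lambda>s \<omega>. - Im (1 / B s \<omega>)) t (\<lambda>\<omega>. Re (log_integral t \<omega>))"
  proof (rule divergence_integral_by_cutoff[OF t z0])
    show "\<exists>f1\<in>Cb_infinity 2. \<exists>f2\<in>Cb_infinity 2. \<forall>z. 1 / (real n + 1) \<le> norm z \<and> norm z \<le> real n + 1 \<longrightarrow>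
      f1 (coords z) = Re (1 / z) \<and> f2 (coords z) = - Im (1 / z) \<and> divg f1 f2 (coords z) = 0" for n
    proof -
      obtain p q where pq: "p \<in> Cb_infinity 2" "(\<lambda>w. - q w) \<in> Cb_infinity 2"
        "\<forall>z. 1 / (real n + 1) \<le> norm z \<and> norm z \<le> real n + 1 \<longrightarrow>
          p (coords z) = Re (1 / z) \<and> q (coords z) = Im (1 / z) \<and>
          divg p (\<lambda>w. - q w) (coords z) = 0 \<and> divg q p (coords z) = 0"
        using cutoff[of n] by blast
      then show ?thesis by (intro bexI[of _ p] bexI[of _ "\<lambda>w. - q w"]) simp_all
    qed
    show "AE \<omega> in M. (\<lambda>N. \<Sum>k<2 ^ N. Re (1 / B (grid t N k) \<omega>) * (Re (B (grid t N (Suc k)) \<omega>) - Re (B (grid t N k) \<omega>)) +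
      - Im (1 / B (grid t N k) \<omega>) * (Im (B (grid t N (Suc k)) \<omega>) - Im (B (grid t N k) \<omega>))) \<longlonglongrightarrow> Re (log_integral t \<omega>)"
      using lim
    proof eventually_elim
      case (elim \<omega>)
      have "(\<lambda>N. Re (log_sum t N \<omega>)) \<longlonglongrightarrow> Re (log_integral t \<omega>)" by (rule tendsto_Re[OF elim])
      moreover have "Re (log_sum t N \<omega>) = (\<Sum>k<2 ^ N. Re (1 / B (grid t N k) \<omega>) * (Re (B (grid t N (Suc k)) \<omega>) - Re (B (grid t N k) \<omega>)) +
        - Im (1 / B (grid t N k) \<omega>) * (Im (B (grid t N (Suc k)) \<omega>) - Im (B (grid t N k) \<omega>)))" for N
        unfolding log_sum_def by (simp only: Re_sum times_complex.sel minus_complex.sel) simp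
      ultimately show ?case by simp
    qed
  qed (use Re_cont in auto)
  moreover have "has_real_divergence_integral M \<G> H e W1 W2 (\<lambda>s \<omega>. Im (1 / B s \<omega>)) (\<lambda>s \<omega>. Re (1 / B s \<omega>)) t (\<lambda>\<omega>. Im (log_integral t \<omega>))"
  proof (rule divergence_integral_by_cutoff[OF t z0])
    show "\<exists>f1\<in>Cb_infinity 2. \<exists>f2\<in>Cb_infinity 2. \<forall>z. 1 / (real n + 1) \<le> norm z \<and> norm z \<le> real n + 1 \<longrightarrow>
      f1 (coords z) = Im (1 / z) \<and> f2 (coords z) = Re (1 / z) \<and> divg f1 f2 (coords z) = 0" for n
      using cutoff[of n] by blast
    show "AE \<omega> in M. (\<lambda>N. \<Sum>k<2 ^ N. Im (1 / B (grid t N k) \<omega>) * (Re (B (grid t N (Suc k)) \<omega>) - Re (B (grid t N k) \<omega>)) +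
      Re (1 / B (grid t N k) \<omega>) * (Im (B (grid t N (Suc k)) \<omega>) - Im (B (grid t N k) \<omega>))) \<longlonglongrightarrow> Im (log_integral t \<omega>)"
      using lim
    proof eventually_elim
      case (elim \<omega>)
      have "(\<lambda>N. Im (log_sum t N \<omega>)) \<longlonglongrightarrow> Im (log_integral t \<omega>)" by (rule tendsto_Im[OF elim])
      moreover have "Im (log_sum t N \<omega>) = (\<Sum>k<2 ^ N. Im (1 / B (grid t N k) \<omega>) * (Re (B (grid t N (Suc k)) \<omega>) - Re (B (grid t N k) \<omega>)) +
        Re (1 / B (grid t N k) \<omega>) * (Im (B (grid t N (Suc k)) \<omega>) - Im (B (grid t N k) \<omega>)))" for N
        unfolding log_sum_def by (simp only: Im_sum times_complex.sel minus_complex.sel add.commute)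
      ultimately show ?case by simp
    qed
  qed (use Re_cont in auto)
  ultimately show ?thesis
    unfolding has_divergence_integral_def by blast
qed

end

text \<open>At each t a divergence integral is a class modulo null sets. Exhibiting one process Z
  with almost surely continuous paths gives the identity a meaning for all t simultaneously.\<close>

theorem proposition8:
  fixes M :: "'a measure" and H :: real and z0 :: complex
    and B :: "real \<Rightarrow> 'a \<Rightarrow> complex"
    and e :: "real \<Rightarrow> 'h::{real_inner, banach, second_countable_topology}"
    and W1 W2 :: "'h \<Rightarrow> 'a \<Rightarrow> real"
  assumes "prob_space M"
    and "1/2 < H" and "H < 1" and "z0 \<noteq> 0"
    and "complex_fbm M H z0 B"
    and "fbm_hilbert_space H e"
    and "wiener_isometry M e (Re z0) (\<lambda>t \<omega>. Re (B t \<omega>)) W1"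
    and "wiener_isometry M e (Im z0) (\<lambda>t \<omega>. Im (B t \<omega>)) W2"
  shows "\<exists>Z. (\<forall>t\<ge>0. has_divergence_integral M (generated_algebra M B) H e W1 W2
                   (\<lambda>s \<omega>. 1 / B s \<omega>) t (Z t)) \<and>
             (AE \<omega> in M. continuous_on {0..} (\<lambda>t. Z t \<omega>) \<and>
                (\<forall>t\<ge>0. B t \<omega> = z0 * exp (Z t \<omega>) \<and>
                   (\<exists>J. has_RS_integral (\<lambda>s. 1 / B s \<omega>) (\<lambda>s. B s \<omega>) 0 t J \<and>
                        B t \<omega> = z0 * exp J)))"
proof -
  interpret prob_space M by fact
  interpret fbm_setting M H e z0 B W1 W2
    by unfold_locales (fact assms)+
  have "AE \<omega> in M. continuous_on {0..} (\<lambda>t. log_integral t \<omega>) \<and>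
      (\<forall>t\<ge>0. B t \<omega> = z0 * exp (log_integral t \<omega>) \<and>
        (\<exists>J. has_RS_integral (\<lambda>s. 1 / B s \<omega>) (\<lambda>s. B s \<omega>) 0 t J \<and> B t \<omega> = z0 * exp J))"
    using log_integral_paths[OF \<open>z0 \<noteq> 0\<close>] by eventually_elim blast
  then show ?thesis
    using has_divergence_integral_log[OF _ \<open>z0 \<noteq> 0\<close>] by (intro exI[of _ log_integral]) blast
qed

end
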